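(* Let $p\in[2,\infty]$. For each integer $n\ge 2$ let $k_n\in\{1,\ldots,n-1\}$, and assume that the limit $\lambda:=\lim_{n\to\infty}\frac{k_n}{n}$ exists in $[0,1]$. For each $n\geq 2$ let $X^{(n)}$ be a random point uniformly distributed in $\mathbb{B}_p^n=\{x\in\mathbb{R}^n:\|x\|_p\le 1\}$, and let $E^{(n)}$ be a random $k_n$-dimensional linear subspace of $\mathbb{R}^n$, independent of $X^{(n)}$ and distributed according to the Haar probability measure on the Grassmannian $\mathbb{G}_{n,k_n}$. Let $P_{E^{(n)}}$ denote the orthogonal projection onto $E^{(n)}$. Then the sequence of random variables $$\Big(n^{\frac1p-\frac12}\,\big\|P_{E^{(n)}}X^{(n)}\big\|_2\Big)_{n}$$ (with $\frac1p:=0$ if $p=\infty$) satisfies a large deviation principle with speed $n$ and rate function $$ \mathcal{I}(y) = \begin{cases} \inf\limits_{x\geq y}\Big[\frac{\lambda}{2}\log\Big(\frac{\lambda x^2}{y^2}\Big)+\frac{1-\lambda}{2}\log\Big(\frac{1-\lambda}{1-y^2x^{-2}}\Big)+\mathcal{J}_p(x)\Big] &: y>0\\ \mathcal{J}_p(0) &: y=0,\ \lambda\in(0,1]\\ \inf\limits_{x\geq 0}\mathcal{J}_p(x) &: y=0,\ \lambda=0\\ +\infty &: y<0, \end{cases} $$ where the cases $\lambda\in\{0,1\}$ are understood as the corresponding limits and $\mathcal{J}_p$ is the function defined in the context.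
   Context: Large deviation principle (LDP): a sequence $(X^{(n)})_n$ of $\mathbb{R}^d$-valued random vectors satisfies a (full) LDP with speed $s(n)\in[0,\infty]$ and (good) rate function $\mathcal{I}:\mathbb{R}^d\to[0,\infty]$ if $\mathcal{I}$ is lower semi-continuous with compact level sets $\{x:\mathcal{I}(x)\le\alpha\}$, $\alpha\in\mathbb{R}$, and for all Lebesgue measurable $A\subset\mathbb{R}^d$, $$-\inf_{x\in A^\circ}\mathcal{I}(x)\le\liminf_{n\to\infty}\tfrac{1}{s(n)}\log\mathbb{P}(X^{(n)}\in A)\le\limsup_{n\to\infty}\tfrac{1}{s(n)}\log\mathbb{P}(X^{(n)}\in A)\le-\inf_{x\in\overline{A}}\mathcal{I}(x),$$ where $A^\circ$ and $\overline A$ are the interior and closure of $A$. Conventions: $\log 0=-\infty$, $\inf\emptyset=+\infty$. Norms: $\|x\|_p=(\sum_i|x_i|^p)^{1/p}$ for $p<\infty$ and $\|x\|_\infty=\max_i|x_i|$. Legendre-Fenchel transform: for convex $\Lambda:\mathbb{R}^d\to(-\infty,+\infty]$, $\Lambda^*(x)=\sup_{u\in\mathbb{R}^d}[\langle u,x\rangle-\Lambda(u)]$. Definition of $\mathcal{J}_p$ for $p\in[2,\infty)$: let $f_p(x)=\frac{1}{2p^{1/p}\Gamma(1+1/p)}e^{-|x|^p/p}$, $x\in\mathbb{R}$, and $$\mathcal{I}_p(t_1,t_2)=\log\Big(\int_{\mathbb{R}}e^{t_1x^2+t_2|x|^p}f_p(x)\,dx\Big)$$ for $(t_1,t_2)\in\mathbb{R}\times(-\infty,\frac1p)$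 if $p>2$, and for $(t_1,t_2)$ with $t_1+t_2<\frac12$ if $p=2$; $\mathcal{I}_p=+\infty$ elsewhere on $\mathbb{R}^2$. Let $\mathcal{I}_p^*$ be its Legendre-Fenchel transform and $$\mathcal{J}_p(y)=\inf\{\mathcal{I}_p^*(x_1,x_2): x_1,x_2>0,\ x_1^{1/2}x_2^{-1/p}=y\},\qquad y\in\mathbb{R}.$$ Definition of $\mathcal{J}_\infty$: $\mathcal{J}_\infty(y)=\mathcal{I}_\infty^*(y^2)$, where $\mathcal{I}_\infty^*$ is the Legendre-Fenchel transform of $\mathcal{I}_\infty(t)=\log\big(\int_0^1e^{tx^2}\,dx\big)$, $t\in\mathbb{R}$. Limiting conventions: for $\lambda=0$ the sum of the two logarithmic terms is $-\frac12\log(1-y^2x^{-2})$; for $\lambda=1$ it is $\frac12\log(x^2/y^2)$ for all $x\geq y$ (including $x=y$). For $\lambda<1$ the second logarithmic term is $+\infty$ when $x=y$. *)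

theory Defs
  imports "HOL-Probability.Probability" "HOL-Library.Function_Algebras"
begin

section \<open>Large deviation principles\<close>

definition elog :: "real \<Rightarrow> ereal" where
  "elog x = (if x > 0 then ereal (ln x) else - \<infinity>)"

text \<open>
  The random vector \<open>Y n\<close> is defined on its own probability space \<open>M n\<close>. The test sets \<open>A\<close> are
  Lebesgue measurable and not only Borel, so the event that \<open>Y n\<close> lies in \<open>A\<close> is measured in the
  completion of \<open>M n\<close> (this changes nothing for Borel sets \<open>A\<close>). On \<^typ>\<open>ereal\<close>, the infimum over
  the empty set is \<open>\<infinity>\<close>.
\<close>

definition LDP ::
  "(nat \<Rightarrow> 'w measure) \<Rightarrow> (nat \<Rightarrow> 'w \<Rightarrow> 'a::euclidean_space) \<Rightarrow> (nat \<Rightarrow> ereal) \<Rightarrow> ('a \<Rightarrow> ereal) \<Rightarrow> bool"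
where
  "LDP M Y s I \<longleftrightarrow>
     (\<forall>n. 0 \<le> s n) \<and>
     (\<forall>x. 0 \<le> I x) \<and>
     (\<forall>x. I x \<le> Liminf (at x) I) \<and>
     (\<forall>\<alpha>::real. compact {x. I x \<le> ereal \<alpha>}) \<and>
     (\<forall>A \<in> sets (lebesgue :: 'a measure).
        (let L = (\<lambda>n. 1 / s n * elog (measure (completion (M n)) {\<omega> \<in> space (M n). Y n \<omega> \<in> A}))
         in - (INF x\<in>interior A. I x) \<le> liminf L \<and> limsup L \<le> - (INF x\<in>closure A. I x)))"

section \<open>The rate function\<close>

definition legendre :: "('a::euclidean_space \<Rightarrow> ereal) \<Rightarrow> 'a \<Rightarrow> ereal" where
  "legendre \<Lambda> x = (SUP u. ereal (u \<bullet> x) - \<Lambda> u)"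

definition f_dens :: "real \<Rightarrow> real \<Rightarrow> real" where
  "f_dens p x = 1 / (2 * p powr (1 / p) * Gamma (1 + 1 / p)) * exp (- (\<bar>x\<bar> powr p) / p)"

definition I_fin :: "real \<Rightarrow> real \<times> real \<Rightarrow> ereal" where
  "I_fin p = (\<lambda>(t1, t2).
     if (p > 2 \<and> t2 < 1 / p) \<or> (p = 2 \<and> t1 + t2 < 1 / 2)
     then ereal (ln (LINT x|lborel. exp (t1 * x\<^sup>2 + t2 * \<bar>x\<bar> powr p) * f_dens p x))
     else \<infinity>)"

definition I_infty :: "real \<Rightarrow> ereal" where
  "I_infty t = ereal (ln (LINT x:{0..1}|lborel. exp (t * x\<^sup>2)))"

definition J_fin :: "real \<Rightarrow> real \<Rightarrow> ereal" where
  "J_fin p y = (INF x \<in> {(x1, x2). x1 > 0 \<and> x2 > 0 \<and> x1 powr (1 / 2) * x2 powr (- 1 / p) = y}.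
                  legendre (I_fin p) x)"

definition J_infty :: "real \<Rightarrow> ereal" where
  "J_infty y = legendre I_infty (y\<^sup>2)"

definition J_rate :: "ereal \<Rightarrow> real \<Rightarrow> ereal" where
  "J_rate p y = (if p = \<infinity> then J_infty y else J_fin (real_of_ereal p) y)"

text \<open>
  The sum of the two logarithmic terms, for \<open>0 < y \<le> x\<close>, with the limiting conventions for
  \<open>\<lambda> = 0\<close> and \<open>\<lambda> = 1\<close>. For \<open>\<lambda> < 1\<close> it is \<open>\<infinity>\<close> at \<open>x = y\<close>, where the logarithm would be taken of
  a quotient with denominator \<open>0\<close>.
\<close>

definition log_terms :: "real \<Rightarrow> real \<Rightarrow> real \<Rightarrow> ereal" where
  "log_terms l x y =
     (if l = 1 then ereal (1 / 2 * ln (x\<^sup>2 / y\<^sup>2))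
      else if x = y then \<infinity>
      else if l = 0 then ereal (- 1 / 2 * ln (1 - y\<^sup>2 / x\<^sup>2))
      else ereal (l / 2 * ln (l * x\<^sup>2 / y\<^sup>2) + (1 - l) / 2 * ln ((1 - l) / (1 - y\<^sup>2 / x\<^sup>2))))"

definition proj_rate :: "ereal \<Rightarrow> real \<Rightarrow> real \<Rightarrow> ereal" where
  "proj_rate p l y =
     (if y > 0 then (INF x\<in>{y..}. log_terms l x y + J_rate p x)
      else if y < 0 then \<infinity>
      else if l = 0 then (INF x\<in>{0..}. J_rate p x)
      else J_rate p 0)"

section \<open>Euclidean space of varying dimension\<close>

text \<open>
  \<open>\<real>\<^sup>n\<close> is the set of all \<open>x :: nat \<Rightarrow> real\<close> that vanish outside \<open>{..<n}\<close>, with coordinates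
  indexed from \<open>0\<close>. Addition is the pointwise one of \<^theory>\<open>HOL-Library.Function_Algebras\<close>. The
  product topology of \<^typ>\<open>nat \<Rightarrow> real\<close> induces the usual topology on \<open>\<real>\<^sup>n\<close>.
\<close>

definition scale_fun :: "real \<Rightarrow> (nat \<Rightarrow> real) \<Rightarrow> (nat \<Rightarrow> real)" where
  "scale_fun c x = (\<lambda>i. c * x i)"

global_interpretation rvec: vector_space scale_fun
  by unfold_locales (auto simp: scale_fun_def fun_eq_iff algebra_simps)

definition Rn :: "nat \<Rightarrow> (nat \<Rightarrow> real) set" where
  "Rn n = {x. \<forall>i\<ge>n. x i = 0}"

definition dot :: "nat \<Rightarrow> (nat \<Rightarrow> real) \<Rightarrow> (nat \<Rightarrow> real) \<Rightarrow> real" where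
  "dot n x y = (\<Sum>i<n. x i * y i)"

definition lp_norm :: "nat \<Rightarrow> ereal \<Rightarrow> (nat \<Rightarrow> real) \<Rightarrow> real" where
  "lp_norm n p x =
     (if p = \<infinity> then Max ((\<lambda>i. \<bar>x i\<bar>) ` {..<n})
      else (\<Sum>i<n. \<bar>x i\<bar> powr real_of_ereal p) powr (1 / real_of_ereal p))"

definition lp_ball :: "nat \<Rightarrow> ereal \<Rightarrow> (nat \<Rightarrow> real) set" where
  "lp_ball n p = {x \<in> Rn n. lp_norm n p x \<le> 1}"

text \<open>
  Elements of \<^term>\<open>space (PiM {..<n} (\<lambda>_. lborel))\<close> are \<^const>\<open>undefined\<close> outside \<open>{..<n}\<close>; the
  map below replaces this value by \<open>0\<close>.
\<close>

definition lebesgue_Rn :: "nat \<Rightarrow> (nat \<Rightarrow> real) measure" where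
  "lebesgue_Rn n = distr (PiM {..<n} (\<lambda>_. lborel)) borel (\<lambda>x i. if i < n then x i else 0)"

definition uniform_lp_ball :: "nat \<Rightarrow> ereal \<Rightarrow> (nat \<Rightarrow> real) measure" where
  "uniform_lp_ball n p = uniform_measure (lebesgue_Rn n) (lp_ball n p)"

section \<open>The Grassmannian and its Haar probability measure\<close>

definition grassmannian :: "nat \<Rightarrow> nat \<Rightarrow> (nat \<Rightarrow> real) set set" where
  "grassmannian n k = {E. rvec.subspace E \<and> E \<subseteq> Rn n \<and> rvec.dim E = k}"

definition proj :: "nat \<Rightarrow> (nat \<Rightarrow> real) set \<Rightarrow> (nat \<Rightarrow> real) \<Rightarrow> (nat \<Rightarrow> real)" where
  "proj n E x = (THE y. y \<in> E \<and> (\<forall>z\<in>E. dot n (x - y) z = 0))"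

definition unit_vec :: "nat \<Rightarrow> (nat \<Rightarrow> real)" where
  "unit_vec j = (\<lambda>i. if i = j then 1 else 0)"

definition proj_matrix :: "nat \<Rightarrow> (nat \<Rightarrow> real) set \<Rightarrow> nat \<Rightarrow> nat \<Rightarrow> real" where
  "proj_matrix n E i j = (if i < n \<and> j < n then proj n E (unit_vec j) i else 0)"

text \<open>
  The Borel \<open>\<sigma>\<close>-algebra of the Grassmannian. Its topology is that of the metric
  \<open>d(E, F) = \<parallel>P\<^sub>E - P\<^sub>F\<parallel>\<close>, that is, the one induced by the embedding of the Grassmannian into the
  space of matrices that maps a subspace to the matrix of its orthogonal projection.
\<close>

definition grassmann_algebra :: "nat \<Rightarrow> nat \<Rightarrow> (nat \<Rightarrow> real) set measure" where
  "grassmann_algebra n k = vimage_algebra (grassmannian n k) (proj_matrix n) borel"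

definition orthogonal_map :: "nat \<Rightarrow> ((nat \<Rightarrow> real) \<Rightarrow> (nat \<Rightarrow> real)) \<Rightarrow> bool" where
  "orthogonal_map n g \<longleftrightarrow>
     Vector_Spaces.linear scale_fun scale_fun g \<and> g ` Rn n \<subseteq> Rn n \<and>
     (\<forall>x\<in>Rn n. \<forall>y\<in>Rn n. dot n (g x) (g y) = dot n x y)"

text \<open>
  The Haar probability measure is the unique Borel probability measure on the Grassmannian that is
  invariant under the action of the orthogonal group.
\<close>

definition grassmann_haar :: "nat \<Rightarrow> nat \<Rightarrow> (nat \<Rightarrow> real) set measure \<Rightarrow> bool" where
  "grassmann_haar n k \<mu> \<longleftrightarrow>
     prob_space \<mu> \<and> sets \<mu> = sets (grassmann_algebra n k) \<and>
     (\<forall>g. orthogonal_map n g \<longrightarrow> distr \<mu> (grassmann_algebra n k) (\<lambda>E. g ` E) = \<mu>)"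

end

theory Submission
  imports Defs
begin

text \<open>
  Write \<open>|x|\<close> for the Euclidean norm. The proof represents the random variable as a product of
  two independent factors with values in \<open>[0, 1]\<close>, proves a large deviation principle for each
  factor, and pushes the pair forward under multiplication.

  \<^bold>\<open>The factors.\<close> A reflection maps \<open>x\<close> to \<open>|x|\<close> times the first unit vector, so by invariance of
  the Haar measure the projection of a fixed \<open>x\<close> to \<open>E\<close> has the norm \<open>|x| R\<close>, where the law of \<open>R\<close>
  does not depend on \<open>x\<close>. Averaging over a uniform point of the Euclidean ball and rotating \<open>E\<close>
  to a coordinate subspace shows that \<open>R\<close> is distributed like the ratio of the norm of the
  first \<open>k\<close> coordinates of that point to its full norm (\<open>haar_direction_law\<close>). Hence the variable
  has the law of \<open>W R\<close> with \<open>W = n\<^bsup>1/p - 1/2\<^esup> |X|\<close> and \<open>R\<close> independent (\<open>projected_norm_law\<close>).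

  If \<open>p = \<infinity>\<close>, the coordinates of \<open>X\<close> are independent, \<open>W\<^sup>2\<close> is an empirical mean of squares, and
  Cramer's theorem gives \<open>W\<close> the rate \<open>J_infty\<close>. If \<open>p < \<infinity>\<close>, write \<open>W = S N\<close>, where \<open>N\<close> is the \<open>p\<close>-norm
  of \<open>X\<close> and \<open>S\<close> depends on the direction of \<open>X\<close> only. Homogeneity makes \<open>S\<close> and \<open>N\<close> independent and
  gives \<open>N\<close> the density \<open>n s\<^bsup>n-1\<^esup>\<close> on \<open>[0, 1]\<close>, which is also the law of the Euclidean norm of a
  uniform point of the Euclidean ball. Therefore \<open>N R\<close> is distributed like the norm of the
  first \<open>k\<close> coordinates of such a point (\<open>partial_norm_law\<close>). The direction of \<open>X\<close> is that of a
  sample with density \<open>f_dens p\<close>, so \<open>S\<close> is a function of the empirical means of \<open>y\<^sup>2\<close> and \<open>|y|\<^sup>p\<close>.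
  For \<open>p > 2\<close>, Cramer's theorem in the plane gives the rate \<open>J_fin p\<close> (\<open>local_ldp_ratio\<close>). For
  \<open>p = 2\<close>, both \<open>S = 1\<close> and \<open>J_fin 2\<close>, which is \<open>0\<close> at \<open>1\<close> and \<open>\<infinity>\<close> elsewhere, degenerate
  (\<open>local_ldp_ratio_2\<close>).

  \<^bold>\<open>The radius.\<close> Under the uniform distribution on the Euclidean ball, the probability that the
  first \<open>k\<close> coordinates have norm near \<open>r\<close> is, up to subexponential factors,
  \<open>c r\<^sup>k (1 - r\<^sup>2)\<^bsup>(n-k)/2\<^esup>\<close> with \<open>c\<close> the quotient of the volumes of unit balls. Since the total
  mass is \<open>1\<close>, \<open>c\<close> is inverse to the maximum of the other factor, up to a polynomial in \<open>n\<close>. The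
  exponential rate is \<open>log_terms l 1 r\<close>, for the radius and for the ratio \<open>R\<close> alike
  (\<open>local_ldp_partial_norm\<close>, \<open>local_ldp_direction_norm\<close>).

  \<^bold>\<open>Assembly.\<close> The rate of the product at \<open>y\<close> is the infimum of \<open>J_rate p w + log_terms l 1 r\<close> over
  \<open>w r = y\<close>, which is \<open>proj_rate p l y\<close> (\<open>proj_rate_eq\<close>). All intermediate principles are stated in
  a local form, as bounds for small balls; since the variable lies in \<open>[0, 1]\<close>, the local form
  implies the full principle (\<open>LDP_of_local_ldp\<close>). Test sets are Lebesgue measurable, so it
  also matters that \<open>W\<close>, and with it the product, has an absolutely continuous law.
\<close>

section \<open>Empirical means and Cramer's lower bound\<close>

lemma PiM_density:
  fixes w :: "'a \<Rightarrow> ennreal"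
  assumes M: "sigma_finite_measure M" and D: "sigma_finite_measure (density M w)"
    and w [measurable]: "w \<in> borel_measurable M" and I: "finite I"
  shows "PiM I (\<lambda>_. density M w) = density (PiM I (\<lambda>_. M)) (\<lambda>x. \<Prod>i\<in>I. w (x i))"
proof -
  interpret M: product_sigma_finite "\<lambda>_. M" by (simp add: product_sigma_finite_def M)
  interpret D: product_sigma_finite "\<lambda>_. density M w" by (simp add: product_sigma_finite_def D)
  have "density (PiM I (\<lambda>_. M)) (\<lambda>x. \<Prod>i\<in>I. w (x i)) = PiM I (\<lambda>_. density M w)"
  proof (rule D.PiM_eqI[OF I])
    show "sets (density (PiM I (\<lambda>_. M)) (\<lambda>x. \<Prod>i\<in>I. w (x i))) = sets (PiM I (\<lambda>_. density M w))"
      by (simp cong: sets_PiM_cong)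
    fix A assume A: "\<And>i. i \<in> I \<Longrightarrow> A i \<in> sets (density M w)"
    then have A'[measurable]: "\<And>i. i \<in> I \<Longrightarrow> A i \<in> sets M" by simp
    have [measurable]: "Pi\<^sub>E I A \<in> sets (PiM I (\<lambda>_. M))" using I by (intro sets_PiM_I_finite) auto
    have "emeasure (density (PiM I (\<lambda>_. M)) (\<lambda>x. \<Prod>i\<in>I. w (x i))) (Pi\<^sub>E I A) =
        (\<integral>\<^sup>+x. (\<Prod>i\<in>I. w (x i)) * indicator (Pi\<^sub>E I A) x \<partial>PiM I (\<lambda>_. M))"
      by (subst emeasure_density) (auto intro!: borel_measurable_prod_ennreal)
    also have "\<dots> = (\<integral>\<^sup>+x. (\<Prod>i\<in>I. w (x i) * indicator (A i) (x i)) \<partial>PiM I (\<lambda>_. M))"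
    proof (rule nn_integral_cong)
      fix x assume x: "x \<in> space (PiM I (\<lambda>_. M))"
      have "indicator (Pi\<^sub>E I A) x = (\<Prod>i\<in>I. indicator (A i) (x i) :: ennreal)"
        using x I by (auto simp: indicator_def space_PiM PiE_iff prod_zero_iff split: if_splits)
      then show "(\<Prod>i\<in>I. w (x i)) * indicator (Pi\<^sub>E I A) x = (\<Prod>i\<in>I. w (x i) * indicator (A i) (x i))"
        by (simp add: prod.distrib)
    qed
    also have "\<dots> = (\<Prod>i\<in>I. \<integral>\<^sup>+x. w x * indicator (A i) x \<partial>M)"
      using I by (intro M.product_nn_integral_prod) auto
    also have "\<dots> = (\<Prod>i\<in>I. emeasure (density M w) (A i))"
      by (intro prod.cong refl) (simp add: emeasure_density)
    finally show "emeasure (density (PiM I (\<lambda>_. M)) (\<lambda>x. \<Prod>i\<in>I. w (x i))) (Pi\<^sub>E I A) =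
       (\<Prod>i\<in>I. emeasure (density M w) (A i))" .
  qed
  then show ?thesis by simp
qed

abbreviation iid :: "'b measure \<Rightarrow> nat \<Rightarrow> (nat \<Rightarrow> 'b) measure" where
  "iid \<mu> n \<equiv> PiM {..<n} (\<lambda>_. \<mu>)"

definition emp :: "('b \<Rightarrow> 'a::real_vector) \<Rightarrow> nat \<Rightarrow> (nat \<Rightarrow> 'b) \<Rightarrow> 'a" where
  "emp \<phi> n x = (1 / real n) *\<^sub>R (\<Sum>i<n. \<phi> (x i))"

lemma measurable_emp [measurable]:
  fixes \<phi> :: "'b \<Rightarrow> 'a::euclidean_space"
  assumes [measurable]: "\<phi> \<in> borel_measurable M"
  shows "emp \<phi> n \<in> borel_measurable (iid M n)"
  unfolding emp_def by measurable

abbreviation emp_law :: "'b measure \<Rightarrow> ('b \<Rightarrow> 'a::euclidean_space) \<Rightarrow> nat \<Rightarrow> 'a measure" where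
  "emp_law \<mu> \<phi> n \<equiv> distr (iid \<mu> n) borel (emp \<phi> n)"

lemma inner_emp: "u \<bullet> emp \<phi> n x = (1 / real n) * (\<Sum>i<n. u \<bullet> \<phi> (x i))"
  by (simp add: emp_def inner_sum_right)

text \<open>
  Markov's inequality for the exponential of \<open>n (u \<bullet> emp - c)\<close>; by independence its mean is an
  \<open>n\<close>-th power.
\<close>

lemma chernoff:
  fixes \<phi> :: "'b \<Rightarrow> 'a::euclidean_space"
  assumes pr: "prob_space \<mu>" and \<phi>[measurable]: "\<phi> \<in> borel_measurable \<mu>"
    and int: "integrable \<mu> (\<lambda>y. exp (u \<bullet> \<phi> y))"
    and B[measurable]: "B \<in> sets borel" and c: "\<And>z. z \<in> B \<Longrightarrow> c \<le> u \<bullet> z" and n: "n > 0"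
  shows "measure (iid \<mu> n) {x\<in>space (iid \<mu> n). emp \<phi> n x \<in> B}
      \<le> ((LINT y|\<mu>. exp (u \<bullet> \<phi> y)) * exp (- c)) ^ n"
proof -
  interpret prob_space \<mu> by fact
  interpret product_prob_space "\<lambda>_. \<mu>" "{..<n}" ..
  let ?P = "iid \<mu> n"
  have "emeasure ?P {x\<in>space ?P. emp \<phi> n x \<in> B} =
      (\<integral>\<^sup>+x. indicator {x\<in>space ?P. emp \<phi> n x \<in> B} x \<partial>?P)" by simp
  also have "\<dots> \<le> (\<integral>\<^sup>+x. (\<Prod>i<n. ennreal (exp (u \<bullet> \<phi> (x i)) * exp (- c))) \<partial>?P)"
  proof (rule nn_integral_mono)
    fix x
    show "indicator {x\<in>space ?P. emp \<phi> n x \<in> B} x \<le> (\<Prod>i<n. ennreal (exp (u \<bullet> \<phi> (x i)) * exp (- c)))"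
    proof (cases "emp \<phi> n x \<in> B")
      case True
      have "c \<le> (1 / real n) * (\<Sum>i<n. u \<bullet> \<phi> (x i))" using c[OF True] by (simp only: inner_emp)
      then have "real n * c \<le> (\<Sum>i<n. u \<bullet> \<phi> (x i))" using n by (simp add: field_simps)
      then have "0 \<le> (\<Sum>i<n. u \<bullet> \<phi> (x i) - c)" by (simp add: sum_subtractf)
      then have "1 \<le> exp (\<Sum>i<n. u \<bullet> \<phi> (x i) - c)" by simp
      also have "\<dots> = (\<Prod>i<n. exp (u \<bullet> \<phi> (x i)) * exp (- c))"
        by (simp add: exp_sum exp_add[symmetric])
      finally have "ennreal 1 \<le> ennreal (\<Prod>i<n. exp (u \<bullet> \<phi> (x i)) * exp (- c))"
        by (rule ennreal_leI)
      then show ?thesis by (auto simp: indicator_def prod_ennreal)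
    qed auto
  qed
  also have "\<dots> = (\<Prod>i<n. \<integral>\<^sup>+y. ennreal (exp (u \<bullet> \<phi> y) * exp (- c)) \<partial>\<mu>)"
    by (intro product_nn_integral_prod) auto
  also have "\<dots> = (\<Prod>i<n. ennreal ((LINT y|\<mu>. exp (u \<bullet> \<phi> y)) * exp (- c)))"
    using int by (subst nn_integral_eq_integral) auto
  also have "\<dots> = ennreal (((LINT y|\<mu>. exp (u \<bullet> \<phi> y)) * exp (- c)) ^ n)"
    by (simp add: ennreal_power Bochner_Integration.integral_nonneg)
  finally show ?thesis
    by (simp add: emeasure_eq_measure Bochner_Integration.integral_nonneg)
qed

lemma exp_le_quadratic:
  fixes t :: real assumes "\<bar>t\<bar> \<le> 1" shows "exp t \<le> 1 + t + t\<^sup>2"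
proof (cases "t \<ge> 0")
  case True then show ?thesis using exp_bound[of t] assms by simp
next
  case False
  have "exp t \<le> 1 / (1 - t)"
    using exp_ge_add_one_self[of "-t"] False by (simp add: exp_minus field_simps)
  also have "\<dots> \<le> 1 + t + t\<^sup>2"
  proof -
    have "t^3 \<le> 0" using False by (simp add: power3_eq_cube mult_nonneg_nonpos mult_nonpos_nonpos)
    then have "1 \<le> (1 + t + t\<^sup>2) * (1 - t)" by (simp add: algebra_simps power2_eq_square power3_eq_cube)
    then show ?thesis using False by (simp add: divide_le_eq)
  qed
  finally show ?thesis .
qed

text \<open>
  The Chernoff bound at a small multiple of \<open>v\<close>: the mean vanishes, so the moment generating
  function at \<open>s v\<close> is only \<open>1 + O(s\<^sup>2)\<close>.
\<close>

lemma lln_halfspace: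
  fixes \<psi> :: "'b \<Rightarrow> 'a::euclidean_space"
  assumes pr: "prob_space \<nu>" and [measurable]: "\<psi> \<in> borel_measurable \<nu>"
    and K: "AE y in \<nu>. norm (\<psi> y) \<le> K" "K > 0" and v: "norm v = 1"
    and mean: "(LINT y|\<nu>. v \<bullet> \<psi> y) = 0" and e: "e > 0"
  shows "(\<lambda>n. measure (iid \<nu> n) {x\<in>space (iid \<nu> n). e \<le> v \<bullet> emp \<psi> n x})
     \<longlonglongrightarrow> 0"
proof -
  interpret prob_space \<nu> by fact
  \<comment> \<open>With this s, the quadratic expansion of exp applies, and its error \<open>(s K)\<^sup>2\<close> is at most
    half of the gain \<open>s e\<close>.\<close>
  define s where "s = min (1 / K) (e / (2 * K\<^sup>2))"
  have s: "s > 0" "s * K \<le> 1" "s * K\<^sup>2 \<le> e / 2"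
    using K e by (auto simp: s_def min_def field_simps)
  have vb: "AE y in \<nu>. \<bar>v \<bullet> \<psi> y\<bar> \<le> K"
    using K(1)
  proof eventually_elim
    case (elim y)
    have "\<bar>v \<bullet> \<psi> y\<bar> \<le> norm v * norm (\<psi> y)" by (rule Cauchy_Schwarz_ineq2)
    then show ?case using elim v by simp
  qed
  have int1: "integrable \<nu> (\<lambda>y. v \<bullet> \<psi> y)"
    using vb by (intro integrable_const_bound[of _ K]) auto
  have int2: "integrable \<nu> (\<lambda>y. exp ((s *\<^sub>R v) \<bullet> \<psi> y))"
    using vb
    by (intro integrable_const_bound[of _ "exp 1"]) (auto elim!: eventually_mono intro!: order_trans[OF mult_left_mono s(2)] simp: s(1) less_imp_le abs_le_iff)
  have "(LINT y|\<nu>. exp ((s *\<^sub>R v) \<bullet> \<psi> y)) \<le> (LINT y|\<nu>. 1 + s * (v \<bullet> \<psi> y) + (s * K)\<^sup>2)"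
  proof (rule integral_mono_AE[OF int2])
    show "integrable \<nu> (\<lambda>y. 1 + s * (v \<bullet> \<psi> y) + (s * K)\<^sup>2)" using int1 by auto
    show "AE y in \<nu>. exp ((s *\<^sub>R v) \<bullet> \<psi> y) \<le> 1 + s * (v \<bullet> \<psi> y) + (s * K)\<^sup>2"
      using vb
    proof eventually_elim
      case (elim y)
      have a: "\<bar>s * (v \<bullet> \<psi> y)\<bar> \<le> s * K" using elim s(1) by (simp add: abs_mult)
      then have b: "(s * (v \<bullet> \<psi> y))\<^sup>2 \<le> (s * K)\<^sup>2" using s K by (intro abs_le_square_iff[THEN iffD1]) auto
      have "exp (s * (v \<bullet> \<psi> y)) \<le> 1 + s * (v \<bullet> \<psi> y) + (s * (v \<bullet> \<psi> y))\<^sup>2"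
        using a s(2) by (intro exp_le_quadratic) linarith
      then show ?case using b by simp
    qed
  qed
  also have "\<dots> = 1 + (s * K)\<^sup>2" using int1 mean by (simp add: prob_space)
  also have "\<dots> \<le> exp ((s * K)\<^sup>2)" by (rule exp_ge_add_one_self)
  also have "\<dots> \<le> exp (s * e / 2)"
    using mult_left_mono[OF s(3), of s] s(1) by (simp add: power2_eq_square algebra_simps)
  finally have I: "(LINT y|\<nu>. exp ((s *\<^sub>R v) \<bullet> \<psi> y)) \<le> exp (s * e / 2)" .
  have "(LINT y|\<nu>. exp ((s *\<^sub>R v) \<bullet> \<psi> y)) * exp (- (s * e)) \<le> exp (s * e / 2) * exp (- (s * e))"
    using I by (intro mult_right_mono) auto
  also have "\<dots> = exp (- (s * e / 2))" by (simp add: exp_add[symmetric])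
  finally have J: "(LINT y|\<nu>. exp ((s *\<^sub>R v) \<bullet> \<psi> y)) * exp (- (s * e)) \<le> exp (- (s * e / 2))" .
  show ?thesis
  proof (rule tendsto_sandwich[OF _ _ tendsto_const])
    show "(\<lambda>n. exp (- (s * e / 2)) ^ n) \<longlonglongrightarrow> 0"
      using s(1) e by (intro LIMSEQ_power_zero) auto
    show "\<forall>\<^sub>F n in sequentially. measure (iid \<nu> n) {x\<in>space (iid \<nu> n). e \<le> v \<bullet> emp \<psi> n x}
        \<le> exp (- (s * e / 2)) ^ n"
      using eventually_gt_at_top[of 0]
    proof eventually_elim
      case (elim n)
      have "measure (iid \<nu> n) {x\<in>space (iid \<nu> n). emp \<psi> n x \<in> {z. e \<le> v \<bullet> z}}
         \<le> ((LINT y|\<nu>. exp ((s *\<^sub>R v) \<bullet> \<psi> y)) * exp (- (s * e))) ^ n"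
        using int2 s(1) elim by (intro chernoff pr) auto
      also have "\<dots> \<le> exp (- (s * e / 2)) ^ n"
        using J by (intro power_mono) (auto simp: Bochner_Integration.integral_nonneg)
      finally show ?case by simp
    qed
  qed auto
qed

text \<open>
  If the norm is at least \<open>e\<close>, one of the coordinates or its negative is at least \<open>e / DIM\<close>, so
  that finitely many half-spaces suffice.
\<close>

lemma lln_ball:
  fixes \<psi> :: "'b \<Rightarrow> 'a::euclidean_space"
  assumes pr: "prob_space \<nu>" and [measurable]: "\<psi> \<in> borel_measurable \<nu>"
    and K: "AE y in \<nu>. norm (\<psi> y) \<le> K" "K > 0"
    and mean: "\<And>v. (LINT y|\<nu>. v \<bullet> \<psi> y) = 0" and e: "e > 0"
  shows "\<forall>\<^sub>F n in sequentially.
    1 / 2 \<le> measure (iid \<nu> n) {x\<in>space (iid \<nu> n). norm (emp \<psi> n x) < e}"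
proof -
  define V :: "'a set" where "V = Basis \<union> uminus ` Basis"
  define d where "d = e / real DIM('a)"
  have d: "d > 0" using e by (simp add: d_def)
  have V: "finite V" "\<And>v. v \<in> V \<Longrightarrow> norm v = 1" by (auto simp: V_def)
  define p where "p n v = measure (iid \<nu> n) {x\<in>space (iid \<nu> n). d \<le> v \<bullet> emp \<psi> n x}" for n v
  have "(\<lambda>n. \<Sum>v\<in>V. p n v) \<longlonglongrightarrow> (\<Sum>v\<in>V. 0)"
    unfolding p_def using V by (intro tendsto_sum lln_halfspace[OF pr _ K _ mean d]) auto
  then have "\<forall>\<^sub>F n in sequentially. (\<Sum>v\<in>V. p n v) < 1 / 2"
    by (intro order_tendstoD) auto
  then show ?thesis
  proof eventually_elim
    case (elim n)
    interpret prob_space \<nu> by fact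
    let ?P = "iid \<nu> n"
    interpret PP: prob_space ?P by (intro prob_space_PiM pr)
    let ?G = "{x\<in>space ?P. norm (emp \<psi> n x) < e}"
    have "space ?P - ?G \<subseteq> (\<Union>v\<in>V. {x\<in>space ?P. d \<le> v \<bullet> emp \<psi> n x})"
    proof
      fix x assume x: "x \<in> space ?P - ?G"
      show "x \<in> (\<Union>v\<in>V. {x\<in>space ?P. d \<le> v \<bullet> emp \<psi> n x})"
      proof (rule ccontr)
        assume neg: "\<not> ?thesis"
        have "\<bar>emp \<psi> n x \<bullet> b\<bar> < d" if "b \<in> Basis" for b
          using neg x that by (force simp: V_def inner_commute not_le abs_less_iff)
        then have "(\<Sum>b\<in>Basis. \<bar>emp \<psi> n x \<bullet> b\<bar>) < (\<Sum>b\<in>(Basis::'a set). d)"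
          by (intro sum_strict_mono) auto
        then have "norm (emp \<psi> n x) < e"
          using norm_le_l1[of "emp \<psi> n x"] by (simp add: d_def)
        then show False using x by auto
      qed
    qed
    then have "measure ?P (space ?P - ?G) \<le> measure ?P (\<Union>v\<in>V. {x\<in>space ?P. d \<le> v \<bullet> emp \<psi> n x})"
      using V by (intro PP.finite_measure_mono) auto
    also have "\<dots> \<le> (\<Sum>v\<in>V. p n v)"
      unfolding p_def using V by (intro measure_UNION_le) auto
    finally have "measure ?P (space ?P - ?G) < 1 / 2" using elim by simp
    moreover have "measure ?P (space ?P - ?G) = 1 - measure ?P ?G"
      by (rule PP.prob_compl) measurable
    ultimately show ?case by simp
  qed
qed

text \<open>
  Change of measure. The stationarity hypothesis says that \<open>\<phi>\<close> has mean \<open>x\<close> under the probability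
  measure with density \<open>w / Z\<close>. By the law of large numbers, its powers give the event mass at
  least \<open>1 / 2\<close> for large \<open>n\<close>, and on the event the density of these powers is at most
  \<open>Z\<^bsup>-n\<^esup> exp (n |u| e)\<close>.
\<close>

lemma tilted_lower:
  fixes \<phi> :: "'b \<Rightarrow> 'a::euclidean_space"
  assumes pr: "prob_space \<mu>" and [measurable]: "\<phi> \<in> borel_measurable \<mu>" "T \<in> sets \<mu>"
    and M: "\<And>y. y \<in> T \<Longrightarrow> norm (\<phi> y) \<le> M"
    and w: "w = (\<lambda>y. indicator T y * exp (u \<bullet> (\<phi> y - x)))"
    and Z: "Z = (LINT y|\<mu>. w y)" "Z > 0"
    and stat: "\<And>v. (LINT y|\<mu>. w y * (v \<bullet> (\<phi> y - x))) = 0" and e: "e > 0"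
  shows "\<forall>\<^sub>F n in sequentially. Z ^ n * exp (- real n * (norm u * e)) / 2 \<le>
    measure (iid \<mu> n) {y\<in>space (iid \<mu> n). emp \<phi> n y \<in> ball x e}"
proof -
  interpret prob_space \<mu> by fact
  have w0: "w y \<ge> 0" for y by (simp add: w)
  have wm[measurable]: "w \<in> borel_measurable \<mu>" unfolding w by measurable
  have wint: "integrable \<mu> w" using Z not_integrable_integral_eq by fastforce
  define \<nu> where "\<nu> = density \<mu> (\<lambda>y. ennreal (w y / Z))"
  have sets_\<nu>[simp, measurable_cong]: "sets \<nu> = sets \<mu>" by (simp add: \<nu>_def)
  have P\<nu>: "prob_space \<nu>"
  proof
    have "emeasure \<nu> (space \<nu>) = (\<integral>\<^sup>+y. ennreal (w y / Z) \<partial>\<mu>)"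
      unfolding \<nu>_def by (subst emeasure_density) (auto intro!: nn_integral_cong)
    also have "\<dots> = ennreal (LINT y|\<mu>. w y / Z)"
      using wint w0 Z by (intro nn_integral_eq_integral) auto
    also have "\<dots> = 1" using Z by simp
    finally show "emeasure \<nu> (space \<nu>) = 1" .
  qed
  have "\<forall>\<^sub>F n in sequentially. 1 / 2 \<le> measure (iid \<nu> n)
      {y\<in>space (iid \<nu> n). norm (emp (\<lambda>y. \<phi> y - x) n y) < e}"
  proof (rule lln_ball[OF P\<nu>])
    show "(\<lambda>y. \<phi> y - x) \<in> borel_measurable \<nu>" by simp
    show "AE y in \<nu>. norm (\<phi> y - x) \<le> \<bar>M\<bar> + norm x + 1"
      unfolding \<nu>_def
    proof (subst AE_density, goal_cases)
      case 2
      have "norm (\<phi> y - x) \<le> \<bar>M\<bar> + norm x + 1" if "y \<in> T" for y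
        using M[OF that] norm_triangle_ineq4[of "\<phi> y" x] by linarith
      then show ?case by (intro AE_I2) (auto simp: w indicator_def split: if_splits)
    qed simp
    show "0 < \<bar>M\<bar> + norm x + 1" by (simp add: add_nonneg_pos)
    show "(LINT y|\<nu>. v \<bullet> (\<phi> y - x)) = 0" for v
    proof -
      have "(LINT y|\<nu>. v \<bullet> (\<phi> y - x)) = (LINT y|\<mu>. (w y / Z) * (v \<bullet> (\<phi> y - x)))"
        unfolding \<nu>_def using Z w0 by (subst integral_real_density) auto
      also have "\<dots> = (LINT y|\<mu>. w y * (v \<bullet> (\<phi> y - x))) / Z"
        by simp
      finally show ?thesis using stat by simp
    qed
  qed (fact e)
  then show ?thesis using eventually_gt_at_top[of 0]
  proof eventually_elim
    case (elim n)
    let ?P = "iid \<mu> n" and ?N = "iid \<nu> n"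
    interpret PP: prob_space ?P by (intro prob_space_PiM pr)
    interpret NN: prob_space ?N by (intro prob_space_PiM P\<nu>)
    have spN: "space ?N = space ?P" by (simp add: space_PiM \<nu>_def)
    have emp_sub: "emp (\<lambda>y. \<phi> y - x) n y = emp \<phi> n y - x" for y
      using elim by (simp add: emp_def sum_subtractf scaleR_diff_right sum_constant_scaleR)
    let ?A = "{y\<in>space ?P. emp \<phi> n y \<in> ball x e}"
    have A[measurable]: "?A \<in> sets ?P"
    proof -
      have "?A = emp \<phi> n -` ball x e \<inter> space ?P" by auto
      then show ?thesis by (simp add: measurable_sets[OF measurable_emp])
    qed
    have "?N = density ?P (\<lambda>x. \<Prod>i<n. ennreal (w (x i) / Z))"
      unfolding \<nu>_def by (intro PiM_density prob_space_imp_sigma_finite pr P\<nu>[unfolded \<nu>_def]) auto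
    then have "emeasure ?N ?A = (\<integral>\<^sup>+y. (\<Prod>i<n. ennreal (w (y i) / Z)) * indicator ?A y \<partial>?P)"
      by (simp add: emeasure_density)
    also have "\<dots> \<le> (\<integral>\<^sup>+y. ennreal ((1 / Z) ^ n * exp (real n * (norm u * e))) * indicator ?A y \<partial>?P)"
    proof (intro nn_integral_mono)
      fix y
      show "(\<Prod>i<n. ennreal (w (y i) / Z)) * indicator ?A y \<le>
          ennreal ((1 / Z) ^ n * exp (real n * (norm u * e))) * indicator ?A y"
      proof (cases "y \<in> ?A")
        case True
        have "(\<Prod>i<n. w (y i) / Z) \<le> (\<Prod>i<n. exp (u \<bullet> (\<phi> (y i) - x)) / Z)"
          using Z by (intro prod_mono) (auto simp: w indicator_def divide_right_mono)
        also have "\<dots> = (1 / Z) ^ n * exp (\<Sum>i<n. u \<bullet> (\<phi> (y i) - x))"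
          by (simp add: exp_sum prod_dividef power_divide)
        also have "(\<Sum>i<n. u \<bullet> (\<phi> (y i) - x)) = real n * (u \<bullet> (emp \<phi> n y - x))"
          using elim by (simp add: emp_sub[symmetric] inner_emp)
        also have "u \<bullet> (emp \<phi> n y - x) \<le> norm u * e"
        proof -
          have "u \<bullet> (emp \<phi> n y - x) \<le> norm u * norm (emp \<phi> n y - x)" by (rule norm_cauchy_schwarz)
          also have "\<dots> \<le> norm u * e"
            using True by (intro mult_left_mono) (auto simp: dist_norm norm_minus_commute)
          finally show ?thesis .
        qed
        finally have "(\<Prod>i<n. w (y i) / Z) \<le> (1 / Z) ^ n * exp (real n * (norm u * e))"
          using Z elim by (simp add: mult_left_mono)
        then show ?thesis using True w0 Z by (simp add: prod_ennreal ennreal_leI)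
      qed simp
    qed
    also have "\<dots> = ennreal ((1 / Z) ^ n * exp (real n * (norm u * e)) * measure ?P ?A)"
      using Z by (simp add: nn_integral_cmult_indicator PP.emeasure_eq_measure ennreal_mult)
    finally have "measure ?N ?A \<le> (1 / Z) ^ n * exp (real n * (norm u * e)) * measure ?P ?A"
      using Z by (simp add: NN.emeasure_eq_measure)
    moreover have "1 / 2 \<le> measure ?N ?A"
      using elim(1) by (simp add: emp_sub spN dist_norm norm_minus_commute)
    ultimately have "1 / 2 \<le> (1 / Z) ^ n * exp (real n * (norm u * e)) * measure ?P ?A" by simp
    then have "Z ^ n * exp (- real n * (norm u * e)) * (1 / 2) \<le>
       Z ^ n * exp (- real n * (norm u * e)) * ((1 / Z) ^ n * exp (real n * (norm u * e)) * measure ?P ?A)"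
      using Z by (intro mult_left_mono) auto
    also have "\<dots> = measure ?P ?A"
      using Z by (simp add: power_divide exp_minus field_simps)
    finally show ?case by simp
  qed
qed

lemma eventually_le_exp_mult:
  fixes B c :: real
  assumes "c > 0"
  shows "\<forall>\<^sub>F n in sequentially. B \<le> exp (real n * c)"
proof -
  have "filterlim (\<lambda>n. exp (real n * c)) at_top sequentially"
    by (intro filterlim_compose[OF exp_at_top]
        filterlim_at_top_mult_tendsto_pos[OF tendsto_const assms filterlim_real_sequentially])
  then show ?thesis by (simp add: filterlim_at_top)
qed

text \<open>
  The first-order condition at a minimum.
\<close>

lemma quadratic_nonneg_imp_zero:
  fixes g C \<delta> :: real
  assumes "\<And>s. \<bar>s\<bar> \<le> \<delta> \<Longrightarrow> 0 \<le> s * g + s\<^sup>2 * C" "\<delta> > 0" "C \<ge> 0"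
  shows "g = 0"
proof (rule ccontr)
  assume g: "g \<noteq> 0"
  define r where "r = min \<delta> (\<bar>g\<bar> / (2 * C + 1))"
  have C1: "2 * C + 1 > 0" using assms by simp
  have "r \<le> \<bar>g\<bar> / (2 * C + 1)" by (simp add: r_def)
  then have "r * (2 * C + 1) \<le> \<bar>g\<bar>" by (simp only: pos_le_divide_eq[OF C1])
  then have r: "r > 0" "r \<le> \<delta>" "r * (2 * C + 1) \<le> \<bar>g\<bar>"
    using g assms C1 by (auto simp: r_def)
  have "0 \<le> (- sgn g * r) * g + (- sgn g * r)\<^sup>2 * C"
    using r by (intro assms(1)) (auto simp: abs_mult abs_sgn_eq)
  also have "(- sgn g * r) * g = - r * \<bar>g\<bar>" by (simp add: abs_sgn)
  also have "(- sgn g * r)\<^sup>2 = r * r" using g by (simp add: power2_eq_square sgn_if)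
  finally have "r * \<bar>g\<bar> \<le> r * (r * C)" by simp
  then have "\<bar>g\<bar> \<le> r * C" using r by simp
  moreover have "r * (2 * C + 1) = 2 * (r * C) + r" by (simp add: algebra_simps)
  moreover have "r * C \<ge> 0" using r assms by simp
  ultimately show False using r by linarith
qed

text \<open>
  The hypothesis \<open>inter\<close> says that \<open>x\<close> is interior to the convex hull of the support of \<open>\<phi>\<close>.
  Restrict the law to the set \<open>T M\<close> where \<open>|\<phi>| \<le> M\<close>. There \<open>G M u\<close>, the moment generating function
  of \<open>\<phi> - x\<close>, is finite for all \<open>u\<close>, and \<open>inter\<close> makes it coercive, uniformly in large \<open>M\<close>. So it has
  a minimiser, at which the tilted law has mean \<open>x\<close>, and \<open>tilted_lower\<close> applies. The minima
  exceed \<open>exp a\<close> for some \<open>M\<close>: otherwise the minimisers, which stay in a fixed ball, have a limit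
  point \<open>v\<close>, and by monotone convergence the full moment generating function at \<open>v\<close> is at most
  \<open>exp a\<close>, contrary to \<open>a\<close>.
\<close>

lemma cramer_lower_interior:
  fixes \<phi> :: "'b \<Rightarrow> 'a::euclidean_space"
  assumes pr: "prob_space \<mu>" and [measurable]: "\<phi> \<in> borel_measurable \<mu>"
    and inter: "\<And>u. u \<noteq> 0 \<Longrightarrow> \<not> (AE y in \<mu>. u \<bullet> (\<phi> y - x) \<le> 0)"
    and a: "\<And>v. integrable \<mu> (\<lambda>y. exp (v \<bullet> \<phi> y)) \<Longrightarrow> exp a < (LINT y|\<mu>. exp (v \<bullet> (\<phi> y - x)))"
    and e: "e > 0"
  shows "\<forall>\<^sub>F n in sequentially. exp (real n * a) \<le>
    measure (iid \<mu> n) {y\<in>space (iid \<mu> n). emp \<phi> n y \<in> ball x e}"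
proof -
  interpret prob_space \<mu> by fact
  \<comment> \<open>F u weighs the half-space \<open>u \<bullet> (\<phi> - x) > 0\<close>; the denominator makes it finite and
    Lipschitz in u. It is positive by \<open>inter\<close>, hence bounded below on the unit sphere, and
    this bound yields coercivity.\<close>
  define F where "F u = (LINT y|\<mu>. max 0 (u \<bullet> (\<phi> y - x)) / (1 + norm (\<phi> y - x)))" for u
  have pos1: "1 + norm (\<phi> y - x) > 0" for y by (simp add: add_pos_nonneg)
  have Fb: "\<bar>max 0 (u \<bullet> (\<phi> y - x)) / (1 + norm (\<phi> y - x))\<bar> \<le> norm u" for u y
  proof -
    have "\<bar>u \<bullet> (\<phi> y - x)\<bar> \<le> norm u * norm (\<phi> y - x)" by (rule Cauchy_Schwarz_ineq2)
    also have "\<dots> \<le> norm u * (1 + norm (\<phi> y - x))" by (intro mult_left_mono) auto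
    finally show ?thesis using pos1[of y] by (auto simp: divide_le_eq max_def)
  qed
  have Fint: "integrable \<mu> (\<lambda>y. max 0 (u \<bullet> (\<phi> y - x)) / (1 + norm (\<phi> y - x)))" for u
    using Fb by (intro integrable_const_bound[of _ "norm u"]) auto
  have FL: "\<bar>F u - F v\<bar> \<le> norm (u - v)" for u v
  proof -
    have "\<bar>F u - F v\<bar> = \<bar>LINT y|\<mu>. (max 0 (u \<bullet> (\<phi> y - x)) - max 0 (v \<bullet> (\<phi> y - x))) / (1 + norm (\<phi> y - x))\<bar>"
      unfolding F_def using Fint by (simp add: diff_divide_distrib)
    also have "\<dots> \<le> (LINT y|\<mu>. norm (u - v))"
    proof (rule integral_abs_bound[THEN order_trans], rule integral_mono)
      show "integrable \<mu> (\<lambda>y. \<bar>(max 0 (u \<bullet> (\<phi> y - x)) - max 0 (v \<bullet> (\<phi> y - x))) / (1 + norm (\<phi> y - x))\<bar>)"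
        using Fint by (simp add: diff_divide_distrib)
      fix y
      have "\<bar>max 0 (u \<bullet> (\<phi> y - x)) - max 0 (v \<bullet> (\<phi> y - x))\<bar> \<le> \<bar>(u - v) \<bullet> (\<phi> y - x)\<bar>"
        by (simp add: inner_diff_left)
      also have "\<dots> \<le> norm (u - v) * norm (\<phi> y - x)" by (rule Cauchy_Schwarz_ineq2)
      also have "\<dots> \<le> norm (u - v) * (1 + norm (\<phi> y - x))" by (intro mult_left_mono) auto
      finally show "\<bar>(max 0 (u \<bullet> (\<phi> y - x)) - max 0 (v \<bullet> (\<phi> y - x))) / (1 + norm (\<phi> y - x))\<bar> \<le> norm (u - v)"
        using pos1[of y] by (simp add: divide_le_eq)
    qed simp
    finally show ?thesis by (simp add: prob_space)
  qed
  have Fpos: "F u > 0" if "u \<noteq> 0" for u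
  proof -
    have "F u \<ge> 0" unfolding F_def by (intro Bochner_Integration.integral_nonneg) (simp add: pos1 less_imp_le)
    moreover have "F u \<noteq> 0"
    proof
      assume "F u = 0"
      then have "AE y in \<mu>. max 0 (u \<bullet> (\<phi> y - x)) / (1 + norm (\<phi> y - x)) = 0"
        unfolding F_def using Fint
        by (subst (asm) integral_nonneg_eq_0_iff_AE) (auto simp: pos1 less_imp_le)
      then have "AE y in \<mu>. u \<bullet> (\<phi> y - x) \<le> 0"
      proof eventually_elim
        case (elim y)
        then show ?case using pos1[of y] by (auto simp: max_def split: if_splits)
      qed
      with inter[OF that] show False by simp
    qed
    ultimately show ?thesis by simp
  qed
  have "continuous_on (sphere 0 1) F"
    unfolding continuous_on_iff
  proof (intro ballI allI impI)
    fix u :: 'a and d :: real assume "d > 0"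
    then show "\<exists>d'>0. \<forall>v\<in>sphere 0 1. dist v u < d' \<longrightarrow> dist (F v) (F u) < d"
      using FL by (intro exI[of _ d]) (auto simp: dist_norm intro: le_less_trans)
  qed
  then obtain u0 where u0: "u0 \<in> sphere 0 1" "\<And>u. u \<in> sphere 0 1 \<Longrightarrow> F u0 \<le> F u"
    using continuous_attains_inf[of "sphere (0::'a) 1" F] by auto
  define c where "c = F u0 / 2"
  have "u0 \<noteq> 0" using u0(1) by auto
  then have c: "c > 0" using Fpos[of u0] by (simp add: c_def)
  have Fc: "2 * c \<le> F u" if "norm u = 1" for u using u0(2)[of u] that by (simp add: c_def)
  define T where "T M = {y\<in>space \<mu>. norm (\<phi> y) \<le> real M}" for M :: nat
  have T[measurable]: "T M \<in> sets \<mu>" for M unfolding T_def by measurable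
  have Tmono: "T M \<subseteq> T M'" if "M \<le> M'" for M M' using that by (auto simp: T_def)
  have TU: "(\<Union>M. T M) = space \<mu>"
    by (auto simp: T_def intro: real_arch_simple)
  have "(\<lambda>M. measure \<mu> (T M)) \<longlonglongrightarrow> measure \<mu> (\<Union>M. T M)"
    by (intro finite_Lim_measure_incseq) (auto simp: incseq_def Tmono)
  then have "\<forall>\<^sub>F M in sequentially. measure \<mu> (T M) > 1 - c"
    using c by (intro order_tendstoD) (auto simp: TU prob_space)
  then obtain M0 where M0: "\<And>M. M \<ge> M0 \<Longrightarrow> measure \<mu> (T M) > 1 - c"
    by (auto simp: eventually_sequentially)
  define w where "w M u y = indicator (T M) y * exp (u \<bullet> (\<phi> y - x))" for M u y
  define G where "G M u = (LINT y|\<mu>. w M u y)" for M u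
  have wm[measurable]: "w M u \<in> borel_measurable \<mu>" for M u unfolding w_def by measurable
  have w0: "w M u y \<ge> 0" for M u y by (simp add: w_def)
  have wb: "w M u y \<le> exp (R * (real M + norm x))" if "norm u \<le> R" for M u y R
  proof (cases "y \<in> T M")
    case True
    have "u \<bullet> (\<phi> y - x) \<le> norm u * norm (\<phi> y - x)" by (rule norm_cauchy_schwarz)
    also have "\<dots> \<le> R * (real M + norm x)"
      using that True norm_triangle_ineq4[of "\<phi> y" x] order_trans[OF norm_ge_zero that]
      by (intro mult_mono) (auto simp: T_def)
    finally show ?thesis using True by (simp add: w_def)
  qed (simp add: w_def)
  have wint: "integrable \<mu> (w M u)" for M u
    using wb[of u "norm u" M] w0 by (intro integrable_const_bound[of _ "exp (norm u * (real M + norm x))"]) auto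
  have Gcont: "(\<lambda>j. G M (us j)) \<longlonglongrightarrow> G M u" if us: "us \<longlonglongrightarrow> u" for M us u
  proof -
    obtain R where R: "\<And>j. norm (us j) \<le> R"
      using convergent_imp_Bseq[of us] us by (auto simp: convergent_def Bseq_def)
    show ?thesis
      unfolding G_def
    proof (rule integral_dominated_convergence)
      show "integrable \<mu> (\<lambda>y. exp (R * (real M + norm x)))" by simp
      show "AE y in \<mu>. (\<lambda>j. w M (us j) y) \<longlonglongrightarrow> w M u y"
        unfolding w_def using us by (intro AE_I2 tendsto_intros)
      show "AE y in \<mu>. norm (w M (us j) y) \<le> exp (R * (real M + norm x))" for j
        using wb[OF R] w0 by simp
    qed auto
  qed
  have Gmono: "G M u \<le> G M' u" if "M \<le> M'" for M M' u
    unfolding G_def using wint Tmono[OF that]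
    by (intro integral_mono) (auto simp: w_def indicator_def)
  have coercive: "c * norm v \<le> G M v" if M: "M \<ge> M0" for M v
  proof (cases "v = 0")
    case True
    then show ?thesis unfolding G_def by (simp add: Bochner_Integration.integral_nonneg w0)
  next
    case False
    define u where "u = (1 / norm v) *\<^sub>R v"
    have u: "norm u = 1" "v = norm v *\<^sub>R u" using False by (auto simp: u_def)
    let ?f = "\<lambda>y. max 0 (u \<bullet> (\<phi> y - x)) / (1 + norm (\<phi> y - x))"
    have ii: "integrable \<mu> (\<lambda>y. indicator (space \<mu> - T M) y :: real)"
      by (intro integrable_real_indicator) (auto simp: emeasure_eq_measure)
    have "norm v * (F u - measure \<mu> (space \<mu> - T M)) = (LINT y|\<mu>. norm v * (?f y - indicator (space \<mu> - T M) y))"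
      unfolding F_def using Fint[of u] ii by (simp add: Int_absorb1 Diff_subset)
    also have "\<dots> \<le> G M v"
      unfolding G_def
    proof (rule integral_mono)
      show "integrable \<mu> (\<lambda>y. norm v * (?f y - indicator (space \<mu> - T M) y))" using Fint[of u] ii by simp
      fix y assume y: "y \<in> space \<mu>"
      have f1: "?f y \<le> 1" using Fb[of u y] u(1) by (simp add: abs_le_iff)
      show "norm v * (?f y - indicator (space \<mu> - T M) y) \<le> w M v y"
      proof (cases "y \<in> T M")
        case True
        have "?f y \<le> max 0 (u \<bullet> (\<phi> y - x)) / 1"
          by (intro divide_left_mono) (auto simp: pos1 add_pos_nonneg)
        then have "norm v * ?f y \<le> norm v * max 0 (u \<bullet> (\<phi> y - x))" by (intro mult_left_mono) auto
        also have "\<dots> = max 0 (v \<bullet> (\<phi> y - x))"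
          by (subst (2) u(2)) (simp add: max_mult_distrib_left)
        also have "\<dots> \<le> exp (v \<bullet> (\<phi> y - x))"
          using exp_ge_add_one_self[of "v \<bullet> (\<phi> y - x)"] exp_gt_zero[of "v \<bullet> (\<phi> y - x)"]
          unfolding max_def by (smt (verit))
        finally show ?thesis using True by (simp add: w_def)
      next
        case False
        then have "norm v * (?f y - indicator (space \<mu> - T M) y) \<le> norm v * 0"
          using f1 y by (intro mult_left_mono) auto
        then show ?thesis using w0[of M v y] by simp
      qed
    qed (rule wint)
    finally have "norm v * (F u - measure \<mu> (space \<mu> - T M)) \<le> G M v" .
    moreover have "c \<le> F u - measure \<mu> (space \<mu> - T M)"
      using Fc[OF u(1)] M0[OF M] prob_compl[OF T[of M]] by simp
    ultimately show ?thesis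
      using mult_left_mono[of c "F u - measure \<mu> (space \<mu> - T M)" "norm v"] by (simp add: mult.commute)
  qed
  have G0: "G M 0 \<le> 1" for M
  proof -
    have "w M 0 = (\<lambda>y. indicator (T M) y)" by (rule ext) (simp add: w_def)
    then show ?thesis unfolding G_def by simp
  qed
  have minim: "\<exists>u\<in>cball 0 (1 / c). \<forall>v. G M u \<le> G M v" if M: "M \<ge> M0" for M
  proof -
    have "continuous_on (cball 0 (1 / c)) (G M)"
      unfolding continuous_on_sequentially using Gcont by (auto simp: o_def)
    then obtain u where u: "u \<in> cball 0 (1 / c)" "\<And>v. v \<in> cball 0 (1 / c) \<Longrightarrow> G M u \<le> G M v"
      using continuous_attains_inf[of "cball (0::'a) (1 / c)" "G M"] c by auto
    have "G M u \<le> G M v" if "v \<notin> cball 0 (1 / c)" for v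
    proof -
      have "1 < c * norm v" using that c by (simp add: field_simps not_le)
      then show ?thesis using coercive[OF M, of v] u(2)[of 0] G0[of M] c by simp
    qed
    with u show ?thesis by blast
  qed
  \<comment> \<open>The compactness argument that lets the truncation level grow.\<close>
  obtain M u where Mu: "M \<ge> M0" "\<And>v. G M u \<le> G M v" "exp a < G M u"
  proof -
    have "\<exists>M\<ge>M0. \<exists>u. (\<forall>v. G M u \<le> G M v) \<and> exp a < G M u"
    proof (rule ccontr)
      assume neg: "\<not> ?thesis"
      have "\<exists>u\<in>cball 0 (1 / c). G (M0 + j) u \<le> exp a" for j
        using minim[of "M0 + j"] neg by (metis le_add1 not_less)
      then obtain us where us: "\<And>j. us j \<in> cball 0 (1 / c)" "\<And>j. G (M0 + j) (us j) \<le> exp a" by metis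
      obtain v r where r: "strict_mono (r :: nat \<Rightarrow> nat)" "(us \<circ> r) \<longlonglongrightarrow> v"
        using compact_cball[of "0::'a" "1/c"] us(1) unfolding compact_def by metis
      have Gv: "G K v \<le> exp a" for K
      proof (rule LIMSEQ_le_const2)
        show "(\<lambda>j. G K ((us \<circ> r) j)) \<longlonglongrightarrow> G K v" by (rule Gcont[OF r(2)])
        have "G K ((us \<circ> r) j) \<le> exp a" if "j \<ge> K" for j
        proof -
          have "K \<le> M0 + r j" using seq_suble[OF r(1), of j] that by simp
          then show ?thesis using Gmono[of K "M0 + r j" "us (r j)"] us(2)[of "r j"] by simp
        qed
        then show "\<exists>N. \<forall>j\<ge>N. G K ((us \<circ> r) j) \<le> exp a" by blast
      qed
      have "(\<lambda>K. \<integral>\<^sup>+y. ennreal (w K v y) \<partial>\<mu>) \<longlonglongrightarrow> (\<integral>\<^sup>+y. ennreal (exp (v \<bullet> (\<phi> y - x)) * indicator (space \<mu>) y) \<partial>\<mu>)"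
      proof (rule nn_integral_LIMSEQ)
        show "incseq (\<lambda>K y. ennreal (w K v y))"
          using Tmono by (auto simp: incseq_def le_fun_def w_def indicator_def intro!: ennreal_leI)
        show "(\<lambda>K. ennreal (w K v y)) \<longlonglongrightarrow> ennreal (exp (v \<bullet> (\<phi> y - x)) * indicator (space \<mu>) y)" for y
        proof (cases "y \<in> space \<mu>")
          case True
          then obtain N where N: "y \<in> T N" using TU by blast
          then have "\<forall>K\<ge>N. ennreal (w K v y) = ennreal (exp (v \<bullet> (\<phi> y - x)) * indicator (space \<mu>) y)"
            using Tmono True by (auto simp: w_def indicator_def)
          then show ?thesis by (intro tendsto_eventually) (auto simp: eventually_sequentially)
        next
          case False
          then have "w K v y = 0" for K by (simp add: w_def T_def)
          then show ?thesis using False by simp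
        qed
      qed auto
      moreover have "(\<integral>\<^sup>+y. ennreal (w K v y) \<partial>\<mu>) \<le> ennreal (exp a)" for K
        using wint Gv[of K] w0 by (subst nn_integral_eq_integral) (auto simp: G_def intro!: ennreal_leI)
      ultimately have "(\<integral>\<^sup>+y. ennreal (exp (v \<bullet> (\<phi> y - x)) * indicator (space \<mu>) y) \<partial>\<mu>) \<le> ennreal (exp a)"
        by (intro LIMSEQ_le_const2) auto
      then have le: "(\<integral>\<^sup>+y. ennreal (exp (v \<bullet> (\<phi> y - x))) \<partial>\<mu>) \<le> ennreal (exp a)"
        by (subst (asm) nn_integral_cong[of \<mu> _ "\<lambda>y. ennreal (exp (v \<bullet> (\<phi> y - x)))"]) auto
      then have int: "integrable \<mu> (\<lambda>y. exp (v \<bullet> (\<phi> y - x)))"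
        by (intro integrableI_bounded) (auto simp: le_less_trans ennreal_less_top)
      have "integrable \<mu> (\<lambda>y. exp (v \<bullet> x) * exp (v \<bullet> (\<phi> y - x)))" using int by simp
      then have "integrable \<mu> (\<lambda>y. exp (v \<bullet> \<phi> y))" by (simp add: exp_add[symmetric] inner_diff_right)
      from a[OF this] have "exp a < (LINT y|\<mu>. exp (v \<bullet> (\<phi> y - x)))" .
      moreover have "ennreal (LINT y|\<mu>. exp (v \<bullet> (\<phi> y - x))) \<le> ennreal (exp a)"
        using le int by (subst (asm) nn_integral_eq_integral) auto
      ultimately show False by simp
    qed
    then show ?thesis using that by blast
  qed
  \<comment> \<open>Compare G at u and at \<open>u + s v\<close> for small s of either sign.\<close>
  have stat: "(LINT y|\<mu>. w M u y * (v \<bullet> (\<phi> y - x))) = 0" for v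
  proof -
    define K where "K = norm v * (real M + norm x) + 1"
    have K: "K > 0" by (simp add: K_def add_nonneg_pos)
    have vK: "\<bar>v \<bullet> (\<phi> y - x)\<bar> \<le> K" if "y \<in> T M" for y
    proof -
      have "\<bar>v \<bullet> (\<phi> y - x)\<bar> \<le> norm v * norm (\<phi> y - x)" by (rule Cauchy_Schwarz_ineq2)
      also have "\<dots> \<le> norm v * (real M + norm x)"
        using that norm_triangle_ineq4[of "\<phi> y" x] by (intro mult_left_mono) (auto simp: T_def)
      finally show ?thesis by (simp add: K_def)
    qed
    have int1: "integrable \<mu> (\<lambda>y. w M u y * (v \<bullet> (\<phi> y - x)))"
    proof (rule integrable_const_bound[of _ "exp (norm u * (real M + norm x)) * K"])
      show "AE y in \<mu>. norm (w M u y * (v \<bullet> (\<phi> y - x))) \<le> exp (norm u * (real M + norm x)) * K"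
      proof (rule AE_I2)
        fix y
        show "norm (w M u y * (v \<bullet> (\<phi> y - x))) \<le> exp (norm u * (real M + norm x)) * K"
        proof (cases "y \<in> T M")
          case True
          then show ?thesis using wb[of u "norm u" M y] w0[of M u y] vK[OF True] K
            by (auto simp: abs_mult intro!: mult_mono)
        qed (use K in \<open>simp add: w_def\<close>)
      qed
    qed auto
    show ?thesis
    proof (rule quadratic_nonneg_imp_zero[of "1 / K" _ "K\<^sup>2 * G M u"])
      fix s :: real assume s: "\<bar>s\<bar> \<le> 1 / K"
      have "G M u \<le> G M (u + s *\<^sub>R v)" by (rule Mu(2))
      also have "\<dots> \<le> (LINT y|\<mu>. w M u y + s * (w M u y * (v \<bullet> (\<phi> y - x))) + s\<^sup>2 * K\<^sup>2 * w M u y)"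
        unfolding G_def
      proof (rule integral_mono)
        show "integrable \<mu> (\<lambda>y. w M u y + s * (w M u y * (v \<bullet> (\<phi> y - x))) + s\<^sup>2 * K\<^sup>2 * w M u y)"
          using wint int1 by simp
        fix y
        show "w M (u + s *\<^sub>R v) y \<le> w M u y + s * (w M u y * (v \<bullet> (\<phi> y - x))) + s\<^sup>2 * K\<^sup>2 * w M u y"
        proof (cases "y \<in> T M")
          case True
          define q where "q = v \<bullet> (\<phi> y - x)"
          have q: "\<bar>q\<bar> \<le> K" using vK[OF True] by (simp add: q_def)
          have "\<bar>s * q\<bar> \<le> (1 / K) * K" unfolding abs_mult using s q K by (intro mult_mono) auto
          then have "exp (s * q) \<le> 1 + s * q + (s * q)\<^sup>2" using K by (intro exp_le_quadratic) simp
          also have "(s * q)\<^sup>2 \<le> s\<^sup>2 * K\<^sup>2"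
            unfolding power_mult_distrib using q K abs_le_square_iff[of q K] by (intro mult_left_mono) auto
          finally have "exp (s * q) \<le> 1 + s * q + s\<^sup>2 * K\<^sup>2" by simp
          then have "w M u y * exp (s * q) \<le> w M u y * (1 + s * q + s\<^sup>2 * K\<^sup>2)"
            using w0 by (intro mult_left_mono) auto
          moreover have "w M (u + s *\<^sub>R v) y = w M u y * exp (s * q)"
            using True by (simp add: w_def q_def inner_add_left exp_add)
          ultimately show ?thesis by (simp add: q_def algebra_simps)
        qed (simp add: w_def)
      qed (rule wint)
      also have "\<dots> = G M u + s * (LINT y|\<mu>. w M u y * (v \<bullet> (\<phi> y - x))) + s\<^sup>2 * K\<^sup>2 * G M u"
        unfolding G_def using wint int1 by simp
      finally show "0 \<le> s * (LINT y|\<mu>. w M u y * (v \<bullet> (\<phi> y - x))) + s\<^sup>2 * (K\<^sup>2 * G M u)"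
        by (simp add: algebra_simps)
    qed (use K less_trans[OF exp_gt_zero Mu(3)] in \<open>auto intro!: mult_nonneg_nonneg\<close>)
  qed
  define Z where "Z = G M u"
  have Z0: "Z > 0" unfolding Z_def by (rule less_trans[OF exp_gt_zero Mu(3)])
  have "ln (exp a) < ln Z" using Mu(3) Z0 unfolding Z_def by (subst ln_less_cancel_iff) auto
  then have Z: "Z > 0" "a < ln Z" using Z0 by auto
  \<comment> \<open>On so small a ball the factor \<open>exp (n |u| e')\<close> of the tilting bound costs at most half of
    the gap between a and \<open>ln Z\<close>.\<close>
  define e' where "e' = min e ((ln Z - a) / (2 * (norm u + 1)))"
  have np: "norm u + 1 > 0" by (simp add: add_nonneg_pos)
  have e': "e' > 0" "e' \<le> e" using e Z np by (auto simp: e'_def)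
  have "norm u * e' \<le> (norm u + 1) * ((ln Z - a) / (2 * (norm u + 1)))"
    using e' np by (intro mult_mono) (auto simp: e'_def)
  also have "\<dots> = (ln Z - a) / 2" using np by (simp add: field_simps)
  finally have ue: "norm u * e' \<le> (ln Z - a) / 2" .
  have ev: "\<forall>\<^sub>F n in sequentially. 2 \<le> exp (real n * ((ln Z - a) / 2))"
    using Z by (intro eventually_le_exp_mult) simp
  have "\<forall>\<^sub>F n in sequentially. Z ^ n * exp (- real n * (norm u * e')) / 2 \<le>
    measure (iid \<mu> n) {y\<in>space (iid \<mu> n). emp \<phi> n y \<in> ball x e'}"
  proof (rule tilted_lower[OF pr _ T])
    show "norm (\<phi> y) \<le> real M" if "y \<in> T M" for y using that by (simp add: T_def)
    show "w M u = (\<lambda>y. indicator (T M) y * exp (u \<bullet> (\<phi> y - x)))" by (rule ext) (simp add: w_def)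
  qed (use Z e' stat in \<open>auto simp: Z_def G_def\<close>)
  with ev show ?thesis
  proof eventually_elim
    case (elim n)
    interpret P: prob_space "iid \<mu> n" by (intro prob_space_PiM pr)
    have "exp (real n * a) * 2 \<le> exp (real n * a) * exp (real n * ((ln Z - a) / 2))"
      using elim by (intro mult_left_mono) auto
    also have "\<dots> = exp (real n * (ln Z - (ln Z - a) / 2))"
      by (simp add: exp_add[symmetric] algebra_simps)
    also have "\<dots> \<le> exp (real n * (ln Z - norm u * e'))"
      using ue by (auto intro!: mult_left_mono)
    also have "\<dots> = Z ^ n * exp (- real n * (norm u * e'))"
      using Z by (simp add: right_diff_distrib exp_diff exp_minus exp_of_nat_mult divide_inverse)
    finally have "exp (real n * a) \<le> measure (iid \<mu> n) {y\<in>space (iid \<mu> n). emp \<phi> n y \<in> ball x e'}"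
      using elim by simp
    also have "\<dots> \<le> measure (iid \<mu> n) {y\<in>space (iid \<mu> n). emp \<phi> n y \<in> ball x e}"
    proof (rule P.finite_measure_mono)
      have "{y\<in>space (iid \<mu> n). emp \<phi> n y \<in> ball x e} = emp \<phi> n -` ball x e \<inter> space (iid \<mu> n)" by auto
      then show "{y\<in>space (iid \<mu> n). emp \<phi> n y \<in> ball x e} \<in> sets (iid \<mu> n)"
        by (simp add: measurable_sets[OF measurable_emp])
    qed (use e' in auto)
    finally show ?case .
  qed
qed

text \<open>
  A point \<open>x\<close> with finite rate may lie on the boundary of the convex support. So move it
  slightly towards the mean \<open>m\<close>, to a point \<open>z\<close> in the given ball. A half-space through \<open>z\<close> that
  contains the law would contain \<open>m\<close>; then either the law sits on a hyperplane, or \<open>x\<close> is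
  separated from the law and has infinite rate. The rate at \<open>z\<close> is at most \<open>b\<close> by convexity, as
  it is \<open>0\<close> at \<open>m\<close>.
\<close>

lemma cramer_lower:
  fixes \<phi> :: "'b \<Rightarrow> 'a::euclidean_space"
  assumes pr: "prob_space \<mu>" and [measurable]: "\<phi> \<in> borel_measurable \<mu>"
    and int: "integrable \<mu> \<phi>"
    and nondeg: "\<And>u c. u \<noteq> 0 \<Longrightarrow> \<not> (AE y in \<mu>. u \<bullet> \<phi> y = c)"
    and b: "\<And>v. integrable \<mu> (\<lambda>y. exp (v \<bullet> \<phi> y)) \<Longrightarrow> exp (- b) \<le> (LINT y|\<mu>. exp (v \<bullet> (\<phi> y - x)))"
    and ab: "b < a" and e: "e > 0"
  shows "\<forall>\<^sub>F n in sequentially. exp (- real n * a) \<le>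
    measure (iid \<mu> n) {y\<in>space (iid \<mu> n). emp \<phi> n y \<in> ball x e}"
proof -
  interpret prob_space \<mu> by fact
  define m where "m = (LINT y|\<mu>. \<phi> y)"
  have m: "(LINT y|\<mu>. u \<bullet> \<phi> y) = u \<bullet> m" for u unfolding m_def using int by (rule integral_inner_right)
  have iu: "integrable \<mu> (\<lambda>y. u \<bullet> \<phi> y)" for u using int by (rule integrable_inner_right)
  have b0: "b \<ge> 0" using b[of 0] by (simp add: prob_space)
  define t where "t = min (1/2) (e / (2 * (norm (m - x) + 1)))"
  have np: "norm (m - x) + 1 > 0" by (simp add: add_nonneg_pos)
  have t: "t > 0" "t < 1" using e np by (auto simp: t_def)
  define z where "z = x + t *\<^sub>R (m - x)"
  have "t * norm (m - x) \<le> (e / (2 * (norm (m - x) + 1))) * (norm (m - x) + 1)"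
    using t by (intro mult_mono) (auto simp: t_def)
  also have "\<dots> = e / 2" using np by (simp add: field_simps)
  finally have zx: "dist x z \<le> e / 2" using t by (simp add: z_def dist_norm)
  have "\<forall>\<^sub>F n in sequentially. exp (real n * (- a)) \<le>
    measure (iid \<mu> n) {y\<in>space (iid \<mu> n). emp \<phi> n y \<in> ball z (e / 2)}"
  proof (rule cramer_lower_interior[OF pr])
    fix u :: 'a assume u: "u \<noteq> 0"
    show "\<not> (AE y in \<mu>. u \<bullet> (\<phi> y - z) \<le> 0)"
    proof
      assume *: "AE y in \<mu>. u \<bullet> (\<phi> y - z) \<le> 0"
      have "(LINT y|\<mu>. u \<bullet> \<phi> y - u \<bullet> z) \<le> (LINT y|\<mu>. 0)"
        using * iu by (intro integral_mono_AE) (auto simp: inner_diff_right)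
      then have "u \<bullet> (m - z) \<le> 0" using iu m by (simp add: prob_space inner_diff_right)
      moreover have "m - z = (1 - t) *\<^sub>R (m - x)" by (simp add: z_def algebra_simps)
      ultimately have "(1 - t) * (u \<bullet> (m - x)) \<le> 0" by simp
      then have umx: "u \<bullet> (m - x) \<le> 0" using t by (simp add: mult_le_0_iff)
      have uz: "u \<bullet> (z - x) = t * (u \<bullet> (m - x))" by (simp add: z_def)
      show False
      proof (cases "u \<bullet> (m - x) = 0")
        case True
        then have "u \<bullet> z = u \<bullet> m" using uz by (simp add: inner_diff_right)
        then have le: "AE y in \<mu>. 0 \<le> u \<bullet> m - u \<bullet> \<phi> y" using * by (simp add: inner_diff_right)
        have "(LINT y|\<mu>. u \<bullet> m - u \<bullet> \<phi> y) = 0" using iu m by (simp add: prob_space)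
        then have "AE y in \<mu>. u \<bullet> m - u \<bullet> \<phi> y = 0"
          using le iu by (subst (asm) integral_nonneg_eq_0_iff_AE) auto
        then have "AE y in \<mu>. u \<bullet> \<phi> y = u \<bullet> m" by eventually_elim simp
        with nondeg[OF u] show False by blast
      next
        case False
        \<comment> \<open>The law stays at distance \<open>\<kappa>\<close> from x in the direction u, so the moment generating
          function of \<open>\<phi> - x\<close> falls below \<open>exp (- b)\<close> far out in this direction.\<close>
        define \<kappa> where "\<kappa> = - t * (u \<bullet> (m - x))"
        have \<kappa>: "\<kappa> > 0" using False umx t by (simp add: \<kappa>_def mult_less_0_iff)
        have **: "AE y in \<mu>. u \<bullet> (\<phi> y - x) \<le> - \<kappa>"
          using * by eventually_elim (use uz in \<open>simp add: \<kappa>_def inner_diff_right\<close>)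
        define s where "s = (b + 1) / \<kappa>"
        have s: "s > 0" "s * \<kappa> = b + 1" using \<kappa> b0 by (auto simp: s_def)
        have 1: "AE y in \<mu>. exp ((s *\<^sub>R u) \<bullet> (\<phi> y - x)) \<le> exp (- (b + 1))"
          using **
        proof eventually_elim
          case (elim y)
          have "s * (u \<bullet> (\<phi> y - x)) \<le> s * (- \<kappa>)" using elim s by (intro mult_left_mono) auto
          then show ?case using s(2) by simp
        qed
        have i1: "integrable \<mu> (\<lambda>y. exp ((s *\<^sub>R u) \<bullet> (\<phi> y - x)))"
          using 1 by (intro integrable_const_bound[of _ "exp (- (b + 1))"]) auto
        then have "integrable \<mu> (\<lambda>y. exp ((s *\<^sub>R u) \<bullet> x) * exp ((s *\<^sub>R u) \<bullet> (\<phi> y - x)))" by simp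
        then have "integrable \<mu> (\<lambda>y. exp ((s *\<^sub>R u) \<bullet> \<phi> y))"
          by (simp add: exp_add[symmetric] inner_diff_right right_diff_distrib)
        from b[OF this] have "exp (- b) \<le> (LINT y|\<mu>. exp ((s *\<^sub>R u) \<bullet> (\<phi> y - x)))" .
        also have "\<dots> \<le> (LINT y|\<mu>. exp (- (b + 1)))" using i1 1 by (intro integral_mono_AE) auto
        also have "\<dots> = exp (- (b + 1))" by (simp add: prob_space)
        finally show False by simp
      qed
    qed
  next
    fix v assume iv: "integrable \<mu> (\<lambda>y. exp (v \<bullet> \<phi> y))"
    define \<Lambda> where "\<Lambda> = (LINT y|\<mu>. exp (v \<bullet> \<phi> y))"
    have sh: "(LINT y|\<mu>. exp (v \<bullet> (\<phi> y - q))) = \<Lambda> * exp (- (v \<bullet> q))" for q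
      by (simp add: \<Lambda>_def inner_diff_right exp_diff exp_minus divide_inverse)
    have ex: "exp (- b) \<le> \<Lambda> * exp (- (v \<bullet> x))" using b[OF iv] sh by simp
    \<comment> \<open>Jensen's inequality: the rate vanishes at the mean.\<close>
    have em: "1 \<le> \<Lambda> * exp (- (v \<bullet> m))"
    proof -
      have "1 = (LINT y|\<mu>. 1 + (v \<bullet> \<phi> y - v \<bullet> m))" using iu m by (simp add: prob_space)
      also have "\<dots> \<le> (LINT y|\<mu>. exp (v \<bullet> (\<phi> y - m)))"
      proof (rule integral_mono)
        have "integrable \<mu> (\<lambda>y. exp (- (v \<bullet> m)) * exp (v \<bullet> \<phi> y))" using iv by simp
        then show "integrable \<mu> (\<lambda>y. exp (v \<bullet> (\<phi> y - m)))" by (simp add: exp_add[symmetric] inner_diff_right)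
        show "1 + (v \<bullet> \<phi> y - v \<bullet> m) \<le> exp (v \<bullet> (\<phi> y - m))" for y
          using exp_ge_add_one_self[of "v \<bullet> (\<phi> y - m)"] by (simp add: inner_diff_right)
      qed (use iu in auto)
      finally show ?thesis using sh by simp
    qed
    have \<Lambda>: "\<Lambda> > 0" using ex exp_gt_zero[of "- b"] by (smt (verit) exp_gt_zero mult_nonpos_nonneg)
    have l1: "- b \<le> ln \<Lambda> - v \<bullet> x"
    proof -
      have "ln (exp (- b)) \<le> ln (\<Lambda> * exp (- (v \<bullet> x)))" using ex by (subst ln_le_cancel_iff) (use \<Lambda> in auto)
      then show ?thesis using \<Lambda> by (simp add: ln_mult)
    qed
    have l2: "0 \<le> ln \<Lambda> - v \<bullet> m"
    proof -
      have "ln 1 \<le> ln (\<Lambda> * exp (- (v \<bullet> m)))" using em by (subst ln_le_cancel_iff) (use \<Lambda> in auto)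
      then show ?thesis using \<Lambda> by (simp add: ln_mult)
    qed
    have "- b \<le> (1 - t) * (- b) + t * 0" using t b0 by (simp add: algebra_simps)
    also have "\<dots> \<le> (1 - t) * (ln \<Lambda> - v \<bullet> x) + t * (ln \<Lambda> - v \<bullet> m)"
      using l1 l2 t by (intro add_mono mult_left_mono) auto
    also have "\<dots> = ln \<Lambda> - v \<bullet> z" by (simp add: z_def inner_add_right inner_diff_right algebra_simps)
    finally have "- a < ln \<Lambda> - v \<bullet> z" using ab by simp
    then have "exp (- a) < exp (ln \<Lambda> - v \<bullet> z)" by simp
    also have "\<dots> = \<Lambda> * exp (- (v \<bullet> z))" using \<Lambda> by (simp add: exp_diff exp_minus divide_inverse)
    finally show "exp (- a) < (LINT y|\<mu>. exp (v \<bullet> (\<phi> y - z)))" using sh by simp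
  qed (use e in auto)
  then show ?thesis
  proof eventually_elim
    case (elim n)
    interpret P: prob_space "iid \<mu> n" by (intro prob_space_PiM pr)
    have "exp (- real n * a) \<le> measure (iid \<mu> n) {y\<in>space (iid \<mu> n). emp \<phi> n y \<in> ball z (e / 2)}"
      using elim by simp
    also have "\<dots> \<le> measure (iid \<mu> n) {y\<in>space (iid \<mu> n). emp \<phi> n y \<in> ball x e}"
    proof (rule P.finite_measure_mono)
      have "{y\<in>space (iid \<mu> n). emp \<phi> n y \<in> ball x e} = emp \<phi> n -` ball x e \<inter> space (iid \<mu> n)" by auto
      then show "{y\<in>space (iid \<mu> n). emp \<phi> n y \<in> ball x e} \<in> sets (iid \<mu> n)"
        by (simp add: measurable_sets[OF measurable_emp])
      have "ball z (e / 2) \<subseteq> ball x e"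
      proof
        fix q assume "q \<in> ball z (e / 2)"
        then show "q \<in> ball x e" using dist_triangle[of x q z] zx by auto
      qed
      then show "{y\<in>space (iid \<mu> n). emp \<phi> n y \<in> ball z (e / 2)} \<subseteq>
         {y\<in>space (iid \<mu> n). emp \<phi> n y \<in> ball x e}" by blast
    qed
    finally show ?case .
  qed
qed

section \<open>Local large deviation principles\<close>

text \<open>
  The large deviation bounds for small balls, which are equivalent to the weak large
  deviation principle. In this form the bounds are exponentials of real numbers, and they
  pass to products and continuous images by elementary inclusions of balls.
\<close>

definition local_ldp :: "(nat \<Rightarrow> 'a::metric_space measure) \<Rightarrow> ('a \<Rightarrow> ereal) \<Rightarrow> bool" where
  "local_ldp Q I \<longleftrightarrow>
    (\<forall>\<^sub>F n in sequentially. prob_space (Q n) \<and> sets (Q n) = sets borel) \<and>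
    (\<forall>x a. ereal a < I x \<longrightarrow>
       (\<exists>e>0. \<forall>\<^sub>F n in sequentially. measure (Q n) (ball x e) \<le> exp (- real n * a))) \<and>
    (\<forall>x a e. I x < ereal a \<longrightarrow> e > 0 \<longrightarrow>
       (\<forall>\<^sub>F n in sequentially. exp (- real n * a) \<le> measure (Q n) (ball x e)))"

lemma local_ldpD:
  assumes "local_ldp Q I"
  shows local_ldp_prob: "\<forall>\<^sub>F n in sequentially. prob_space (Q n) \<and> sets (Q n) = sets borel"
    and local_ldp_upper: "ereal a < I x \<Longrightarrow>
       \<exists>e>0. \<forall>\<^sub>F n in sequentially. measure (Q n) (ball x e) \<le> exp (- real n * a)"
    and local_ldp_lower: "I x < ereal a \<Longrightarrow> e > 0 \<Longrightarrow>
       \<forall>\<^sub>F n in sequentially. exp (- real n * a) \<le> measure (Q n) (ball x e)"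
  using assms unfolding local_ldp_def by blast+

lemma local_ldp_nonneg:
  assumes "local_ldp Q I" shows "0 \<le> I x"
proof (rule ccontr)
  assume "\<not> 0 \<le> I x"
  then have "I x < 0" by simp
  then obtain a where a: "I x < ereal a" "ereal a < 0"
    using ereal_dense2 by blast
  have "\<forall>\<^sub>F n in sequentially. exp (- real n * a) \<le> measure (Q n) (ball x 1)"
    using local_ldp_lower[OF assms a(1), of 1] by simp
  with local_ldp_prob[OF assms] eventually_ge_at_top[of "1::nat"]
  have "\<forall>\<^sub>F n::nat in sequentially. False"
  proof eventually_elim
    case (elim n)
    then have "measure (Q n) (ball x 1) \<le> 1" using prob_space.prob_le_1 by blast
    moreover have "exp (- real n * a) > 1" using elim a(2) by (simp add: mult_pos_neg)
    ultimately show False using elim by linarith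
  qed
  then show False by simp
qed

text \<open>
  A ball around \<open>x\<close> contains balls around its other points, so the upper bound at \<open>x\<close> competes
  with the lower bounds there.
\<close>

lemma local_ldp_lsc:
  assumes "local_ldp Q I" "ereal a < I x"
  obtains e where "e > 0" "\<And>y. y \<in> ball x e \<Longrightarrow> ereal a \<le> I y"
proof -
  obtain e where e: "e > 0"
    "\<forall>\<^sub>F n in sequentially. measure (Q n) (ball x e) \<le> exp (- real n * a)"
    using local_ldp_upper[OF assms] by blast
  show ?thesis
  proof (rule that[OF e(1)], rule ccontr)
    fix y assume y: "y \<in> ball x e" and "\<not> ereal a \<le> I y"
    then have "I y < ereal a" by simp
    then obtain c where c: "I y < ereal c" "ereal c < ereal a"
      using ereal_dense2 by blast
    obtain d where d: "d > 0" "ball y d \<subseteq> ball x e"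
      using y by (meson open_ball openE)
    have "\<forall>\<^sub>F n in sequentially. exp (- real n * c) \<le> measure (Q n) (ball y d)"
      using local_ldp_lower[OF assms(1) c(1) d(1)] .
    with e(2) local_ldp_prob[OF assms(1)] eventually_ge_at_top[of "1::nat"]
    have "\<forall>\<^sub>F n::nat in sequentially. False"
    proof eventually_elim
      case (elim n)
      then interpret prob_space "Q n" by simp
      have "measure (Q n) (ball y d) \<le> measure (Q n) (ball x e)"
        using d elim by (intro finite_measure_mono) auto
      then have "exp (- real n * c) \<le> exp (- real n * a)" using elim by linarith
      then show False using elim c(2) by simp
    qed
    then show False by simp
  qed
qed

text \<open>
  Finitely many balls cover \<open>K\<close>, and the gap between \<open>a\<close> and \<open>b\<close> absorbs their number.
\<close>

lemma local_ldp_compact_upper: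
  assumes L: "local_ldp Q I" and K: "compact K" and ab: "a < b"
    and b: "\<And>x. x \<in> K \<Longrightarrow> ereal b < I x"
  obtains G where "open G" "K \<subseteq> G" "\<forall>\<^sub>F n in sequentially. measure (Q n) G \<le> exp (- real n * a)"
proof -
  have "\<forall>x\<in>K. \<exists>e>0. \<forall>\<^sub>F n in sequentially. measure (Q n) (ball x e) \<le> exp (- real n * b)"
    using local_ldp_upper[OF L b] by blast
  then obtain e where e: "\<And>x. x \<in> K \<Longrightarrow> e x > 0"
    "\<And>x. x \<in> K \<Longrightarrow> \<forall>\<^sub>F n in sequentially. measure (Q n) (ball x (e x)) \<le> exp (- real n * b)"
    by metis
  obtain D where D: "D \<subseteq> K" "finite D" "K \<subseteq> (\<Union>x\<in>D. ball x (e x))"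
  proof (rule compactE_image[OF K, of K "\<lambda>x. ball x (e x)"])
    show "K \<subseteq> (\<Union>x\<in>K. ball x (e x))" using e(1) by fastforce
  qed auto
  have "filterlim (\<lambda>n. exp (real n * (b - a))) at_top sequentially"
    using ab by (intro filterlim_compose[OF exp_at_top] filterlim_tendsto_pos_mult_at_top
        filterlim_at_top_mult_tendsto_pos[OF _ _ filterlim_real_sequentially] tendsto_const) auto
  then have ev: "\<forall>\<^sub>F n in sequentially. real (card D) \<le> exp (real n * (b - a))"
    by (simp add: filterlim_at_top)
  have "\<forall>\<^sub>F n in sequentially. \<forall>x\<in>D. measure (Q n) (ball x (e x)) \<le> exp (- real n * b)"
    using D e(2) by (intro eventually_ball_finite) auto
  with ev local_ldp_prob[OF L]
  have "\<forall>\<^sub>F n in sequentially. measure (Q n) (\<Union>x\<in>D. ball x (e x)) \<le> exp (- real n * a)"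
  proof eventually_elim
    case (elim n)
    then interpret prob_space "Q n" by simp
    have "measure (Q n) (\<Union>x\<in>D. ball x (e x)) \<le> (\<Sum>x\<in>D. measure (Q n) (ball x (e x)))"
      using D elim by (intro measure_UNION_le) auto
    also have "\<dots> \<le> (\<Sum>x\<in>D. exp (- real n * b))" using elim by (intro sum_mono) auto
    also have "\<dots> = real (card D) * exp (- real n * b)" by simp
    also have "\<dots> \<le> exp (real n * (b - a)) * exp (- real n * b)"
      using elim by (intro mult_right_mono) auto
    also have "\<dots> = exp (- real n * a)" by (simp add: exp_add[symmetric] algebra_simps)
    finally show ?case .
  qed
  with D that[of "\<Union>x\<in>D. ball x (e x)"] show ?thesis by blast
qed

lemma local_ldp_outside:
  assumes L: "local_ldp Q I" and C: "closed C"
    and Q: "\<forall>\<^sub>F n in sequentially. measure (Q n) (- C) = 0" and x: "x \<notin> C"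
  shows "I x = \<infinity>"
proof (rule ccontr)
  assume "I x \<noteq> \<infinity>"
  then obtain a where a: "I x < ereal a"
    by (metis ereal_infty_less(1) less_PInf_Ex_of_nat)
  obtain d where d: "d > 0" "ball x d \<subseteq> - C"
    using C x by (meson ComplI open_Compl openE)
  have "\<forall>\<^sub>F n in sequentially. exp (- real n * a) \<le> measure (Q n) (ball x d)"
    using local_ldp_lower[OF L a d(1)] .
  with Q local_ldp_prob[OF L] have "\<forall>\<^sub>F n::nat in sequentially. False"
  proof eventually_elim
    case (elim n)
    then interpret prob_space "Q n" by simp
    have "measure (Q n) (ball x d) \<le> measure (Q n) (- C)"
      using d elim C by (intro finite_measure_mono) auto
    then show False using elim exp_gt_zero[of "- real n * a"] by linarith
  qed
  then show False by simp
qed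

text \<open>
  The contraction principle. For the upper bound, an open neighbourhood \<open>G\<close> of the compact
  fibre over \<open>y\<close> inside \<open>C\<close> has small probability, and the image of the compact set \<open>C - G\<close> keeps a
  distance from \<open>y\<close>.
\<close>

lemma local_ldp_contraction:
  fixes f :: "'a::metric_space \<Rightarrow> 'b::metric_space"
  assumes L: "local_ldp Q I" and f: "continuous_on UNIV f" and C: "compact C"
    and Q: "\<forall>\<^sub>F n in sequentially. measure (Q n) (- C) = 0"
  shows "local_ldp (\<lambda>n. distr (Q n) borel f) (\<lambda>y. INF z\<in>{z. f z = y}. I z)"
  unfolding local_ldp_def
proof (intro conjI allI impI)
  have fm: "f \<in> borel_measurable borel" using f by (rule borel_measurable_continuous_onI)
  show "\<forall>\<^sub>F n in sequentially. prob_space (distr (Q n) borel f) \<and> sets (distr (Q n) borel f) = sets borel"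
    using local_ldp_prob[OF L]
    by eventually_elim (auto intro!: prob_space.prob_space_distr simp: fm cong: measurable_cong_sets)
  {
    fix y a assume "ereal a < (INF z\<in>{z. f z = y}. I z)"
    then obtain b where b: "ereal a < ereal b" "ereal b < (INF z\<in>{z. f z = y}. I z)"
      using ereal_dense2 by blast
    have "closed {z. f z = y}"
      using continuous_closed_vimage[of "{y}" f] f
      by (simp add: vimage_def continuous_on_eq_continuous_at)
    then have K: "compact (C \<inter> {z. f z = y})" using C by (rule compact_Int_closed[rotated])
    have ab: "a < b" using b(1) by simp
    obtain G where G: "open G" "C \<inter> {z. f z = y} \<subseteq> G"
      "\<forall>\<^sub>F n in sequentially. measure (Q n) G \<le> exp (- real n * a)"
    proof (rule local_ldp_compact_upper[OF L K ab])
      fix x assume "x \<in> C \<inter> {z. f z = y}"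
      then have "(INF z\<in>{z. f z = y}. I z) \<le> I x" by (intro INF_lower) auto
      then show "ereal b < I x" using b(2) by (rule less_le_trans[rotated])
    qed blast
    have "compact (f ` (C - G))"
      using C G(1) f by (intro compact_continuous_image compact_diff) (auto intro: continuous_on_subset)
    moreover have "y \<notin> f ` (C - G)" using G(2) by auto
    ultimately obtain e where e: "e > 0" "ball y e \<subseteq> - f ` (C - G)"
      by (meson ComplI compact_imp_closed open_Compl openE)
    show "\<exists>e>0. \<forall>\<^sub>F n in sequentially. measure (distr (Q n) borel f) (ball y e) \<le> exp (- real n * a)"
    proof (intro exI[of _ e] conjI e(1))
      show "\<forall>\<^sub>F n in sequentially. measure (distr (Q n) borel f) (ball y e) \<le> exp (- real n * a)"
        using G(3) Q local_ldp_prob[OF L]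
      proof eventually_elim
        case (elim n)
        then interpret prob_space "Q n" by simp
        have [simp]: "sets (Q n) = sets borel" "space (Q n) = UNIV"
          using elim sets_eq_imp_space_eq[of "Q n" borel] by auto
        have "measure (distr (Q n) borel f) (ball y e) = measure (Q n) (f -` ball y e)"
          using fm by (subst measure_distr) (auto cong: measurable_cong_sets)
        also have "\<dots> \<le> measure (Q n) (G \<union> - C)"
        proof (intro finite_measure_mono)
          show "f -` ball y e \<subseteq> G \<union> - C" using e(2) by blast
          show "G \<union> - C \<in> sets (Q n)" using G(1) C by (auto dest: compact_imp_closed)
        qed
        also have "\<dots> \<le> measure (Q n) G + measure (Q n) (- C)"
          using G(1) C by (intro measure_Un_le) (auto dest: compact_imp_closed)
        finally show ?case using elim by simp
      qed
    qed
  }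
  fix y a and e :: real assume "(INF z\<in>{z. f z = y}. I z) < ereal a" "e > 0"
  then obtain z where z: "f z = y" "I z < ereal a" by (auto simp: INF_less_iff)
  have "open (f -` ball y e)"
    using f by (intro open_vimage) auto
  then obtain d where d: "d > 0" "ball z d \<subseteq> f -` ball y e"
    using z \<open>e > 0\<close> by (metis centre_in_ball openE vimageI)
  show "\<forall>\<^sub>F n in sequentially. exp (- real n * a) \<le> measure (distr (Q n) borel f) (ball y e)"
    using local_ldp_lower[OF L z(2) d(1)] local_ldp_prob[OF L]
  proof eventually_elim
    case (elim n)
    then interpret prob_space "Q n" by simp
    have [simp]: "sets (Q n) = sets borel" "space (Q n) = UNIV"
      using elim sets_eq_imp_space_eq[of "Q n" borel] by auto
    have "exp (- real n * a) \<le> measure (Q n) (ball z d)" using elim by simp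
    also have "\<dots> \<le> measure (Q n) (f -` ball y e)"
      using d(2) fm measurable_sets[OF fm, of "ball y e"] by (intro finite_measure_mono) auto
    also have "\<dots> = measure (distr (Q n) borel f) (ball y e)"
      using fm by (subst measure_distr) (auto cong: measurable_cong_sets)
    finally show ?case .
  qed
qed

lemma ereal_less_addE:
  fixes u v :: ereal
  assumes "ereal a < u + v" "0 \<le> u" "0 \<le> v"
  obtains c d where "ereal c < u" "ereal d < v" "a = c + d"
proof (cases "u = \<infinity>")
  case True
  have "ereal (-1) < v" using assms(3) by (rule less_le_trans[rotated]) simp
  then show ?thesis using that[of "a + 1" "-1"] True by simp
next
  case u: False
  show ?thesis
  proof (cases "v = \<infinity>")
    case True
    have "ereal (-1) < u" using assms(2) by (rule less_le_trans[rotated]) simp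
    then show ?thesis using that[of "-1" "a + 1"] True by simp
  next
    case False
    with u assms obtain r s where rs: "u = ereal r" "v = ereal s" by (cases u; cases v) auto
    with assms(1) have "a < r + s" by simp
    then show ?thesis using that[of "r - (r + s - a) / 2" "s - (r + s - a) / 2"] rs
      by (auto simp: field_simps)
  qed
qed

text \<open>
  Rates of independent variables add because a product of balls has the product of their
  probabilities.
\<close>

lemma local_ldp_pair:
  fixes P :: "nat \<Rightarrow> 'a::{metric_space, second_countable_topology} measure"
    and Q :: "nat \<Rightarrow> 'b::{metric_space, second_countable_topology} measure"
  assumes P: "local_ldp P I" and Q: "local_ldp Q J"
  shows "local_ldp (\<lambda>n. P n \<Otimes>\<^sub>M Q n) (\<lambda>(x, y). I x + J y)"
  unfolding local_ldp_def
proof (intro conjI allI impI)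
  have ev: "\<forall>\<^sub>F n in sequentially. prob_space (P n \<Otimes>\<^sub>M Q n) \<and> sets (P n \<Otimes>\<^sub>M Q n) = sets borel \<and>
     (\<forall>A\<in>sets borel. \<forall>B\<in>sets borel. measure (P n \<Otimes>\<^sub>M Q n) (A \<times> B) = measure (P n) A * measure (Q n) B)"
    using local_ldp_prob[OF P] local_ldp_prob[OF Q]
  proof eventually_elim
    case (elim n)
    interpret P: prob_space "P n" using elim by simp
    interpret Q: prob_space "Q n" using elim by simp
    interpret PQ: pair_prob_space "P n" "Q n" ..
    have "sets (P n \<Otimes>\<^sub>M Q n) = sets (borel \<Otimes>\<^sub>M borel)"
      using elim by (intro sets_pair_measure_cong) auto
    also have "(borel \<Otimes>\<^sub>M borel :: ('a \<times> 'b) measure) = borel" by (rule borel_prod)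
    finally have "sets (P n \<Otimes>\<^sub>M Q n) = sets borel" .
    moreover have "measure (P n \<Otimes>\<^sub>M Q n) (A \<times> B) = measure (P n) A * measure (Q n) B"
      if "A \<in> sets borel" "B \<in> sets borel" for A B
      unfolding measure_def using that elim
      by (subst Q.emeasure_pair_measure_Times) (auto simp: enn2real_mult)
    ultimately show ?case using PQ.prob_space_axioms by simp
  qed
  then show "\<forall>\<^sub>F n in sequentially. prob_space (P n \<Otimes>\<^sub>M Q n) \<and> sets (P n \<Otimes>\<^sub>M Q n) = sets borel"
    by eventually_elim auto
  {
    fix z :: "'a \<times> 'b" and a assume *: "ereal a < (case z of (x, y) \<Rightarrow> I x + J y)"
    obtain x y where z: "z = (x, y)" by (cases z)
    obtain c d where cd: "ereal c < I x" "ereal d < J y" "a = c + d"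
      using * z local_ldp_nonneg[OF P] local_ldp_nonneg[OF Q] by (auto elim: ereal_less_addE)
    obtain e1 where e1: "e1 > 0" "\<forall>\<^sub>F n in sequentially. measure (P n) (ball x e1) \<le> exp (- real n * c)"
      using local_ldp_upper[OF P cd(1)] by blast
    obtain e2 where e2: "e2 > 0" "\<forall>\<^sub>F n in sequentially. measure (Q n) (ball y e2) \<le> exp (- real n * d)"
      using local_ldp_upper[OF Q cd(2)] by blast
    show "\<exists>e>0. \<forall>\<^sub>F n in sequentially. measure (P n \<Otimes>\<^sub>M Q n) (ball z e) \<le> exp (- real n * a)"
    proof (intro exI[of _ "min e1 e2"] conjI)
      show "\<forall>\<^sub>F n in sequentially. measure (P n \<Otimes>\<^sub>M Q n) (ball z (min e1 e2)) \<le> exp (- real n * a)"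
        using e1(2) e2(2) ev
      proof eventually_elim
        case (elim n)
        interpret prob_space "P n \<Otimes>\<^sub>M Q n" using elim by simp
        have "ball z (min e1 e2) \<subseteq> ball x e1 \<times> ball y e2"
        proof
          fix w assume w: "w \<in> ball z (min e1 e2)"
          show "w \<in> ball x e1 \<times> ball y e2"
            using w dist_fst_le[of z w] dist_snd_le[of z w] z
            by (cases w) (auto simp del: dist_fst_le dist_snd_le)
        qed
        moreover have "ball x e1 \<times> ball y e2 \<in> sets (P n \<Otimes>\<^sub>M Q n)"
          using elim by (simp add: open_Times)
        ultimately have "measure (P n \<Otimes>\<^sub>M Q n) (ball z (min e1 e2))
            \<le> measure (P n \<Otimes>\<^sub>M Q n) (ball x e1 \<times> ball y e2)"
          by (intro finite_measure_mono) auto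
        also have "\<dots> = measure (P n) (ball x e1) * measure (Q n) (ball y e2)" using elim by simp
        also have "\<dots> \<le> exp (- real n * c) * exp (- real n * d)"
          using elim by (intro mult_mono) auto
        also have "\<dots> = exp (- real n * a)" using cd(3) by (simp add: exp_add[symmetric] algebra_simps)
        finally show ?case .
      qed
    qed (use e1 e2 in auto)
  }
  fix z :: "'a \<times> 'b" and a and e :: real
  assume *: "(case z of (x, y) \<Rightarrow> I x + J y) < ereal a" and e: "e > 0"
  obtain x y where z: "z = (x, y)" by (cases z)
  have "I x + J y < ereal a" using * z by simp
  then obtain r s where rs: "I x = ereal r" "J y = ereal s" "r + s < a"
    using local_ldp_nonneg[OF P, of x] local_ldp_nonneg[OF Q, of y]
    by (cases "I x"; cases "J y") auto
  define c where "c = r + (a - r - s) / 2"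
  define d where "d = s + (a - r - s) / 2"
  have cd: "I x < ereal c" "J y < ereal d" "a = c + d"
    using rs by (auto simp: c_def d_def field_simps)
  have e2: "e / 2 > 0" using e by simp
  show "\<forall>\<^sub>F n in sequentially. exp (- real n * a) \<le> measure (P n \<Otimes>\<^sub>M Q n) (ball z e)"
    using local_ldp_lower[OF P cd(1) e2] local_ldp_lower[OF Q cd(2) e2] ev
  proof eventually_elim
    case (elim n)
    interpret prob_space "P n \<Otimes>\<^sub>M Q n" using elim by simp
    have sub: "ball x (e / 2) \<times> ball y (e / 2) \<subseteq> ball z e"
    proof
      fix w assume w: "w \<in> ball x (e / 2) \<times> ball y (e / 2)"
      have "dist z w \<le> dist x (fst w) + dist y (snd w)"
        unfolding z by (cases w) (auto simp: dist_Pair_Pair sqrt_sum_squares_le_sum)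
      then show "w \<in> ball z e" using w by auto
    qed
    have "exp (- real n * a) = exp (- real n * c) * exp (- real n * d)"
      using cd(3) by (simp add: exp_add[symmetric] algebra_simps)
    also have "\<dots> \<le> measure (P n) (ball x (e / 2)) * measure (Q n) (ball y (e / 2))"
      using elim by (intro mult_mono) auto
    also have "\<dots> = measure (P n \<Otimes>\<^sub>M Q n) (ball x (e / 2) \<times> ball y (e / 2))" using elim by simp
    also have "\<dots> \<le> measure (P n \<Otimes>\<^sub>M Q n) (ball z e)"
      using sub elim by (intro finite_measure_mono) auto
    finally show ?case .
  qed
qed

lemma elog_mono: "x \<le> y \<Longrightarrow> elog x \<le> elog y"
  by (auto simp: elog_def)

lemma elog_exp [simp]: "elog (exp t) = ereal t"
  by (simp add: elog_def)

text \<open>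
  The concentration on \<open>C\<close> turns the local upper bound into one for closed sets and makes the
  level sets compact. A Lebesgue measurable test set is a Borel set up to a part of a null
  set; the last hypothesis makes the preimage of that part negligible, so that the event is
  measurable in the completion and can be compared with the events of the interior and the
  closure.
\<close>

lemma LDP_of_local_ldp:
  fixes Y :: "nat \<Rightarrow> 'w \<Rightarrow> 'a::euclidean_space"
  assumes L: "local_ldp (\<lambda>n. distr (M n) borel (Y n)) I"
    and C: "compact C"
    and M: "\<forall>\<^sub>F n in sequentially. prob_space (M n) \<and> Y n \<in> borel_measurable (M n) \<and>
          measure (M n) {\<omega>\<in>space (M n). Y n \<omega> \<notin> C} = 0 \<and>
          (\<forall>N\<in>null_sets lborel. Y n -` N \<inter> space (M n) \<in> null_sets (M n))"
  shows "LDP M Y (\<lambda>n. ereal (real n)) I"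
proof -
  have QC: "\<forall>\<^sub>F n in sequentially. measure (distr (M n) borel (Y n)) (- C) = 0"
    using M
  proof eventually_elim
    case (elim n)
    have "measure (distr (M n) borel (Y n)) (- C) = measure (M n) (Y n -` (- C) \<inter> space (M n))"
      using elim C by (intro measure_distr) (auto dest: compact_imp_closed)
    also have "Y n -` (- C) \<inter> space (M n) = {\<omega>\<in>space (M n). Y n \<omega> \<notin> C}" by auto
    finally show ?case using elim by simp
  qed
  have lsc: "I x \<le> Liminf (at x) I" for x
    unfolding le_Liminf_iff
  proof (intro allI impI)
    fix y assume "y < I x"
    then obtain a where a: "y < ereal a" "ereal a < I x" using ereal_dense2 by blast
    obtain e where e: "e > 0" "\<And>z. z \<in> ball x e \<Longrightarrow> ereal a \<le> I z"
      using local_ldp_lsc[OF L a(2)] by blast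
    show "\<forall>\<^sub>F z in at x. y < I z"
      unfolding eventually_at
      by (intro exI[of _ e]) (use e a(1) in \<open>auto simp: dist_commute intro: less_le_trans\<close>)
  qed
  have good: "compact {x. I x \<le> ereal \<alpha>}" for \<alpha>
  proof -
    have sub: "{x. I x \<le> ereal \<alpha>} \<subseteq> C"
      using local_ldp_outside[OF L compact_imp_closed[OF C] QC] by fastforce
    have "open {x. ereal \<alpha> < I x}"
      unfolding open_contains_ball
    proof safe
      fix x assume "ereal \<alpha> < I x"
      then obtain a where a: "ereal \<alpha> < ereal a" "ereal a < I x" using ereal_dense2 by blast
      obtain e where e: "e > 0" "\<And>z. z \<in> ball x e \<Longrightarrow> ereal a \<le> I z"
        using local_ldp_lsc[OF L a(2)] by blast
      then show "\<exists>e>0. ball x e \<subseteq> {x. ereal \<alpha> < I x}"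
        using a(1) less_le_trans by (intro exI[of _ e]) blast
    qed
    moreover have "- {x. ereal \<alpha> < I x} = {x. I x \<le> ereal \<alpha>}" by auto
    ultimately have "closed {x. I x \<le> ereal \<alpha>}" by (metis closed_Compl)
    with sub C show ?thesis
      by (metis compact_Int_closed inf.absorb_iff2)
  qed
  define m where "m = (\<lambda>n A. measure (completion (M n)) {\<omega> \<in> space (M n). Y n \<omega> \<in> A})"
  have m_borel: "\<forall>\<^sub>F n in sequentially. \<forall>B\<in>sets borel. m n B = measure (distr (M n) borel (Y n)) B"
    using M
  proof eventually_elim
    case (elim n)
    show ?case
    proof
      fix B :: "'a set" assume B: "B \<in> sets borel"
      have eq: "{\<omega> \<in> space (M n). Y n \<omega> \<in> B} = Y n -` B \<inter> space (M n)" by auto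
      have "Y n -` B \<inter> space (M n) \<in> sets (M n)" using elim B by (auto intro: measurable_sets)
      then show "m n B = measure (distr (M n) borel (Y n)) B"
        unfolding m_def eq using elim B by (subst measure_distr) (auto simp: measure_completion)
    qed
  qed
  have m_mono: "\<forall>\<^sub>F n in sequentially. \<forall>A\<in>sets lebesgue. \<forall>U\<in>sets borel.
      (U \<subseteq> A \<longrightarrow> m n U \<le> m n A) \<and> (A \<subseteq> U \<longrightarrow> m n A \<le> m n U)"
    using M
  proof eventually_elim
    case (elim n)
    interpret prob_space "M n" using elim by simp
    interpret c: prob_space "completion (M n)" by (rule prob_space_completion)
    have me: "{\<omega> \<in> space (M n). Y n \<omega> \<in> A} \<in> sets (completion (M n))"
      if "A \<in> sets lebesgue" for A
    proof -
      obtain S N N' where A: "A = S \<union> N" "N \<subseteq> N'" "N' \<in> null_sets lborel" "S \<in> sets lborel"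
        using \<open>A \<in> sets lebesgue\<close> by (elim sets_completionE)
      have "{\<omega> \<in> space (M n). Y n \<omega> \<in> A} =
          (Y n -` S \<inter> space (M n)) \<union> (Y n -` N \<inter> space (M n))" using A by auto
      moreover have "Y n -` S \<inter> space (M n) \<in> sets (M n)"
        using elim A by (auto intro: measurable_sets)
      moreover have "Y n -` N' \<inter> space (M n) \<in> null_sets (M n)" using elim A by blast
      ultimately show ?thesis using A(2) by (intro sets_completionI[of _ _ "Y n -` N \<inter> space (M n)" "Y n -` N' \<inter> space (M n)"]) auto
    qed
    show ?case
      unfolding m_def using me by (auto intro!: c.finite_measure_mono)
  qed
  have bounds: "- (INF x\<in>interior A. I x) \<le> liminf (\<lambda>n. 1 / ereal (real n) * elog (m n A))"
       "limsup (\<lambda>n. 1 / ereal (real n) * elog (m n A)) \<le> - (INF x\<in>closure A. I x)"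
    if A: "A \<in> sets lebesgue" for A
  proof -
    have "- I x \<le> liminf (\<lambda>n. 1 / ereal (real n) * elog (m n A))" if x: "x \<in> interior A" for x
    proof (rule ccontr)
      assume "\<not> - I x \<le> liminf (\<lambda>n. 1 / ereal (real n) * elog (m n A))"
      then have "liminf (\<lambda>n. 1 / ereal (real n) * elog (m n A)) < - I x" by simp
      then obtain b where b: "liminf (\<lambda>n. 1 / ereal (real n) * elog (m n A)) < ereal b" "ereal b < - I x"
        using ereal_dense2 by blast
      have "I x < ereal (- b)" using b(2) by (metis ereal_less_uminus_reorder uminus_ereal.simps(1))
      obtain e where e: "e > 0" "ball x e \<subseteq> interior A" using x by (meson open_interior openE)
      have "\<forall>\<^sub>F n in sequentially. ereal b \<le> 1 / ereal (real n) * elog (m n A)"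
        using local_ldp_lower[OF L \<open>I x < ereal (- b)\<close> e(1)] m_mono m_borel eventually_gt_at_top[of 0]
      proof eventually_elim
        case (elim n)
        have "exp (real n * b) \<le> m n (ball x e)" using elim by simp
        also have "\<dots> \<le> m n A" using elim(2) A e(2) interior_subset[of A] by (auto intro: borel_open)
        finally have "ereal (real n * b) \<le> elog (m n A)" using elog_mono elog_exp by metis
        then have "ereal (1 / real n) * ereal (real n * b) \<le> ereal (1 / real n) * elog (m n A)"
          by (intro ereal_mult_left_mono) auto
        then show ?case using elim(4) by (simp add: one_ereal_def)
      qed
      then have "ereal b \<le> liminf (\<lambda>n. 1 / ereal (real n) * elog (m n A))" by (rule Liminf_bounded)
      with b(1) show False by simp
    qed
    then have "(SUP x\<in>interior A. - I x) \<le> liminf (\<lambda>n. 1 / ereal (real n) * elog (m n A))"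
      by (rule SUP_least)
    then show "- (INF x\<in>interior A. I x) \<le> liminf (\<lambda>n. 1 / ereal (real n) * elog (m n A))"
      by (simp add: ereal_SUP_uminus_eq)
    show "limsup (\<lambda>n. 1 / ereal (real n) * elog (m n A)) \<le> - (INF x\<in>closure A. I x)"
    proof (rule ccontr)
      assume "\<not> limsup (\<lambda>n. 1 / ereal (real n) * elog (m n A)) \<le> - (INF x\<in>closure A. I x)"
      then have "- (INF x\<in>closure A. I x) < limsup (\<lambda>n. 1 / ereal (real n) * elog (m n A))" by simp
      then obtain a where a: "- (INF x\<in>closure A. I x) < ereal a"
          "ereal a < limsup (\<lambda>n. 1 / ereal (real n) * elog (m n A))" using ereal_dense2 by blast
      obtain a' where a': "- (INF x\<in>closure A. I x) < ereal a'" "ereal a' < ereal a"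
        using a(1) ereal_dense2 by blast
      have a'2: "ereal (- a') < (INF x\<in>closure A. I x)"
        using a'(1) by (metis ereal_uminus_less_reorder uminus_ereal.simps(1))
      have K: "compact (C \<inter> closure A)" using C by (auto intro: compact_Int_closed)
      have lt: "- a < - a'" using a'(2) by simp
      obtain G where G: "open G" "C \<inter> closure A \<subseteq> G"
          "\<forall>\<^sub>F n in sequentially. measure (distr (M n) borel (Y n)) G \<le> exp (- real n * - a)"
      proof (rule local_ldp_compact_upper[OF L K lt])
        fix x assume "x \<in> C \<inter> closure A"
        then have "(INF x\<in>closure A. I x) \<le> I x" by (intro INF_lower) auto
        then show "ereal (- a') < I x" using a'2 by (rule less_le_trans[rotated])
      qed blast
      have "\<forall>\<^sub>F n in sequentially. 1 / ereal (real n) * elog (m n A) \<le> ereal a"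
        using G(3) m_mono m_borel QC local_ldp_prob[OF L] eventually_gt_at_top[of 0]
      proof eventually_elim
        case (elim n)
        interpret prob_space "distr (M n) borel (Y n)" using elim by simp
        have "m n A \<le> m n (closure A)"
          using elim(2) A closure_subset[of A] by (auto intro: borel_closed)
        also have "\<dots> = measure (distr (M n) borel (Y n)) (closure A)" using elim(3) by auto
        also have "\<dots> \<le> measure (distr (M n) borel (Y n)) (G \<union> - C)"
          using G C by (intro finite_measure_mono) (auto dest: compact_imp_closed)
        also have "\<dots> \<le> measure (distr (M n) borel (Y n)) G + measure (distr (M n) borel (Y n)) (- C)"
          using G(1) C by (intro measure_Un_le) (auto dest: compact_imp_closed)
        finally have "m n A \<le> exp (real n * a)" using elim by simp
        then have "elog (m n A) \<le> ereal (real n * a)" using elog_mono elog_exp by metis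
        then have "ereal (1 / real n) * elog (m n A) \<le> ereal (1 / real n) * ereal (real n * a)"
          by (intro ereal_mult_left_mono) auto
        then show ?case using elim(6) by (simp add: one_ereal_def)
      qed
      then have "limsup (\<lambda>n. 1 / ereal (real n) * elog (m n A)) \<le> ereal a" by (rule Limsup_bounded)
      with a(2) show False by simp
    qed
  qed
  show ?thesis
    using local_ldp_nonneg[OF L] lsc good bounds
    unfolding LDP_def Let_def m_def by auto
qed

section \<open>Lebesgue measure and Euclidean balls\<close>

abbreviation lbPi :: "'i set \<Rightarrow> ('i \<Rightarrow> real) measure" where
  "lbPi I \<equiv> PiM I (\<lambda>_. lborel)"

interpretation lbPi: product_sigma_finite "\<lambda>_. lborel :: real measure"
  by standard

lemma emeasure_lborel_affine:
  assumes "c > 0" "B \<in> sets borel"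
  shows "ennreal c * emeasure lborel ((\<lambda>t::real. a + c * t) -` B) = emeasure lborel B"
proof -
  have "emeasure lborel B = emeasure (density (distr lborel borel (\<lambda>x. a + c * x)) (\<lambda>_. ennreal \<bar>c\<bar>)) B"
    using lborel_real_affine[of c a] assms by simp
  also have "\<dots> = ennreal c * emeasure (distr lborel borel (\<lambda>x. a + c * x)) B"
    using assms by (subst emeasure_density) (auto simp: nn_integral_cmult)
  also have "emeasure (distr lborel borel (\<lambda>x. a + c * x)) B = emeasure lborel ((\<lambda>t::real. a + c * t) -` B)"
    using assms by (subst emeasure_distr) auto
  finally show ?thesis by simp
qed

lemma null_sets_scale:
  assumes c: "c > 0" and N: "N \<in> null_sets lborel"
  shows "(\<lambda>t::real. c * t) -` N \<in> null_sets lborel"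
proof -
  have Nb: "N \<in> sets borel" using N by auto
  have "(\<lambda>t. c * t) -` N \<in> sets borel" using measurable_sets[of "\<lambda>t. c * t" borel borel N] Nb by simp
  moreover have "ennreal c * emeasure lborel ((\<lambda>t. c * t) -` N) = 0"
    using emeasure_lborel_affine[OF c Nb, of 0] N by (simp add: null_sets_def)
  ultimately show ?thesis using c by (auto simp: null_sets_def)
qed

lemma emeasure_lbPi_affine:
  assumes I: "finite I" and c: "c > 0" and A: "A \<in> sets (lbPi I)"
  shows "ennreal c ^ card I * emeasure (lbPi I) {x \<in> space (lbPi I). (\<lambda>i\<in>I. a i + c * x i) \<in> A}
    = emeasure (lbPi I) A"
proof -
  let ?T = "\<lambda>x. \<lambda>i\<in>I. a i + c * x i"
  have T[measurable]: "?T \<in> measurable (lbPi I) (lbPi I)"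
    by (intro measurable_restrict) simp
  have "scale_measure (ennreal c ^ card I) (distr (lbPi I) (lbPi I) ?T) = lbPi I"
  proof (rule lbPi.PiM_eqI[OF I])
    fix B :: "'a \<Rightarrow> real set" assume B: "\<And>i. i \<in> I \<Longrightarrow> B i \<in> sets lborel"
    have "?T -` (Pi\<^sub>E I B) \<inter> space (lbPi I) = (Pi\<^sub>E I (\<lambda>i. (\<lambda>t. a i + c * t) -` B i))"
      by (auto simp: space_PiM PiE_iff)
    moreover have "Pi\<^sub>E I B \<in> sets (lbPi I)" using I B by (intro sets_PiM_I_finite) auto
    moreover have "(\<lambda>t. a i + c * t) -` B i \<in> sets borel" if "i \<in> I" for i
      using measurable_sets[of "\<lambda>t. a i + c * t" borel borel "B i"] B[OF that] by simp
    ultimately have "emeasure (distr (lbPi I) (lbPi I) ?T) (Pi\<^sub>E I B) = (\<Prod>i\<in>I. emeasure lborel ((\<lambda>t. a i + c * t) -` B i))"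
      using I by (subst emeasure_distr) (auto intro!: lbPi.emeasure_PiM)
    then have "emeasure (scale_measure (ennreal c ^ card I) (distr (lbPi I) (lbPi I) ?T)) (Pi\<^sub>E I B)
       = (\<Prod>i\<in>I. ennreal c * emeasure lborel ((\<lambda>t. a i + c * t) -` B i))"
      by (simp add: prod.distrib)
    also have "\<dots> = (\<Prod>i\<in>I. emeasure lborel (B i))"
      using c B by (intro prod.cong refl emeasure_lborel_affine) auto
    finally show "emeasure (scale_measure (ennreal c ^ card I) (distr (lbPi I) (lbPi I) ?T)) (Pi\<^sub>E I B)
       = (\<Prod>i\<in>I. emeasure lborel (B i))" .
  qed simp
  then have "emeasure (lbPi I) A = emeasure (scale_measure (ennreal c ^ card I) (distr (lbPi I) (lbPi I) ?T)) A"
    by simp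
  also have "\<dots> = ennreal c ^ card I * emeasure (lbPi I) (?T -` A \<inter> space (lbPi I))"
    using A by (simp add: emeasure_distr)
  also have "?T -` A \<inter> space (lbPi I) = {x \<in> space (lbPi I). (\<lambda>i\<in>I. a i + c * x i) \<in> A}" by auto
  finally show ?thesis by simp
qed

definition zero_fill :: "nat \<Rightarrow> (nat \<Rightarrow> real) \<Rightarrow> nat \<Rightarrow> real" where
  "zero_fill n x = (\<lambda>i. if i < n then x i else 0)"

lemma lebesgue_Rn_eq: "lebesgue_Rn n = distr (lbPi {..<n}) borel (zero_fill n)"
  by (simp add: lebesgue_Rn_def zero_fill_def[abs_def])

lemma measurable_fun_borelI:
  fixes f :: "'b \<Rightarrow> nat \<Rightarrow> real"
  assumes "\<And>i. (\<lambda>x. f x i) \<in> borel_measurable M"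
  shows "f \<in> borel_measurable M"
  using assms by (rule measurable_coordinatewise_then_product)

lemma coord_lbPi: "i \<in> I \<Longrightarrow> (\<lambda>x. x i) \<in> borel_measurable (lbPi I)"
  using measurable_component_singleton[of i I "\<lambda>_. lborel"] by simp

lemma measurable_zero_fill [measurable]: "zero_fill n \<in> borel_measurable (lbPi {..<n})"
proof (rule measurable_fun_borelI)
  fix i show "(\<lambda>x. zero_fill n x i) \<in> borel_measurable (lbPi {..<n})"
    by (cases "i < n") (auto simp: zero_fill_def coord_lbPi)
qed

lemma sets_lebesgue_Rn [simp, measurable_cong]: "sets (lebesgue_Rn n) = sets borel"
  and space_lebesgue_Rn [simp]: "space (lebesgue_Rn n) = UNIV"
  by (simp_all add: lebesgue_Rn_def)

lemma emeasure_lebesgue_Rn: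
  assumes "A \<in> sets borel"
  shows "emeasure (lebesgue_Rn n) A = emeasure (lbPi {..<n}) {x\<in>space (lbPi {..<n}). zero_fill n x \<in> A}"
  unfolding lebesgue_Rn_eq using assms
  by (subst emeasure_distr) (auto intro!: arg_cong2[where f=emeasure])

lemma coord_borel [measurable]: "(\<lambda>x::nat \<Rightarrow> real. x i) \<in> borel_measurable borel"
  by (rule measurable_product_coordinates)

lemma measurable_dot [measurable (raw)]:
  assumes [measurable]: "f \<in> borel_measurable M" "g \<in> borel_measurable M"
  shows "(\<lambda>x. dot n (f x) (g x)) \<in> borel_measurable M"
proof -
  have [measurable]: "(\<lambda>x. f x i) \<in> borel_measurable M" "(\<lambda>x. g x i) \<in> borel_measurable M" for i
    using measurable_compose[OF assms(1) coord_borel] measurable_compose[OF assms(2) coord_borel] by auto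
  show ?thesis unfolding dot_def by measurable
qed

lemma Rn_borel [measurable]: "Rn n \<in> sets borel"
proof -
  have "Rn n = {x \<in> space borel. \<forall>i. i \<ge> n \<longrightarrow> x i = 0}" by (auto simp: Rn_def)
  also have "\<dots> \<in> sets borel" by measurable
  finally show ?thesis .
qed

lemma AE_lebesgue_Rn: "AE x in lebesgue_Rn n. x \<in> Rn n"
  unfolding lebesgue_Rn_eq by (subst AE_distr_iff) (auto simp: Rn_def zero_fill_def)

lemma emeasure_lebesgue_Rn_affine:
  assumes A: "A \<in> sets borel" and c: "c > 0" and a: "a \<in> Rn n"
  shows "ennreal c ^ n * emeasure (lebesgue_Rn n) {x. (\<lambda>i. a i + c * x i) \<in> A} = emeasure (lebesgue_Rn n) A"
proof -
  let ?P = "lbPi {..<n}"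
  have m: "(\<lambda>x::nat\<Rightarrow>real. \<lambda>i. a i + c * x i) \<in> borel_measurable borel"
    by (intro measurable_fun_borelI) simp
  have A': "{x. (\<lambda>i. a i + c * x i) \<in> A} \<in> sets borel"
    using measurable_sets[OF m A] by (simp add: vimage_def)
  have B: "{x\<in>space ?P. zero_fill n x \<in> A} \<in> sets ?P"
    using measurable_sets[OF measurable_zero_fill A, of n] by (simp add: vimage_def Int_def conj_commute)
  have "{x\<in>space ?P. zero_fill n x \<in> {x. (\<lambda>i. a i + c * x i) \<in> A}} =
      {x\<in>space ?P. (\<lambda>i\<in>{..<n}. a i + c * x i) \<in> {x\<in>space ?P. zero_fill n x \<in> A}}"
  proof -
    have "(\<lambda>i. a i + c * zero_fill n x i) = zero_fill n (\<lambda>i\<in>{..<n}. a i + c * x i)" for x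
      using a by (auto simp: zero_fill_def Rn_def fun_eq_iff)
    moreover have "(\<lambda>i\<in>{..<n}. a i + c * x i) \<in> space ?P" for x by (simp add: space_PiM)
    ultimately show ?thesis by auto
  qed
  then show ?thesis
    using emeasure_lbPi_affine[OF _ c B, of a] A A' by (simp add: emeasure_lebesgue_Rn)
qed

lemma dot_nonneg: "0 \<le> dot n x x"
  by (auto simp: dot_def intro: sum_nonneg)

lemma dot_commute: "dot n x y = dot n y x"
  by (simp add: dot_def mult.commute)

lemma dot_scale: "dot n (\<lambda>i. c * x i) (\<lambda>i. c * x i) = c\<^sup>2 * dot n x x"
  by (simp add: dot_def algebra_simps sum_distrib_left power2_eq_square)

lemma emeasure_lebesgue_Rn_scale:
  assumes A: "A \<in> sets borel" and c: "c > 0"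
  shows "ennreal c ^ n * emeasure (lebesgue_Rn n) {x. (\<lambda>i. c * x i) \<in> A} = emeasure (lebesgue_Rn n) A"
proof -
  have "0 \<in> Rn n" by (simp add: Rn_def)
  from emeasure_lebesgue_Rn_affine[OF A c this] show ?thesis by simp
qed

lemma emeasure_lebesgue_Rn_translate:
  assumes A: "A \<in> sets borel" and a: "a \<in> Rn n"
  shows "emeasure (lebesgue_Rn n) {x. x + a \<in> A} = emeasure (lebesgue_Rn n) A"
proof -
  have "x + a = (\<lambda>i. a i + 1 * x i)" for x by (auto simp: fun_eq_iff)
  then show ?thesis using emeasure_lebesgue_Rn_affine[OF A _ a, of 1] by simp
qed

definition sqsum :: "'i set \<Rightarrow> ('i \<Rightarrow> real) \<Rightarrow> real" where
  "sqsum I x = (\<Sum>i\<in>I. (x i)\<^sup>2)"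

lemma measurable_sqsum [measurable]: "sqsum I \<in> borel_measurable (lbPi I)"
  unfolding sqsum_def by (intro borel_measurable_sum borel_measurable_power coord_lbPi)

lemma sqsum_nonneg: "0 \<le> sqsum I x" by (simp add: sqsum_def sum_nonneg)

lemma dot_sqsum: "dot n x x = sqsum {..<n} x"
  by (simp add: dot_def sqsum_def power2_eq_square)

definition ball_vol :: "'i set \<Rightarrow> real" where
  "ball_vol I = measure (lbPi I) {x\<in>space (lbPi I). sqsum I x \<le> 1}"

lemma emeasure_lbPi_box:
  assumes "finite I" "r \<ge> 0"
  shows "emeasure (lbPi I) (Pi\<^sub>E I (\<lambda>_. {- r..r})) = ennreal ((2 * r) ^ card I)"
proof -
  have "emeasure (lbPi I) (Pi\<^sub>E I (\<lambda>_. {- r..r})) = ennreal (2 * r) ^ card I"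
    using assms by (subst lbPi.emeasure_PiM) auto
  also have "\<dots> = ennreal ((2 * r) ^ card I)" using assms by (intro ennreal_power) simp
  finally show ?thesis .
qed

lemma ball_vol:
  assumes I: "finite I"
  shows emeasure_unit_ball: "emeasure (lbPi I) {x\<in>space (lbPi I). sqsum I x \<le> 1} = ennreal (ball_vol I)"
    and ball_vol_pos: "ball_vol I > 0"
proof -
  let ?B = "{x\<in>space (lbPi I). sqsum I x \<le> 1}"
  have "?B \<subseteq> Pi\<^sub>E I (\<lambda>_. {- 1..1})"
  proof
    fix x assume x: "x \<in> ?B"
    have "\<bar>x i\<bar> \<le> 1" if "i \<in> I" for i
    proof -
      have "(x i)\<^sup>2 \<le> sqsum I x" unfolding sqsum_def using I that by (intro member_le_sum) auto
      then have "(x i)\<^sup>2 \<le> 1" using x by simp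
      then show ?thesis by (simp add: abs_square_le_1)
    qed
    then show "x \<in> Pi\<^sub>E I (\<lambda>_. {- 1..1})" using x by (auto simp: space_PiM PiE_iff abs_le_iff minus_le_iff)
  qed
  moreover have "Pi\<^sub>E I (\<lambda>_. {- 1..1::real}) \<in> sets (lbPi I)" using I by (intro sets_PiM_I_finite) auto
  ultimately have "emeasure (lbPi I) ?B \<le> ennreal (2 ^ card I)"
    using emeasure_mono[of ?B "Pi\<^sub>E I (\<lambda>_. {- 1..1::real})" "lbPi I"] emeasure_lbPi_box[OF I, of 1] by simp
  then have fin: "emeasure (lbPi I) ?B < \<infinity>" by (rule le_less_trans) simp
  then show 1: "emeasure (lbPi I) ?B = ennreal (ball_vol I)"
    unfolding ball_vol_def by (intro emeasure_eq_ennreal_measure) auto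
  define r where "r = 1 / (real (card I) + 1)"
  have "real (card I) \<le> (real (card I) + 1)\<^sup>2" by (simp add: power2_eq_square algebra_simps)
  then have r: "r > 0" "real (card I) * r\<^sup>2 \<le> 1"
    by (auto simp: r_def power_divide divide_le_eq_1 zero_less_power2 add_nonneg_eq_0_iff)
  have "Pi\<^sub>E I (\<lambda>_. {- r..r}) \<subseteq> ?B"
  proof
    fix x assume x: "x \<in> Pi\<^sub>E I (\<lambda>_. {- r..r})"
    have "sqsum I x \<le> (\<Sum>i\<in>I. r\<^sup>2)"
      unfolding sqsum_def
    proof (rule sum_mono)
      fix i assume "i \<in> I"
      then have "- r \<le> x i \<and> x i \<le> r" using x by (auto simp: PiE_iff)
      then have "\<bar>x i\<bar> \<le> \<bar>r\<bar>" by linarith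
      then show "(x i)\<^sup>2 \<le> r\<^sup>2" by (simp add: abs_le_square_iff)
    qed
    then show "x \<in> ?B" using x r by (auto simp: space_PiM PiE_iff)
  qed
  then have "ennreal ((2 * r) ^ card I) \<le> emeasure (lbPi I) ?B"
    using emeasure_lbPi_box[OF I, of r] r emeasure_mono[of "Pi\<^sub>E I (\<lambda>_. {- r..r})" ?B "lbPi I"] by simp
  moreover have "(2 * r) ^ card I > 0" using r by simp
  ultimately show "ball_vol I > 0" using 1 by (metis ennreal_less_zero_iff less_le_trans)
qed

lemma emeasure_ball_radius:
  assumes I: "finite I" and r: "r > 0"
  shows "emeasure (lbPi I) {x\<in>space (lbPi I). sqsum I x \<le> r\<^sup>2} = ennreal (r ^ card I * ball_vol I)"
proof -
  let ?A = "{x\<in>space (lbPi I). sqsum I x \<le> r\<^sup>2}"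
  have "sqsum I (\<lambda>i\<in>I. r * x i) = r\<^sup>2 * sqsum I x" for x
    by (simp add: sqsum_def power_mult_distrib sum_distrib_left)
  then have "{x \<in> space (lbPi I). (\<lambda>i\<in>I. 0 + r * x i) \<in> ?A} = {x\<in>space (lbPi I). sqsum I x \<le> 1}"
    using r by (auto simp: space_PiM)
  then have "emeasure (lbPi I) ?A = ennreal r ^ card I * ennreal (ball_vol I)"
    using emeasure_lbPi_affine[OF I r, of ?A "\<lambda>_. 0"] emeasure_unit_ball[OF I] by simp
  then show ?thesis
    using r ball_vol_pos[OF I] by (simp add: ennreal_power ennreal_mult)
qed

text \<open>
  The ball of radius \<open>r (1 - d)\<close> carries the fraction \<open>(1 - d)\<^sup>n \<le> 1 - d\<close> of the volume of the
  ball of radius \<open>r\<close>.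
\<close>

lemma emeasure_shell:
  assumes I: "finite I" "I \<noteq> {}" and r: "r > 0" and d: "0 < d" "d < 1"
  shows "ennreal (d * r ^ card I * ball_vol I) \<le>
    emeasure (lbPi I) {x\<in>space (lbPi I). (r * (1 - d))\<^sup>2 < sqsum I x \<and> sqsum I x \<le> r\<^sup>2}"
proof -
  let ?s = "r * (1 - d)"
  have s: "?s > 0" "?s\<^sup>2 \<le> r\<^sup>2" using r d by (auto intro!: power_mono mult_left_le)
  have "emeasure (lbPi I) {x\<in>space (lbPi I). ?s\<^sup>2 < sqsum I x \<and> sqsum I x \<le> r\<^sup>2} =
     emeasure (lbPi I) ({x\<in>space (lbPi I). sqsum I x \<le> r\<^sup>2} - {x\<in>space (lbPi I). sqsum I x \<le> ?s\<^sup>2})"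
    by (intro arg_cong2[where f=emeasure]) auto
  also have "\<dots> = ennreal (r ^ card I * ball_vol I) - ennreal (?s ^ card I * ball_vol I)"
    using s by (subst emeasure_Diff) (auto simp: emeasure_ball_radius[OF I(1) r] emeasure_ball_radius[OF I(1) s(1)])
  also have "\<dots> = ennreal (r ^ card I * ball_vol I - ?s ^ card I * ball_vol I)"
    using s ball_vol_pos[OF I(1)] by (intro ennreal_minus) auto
  also have "\<dots> \<ge> ennreal (d * r ^ card I * ball_vol I)"
  proof (rule ennreal_leI)
    have "card I > 0" using I by (simp add: card_gt_0_iff)
    then have "(1 - d) ^ card I \<le> (1 - d) ^ 1" using d by (intro power_decreasing) auto
    then have "d \<le> 1 - (1 - d) ^ card I" by simp
    then have "d * (r ^ card I * ball_vol I) \<le> (1 - (1 - d) ^ card I) * (r ^ card I * ball_vol I)"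
      using r ball_vol_pos[OF I(1)] by (intro mult_right_mono) auto
    then show "d * r ^ card I * ball_vol I \<le> r ^ card I * ball_vol I - ?s ^ card I * ball_vol I"
      unfolding power_mult_distrib by (simp add: algebra_simps)
  qed
  finally show ?thesis .
qed

text \<open>
  Fubini's theorem for two disjoint blocks of coordinates.
\<close>

lemma emeasure_split:
  assumes I: "finite I" and J: "finite J" and IJ: "I \<inter> J = {}"
    and A[measurable]: "A \<in> sets borel" and B[measurable]: "B \<in> sets borel"
  shows "emeasure (lbPi (I \<union> J)) {x\<in>space (lbPi (I \<union> J)). sqsum I x \<in> A \<and> sqsum J x \<in> B} =
    emeasure (lbPi I) {x\<in>space (lbPi I). sqsum I x \<in> A} * emeasure (lbPi J) {x\<in>space (lbPi J). sqsum J x \<in> B}"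
proof -
  interpret I: sigma_finite_measure "lbPi I" by (rule lbPi.sigma_finite[OF I])
  interpret J: sigma_finite_measure "lbPi J" by (rule lbPi.sigma_finite[OF J])
  let ?S = "{x\<in>space (lbPi (I \<union> J)). sqsum I x \<in> A \<and> sqsum J x \<in> B}"
  have [measurable]: "sqsum I \<in> borel_measurable (lbPi (I \<union> J))" "sqsum J \<in> borel_measurable (lbPi (I \<union> J))"
    unfolding sqsum_def by (auto intro!: borel_measurable_sum borel_measurable_power coord_lbPi)
  have S: "?S \<in> sets (lbPi (I \<union> J))" by measurable
  have 1: "sqsum I (merge I J (x, y)) = sqsum I x" "sqsum J (merge I J (x, y)) = sqsum J y" for x y :: "'a \<Rightarrow> real"
    using IJ by (auto simp: sqsum_def merge_def intro!: sum.cong)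
  have "emeasure (lbPi (I \<union> J)) ?S = emeasure (distr (lbPi I \<Otimes>\<^sub>M lbPi J) (lbPi (I \<union> J)) (merge I J)) ?S"
    using lbPi.distr_merge[OF IJ I J] by simp
  also have "\<dots> = emeasure (lbPi I \<Otimes>\<^sub>M lbPi J) (merge I J -` ?S \<inter> space (lbPi I \<Otimes>\<^sub>M lbPi J))"
    by (intro emeasure_distr S) simp
  also have "merge I J -` ?S \<inter> space (lbPi I \<Otimes>\<^sub>M lbPi J) =
     {x\<in>space (lbPi I). sqsum I x \<in> A} \<times> {x\<in>space (lbPi J). sqsum J x \<in> B}"
    using measurable_space[OF measurable_merge, of _ I "\<lambda>_. lborel" J]
    by (auto simp: 1 space_pair_measure)
  also have "emeasure (lbPi I \<Otimes>\<^sub>M lbPi J) \<dots> =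
     emeasure (lbPi I) {x\<in>space (lbPi I). sqsum I x \<in> A} * emeasure (lbPi J) {x\<in>space (lbPi J). sqsum J x \<in> B}"
    by (rule J.emeasure_pair_measure_Times) auto
  finally show ?thesis .
qed

section \<open>Rotation invariance of Lebesgue measure\<close>

text \<open>
  The uniqueness of Haar measure, by the classical double integral: the measure of
  \<open>{(x, y). y \<in> B \<and> x + y \<in> A}\<close> is \<open>\<mu> A * \<nu> B\<close> by invariance of \<open>\<mu>\<close>. The substitution \<open>z = x + y\<close>
  turns the condition on \<open>y\<close> into \<open>z - x \<in> B\<close>, that is \<open>x - z \<in> B\<close>, and the same measure is
  \<open>\<nu> A * \<mu> B\<close>.
\<close>

lemma translation_invariant_unique:
  fixes \<mu> \<nu> :: "(nat \<Rightarrow> real) measure"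
  assumes "sigma_finite_measure \<mu>" "sigma_finite_measure \<nu>"
    and sets[measurable_cong]: "sets \<mu> = sets borel" "sets \<nu> = sets borel"
    and Rn: "AE x in \<mu>. x \<in> Rn n" "AE x in \<nu>. x \<in> Rn n"
    and tr: "\<And>a A. a \<in> Rn n \<Longrightarrow> A \<in> sets borel \<Longrightarrow> emeasure \<mu> {x. x + a \<in> A} = emeasure \<mu> A"
       "\<And>a A. a \<in> Rn n \<Longrightarrow> A \<in> sets borel \<Longrightarrow> emeasure \<nu> {x. x + a \<in> A} = emeasure \<nu> A"
    and B[measurable]: "B \<in> sets borel" and sym: "\<And>x. - x \<in> B \<longleftrightarrow> x \<in> B"
    and eq: "emeasure \<mu> B = emeasure \<nu> B" "emeasure \<nu> B \<noteq> 0" "emeasure \<nu> B \<noteq> \<infinity>"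
  shows "\<mu> = \<nu>"
proof (rule measure_eqI)
  interpret \<mu>: sigma_finite_measure \<mu> by fact
  interpret \<nu>: sigma_finite_measure \<nu> by fact
  interpret P: pair_sigma_finite \<nu> \<mu> ..
  have sp[simp]: "space \<mu> = UNIV" "space \<nu> = UNIV"
    using sets_eq_imp_space_eq[OF sets(1)] sets_eq_imp_space_eq[OF sets(2)] by auto
  fix A assume "A \<in> sets \<mu>"
  then have A[measurable]: "A \<in> sets borel" by (simp add: sets)
  have pc: "(\<lambda>p::(nat\<Rightarrow>real)\<times>(nat\<Rightarrow>real). f (fst p) (snd p)) \<in> borel_measurable (borel \<Otimes>\<^sub>M borel)"
    if "\<And>i. (\<lambda>p::(nat\<Rightarrow>real)\<times>(nat\<Rightarrow>real). f (fst p) (snd p) i) \<in> borel_measurable (borel \<Otimes>\<^sub>M borel)"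
    for f :: "(nat \<Rightarrow> real) \<Rightarrow> (nat \<Rightarrow> real) \<Rightarrow> nat \<Rightarrow> real"
    using that by (rule measurable_fun_borelI)
  have cf: "(\<lambda>p::(nat\<Rightarrow>real)\<times>(nat\<Rightarrow>real). fst p i) \<in> borel_measurable (borel \<Otimes>\<^sub>M borel)"
       "(\<lambda>p::(nat\<Rightarrow>real)\<times>(nat\<Rightarrow>real). snd p i) \<in> borel_measurable (borel \<Otimes>\<^sub>M borel)" for i
    using measurable_compose[OF measurable_fst coord_borel] measurable_compose[OF measurable_snd coord_borel] by auto
  have pl[measurable]: "(\<lambda>p::(nat\<Rightarrow>real)\<times>(nat\<Rightarrow>real). fst p + snd p) \<in> borel_measurable (borel \<Otimes>\<^sub>M borel)"
    using cf by (intro pc) simp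
  have mi[measurable]: "(\<lambda>p::(nat\<Rightarrow>real)\<times>(nat\<Rightarrow>real). snd p - fst p) \<in> borel_measurable (borel \<Otimes>\<^sub>M borel)"
    using cf by (intro pc) simp
  have tm: "{x. x + a \<in> C} \<in> sets borel" "{z. z - a \<in> C} \<in> sets borel" if "C \<in> sets borel" for a :: "nat \<Rightarrow> real" and C
  proof -
    have "(\<lambda>x::nat\<Rightarrow>real. x + a) \<in> borel_measurable borel" by (intro measurable_fun_borelI) simp
    moreover have "(\<lambda>x::nat\<Rightarrow>real. x - a) \<in> borel_measurable borel" by (intro measurable_fun_borelI) simp
    ultimately show "{x. x + a \<in> C} \<in> sets borel" "{z. z - a \<in> C} \<in> sets borel"
      using measurable_sets[of _ borel borel C] that by (auto simp: vimage_def)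
  qed
  have "emeasure \<mu> A * emeasure \<nu> B = (\<integral>\<^sup>+y. indicator B y * emeasure \<mu> A \<partial>\<nu>)"
    by (simp add: nn_integral_multc mult.commute sets)
  also have "\<dots> = (\<integral>\<^sup>+y. indicator B y * emeasure \<mu> {x. x + y \<in> A} \<partial>\<nu>)"
    using Rn(2) by (intro nn_integral_cong_AE) (auto simp: tr elim!: eventually_mono)
  also have "\<dots> = (\<integral>\<^sup>+y. (\<integral>\<^sup>+x. indicator B y * indicator A (x + y) \<partial>\<mu>) \<partial>\<nu>)"
  proof (intro nn_integral_cong)
    fix y
    have "(\<integral>\<^sup>+x. indicator B y * indicator A (x + y) \<partial>\<mu>) = (\<integral>\<^sup>+x. indicator B y * indicator {x. x + y \<in> A} x \<partial>\<mu>)"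
      by (intro nn_integral_cong) (auto simp: indicator_def)
    also have "\<dots> = indicator B y * emeasure \<mu> {x. x + y \<in> A}"
      using tm(1)[OF A] by (subst nn_integral_cmult_indicator) (auto simp: sets)
    finally show "indicator B y * emeasure \<mu> {x. x + y \<in> A} = (\<integral>\<^sup>+x. indicator B y * indicator A (x + y) \<partial>\<mu>)" ..
  qed
  also have "\<dots> = (\<integral>\<^sup>+x. (\<integral>\<^sup>+y. indicator B y * indicator A (x + y) \<partial>\<nu>) \<partial>\<mu>)"
  proof -
    have "(\<lambda>p::(nat\<Rightarrow>real)\<times>(nat\<Rightarrow>real). indicator B (fst p) * indicator A (fst p + snd p) :: ennreal) \<in> borel_measurable (borel \<Otimes>\<^sub>M borel)"
      by measurable
    then have "(\<lambda>(y, x). indicator B y * indicator A (x + y) :: ennreal) \<in> borel_measurable (\<nu> \<Otimes>\<^sub>M \<mu>)"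
      by (simp add: split_beta' add.commute sets cong: measurable_cong_sets sets_pair_measure_cong)
    from P.Fubini'[OF this] show ?thesis by simp
  qed
  also have "\<dots> = (\<integral>\<^sup>+x. (\<integral>\<^sup>+z. indicator A z * indicator B (z - x) \<partial>\<nu>) \<partial>\<mu>)"
    using Rn(1)
  proof (intro nn_integral_cong_AE, eventually_elim)
    case (elim x)
    let ?C = "{z. z - x \<in> B} \<inter> A"
    have C: "?C \<in> sets borel" using tm(2)[OF B] by auto
    have "(\<integral>\<^sup>+y. indicator B y * indicator A (x + y) \<partial>\<nu>) = (\<integral>\<^sup>+y. indicator {y. y + x \<in> ?C} y \<partial>\<nu>)"
      by (intro nn_integral_cong) (auto simp: indicator_def add.commute)
    also have "\<dots> = emeasure \<nu> {y. y + x \<in> ?C}"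
      using tm(1)[OF C, of x] unfolding sets(2)[symmetric] by (rule nn_integral_indicator)
    also have "\<dots> = emeasure \<nu> ?C" using tr(2)[OF elim(2) C] .
    also have "\<dots> = (\<integral>\<^sup>+z. indicator ?C z \<partial>\<nu>)"
      using C unfolding sets(2)[symmetric] by (rule nn_integral_indicator[symmetric])
    also have "\<dots> = (\<integral>\<^sup>+z. indicator A z * indicator B (z - x) \<partial>\<nu>)"
      by (intro nn_integral_cong) (auto simp: indicator_def)
    finally show ?case .
  qed
  also have "\<dots> = (\<integral>\<^sup>+z. (\<integral>\<^sup>+x. indicator A z * indicator B (z - x) \<partial>\<mu>) \<partial>\<nu>)"
  proof -
    have "(\<lambda>p::(nat\<Rightarrow>real)\<times>(nat\<Rightarrow>real). indicator A (fst p) * indicator B (snd p - fst p) :: ennreal) \<in> borel_measurable (borel \<Otimes>\<^sub>M borel)"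
      by measurable
    also have "(\<lambda>p::(nat\<Rightarrow>real)\<times>(nat\<Rightarrow>real). indicator A (fst p) * indicator B (snd p - fst p) :: ennreal) =
        (\<lambda>(z, x). indicator A z * indicator B (z - x))"
      using sym[of "_ - _"] by (auto simp: fun_eq_iff indicator_def)
    finally have "(\<lambda>(z, x). indicator A z * indicator B (z - x) :: ennreal) \<in> borel_measurable (\<nu> \<Otimes>\<^sub>M \<mu>)"
      by (simp add: sets cong: measurable_cong_sets sets_pair_measure_cong)
    from P.Fubini'[OF this] show ?thesis by simp
  qed
  also have "\<dots> = (\<integral>\<^sup>+z. indicator A z * emeasure \<mu> B \<partial>\<nu>)"
    using Rn(2)
  proof (intro nn_integral_cong_AE, eventually_elim)
    case (elim z)
    have mz: "- z \<in> Rn n" using elim(2) by (simp add: Rn_def)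
    have "(\<integral>\<^sup>+x. indicator A z * indicator B (z - x) \<partial>\<mu>) = (\<integral>\<^sup>+x. indicator A z * indicator {x. x + - z \<in> B} x \<partial>\<mu>)"
      using sym[of "_ - z"] by (intro nn_integral_cong) (auto simp: indicator_def)
    also have "\<dots> = indicator A z * emeasure \<mu> {x. x + - z \<in> B}"
      using tm(1)[OF B, of "- z"] by (subst nn_integral_cmult_indicator) (auto simp: sets)
    also have "emeasure \<mu> {x. x + - z \<in> B} = emeasure \<mu> B" by (rule tr(1)[OF mz B])
    finally show ?case .
  qed
  also have "\<dots> = emeasure \<nu> A * emeasure \<nu> B"
    by (simp add: nn_integral_multc sets eq(1))
  finally have "emeasure \<nu> B * emeasure \<mu> A = emeasure \<nu> B * emeasure \<nu> A" by (simp add: mult.commute)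
  then show "emeasure \<mu> A = emeasure \<nu> A"
    using eq(2,3) by (simp add: ennreal_mult_cancel_left)
qed (simp add: sets)

text \<open>
  The reflection in the hyperplane orthogonal to \<open>w\<close>; if \<open>dot n w w = 0\<close>, division by zero makes
  it the identity.
\<close>

definition reflect :: "nat \<Rightarrow> (nat \<Rightarrow> real) \<Rightarrow> (nat \<Rightarrow> real) \<Rightarrow> nat \<Rightarrow> real" where
  "reflect n w x = (\<lambda>i. x i + (- 2 * dot n x w / dot n w w) * w i)"

lemma dot_add_right: "dot n y (\<lambda>i. x i + c * w i) = dot n y x + c * dot n y w"
  by (simp add: dot_def algebra_simps sum.distrib sum_distrib_left)

lemma dot_add_left: "dot n (\<lambda>i. x i + c * w i) y = dot n x y + c * dot n w y"
  by (simp add: dot_def algebra_simps sum.distrib sum_distrib_left)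

lemma dot_eq_0:
  assumes "dot n w w = 0" shows "dot n x w = 0"
proof -
  have "(w i)\<^sup>2 = 0" if "i < n" for i
    using assms that sum_nonneg_eq_0_iff[of "{..<n}" "\<lambda>i. w i * w i"] by (simp add: dot_def)
  then show ?thesis by (simp add: dot_def)
qed

lemma dot_reflect: "dot n (reflect n w x) (reflect n w y) = dot n x y"
proof (cases "dot n w w = 0")
  case True then show ?thesis by (simp add: reflect_def)
next
  case False
  then show ?thesis
    unfolding reflect_def dot_add_right dot_add_left dot_commute[of n w x] dot_commute[of n w y]
    by (simp add: field_simps)
qed

lemma reflect_reflect: "reflect n w (reflect n w x) = x"
proof (cases "dot n w w = 0")
  case True then show ?thesis by (simp add: reflect_def)
next
  case False
  then show ?thesis
    unfolding reflect_def dot_add_right dot_add_left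
    by (auto simp: fun_eq_iff field_simps)
qed

lemma reflect_Rn: "w \<in> Rn n \<Longrightarrow> x \<in> Rn n \<Longrightarrow> reflect n w x \<in> Rn n"
  by (simp add: reflect_def Rn_def)

lemma reflect_add: "reflect n w (x + y) = reflect n w x + reflect n w y"
proof -
  have "dot n (x + y) w = dot n x w + dot n y w" by (simp add: dot_def algebra_simps sum.distrib)
  then show ?thesis by (simp add: reflect_def fun_eq_iff algebra_simps add_divide_distrib diff_divide_distrib)
qed

lemma reflect_scale: "reflect n w (scale_fun c x) = scale_fun c (reflect n w x)"
proof -
  have "dot n (scale_fun c x) w = c * dot n x w"
    by (simp add: dot_def scale_fun_def algebra_simps sum_distrib_left)
  then show ?thesis by (simp add: reflect_def scale_fun_def fun_eq_iff algebra_simps)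
qed

lemma reflect_orthogonal_fixed: "dot n x w = 0 \<Longrightarrow> reflect n w x = x"
  by (simp add: reflect_def)

text \<open>
  Reflections act transitively on spheres: the mirror between two points of equal norm is
  orthogonal to their difference.
\<close>

lemma reflect_diff:
  assumes "x \<in> Rn n" "y \<in> Rn n" "dot n x x = dot n y y"
  shows "reflect n (x - y) x = y"
proof -
  have e: "x - y = (\<lambda>i. x i + (-1) * y i)" by (simp add: fun_eq_iff)
  have 1: "dot n x (x - y) = dot n x x - dot n x y"
    unfolding e dot_add_right by simp
  have 2: "dot n (x - y) (x - y) = 2 * (dot n x x - dot n x y)"
    unfolding e dot_add_right dot_add_left using assms(3) by (simp add: dot_commute)
  show ?thesis
  proof (cases "dot n x x = dot n x y")
    case True
    then have z: "dot n (x - y) (x - y) = 0" using 2 by simp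
    have "x i = y i" for i
    proof (cases "i < n")
      case True
      then have "((x - y) i)\<^sup>2 = 0" using z sum_nonneg_eq_0_iff[of "{..<n}" "\<lambda>i. (x - y) i * (x - y) i"] by (simp add: dot_def)
      then show ?thesis by simp
    qed (use assms in \<open>auto simp: Rn_def\<close>)
    then show ?thesis by (auto simp: reflect_def fun_eq_iff)
  next
    case False
    then show ?thesis unfolding reflect_def 1 2 by (auto simp: fun_eq_iff field_simps)
  qed
qed

lemma measurable_reflect [measurable]: "reflect n w \<in> borel_measurable borel"
proof (rule measurable_fun_borelI)
  fix i show "(\<lambda>x. reflect n w x i) \<in> borel_measurable borel"
    unfolding reflect_def by measurable
qed

lemma orthogonal_map_reflect: "w \<in> Rn n \<Longrightarrow> orthogonal_map n (reflect n w)"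
  unfolding orthogonal_map_def
  by (auto simp: reflect_Rn dot_reflect Vector_Spaces.linear_def module_hom_def module_hom_axioms_def reflect_add reflect_scale
      rvec.vector_space_axioms rvec.module_axioms)

lemma emeasure_euclid_ball:
  assumes "r > 0"
  shows "emeasure (lebesgue_Rn n) {x. dot n x x \<le> r\<^sup>2} = ennreal (r ^ n * ball_vol {..<n})"
proof -
  have "dot n (zero_fill n x) (zero_fill n x) = sqsum {..<n} x" for x
    by (simp add: dot_def sqsum_def zero_fill_def power2_eq_square)
  moreover have "{x. dot n x x \<le> r\<^sup>2} \<in> sets borel" by measurable
  ultimately show ?thesis using emeasure_ball_radius[OF _ assms, of "{..<n}"] by (simp add: emeasure_lebesgue_Rn)
qed

lemma sigma_finite_euclid:
  assumes "sets M = sets borel" "\<And>r. r > 0 \<Longrightarrow> emeasure M {x. dot n x x \<le> r\<^sup>2} \<noteq> \<infinity>"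
  shows "sigma_finite_measure M"
proof
  have sp: "space M = UNIV" using sets_eq_imp_space_eq[OF assms(1)] by simp
  let ?A = "range (\<lambda>j::nat. {x. dot n x x \<le> (real (Suc j))\<^sup>2})"
  have "\<Union>?A = UNIV"
  proof (intro UNIV_eq_I[symmetric])
    fix x
    obtain j where j: "dot n x x \<le> real j" using real_arch_simple by blast
    have "real j \<le> (real (Suc j))\<^sup>2" by (simp add: power2_eq_square algebra_simps)
    then have "x \<in> {x. dot n x x \<le> (real (Suc j))\<^sup>2}" using j by simp
    then show "x \<in> \<Union>?A" by (intro UnionI[of "{x. dot n x x \<le> (real (Suc j))\<^sup>2}"]) auto
  qed
  moreover have "?A \<subseteq> sets M" unfolding assms(1) by auto
  moreover have "\<forall>a\<in>?A. emeasure M a \<noteq> \<infinity>" using assms(2) by auto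
  ultimately show "\<exists>A. countable A \<and> A \<subseteq> sets M \<and> \<Union>A = space M \<and> (\<forall>a\<in>A. emeasure M a \<noteq> \<infinity>)"
    unfolding sp by (intro exI[of _ ?A]) auto
qed

lemma sigma_finite_lebesgue_Rn: "sigma_finite_measure (lebesgue_Rn n)"
  by (rule sigma_finite_euclid[of _ n]) (auto simp: emeasure_euclid_ball)

text \<open>
  The image measure is again translation invariant, and it gives the unit ball the same
  volume.
\<close>

lemma distr_reflect:
  assumes w: "w \<in> Rn n"
  shows "distr (lebesgue_Rn n) borel (reflect n w) = lebesgue_Rn n"
proof (rule translation_invariant_unique)
  let ?D = "distr (lebesgue_Rn n) borel (reflect n w)"
  have bb: "emeasure ?D {x. dot n x x \<le> r\<^sup>2} = emeasure (lebesgue_Rn n) {x. dot n x x \<le> r\<^sup>2}" for r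
    by (subst emeasure_distr) (auto simp: dot_reflect)
  show "sigma_finite_measure ?D"
    by (rule sigma_finite_euclid[of _ n]) (auto simp: bb emeasure_euclid_ball)
  show "AE x in ?D. x \<in> Rn n"
    using AE_lebesgue_Rn[of n] by (subst AE_distr_iff) (auto elim!: eventually_mono simp: reflect_Rn w)
  show "{x. dot n x x \<le> 1\<^sup>2} \<in> sets borel" by measurable
  show "- x \<in> {x. dot n x x \<le> 1\<^sup>2} \<longleftrightarrow> x \<in> {x. dot n x x \<le> 1\<^sup>2}" for x by (simp add: dot_def)
  show "emeasure ?D {x. dot n x x \<le> 1\<^sup>2} = emeasure (lebesgue_Rn n) {x. dot n x x \<le> 1\<^sup>2}" by (rule bb)
  show "emeasure (lebesgue_Rn n) {x. dot n x x \<le> 1\<^sup>2} \<noteq> 0" "emeasure (lebesgue_Rn n) {x. dot n x x \<le> 1\<^sup>2} \<noteq> \<infinity>"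
    using emeasure_euclid_ball[of 1 n] ball_vol_pos[of "{..<n}"] by auto
  fix a :: "nat \<Rightarrow> real" and A :: "(nat \<Rightarrow> real) set" assume a: "a \<in> Rn n" and A: "A \<in> sets borel"
  show "emeasure (lebesgue_Rn n) {x. x + a \<in> A} = emeasure (lebesgue_Rn n) A"
    by (rule emeasure_lebesgue_Rn_translate[OF A a])
  have p: "(\<lambda>x::nat\<Rightarrow>real. x + a) \<in> borel_measurable borel" by (intro measurable_fun_borelI) simp
  have m1: "{x. x + a \<in> A} \<in> sets borel" using measurable_sets[OF p A] by (simp add: vimage_def)
  have m2: "{x. reflect n w x \<in> A} \<in> sets borel" using measurable_sets[OF measurable_reflect A] by (simp add: vimage_def)
  have "emeasure ?D {x. x + a \<in> A} = emeasure (lebesgue_Rn n) {x. x + reflect n w a \<in> {x. reflect n w x \<in> A}}"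
    using m1 by (subst emeasure_distr) (auto simp: reflect_add reflect_reflect vimage_def)
  also have "\<dots> = emeasure (lebesgue_Rn n) {x. reflect n w x \<in> A}"
    by (rule emeasure_lebesgue_Rn_translate[OF m2 reflect_Rn[OF w a]])
  also have "\<dots> = emeasure ?D A" using A by (subst emeasure_distr) (auto simp: vimage_def)
  finally show "emeasure ?D {x. x + a \<in> A} = emeasure ?D A" .
qed (auto simp: sigma_finite_lebesgue_Rn AE_lebesgue_Rn)

section \<open>Polar decomposition with respect to a homogeneous function\<close>

definition clip :: "real \<Rightarrow> real" where "clip t = max 0 (min 1 t)"

text \<open>
  Independence of direction and radius rests on homogeneity and on dilations of Lebesgue
  measure. The Euclidean norm and all \<open>p\<close>-norms are treated at once.
\<close>

locale gauge =
  fixes n :: nat and N :: "(nat \<Rightarrow> real) \<Rightarrow> real"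
  assumes n: "n \<ge> 1"
    and N_meas [measurable]: "N \<in> borel_measurable borel"
    and N_scale: "\<And>c x. c > 0 \<Longrightarrow> N (\<lambda>i. c * x i) = c * N x"
    and N_nonneg: "\<And>x. 0 \<le> N x"
    and pos: "emeasure (lebesgue_Rn n) {x. N x \<le> 1} \<noteq> 0"
    and fin: "emeasure (lebesgue_Rn n) {x. N x \<le> 1} \<noteq> \<infinity>"
begin

definition U :: "(nat \<Rightarrow> real) measure" where
  "U = uniform_measure (lebesgue_Rn n) {x. N x \<le> 1}"

lemma prob_U: "prob_space U"
  unfolding U_def by (rule prob_space_uniform_measure) (use pos fin in auto)

lemma space_U [simp]: "space U = UNIV" and sets_U [simp, measurable_cong]: "sets U = sets borel"
  by (simp_all add: U_def uniform_measure_def)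

lemma cone_volume:
  assumes C[measurable]: "C \<in> sets borel" and cone: "\<And>c x. c > 0 \<Longrightarrow> (\<lambda>i. c * x i) \<in> C \<longleftrightarrow> x \<in> C" and t: "t > 0"
  shows "emeasure (lebesgue_Rn n) {x\<in>C. N x \<le> t} = ennreal t ^ n * emeasure (lebesgue_Rn n) {x\<in>C. N x \<le> 1}"
proof -
  have "{x\<in>C. N x \<le> t} \<in> sets borel" by measurable
  moreover have "{x. (\<lambda>i. t * x i) \<in> {x\<in>C. N x \<le> t}} = {x\<in>C. N x \<le> 1}"
    using t by (auto simp: cone N_scale)
  ultimately show ?thesis using emeasure_lebesgue_Rn_scale[of "{x\<in>C. N x \<le> t}" t n] t by simp
qed

lemma emeasure_U: "A \<in> sets borel \<Longrightarrow> emeasure U A = emeasure (lebesgue_Rn n) {x\<in>A. N x \<le> 1} / emeasure (lebesgue_Rn n) {x. N x \<le> 1}"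
  unfolding U_def
  by (subst emeasure_uniform_measure) (auto intro!: arg_cong2[where f="(/)"] arg_cong2[where f=emeasure])

text \<open>
  The part of a cone where \<open>N \<le> t\<close> is the dilation by \<open>t\<close> of the part where \<open>N \<le> 1\<close>.
\<close>

lemma cone_cdf:
  assumes C[measurable]: "C \<in> sets borel" and cone: "\<And>c x. c > 0 \<Longrightarrow> (\<lambda>i. c * x i) \<in> C \<longleftrightarrow> x \<in> C"
  shows "measure U {x\<in>C. N x \<le> t} = clip t ^ n * measure U C"
proof -
  interpret prob_space U by (rule prob_U)
  have 1: "measure U {x\<in>C. N x \<le> t} = t ^ n * measure U C" if "0 < t" "t \<le> 1" for t
  proof -
    have "emeasure U {x\<in>C. N x \<le> t} = ennreal t ^ n * emeasure U C"
    proof -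
      have "{x \<in> {x\<in>C. N x \<le> t}. N x \<le> 1} = {x\<in>C. N x \<le> t}" using that by auto
      then show ?thesis
        using cone_volume[OF C cone that(1)] by (simp add: emeasure_U ennreal_times_divide)
    qed
    then have "ennreal (measure U {x\<in>C. N x \<le> t}) = ennreal (t ^ n * measure U C)"
      using that by (simp add: emeasure_eq_measure ennreal_power ennreal_mult)
    then show ?thesis using that by (subst (asm) ennreal_inj) auto
  qed
  consider "t > 1" | "0 < t" "t \<le> 1" | "t \<le> 0" by linarith
  then show ?thesis
  proof cases
    case 1
    have "{x \<in> {x\<in>C. N x \<le> t}. N x \<le> 1} = {x\<in>C. N x \<le> 1}" using 1 by auto
    then have "emeasure U {x\<in>C. N x \<le> t} = emeasure U C" by (simp add: emeasure_U)
    then show ?thesis using 1 by (simp add: clip_def measure_def)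
  next
    case 2 then show ?thesis using 1 by (simp add: clip_def)
  next
    case 3
    have "measure U {x\<in>C. N x \<le> t} \<le> 0 + s" if "s > 0" for s
    proof -
      define r where "r = min 1 s"
      have r: "0 < r" "r \<le> 1" "r \<le> s" using that by (auto simp: r_def)
      have "measure U {x\<in>C. N x \<le> t} \<le> measure U {x\<in>C. N x \<le> r}"
        using 3 r by (intro finite_measure_mono) (auto intro: order_trans)
      also have "\<dots> = r ^ n * measure U C" by (rule 1[OF r(1,2)])
      also have "\<dots> \<le> r ^ 1 * 1" using r n by (intro mult_mono power_decreasing) auto
      finally show ?thesis using r by simp
    qed
    then have "measure U {x\<in>C. N x \<le> t} \<le> 0" by (rule field_le_epsilon)
    then show ?thesis using 3 n by (simp add: clip_def zero_power measure_le_0_iff)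
  qed
qed

lemma cdf_N: "measure U {x. N x \<le> t} = clip t ^ n"
proof -
  interpret prob_space U by (rule prob_U)
  show ?thesis using cone_cdf[of UNIV t] prob_space by simp
qed

lemma emeasure_N_gt: "emeasure (distr U borel N) {t<..} = ennreal (1 - clip t ^ n)"
proof -
  interpret prob_space U by (rule prob_U)
  have "emeasure (distr U borel N) {t<..} = ennreal (measure U (space U - {x. N x \<le> t}))"
    by (subst emeasure_distr) (auto simp: emeasure_eq_measure not_le intro!: arg_cong2[where f=measure])
  then show ?thesis by (subst (asm) prob_compl) (auto simp: cdf_N)
qed

text \<open>
  The sets \<open>T -` A\<close> are cones, and on each cone \<open>N\<close> has the same conditional distribution
  function.
\<close>

lemma cone_gauge_independent:
  assumes T[measurable]: "T \<in> borel_measurable borel" and inv: "\<And>c x. c > 0 \<Longrightarrow> T (\<lambda>i. c * x i) = (T x :: real)"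
  shows "distr U borel T \<Otimes>\<^sub>M distr U borel N = distr U (borel \<Otimes>\<^sub>M borel) (\<lambda>x. (T x, N x))"
proof (rule pair_measure_eqI)
  interpret prob_space U by (rule prob_U)
  interpret T: prob_space "distr U borel T" by (rule prob_space_distr) simp
  interpret N: prob_space "distr U borel N" by (rule prob_space_distr) simp
  show "sigma_finite_measure (distr U borel T)" "sigma_finite_measure (distr U borel N)" by unfold_locales
  show "sets (distr U borel T \<Otimes>\<^sub>M distr U borel N) = sets (distr U (borel \<Otimes>\<^sub>M borel) (\<lambda>x. (T x, N x)))"
    by (simp cong: sets_pair_measure_cong)
  fix A B assume A: "A \<in> sets (distr U borel T)" and B: "B \<in> sets (distr U borel N)"
  then have [measurable]: "A \<in> sets borel" "B \<in> sets borel" by auto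
  let ?C = "T -` A"
  have C[measurable]: "?C \<in> sets borel" using measurable_sets[OF T, of A] by simp
  have cone: "(\<lambda>i. c * x i) \<in> ?C \<longleftrightarrow> x \<in> ?C" if "c > 0" for c x using inv[OF that] by simp
  let ?M = "distr (density U (indicator ?C)) borel N"
  have M: "emeasure ?M S = emeasure U (?C \<inter> N -` S)" if [measurable]: "S \<in> sets borel" for S
  proof -
    have [measurable]: "N -` S \<in> sets borel" using measurable_sets[OF N_meas that] by simp
    have "emeasure ?M S = emeasure (density U (indicator ?C)) (N -` S)"
      by (subst emeasure_distr) auto
    also have "\<dots> = (\<integral>\<^sup>+x. indicator ?C x * indicator (N -` S) x \<partial>U)"
      by (rule emeasure_density) simp_all
    also have "\<dots> = (\<integral>\<^sup>+x. indicator (?C \<inter> N -` S) x \<partial>U)"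
      by (rule nn_integral_cong) (auto simp: indicator_def)
    also have "\<dots> = emeasure U (?C \<inter> N -` S)" by (rule nn_integral_indicator) simp
    finally show ?thesis .
  qed
  have "?M = scale_measure (emeasure U ?C) (distr U borel N)"
  proof (rule measure_eqI_lessThan)
    fix t
    have "emeasure ?M {t<..} \<le> 1" by (subst M) (auto simp: emeasure_le_1)
    then show "emeasure ?M {t<..} < \<infinity>" by (rule le_less_trans) simp
    have "emeasure ?M {t<..} = ennreal (measure U (?C - {x\<in>?C. N x \<le> t}))"
      by (subst M) (auto simp: emeasure_eq_measure not_le intro!: arg_cong2[where f=measure])
    also have "measure U (?C - {x\<in>?C. N x \<le> t}) = measure U ?C - measure U {x\<in>?C. N x \<le> t}"
      by (rule finite_measure_Diff) auto
    also have "\<dots> = measure U ?C * (1 - clip t ^ n)" by (subst cone_cdf[OF C cone]) (auto simp: algebra_simps)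
    also have "ennreal \<dots> = emeasure U ?C * ennreal (1 - clip t ^ n)"
      by (simp add: emeasure_eq_measure ennreal_mult' )
    finally show "emeasure ?M {t<..} = emeasure (scale_measure (emeasure U ?C) (distr U borel N)) {t<..}"
      by (simp add: emeasure_N_gt)
  qed auto
  then have "emeasure ?M B = emeasure U ?C * emeasure (distr U borel N) B" by simp
  moreover have "emeasure (distr U borel T) A = emeasure U ?C" by (subst emeasure_distr) auto
  moreover have "emeasure (distr U (borel \<Otimes>\<^sub>M borel) (\<lambda>x. (T x, N x))) (A \<times> B) = emeasure ?M B"
    by (subst emeasure_distr) (auto simp: M intro!: arg_cong2[where f=emeasure])
  ultimately show "emeasure (distr U borel T) A * emeasure (distr U borel N) B =
      emeasure (distr U (borel \<Otimes>\<^sub>M borel) (\<lambda>x. (T x, N x))) (A \<times> B)" by simp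
qed

text \<open>
  The law depends on \<open>n\<close> alone. This makes the \<open>p\<close>-norm of a uniform point of the \<open>p\<close>-ball
  interchangeable with the Euclidean norm of a uniform point of the Euclidean ball.
\<close>

lemma distr_N_density:
  "distr U borel N = density lborel (\<lambda>s. ennreal (real n * s ^ (n - 1)) * indicator {0..1} s)"
proof (rule measure_eqI_lessThan)
  fix t
  show "emeasure (distr U borel N) {t<..} < \<infinity>" by (simp add: emeasure_N_gt)
  have c: "clip t \<le> 1" "0 \<le> clip t" by (auto simp: clip_def)
  have "emeasure (density lborel (\<lambda>s. ennreal (real n * s ^ (n - 1)) * indicator {0..1} s)) {t<..}
     = (\<integral>\<^sup>+s. ennreal (real n * s ^ (n - 1)) * indicator {0..1} s * indicator {t<..} s \<partial>lborel)"
    by (subst emeasure_density) auto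
  also have "\<dots> = (\<integral>\<^sup>+s. ennreal (real n * s ^ (n - 1)) * indicator {clip t..1} s \<partial>lborel)"
  proof (rule nn_integral_cong_AE)
    show "AE s in lborel. ennreal (real n * s ^ (n - 1)) * indicator {0..1} s * indicator {t<..} s
       = ennreal (real n * s ^ (n - 1)) * indicator {clip t..1} s"
      using AE_lborel_singleton[of t] AE_lborel_singleton[of 1]
      by eventually_elim (auto simp: indicator_def clip_def)
  qed
  also have "\<dots> = ennreal (1 ^ n - clip t ^ n)"
    using c by (intro nn_integral_FTC_Icc) (auto intro!: derivative_eq_intros)
  finally show "emeasure (distr U borel N) {t<..} =
      emeasure (density lborel (\<lambda>s. ennreal (real n * s ^ (n - 1)) * indicator {0..1} s)) {t<..}"
    by (simp add: emeasure_N_gt)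
qed auto

lemma null_N:
  assumes Z: "Z \<in> null_sets lborel"
  shows "emeasure (lebesgue_Rn n) {x. N x \<in> Z} = 0"
proof -
  have 1: "emeasure (lebesgue_Rn n) {x. N x \<le> 1 \<and> N x \<in> Y} = 0" if Y: "Y \<in> null_sets lborel" for Y
  proof -
    have Yb[measurable]: "Y \<in> sets borel" using Y by auto
    have "AE s in lborel. s \<notin> Y" using Y by (rule AE_not_in)
    then have "AE s in distr U borel N. s \<notin> Y"
      unfolding distr_N_density by (subst AE_density) auto
    then have "emeasure (distr U borel N) Y = 0" by (subst (asm) AE_iff_measurable[of Y]) auto
    then have "emeasure U {x. N x \<in> Y} = 0" by (subst (asm) emeasure_distr) (auto simp: vimage_def)
    moreover have "{x. N x \<in> Y} \<in> sets borel" by measurable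
    ultimately have "emeasure (lebesgue_Rn n) {x\<in>{x. N x \<in> Y}. N x \<le> 1} = 0"
      using fin by (subst (asm) emeasure_U) (auto simp: ennreal_divide_eq_0_iff)
    then show ?thesis by (simp add: conj_commute)
  qed
  have Zb[measurable]: "Z \<in> sets borel" using Z by auto
  have 2: "emeasure (lebesgue_Rn n) {x. N x \<le> r \<and> N x \<in> Z} = 0" if r: "r > 0" for r
  proof -
    let ?Y = "(\<lambda>t. r * t) -` Z"
    have Y: "?Y \<in> null_sets lborel" by (rule null_sets_scale[OF r Z])
    have "{x. (\<lambda>i. r * x i) \<in> {x. N x \<le> r \<and> N x \<in> Z}} = {x. N x \<le> 1 \<and> N x \<in> ?Y}"
      using r by (auto simp: N_scale)
    then show ?thesis
      using emeasure_lebesgue_Rn_scale[of "{x. N x \<le> r \<and> N x \<in> Z}" r n] 1[OF Y] r by simp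
  qed
  have "{x. N x \<in> Z} = (\<Union>j::nat. {x. N x \<le> real (Suc j) \<and> N x \<in> Z})"
  proof (intro set_eqI iffI)
    fix x assume x: "x \<in> {x. N x \<in> Z}"
    obtain j :: nat where "N x \<le> real j" using real_arch_simple by blast
    then show "x \<in> (\<Union>j::nat. {x. N x \<le> real (Suc j) \<and> N x \<in> Z})" using x by (intro UN_I[of j]) auto
  qed auto
  also have "emeasure (lebesgue_Rn n) \<dots> = 0"
    by (rule emeasure_UN_eq_0) (use 2 in auto)
  finally show ?thesis .
qed

end

section \<open>The uniform distribution on the Euclidean ball\<close>

definition nrm :: "nat \<Rightarrow> (nat \<Rightarrow> real) \<Rightarrow> real" where
  "nrm n x = sqrt (dot n x x)"

lemma nrm_nonneg [simp]: "0 \<le> nrm n x" by (simp add: nrm_def dot_nonneg)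

lemma nrm_power2: "(nrm n x)\<^sup>2 = dot n x x" by (simp add: nrm_def dot_nonneg)

lemma nrm_scale: "c \<ge> 0 \<Longrightarrow> nrm n (\<lambda>i. c * x i) = c * nrm n x"
  by (simp add: nrm_def dot_scale real_sqrt_mult)

lemma nrm_le_iff: "r \<ge> 0 \<Longrightarrow> nrm n x \<le> r \<longleftrightarrow> dot n x x \<le> r\<^sup>2"
  by (metis nrm_def real_sqrt_le_iff real_sqrt_unique)

lemma measurable_nrm [measurable]: "nrm n \<in> borel_measurable borel"
  unfolding nrm_def by measurable

lemma nrm_mono: "k \<le> n \<Longrightarrow> nrm k x \<le> nrm n x"
  unfolding nrm_def dot_def by (intro real_sqrt_le_mono sum_mono2) auto

lemma gauge_nrm: "n \<ge> 1 \<Longrightarrow> gauge n (nrm n)"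
proof
  have "{x. nrm n x \<le> 1} = {x. dot n x x \<le> 1\<^sup>2}" by (auto simp: nrm_le_iff)
  then show "emeasure (lebesgue_Rn n) {x. nrm n x \<le> 1} \<noteq> 0" "emeasure (lebesgue_Rn n) {x. nrm n x \<le> 1} \<noteq> \<infinity>"
    using emeasure_euclid_ball[of 1 n] ball_vol_pos[of "{..<n}"] by auto
qed (auto simp: nrm_scale)

definition uball :: "nat \<Rightarrow> (nat \<Rightarrow> real) measure" where
  "uball n = uniform_measure (lebesgue_Rn n) {x. nrm n x \<le> 1}"

lemma space_uball [simp]: "space (uball n) = UNIV" and sets_uball [simp, measurable_cong]: "sets (uball n) = sets borel"
  by (simp_all add: uball_def uniform_measure_def)

lemma prob_uball: "n \<ge> 1 \<Longrightarrow> prob_space (uball n)"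
  unfolding uball_def using gauge.prob_U[OF gauge_nrm] by (simp add: gauge.U_def[OF gauge_nrm])

definition ball_ratio :: "nat \<Rightarrow> nat \<Rightarrow> real" where
  "ball_ratio n k = ball_vol {..<k} * ball_vol {k..<n} / ball_vol {..<n}"

lemma ball_ratio_pos: "ball_ratio n k > 0"
  by (simp add: ball_ratio_def ball_vol_pos)

lemma emeasure_uball:
  assumes "A \<in> sets borel"
  shows "emeasure (uball n) A = emeasure (lbPi {..<n}) {x\<in>space (lbPi {..<n}). zero_fill n x \<in> A \<and> sqsum {..<n} x \<le> 1} / ennreal (ball_vol {..<n})"
proof -
  have [measurable]: "{x. nrm n x \<le> 1} \<in> sets borel" by measurable
  have b: "{x. nrm n x \<le> 1} = {x. dot n x x \<le> 1\<^sup>2}" by (auto simp: nrm_le_iff)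
  have d: "dot n (zero_fill n x) (zero_fill n x) = sqsum {..<n} x" for x
    by (simp add: dot_def sqsum_def zero_fill_def power2_eq_square)
  have "emeasure (uball n) A = emeasure (lebesgue_Rn n) ({x. nrm n x \<le> 1} \<inter> A) / emeasure (lebesgue_Rn n) {x. nrm n x \<le> 1}"
    unfolding uball_def using assms by (subst emeasure_uniform_measure) auto
  also have "emeasure (lebesgue_Rn n) {x. nrm n x \<le> 1} = ennreal (ball_vol {..<n})"
    unfolding b by (subst emeasure_euclid_ball) auto
  also have "emeasure (lebesgue_Rn n) ({x. nrm n x \<le> 1} \<inter> A) =
     emeasure (lbPi {..<n}) {x\<in>space (lbPi {..<n}). zero_fill n x \<in> A \<and> sqsum {..<n} x \<le> 1}"
    using assms by (subst emeasure_lebesgue_Rn) (auto simp: b d intro!: arg_cong2[where f=emeasure])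
  finally show ?thesis .
qed

lemma nrm_zero_fill: "k \<le> n \<Longrightarrow> nrm k (zero_fill n x) = sqrt (sqsum {..<k} x)"
  by (auto simp: nrm_def dot_def sqsum_def zero_fill_def power2_eq_square intro!: arg_cong[where f=sqrt] sum.cong)

lemma split_lessThan:
  assumes "k < n"
  shows "{..<k} \<union> {k..<n} = {..<n::nat}" "{..<k} \<inter> {k..<n} = {}"
    "sqsum {..<n} x = sqsum {..<k} x + sqsum {k..<n} x"
proof -
  show 1: "{..<k} \<union> {k..<n} = {..<n::nat}" "{..<k} \<inter> {k..<n} = {}" using assms by auto
  show "sqsum {..<n} x = sqsum {..<k} x + sqsum {k..<n} x"
    unfolding sqsum_def 1(1)[symmetric] by (rule sum.union_disjoint) (use 1 in auto)
qed

text \<open>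
  If the first \<open>k\<close> coordinates have norm between \<open>a\<close> and \<open>b\<close>, the others have norm at most
  \<open>sqrt (1 - a\<^sup>2)\<close>, so the point lies in a product of two balls.
\<close>

lemma uball_upper:
  assumes k: "1 \<le> k" "k < n" and ab: "0 \<le> a" "a < 1" "0 < b"
  shows "measure (uball n) {x. a \<le> nrm k x \<and> nrm k x \<le> b} \<le> ball_ratio n k * (b ^ k * sqrt (1 - a\<^sup>2) ^ (n - k))"
proof -
  interpret prob_space "uball n" by (rule prob_uball) (use k in simp)
  note sp = split_lessThan[OF k(2)]
  have a2: "1 - a\<^sup>2 > 0" using ab abs_square_less_1[of a] by simp
  let ?s = "sqrt (1 - a\<^sup>2)"
  have s: "?s > 0" "?s\<^sup>2 = 1 - a\<^sup>2" using a2 by auto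
  let ?A = "{x. a \<le> nrm k x \<and> nrm k x \<le> b}"
  have [measurable]: "sqsum {..<k} \<in> borel_measurable (lbPi {..<n})" "sqsum {k..<n} \<in> borel_measurable (lbPi {..<n})"
    unfolding sqsum_def using k by (auto intro!: borel_measurable_sum borel_measurable_power coord_lbPi)
  have "emeasure (uball n) ?A = emeasure (lbPi {..<n}) {x\<in>space (lbPi {..<n}). zero_fill n x \<in> ?A \<and> sqsum {..<n} x \<le> 1} / ennreal (ball_vol {..<n})"
    by (rule emeasure_uball) measurable
  also have "\<dots> \<le> emeasure (lbPi {..<n}) {x\<in>space (lbPi {..<n}). sqsum {..<k} x \<in> {..b\<^sup>2} \<and> sqsum {k..<n} x \<in> {..?s\<^sup>2}} / ennreal (ball_vol {..<n})"
  proof (intro divide_right_mono_ennreal emeasure_mono)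
    show "{x\<in>space (lbPi {..<n}). zero_fill n x \<in> ?A \<and> sqsum {..<n} x \<le> 1} \<subseteq>
      {x\<in>space (lbPi {..<n}). sqsum {..<k} x \<in> {..b\<^sup>2} \<and> sqsum {k..<n} x \<in> {..?s\<^sup>2}}"
    proof safe
      fix x assume x: "x \<in> space (lbPi {..<n})" "a \<le> nrm k (zero_fill n x)" "nrm k (zero_fill n x) \<le> b" "sqsum {..<n} x \<le> 1"
      have e: "nrm k (zero_fill n x) = sqrt (sqsum {..<k} x)" using k by (simp add: nrm_zero_fill)
      have "a\<^sup>2 \<le> (sqrt (sqsum {..<k} x))\<^sup>2" using x(2) ab e by (intro power_mono) auto
      moreover have "(sqrt (sqsum {..<k} x))\<^sup>2 \<le> b\<^sup>2" using x(3) ab e by (intro power_mono) (auto simp: sqsum_nonneg)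
      ultimately have "a\<^sup>2 \<le> sqsum {..<k} x" "sqsum {..<k} x \<le> b\<^sup>2" by (simp_all add: sqsum_nonneg)
      then show "sqsum {..<k} x \<le> b\<^sup>2" "sqsum {k..<n} x \<le> ?s\<^sup>2" using x(4) s(2) sp(3)[of x] by auto
    qed
  qed measurable
  also have "emeasure (lbPi {..<n}) {x\<in>space (lbPi {..<n}). sqsum {..<k} x \<in> {..b\<^sup>2} \<and> sqsum {k..<n} x \<in> {..?s\<^sup>2}}
     = ennreal (b ^ k * ball_vol {..<k}) * ennreal (?s ^ (n - k) * ball_vol {k..<n})"
    using emeasure_split[of "{..<k}" "{k..<n}" "{..b\<^sup>2}" "{..?s\<^sup>2}"] emeasure_ball_radius[of "{..<k}" b]
      emeasure_ball_radius[of "{k..<n}" ?s] sp ab s by simp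
  also have "\<dots> / ennreal (ball_vol {..<n}) = ennreal (b ^ k * ball_vol {..<k} * (?s ^ (n - k) * ball_vol {k..<n}) / ball_vol {..<n})"
    using ab s ball_vol_pos[of "{..<k}"] ball_vol_pos[of "{k..<n}"] ball_vol_pos[of "{..<n}"]
    by (simp add: ennreal_mult[symmetric] divide_ennreal del: real_sqrt_gt_0_iff)
  also have "b ^ k * ball_vol {..<k} * (?s ^ (n - k) * ball_vol {k..<n}) / ball_vol {..<n} = ball_ratio n k * (b ^ k * ?s ^ (n - k))"
    by (simp add: ball_ratio_def)
  finally show ?thesis
    using ab s ball_ratio_pos[of n k] by (simp add: emeasure_eq_measure)
qed

text \<open>
  A product of two shells with radii \<open>r\<close> and \<open>s\<close>. Besides the norm of the first \<open>k\<close> coordinates it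
  also controls the full norm, which is needed for the ratio of the two.
\<close>

lemma uball_lower:
  assumes k: "1 \<le> k" "k < n" and rs: "0 < r" "0 < s" "r\<^sup>2 + s\<^sup>2 \<le> 1" and d: "0 < d" "d < 1"
  shows "ball_ratio n k * (d\<^sup>2 * (r ^ k * s ^ (n - k))) \<le>
    measure (uball n) {x. r * (1 - d) < nrm k x \<and> nrm k x \<le> r \<and>
        (s * (1 - d))\<^sup>2 < (nrm n x)\<^sup>2 - (nrm k x)\<^sup>2 \<and> (nrm n x)\<^sup>2 - (nrm k x)\<^sup>2 \<le> s\<^sup>2}"
proof -
  interpret prob_space "uball n" by (rule prob_uball) (use k in simp)
  note sp = split_lessThan[OF k(2)]
  let ?A = "{x. r * (1 - d) < nrm k x \<and> nrm k x \<le> r \<and>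
        (s * (1 - d))\<^sup>2 < (nrm n x)\<^sup>2 - (nrm k x)\<^sup>2 \<and> (nrm n x)\<^sup>2 - (nrm k x)\<^sup>2 \<le> s\<^sup>2}"
  let ?I = "{(r * (1 - d))\<^sup>2<..r\<^sup>2}" and ?J = "{(s * (1 - d))\<^sup>2<..s\<^sup>2}"
  have Am: "?A \<in> sets borel" by measurable
  have [measurable]: "sqsum {..<k} \<in> borel_measurable (lbPi {..<n})" "sqsum {k..<n} \<in> borel_measurable (lbPi {..<n})"
    unfolding sqsum_def using k by (auto intro!: borel_measurable_sum borel_measurable_power coord_lbPi)
  have zf[measurable]: "zero_fill n \<in> borel_measurable (lbPi {..<n})" by measurable
  have "ennreal (d * r ^ k * ball_vol {..<k}) * ennreal (d * s ^ (n - k) * ball_vol {k..<n}) \<le>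
     emeasure (lbPi {..<k}) {x\<in>space (lbPi {..<k}). sqsum {..<k} x \<in> ?I} *
     emeasure (lbPi {k..<n}) {x\<in>space (lbPi {k..<n}). sqsum {k..<n} x \<in> ?J}"
    using emeasure_shell[of "{..<k}" r d] emeasure_shell[of "{k..<n}" s d] k rs d
    by (intro mult_mono) (auto simp: lessThan_empty_iff)
  also have "\<dots> = emeasure (lbPi {..<n}) {x\<in>space (lbPi {..<n}). sqsum {..<k} x \<in> ?I \<and> sqsum {k..<n} x \<in> ?J}"
    using emeasure_split[of "{..<k}" "{k..<n}" ?I ?J] sp by simp
  also have "\<dots> \<le> emeasure (lbPi {..<n}) {x\<in>space (lbPi {..<n}). zero_fill n x \<in> ?A \<and> sqsum {..<n} x \<le> 1}"
  proof (intro emeasure_mono)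
    show "{x\<in>space (lbPi {..<n}). sqsum {..<k} x \<in> ?I \<and> sqsum {k..<n} x \<in> ?J} \<subseteq>
      {x\<in>space (lbPi {..<n}). zero_fill n x \<in> ?A \<and> sqsum {..<n} x \<le> 1}"
    proof safe
      fix x assume x: "sqsum {..<k} x \<in> ?I" "sqsum {k..<n} x \<in> ?J"
      have e: "nrm k (zero_fill n x) = sqrt (sqsum {..<k} x)" "nrm n (zero_fill n x) = sqrt (sqsum {..<n} x)"
        using k by (simp_all add: nrm_zero_fill)
      have "(nrm n (zero_fill n x))\<^sup>2 - (nrm k (zero_fill n x))\<^sup>2 = sqsum {k..<n} x"
        unfolding e using sp(3)[of x] by (simp add: sqsum_nonneg)
      then show "(s * (1 - d))\<^sup>2 < (nrm n (zero_fill n x))\<^sup>2 - (nrm k (zero_fill n x))\<^sup>2"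
         "(nrm n (zero_fill n x))\<^sup>2 - (nrm k (zero_fill n x))\<^sup>2 \<le> s\<^sup>2" using x(2) by auto
      show "r * (1 - d) < nrm k (zero_fill n x)" unfolding e using x(1) by (intro real_less_rsqrt) auto
      show "nrm k (zero_fill n x) \<le> r" unfolding e using x(1) rs by (intro real_le_lsqrt) (auto simp: sqsum_nonneg)
      show "sqsum {..<n} x \<le> 1" using x rs sp(3)[of x] by auto
    qed
    have "{x\<in>space (lbPi {..<n}). zero_fill n x \<in> ?A} = zero_fill n -` ?A \<inter> space (lbPi {..<n})" by auto
    then have "{x\<in>space (lbPi {..<n}). zero_fill n x \<in> ?A} \<in> sets (lbPi {..<n})"
      using measurable_sets[OF zf Am] by simp
    then have "{x\<in>space (lbPi {..<n}). zero_fill n x \<in> ?A} \<inter> {x\<in>space (lbPi {..<n}). sqsum {..<n} x \<le> 1} \<in> sets (lbPi {..<n})"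
      by (intro sets.Int) measurable
    also have "{x\<in>space (lbPi {..<n}). zero_fill n x \<in> ?A} \<inter> {x\<in>space (lbPi {..<n}). sqsum {..<n} x \<le> 1} =
      {x\<in>space (lbPi {..<n}). zero_fill n x \<in> ?A \<and> sqsum {..<n} x \<le> 1}" by auto
    finally show "{x\<in>space (lbPi {..<n}). zero_fill n x \<in> ?A \<and> sqsum {..<n} x \<le> 1} \<in> sets (lbPi {..<n})" .
  qed
  finally have le: "ennreal (d * r ^ k * ball_vol {..<k}) * ennreal (d * s ^ (n - k) * ball_vol {k..<n}) \<le>
    emeasure (lbPi {..<n}) {x\<in>space (lbPi {..<n}). zero_fill n x \<in> ?A \<and> sqsum {..<n} x \<le> 1}" .
  have "ennreal (d * r ^ k * ball_vol {..<k} * (d * s ^ (n - k) * ball_vol {k..<n}) / ball_vol {..<n}) =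
     ennreal (d * r ^ k * ball_vol {..<k}) * ennreal (d * s ^ (n - k) * ball_vol {k..<n}) / ennreal (ball_vol {..<n})"
    using rs d ball_vol_pos[of "{..<k}"] ball_vol_pos[of "{k..<n}"] ball_vol_pos[of "{..<n}"]
    by (simp add: ennreal_mult[symmetric] divide_ennreal)
  also have "\<dots> \<le> emeasure (uball n) ?A"
    unfolding emeasure_uball[OF Am] by (intro divide_right_mono_ennreal le)
  also have "d * r ^ k * ball_vol {..<k} * (d * s ^ (n - k) * ball_vol {k..<n}) / ball_vol {..<n} =
     ball_ratio n k * (d\<^sup>2 * (r ^ k * s ^ (n - k)))"
    by (simp add: ball_ratio_def power2_eq_square)
  finally show ?thesis by (simp add: emeasure_eq_measure)
qed

lemma uball_le_1:
  assumes "n \<ge> 1" shows "AE x in uball n. nrm n x \<le> 1"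
  unfolding uball_def by (rule AE_uniform_measureI) auto

text \<open>
  The maximum of \<open>r\<^sup>k (1 - r\<^sup>2)\<^bsup>(n-k)/2\<^esup>\<close>, attained at \<open>r\<^sup>2 = k / n\<close>.
\<close>

definition peak :: "nat \<Rightarrow> nat \<Rightarrow> real" where
  "peak n k = sqrt (real k / real n) ^ k * sqrt (1 - real k / real n) ^ (n - k)"

text \<open>
  The inequality between weighted arithmetic and geometric means, with weights \<open>k / n\<close> and
  \<open>1 - k / n\<close>.
\<close>

lemma weighted_amgm:
  fixes A B h :: real
  assumes k: "1 \<le> k" "k < n" and AB: "A > 0" "B > 0" "A + B \<le> 1 + h" and h: "h > 0"
  shows "B ^ k * A ^ (n - k) \<le> (real k / real n) ^ k * (1 - real k / real n) ^ (n - k) * (1 + h) ^ n"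
proof -
  define q where "q = real k / real n"
  have q: "0 < q" "q < 1" using k by (auto simp: q_def)
  have lnle: "ln y \<le> ln (1 + h) + (y / (1 + h) - 1)" if "y > 0" for y
  proof -
    have "ln (y / (1 + h)) \<le> y / (1 + h) - 1" using that h by (intro ln_le_minus_one) auto
    then show ?thesis using that h by (simp add: ln_div)
  qed
  have "real k * ln (B / q) + real (n - k) * ln (A / (1 - q)) \<le>
     real k * (ln (1 + h) + (B / q / (1 + h) - 1)) + real (n - k) * (ln (1 + h) + (A / (1 - q) / (1 + h) - 1))"
    using AB q k by (intro add_mono mult_left_mono lnle) auto
  also have "\<dots> = real n * ln (1 + h) + (real k / q * B / (1 + h) + real (n - k) / (1 - q) * A / (1 + h) - real n)"
    using k by (simp add: algebra_simps of_nat_diff)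
  also have "real k / q = real n" unfolding q_def using k by simp
  also have "real (n - k) / (1 - q) = real n" unfolding q_def using k by (simp add: of_nat_diff field_simps)
  also have "real n * B / (1 + h) + real n * A / (1 + h) - real n \<le> 0"
  proof -
    have "real n * (A + B) \<le> real n * (1 + h)" using AB by (intro mult_left_mono) auto
    then have "real n * (A + B) / (1 + h) \<le> real n" using h by (simp add: pos_divide_le_eq)
    moreover have "real n * (A + B) / (1 + h) = real n * B / (1 + h) + real n * A / (1 + h)"
      by (simp add: ring_distribs add_divide_distrib)
    ultimately show ?thesis by simp
  qed
  finally have "real k * ln (B / q) + real (n - k) * ln (A / (1 - q)) \<le> real n * ln (1 + h)" by simp
  then have "exp (real k * ln (B / q) + real (n - k) * ln (A / (1 - q))) \<le> exp (real n * ln (1 + h))" by simp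
  then have "(B / q) ^ k * (A / (1 - q)) ^ (n - k) \<le> (1 + h) ^ n"
    using AB q h k by (simp add: exp_add exp_of_nat_mult del: of_nat_diff)
  then have "(q ^ k * (1 - q) ^ (n - k)) * ((B / q) ^ k * (A / (1 - q)) ^ (n - k)) \<le> (q ^ k * (1 - q) ^ (n - k)) * (1 + h) ^ n"
    using q by (intro mult_left_mono) auto
  moreover have "(q ^ k * (1 - q) ^ (n - k)) * ((B / q) ^ k * (A / (1 - q)) ^ (n - k)) = B ^ k * A ^ (n - k)"
  proof -
    have "q ^ k * (B / q) ^ k = B ^ k" using q by (simp add: power_mult_distrib[symmetric])
    moreover have "(1 - q) ^ (n - k) * (A / (1 - q)) ^ (n - k) = A ^ (n - k)" using q by (simp add: power_mult_distrib[symmetric])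
    ultimately show ?thesis by (metis mult.assoc mult.left_commute)
  qed
  ultimately show ?thesis by (simp add: q_def)
qed

lemma peak_pos: "1 \<le> k \<Longrightarrow> k < n \<Longrightarrow> peak n k > 0"
  by (simp add: peak_def)

text \<open>
  The lower bound for the mass near the peak is at most the total mass \<open>1\<close>.
\<close>

lemma ball_ratio_le:
  assumes k: "1 \<le> k" "k < n" shows "ball_ratio n k * peak n k \<le> 4"
proof -
  interpret prob_space "uball n" by (rule prob_uball) (use k in simp)
  have "ball_ratio n k * ((1/2)\<^sup>2 * (sqrt (real k / real n) ^ k * sqrt (1 - real k / real n) ^ (n - k))) \<le> 1"
    by (rule order_trans[OF uball_lower[OF k, of "sqrt (real k / real n)" "sqrt (1 - real k / real n)" "1/2"] prob_le_1])
      (use k in auto)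
  then show ?thesis by (simp add: peak_def power2_eq_square)
qed

text \<open>
  Cut the ball into \<open>n\<close> slices by the value of \<open>n |(x\<^sub>1, \<dots>, x\<^sub>k)|\<^sup>2\<close>. On each slice the upper
  bound is at most twice that at the peak, as the slices have width \<open>1 / n\<close> and
  \<open>(1 + 1 / n)\<^sup>n \<le> e\<close>; the masses add up to \<open>1\<close>.
\<close>

lemma ball_ratio_ge:
  assumes k: "1 \<le> k" "k < n" shows "1 \<le> ball_ratio n k * (2 * real n * peak n k)"
proof -
  interpret prob_space "uball n" by (rule prob_uball) (use k in simp)
  have n1: "1 \<le> n" using k by simp
  let ?a = "\<lambda>j::nat. sqrt (real j / real n)"
  let ?A = "\<lambda>j::nat. {x. ?a j \<le> nrm k x \<and> nrm k x \<le> ?a (Suc j)}"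
  have "measure (uball n) UNIV \<le> measure (uball n) (\<Union>j<n. ?A j)"
  proof (rule finite_measure_mono_AE)
    show "AE x in uball n. x \<in> UNIV \<longrightarrow> x \<in> (\<Union>j<n. ?A j)"
      using uball_le_1[OF n1]
    proof (eventually_elim)
      case (elim x)
      have le1: "nrm k x \<le> 1" using elim nrm_mono[of k n x] k by simp
      let ?y = "real n * (nrm k x)\<^sup>2"
      have y: "0 \<le> ?y" "?y \<le> real n" using le1 by (auto simp: power_le_one mult_left_le)
      obtain j where j: "j < n" "real j \<le> ?y" "?y \<le> real (Suc j)"
      proof (cases "?y = real n")
        case True
        then show ?thesis using that[of "n - 1"] k by auto
      next
        case False
        then have "?y < real n" using y by simp
        define m where "m = nat \<lfloor>?y\<rfloor>"
        have m: "real m \<le> ?y" "?y \<le> real m + 1" unfolding m_def using y by linarith+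
        then have "m < n" using \<open>?y < real n\<close> by linarith
        then show ?thesis using that[of m] m by simp
      qed
      have "real j / real n \<le> (nrm k x)\<^sup>2" "(nrm k x)\<^sup>2 \<le> real (Suc j) / real n"
        using j k by (auto simp: field_simps)
      then have "x \<in> ?A j"
        by (auto intro!: real_le_lsqrt real_le_rsqrt)
      then show ?case using j by blast
    qed
    show "(\<Union>j<n. ?A j) \<in> sets (uball n)" by measurable
  qed
  also have "\<dots> \<le> (\<Sum>j<n. measure (uball n) (?A j))" by (rule measure_UNION_le) auto
  also have "\<dots> \<le> (\<Sum>j<n. ball_ratio n k * (2 * peak n k))"
  proof (rule sum_mono)
    fix j assume "j \<in> {..<n}"
    then have j: "j < n" by simp
    define A B where "A = 1 - real j / real n" and "B = real (Suc j) / real n"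
    have AB: "A > 0" "B > 0" "A + B \<le> 1 + 1 / real n" using j by (auto simp: A_def B_def field_simps)
    have "measure (uball n) (?A j) \<le> ball_ratio n k * (?a (Suc j) ^ k * sqrt (1 - (?a j)\<^sup>2) ^ (n - k))"
      using j by (intro uball_upper[OF k]) auto
    also have "?a (Suc j) ^ k * sqrt (1 - (?a j)\<^sup>2) ^ (n - k) = sqrt (B ^ k * A ^ (n - k))"
      by (simp add: A_def B_def real_sqrt_mult real_sqrt_power)
    also have "\<dots> \<le> sqrt ((real k / real n) ^ k * (1 - real k / real n) ^ (n - k) * (1 + 1 / real n) ^ n)"
      using weighted_amgm[OF k AB] k by (intro real_sqrt_le_mono) auto
    also have "\<dots> = peak n k * sqrt ((1 + 1 / real n) ^ n)"
      by (simp add: peak_def real_sqrt_mult real_sqrt_power)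
    also have "(1 + 1 / real n) ^ n \<le> exp 1" using exp_ge_one_plus_x_over_n_power_n[of n 1] k by simp
    also have "sqrt (exp 1) \<le> (2::real)" using exp_le by (intro real_le_lsqrt) auto
    finally show "measure (uball n) (?A j) \<le> ball_ratio n k * (2 * peak n k)"
      using ball_ratio_pos[of n k] peak_pos[OF k] by (simp add: mult_left_mono mult.commute)
  qed
  also have "\<dots> = ball_ratio n k * (2 * real n * peak n k)" by simp
  finally show ?thesis using prob_space by simp
qed

section \<open>Large deviations for the radius and the direction\<close>

text \<open>
  Half the entropy of a Bernoulli variable with parameter \<open>l\<close>: the exponential rate of
  \<open>1 / peak n k\<close>.
\<close>

definition ent :: "real \<Rightarrow> real" where
  "ent l = - (l * ln l + (1 - l) * ln (1 - l)) / 2"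

text \<open>
  At \<open>r = 0\<close>, where \<open>log_terms\<close> has a vanishing denominator, the value is the limit for \<open>r\<close>
  decreasing to \<open>0\<close>.
\<close>

definition radius_rate :: "real \<Rightarrow> real \<Rightarrow> ereal" where
  "radius_rate l r = (if r < 0 \<or> 1 < r then \<infinity>
     else if r = 0 then (if l = 0 then 0 else \<infinity>) else log_terms l 1 r)"

lemma log_terms_interior:
  assumes "0 < r" "r < 1" "0 \<le> l" "l \<le> 1"
  shows "log_terms l 1 r = ereal (- (ent l + l * ln r + (1 - l) * ln (1 - r\<^sup>2) / 2))"
proof -
  have r2: "1 - r\<^sup>2 > 0" using assms abs_square_less_1[of r] by simp
  consider "l = 1" | "l = 0" | "0 < l" "l < 1" using assms by linarith
  then show ?thesis
  proof cases
    case 1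
    then show ?thesis using assms by (simp add: log_terms_def ent_def ln_div ln_realpow)
  next
    case 2
    then show ?thesis using assms by (simp add: log_terms_def ent_def)
  next
    case 3
    have "ln (l / r\<^sup>2) = ln l - 2 * ln r" using 3 assms by (simp add: ln_div ln_realpow)
    moreover have "ln ((1 - l) / (1 - r\<^sup>2)) = ln (1 - l) - ln (1 - r\<^sup>2)" using 3 r2 by (simp add: ln_div)
    ultimately have "log_terms l 1 r =
        ereal (l / 2 * (ln l - 2 * ln r) + (1 - l) / 2 * (ln (1 - l) - ln (1 - r\<^sup>2)))"
      using 3 assms by (simp add: log_terms_def)
    then show ?thesis by (simp add: ent_def field_simps)
  qed
qed

text \<open>
  Continuity of \<open>x ln x\<close> up to \<open>0\<close>, where the default \<open>ln 0 = 0\<close> gives the correct limit. The bound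
  \<open>2 sqrt x\<close> for its absolute value is used near \<open>0\<close>.
\<close>

lemma tendsto_mult_ln:
  fixes f :: "nat \<Rightarrow> real"
  assumes f: "f \<longlonglongrightarrow> l" and p: "\<forall>\<^sub>F n in sequentially. 0 < f n"
  shows "(\<lambda>n. f n * ln (f n)) \<longlonglongrightarrow> l * ln l"
proof (cases "l = 0")
  case False
  then show ?thesis using f by (intro tendsto_intros) auto
next
  case True
  have "(\<lambda>n. 2 * sqrt (f n)) \<longlonglongrightarrow> 2 * sqrt 0"
    using f True by (intro tendsto_intros) auto
  then have s: "(\<lambda>n. 2 * sqrt (f n)) \<longlonglongrightarrow> 0" by simp
  have "\<forall>\<^sub>F n in sequentially. f n < 1" using f True by (intro order_tendstoD) auto
  with p have "\<forall>\<^sub>F n in sequentially. \<bar>f n * ln (f n)\<bar> \<le> 2 * sqrt (f n)"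
  proof eventually_elim
    case (elim n)
    define s where "s = sqrt (f n)"
    have s: "s > 0" "f n = s * s" using elim by (auto simp: s_def)
    have "ln (1 / s) \<le> 1 / s - 1" using s by (intro ln_le_minus_one) auto
    then have "- ln s \<le> 1 / s" using s by (simp add: ln_div)
    then have "(2 * s * s) * (- ln s) \<le> (2 * s * s) * (1 / s)" using s by (intro mult_left_mono) auto
    then have "- (f n * ln (f n)) \<le> 2 * s" using s by (simp add: ln_mult)
    moreover have "f n * ln (f n) \<le> 0" using elim by (simp add: mult_nonneg_nonpos)
    ultimately show ?case by (simp add: s_def)
  qed
  then have "\<forall>\<^sub>F n in sequentially. norm (f n * ln (f n)) \<le> 2 * sqrt (f n)" by simp
  then have "(\<lambda>n. f n * ln (f n)) \<longlonglongrightarrow> 0" by (rule Lim_null_comparison[OF _ s])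
  then show ?thesis using True by simp
qed

lemma measure_outside_AE:
  assumes "prob_space P" "sets P = sets borel" "AE x in P. x \<in> {0..1::real}"
  shows "measure P (- {0..1}) = 0"
proof -
  have "AE x in P. x \<notin> - {0..1}" using assms(3) by simp
  then have "emeasure P (- {0..1}) = 0" using assms(2) sets_eq_imp_space_eq[OF assms(2)]
    by (subst (asm) AE_iff_measurable[of "- {0..1}"]) auto
  then show ?thesis by (simp add: measure_def)
qed

lemma partial_norm_01:
  assumes k: "1 \<le> k" "k < n"
  shows "measure (distr (uball n) borel (nrm k)) (- {0..1}) = 0"
proof (rule measure_outside_AE)
  have n: "1 \<le> n" using k by simp
  show "prob_space (distr (uball n) borel (nrm k))" by (rule prob_space.prob_space_distr[OF prob_uball[OF n]]) simp
  have "AE x in uball n. nrm k x \<in> {0..1}"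
    using uball_le_1[OF n] by eventually_elim (use k nrm_mono[of k n] in \<open>auto intro: order_trans\<close>)
  then show "AE y in distr (uball n) borel (nrm k). y \<in> {0..1}" by (subst AE_distr_iff) auto
qed simp

lemma direction_norm_01:
  assumes k: "1 \<le> k" "k < n"
  shows "measure (distr (uball n) borel (\<lambda>x. nrm k x / nrm n x)) (- {0..1}) = 0"
proof (rule measure_outside_AE)
  have n: "1 \<le> n" using k by simp
  show "prob_space (distr (uball n) borel (\<lambda>x. nrm k x / nrm n x))" by (rule prob_space.prob_space_distr[OF prob_uball[OF n]]) simp
  have "nrm k x / nrm n x \<in> {0..1}" for x
    using nrm_mono[of k n x] k by (auto simp: divide_le_eq_1 less_le)
  then show "AE y in distr (uball n) borel (\<lambda>x. nrm k x / nrm n x). y \<in> {0..1}" by (subst AE_distr_iff) auto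
qed simp

context
  fixes k :: "nat \<Rightarrow> nat" and l :: real
  assumes k: "\<forall>\<^sub>F n in sequentially. 1 \<le> k n \<and> k n < n"
    and l: "(\<lambda>n. real (k n) / real n) \<longlonglongrightarrow> l"
begin

lemma limit_fraction: "0 \<le> l" "l \<le> 1"
proof -
  show "0 \<le> l" using l by (rule LIMSEQ_le_const) auto
  have "\<forall>\<^sub>F n in sequentially. real (k n) / real n \<le> 1" using k by eventually_elim auto
  then show "l \<le> 1" by (rule tendsto_upperbound[OF l]) auto
qed

lemma ln_ball_ratio: "(\<lambda>n. ln (ball_ratio n (k n)) / real n) \<longlonglongrightarrow> ent l"
proof (rule tendsto_sandwich)
  define q where "q n = real (k n) / real n" for n
  define p where "p n = - (q n * ln (q n) + (1 - q n) * ln (1 - q n)) / 2" for n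
  have q: "\<forall>\<^sub>F n in sequentially. 0 < q n" "\<forall>\<^sub>F n in sequentially. 0 < 1 - q n"
    using k by (eventually_elim, auto simp: q_def)+
  have "q \<longlonglongrightarrow> l" using l by (simp add: q_def[abs_def])
  then have p: "p \<longlonglongrightarrow> ent l"
    unfolding p_def ent_def using q by (intro tendsto_intros tendsto_mult_ln) auto
  have pk: "\<forall>\<^sub>F n in sequentially. ln (peak n (k n)) = - (real n * p n)"
    using k
  proof eventually_elim
    case (elim n)
    have qn: "0 < q n" "q n < 1" using elim by (auto simp: q_def)
    have "ln (peak n (k n)) = real (k n) * (ln (q n) / 2) + real (n - k n) * (ln (1 - q n) / 2)"
      unfolding peak_def q_def[symmetric] using qn by (simp add: ln_mult ln_realpow ln_sqrt del: of_nat_diff)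
    moreover have "real (k n) = real n * q n" "real (n - k n) = real n * (1 - q n)"
      using elim by (auto simp: q_def of_nat_diff field_simps)
    ultimately have "ln (peak n (k n)) = real n * q n * (ln (q n) / 2) + real n * (1 - q n) * (ln (1 - q n) / 2)"
      by (simp only:)
    then show ?case by (simp add: p_def field_simps)
  qed
  have "(\<lambda>n. p n - ln 2 / real n - ln (real n) / real n) \<longlonglongrightarrow> ent l - 0 - 0"
    by (intro tendsto_diff p lim_const_over_n lim_ln_over_n)
  then show "(\<lambda>n. p n - ln 2 / real n - ln (real n) / real n) \<longlonglongrightarrow> ent l" by simp
  have "(\<lambda>n. p n + ln 4 / real n) \<longlonglongrightarrow> ent l + 0"
    by (intro tendsto_add p lim_const_over_n)
  then show "(\<lambda>n. p n + ln 4 / real n) \<longlonglongrightarrow> ent l" by simp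
  show "\<forall>\<^sub>F n in sequentially. p n - ln 2 / real n - ln (real n) / real n \<le> ln (ball_ratio n (k n)) / real n"
    using k pk
  proof eventually_elim
    case (elim n)
    have k': "1 \<le> k n" "k n < n" using elim by auto
    have "ln 1 \<le> ln (ball_ratio n (k n) * (2 * real n * peak n (k n)))"
      using ball_ratio_ge[OF k'] ball_ratio_pos[of n "k n"] peak_pos[OF k'] k'
      by (subst ln_le_cancel_iff) auto
    then have "real n * p n \<le> ln (ball_ratio n (k n)) + ln 2 + ln (real n)"
      using ball_ratio_pos[of n "k n"] peak_pos[OF k'] k' elim by (simp add: ln_mult)
    then have "real n * p n / real n \<le> (ln (ball_ratio n (k n)) + ln 2 + ln (real n)) / real n"
      by (rule divide_right_mono) simp
    then show ?case using k' by (simp add: add_divide_distrib)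
  qed
  show "\<forall>\<^sub>F n in sequentially. ln (ball_ratio n (k n)) / real n \<le> p n + ln 4 / real n"
    using k pk
  proof eventually_elim
    case (elim n)
    have k': "1 \<le> k n" "k n < n" using elim by auto
    have "ln (ball_ratio n (k n) * peak n (k n)) \<le> ln 4"
      using ball_ratio_le[OF k'] ball_ratio_pos[of n "k n"] peak_pos[OF k'] by (subst ln_le_cancel_iff) auto
    then have "ln (ball_ratio n (k n)) \<le> real n * p n + ln 4"
      using ball_ratio_pos[of n "k n"] peak_pos[OF k'] k' elim by (simp add: ln_mult)
    then have "ln (ball_ratio n (k n)) / real n \<le> (real n * p n + ln 4) / real n"
      by (rule divide_right_mono) simp
    then show ?case using k' by (simp add: add_divide_distrib)
  qed
qed

lemma radius_asymptotics:
  assumes "c > 0" "b > 0" "w > 0"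
  obtains F where "F \<longlonglongrightarrow> ent l + l * ln b + (1 - l) * ln w / 2"
    "\<forall>\<^sub>F n in sequentially. c * (ball_ratio n (k n) * (b ^ k n * sqrt w ^ (n - k n))) = exp (real n * F n)"
proof
  let ?F = "\<lambda>n. ln c / real n + ln (ball_ratio n (k n)) / real n + real (k n) / real n * ln b + (1 - real (k n) / real n) * ln w / 2"
  have "?F \<longlonglongrightarrow> 0 + ent l + l * ln b + (1 - l) * ln w / 2"
    by (intro tendsto_intros lim_const_over_n ln_ball_ratio l) auto
  then show "?F \<longlonglongrightarrow> ent l + l * ln b + (1 - l) * ln w / 2" by simp
  show "\<forall>\<^sub>F n in sequentially. c * (ball_ratio n (k n) * (b ^ k n * sqrt w ^ (n - k n))) = exp (real n * ?F n)"
    using k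
  proof eventually_elim
    case (elim n)
    have "real n * ?F n = ln c + (ln (ball_ratio n (k n)) + (real (k n) * ln b + (real n - real (k n)) * (ln w / 2)))"
      using elim by (simp add: field_simps)
    also have "real n - real (k n) = real (n - k n)" using elim by simp
    also have "ln w / 2 = ln (sqrt w)" using assms by (simp add: ln_sqrt)
    finally show ?case
      using assms ball_ratio_pos[of n "k n"] by (simp add: exp_add exp_of_nat_mult del: of_nat_diff)
  qed
qed

lemma radius_upper_exp:
  assumes "c > 0" "b > 0" "w > 0" "ent l + l * ln b + (1 - l) * ln w / 2 < - a"
  shows "\<forall>\<^sub>F n in sequentially. c * (ball_ratio n (k n) * (b ^ k n * sqrt w ^ (n - k n))) \<le> exp (- real n * a)"
proof -
  obtain F where F: "F \<longlonglongrightarrow> ent l + l * ln b + (1 - l) * ln w / 2"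
    "\<forall>\<^sub>F n in sequentially. c * (ball_ratio n (k n) * (b ^ k n * sqrt w ^ (n - k n))) = exp (real n * F n)"
    using radius_asymptotics[OF assms(1-3)] .
  have "\<forall>\<^sub>F n in sequentially. F n < - a" using F(1) assms(4) by (rule order_tendstoD)
  with F(2) show ?thesis
  proof eventually_elim
    case (elim n)
    have "real n * F n \<le> real n * (- a)" using elim by (intro mult_left_mono) auto
    then show ?case using elim by simp
  qed
qed

lemma radius_lower_exp:
  assumes "c > 0" "b > 0" "w > 0" "- a < ent l + l * ln b + (1 - l) * ln w / 2"
  shows "\<forall>\<^sub>F n in sequentially. exp (- real n * a) \<le> c * (ball_ratio n (k n) * (b ^ k n * sqrt w ^ (n - k n)))"
proof -
  obtain F where F: "F \<longlonglongrightarrow> ent l + l * ln b + (1 - l) * ln w / 2"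
    "\<forall>\<^sub>F n in sequentially. c * (ball_ratio n (k n) * (b ^ k n * sqrt w ^ (n - k n))) = exp (real n * F n)"
    using radius_asymptotics[OF assms(1-3)] .
  have "\<forall>\<^sub>F n in sequentially. - a < F n" using F(1) assms(4) by (rule order_tendstoD)
  with F(2) show ?thesis
  proof eventually_elim
    case (elim n)
    have "real n * (- a) \<le> real n * F n" using elim by (intro mult_left_mono) auto
    then show ?case using elim by simp
  qed
qed

text \<open>
  The bound for a window \<open>[t, b]\<close> around \<open>x\<close>. The alternatives \<open>t = 0\<close> and \<open>b = 1\<close> stand for windows
  that reach the end of \<open>[0, 1]\<close>. At an end with infinite rate the window is chosen so short
  that one of the factors becomes small enough: \<open>b\<close> if \<open>x = 0\<close>, and \<open>1 - t\<^sup>2\<close> if \<open>x = 1\<close>.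
\<close>

lemma radius_window:
  assumes x: "0 \<le> x" "x \<le> 1" and a: "ereal a < radius_rate l x"
  shows "a < 0 \<or> (\<exists>t b e. 0 \<le> t \<and> t < 1 \<and> 0 < b \<and> 0 < e \<and> (t = 0 \<or> t < x - e) \<and> (b = 1 \<or> x + e \<le> b) \<and>
     ent l + l * ln b + (1 - l) * ln (1 - t\<^sup>2) / 2 < - a)"
proof -
  note l01 = limit_fraction
  consider "x = 0" "l = 0" | "x = 0" "l > 0" | "x = 1" "l = 1" | "x = 1" "l < 1" | "0 < x" "x < 1"
    using x l01 by linarith
  then show ?thesis
  proof cases
    case 1 then show ?thesis using a by (simp add: radius_rate_def)
  next
    case 3 then show ?thesis using a by (simp add: radius_rate_def log_terms_def)
  next
    case 2
    define b where "b = exp ((- a - ent l - 1) / l)"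
    have "ent l + l * ln b + (1 - l) * ln (1 - 0\<^sup>2) / 2 < - a" using 2 by (simp add: b_def)
    moreover have "b > 0" "x + b \<le> b" using 2 by (auto simp: b_def)
    ultimately show ?thesis by (intro disjI2 exI[of _ 0] exI[of _ b]) auto
  next
    case 4
    define w where "w = min (1/2) (exp (2 * (- a - ent l - 1) / (1 - l)))"
    have "0 < w" "w \<le> 1 / 2" unfolding w_def by (simp_all only: min_less_iff_conj) auto
    then have w: "0 < w" "w < 1" by auto
    have "ln w \<le> ln (exp (2 * (- a - ent l - 1) / (1 - l)))"
      using w by (subst ln_le_cancel_iff) (auto simp: w_def)
    then have "(1 - l) * ln w \<le> (1 - l) * (2 * (- a - ent l - 1) / (1 - l))" using 4 by (intro mult_left_mono) auto
    then have lw: "(1 - l) * ln w / 2 \<le> - a - ent l - 1" using 4 by simp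
    define t where "t = sqrt (1 - w)"
    have t: "0 \<le> t" "t < 1" "1 - t\<^sup>2 = w" using w by (auto simp: t_def)
    have "ent l + l * ln 1 + (1 - l) * ln (1 - t\<^sup>2) / 2 < - a" using lw t by simp
    moreover have "t < x - (1 - t) / 2" "(1 - t) / 2 > 0" using t(2) 4(1) by (simp_all add: field_simps)
    ultimately show ?thesis using t by (intro disjI2 exI[of _ t] exI[of _ 1] exI[of _ "(1 - t) / 2"]) auto
  next
    case 5
    have x2: "1 - x\<^sup>2 > 0" using 5 abs_square_less_1[of x] by simp
    have lim: "((\<lambda>h. ent l + l * ln (x + h) + (1 - l) * ln (1 - (x - h)\<^sup>2) / 2) \<longlongrightarrow>
       ent l + l * ln (x + 0) + (1 - l) * ln (1 - (x - 0)\<^sup>2) / 2) (at_right 0)"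
      using 5 x2 by (intro tendsto_intros) auto
    have lt: "ent l + l * ln (x + 0) + (1 - l) * ln (1 - (x - 0)\<^sup>2) / 2 < - a"
      using a 5 l01 by (simp add: radius_rate_def log_terms_interior)
    have "\<forall>\<^sub>F h in at_right 0. ent l + l * ln (x + h) + (1 - l) * ln (1 - (x - h)\<^sup>2) / 2 < - a"
      using lim lt by (rule order_tendstoD)
    moreover have "\<forall>\<^sub>F h in at_right 0. 0 < h \<and> h < x"
      unfolding eventually_at_right_field using 5 by (intro exI[of _ x]) auto
    ultimately have "\<forall>\<^sub>F h in at_right 0. 0 < h \<and> h < x \<and> ent l + l * ln (x + h) + (1 - l) * ln (1 - (x - h)\<^sup>2) / 2 < - a"
      by eventually_elim auto
    from eventually_happens'[OF trivial_limit_at_right_real this]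
    obtain h where h: "0 < h" "h < x" "ent l + l * ln (x + h) + (1 - l) * ln (1 - (x - h)\<^sup>2) / 2 < - a"
      by blast
    show ?thesis
      by (intro disjI2 exI[of _ "x - h"] exI[of _ "x + h"] exI[of _ "h / 2"] conjI) (use h 5 in simp_all)
  qed
qed

text \<open>
  The two laws to be treated satisfy the same bounds up to a constant and up to factors \<open>1 - d\<close>
  with \<open>d\<close> arbitrarily small, and this determines the exponential rate.
\<close>

lemma local_ldp_radius:
  fixes \<sigma> :: "nat \<Rightarrow> real measure"
  assumes prob: "\<forall>\<^sub>F n in sequentially. prob_space (\<sigma> n) \<and> sets (\<sigma> n) = sets borel"
    and supp: "\<forall>\<^sub>F n in sequentially. measure (\<sigma> n) (- {0..1}) = 0"
    and upper: "\<And>d. 0 < d \<Longrightarrow> d < 1 \<Longrightarrow> \<exists>C>0. \<forall>\<^sub>F n in sequentially. \<forall>a b. 0 \<le> a \<and> a < 1 \<and> 0 < b \<longrightarrow>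
       measure (\<sigma> n) {a..b} \<le> C * (ball_ratio n (k n) * (b ^ k n * sqrt (1 - (a * (1 - d))\<^sup>2) ^ (n - k n)))"
    and lower: "\<And>d r. 0 < d \<Longrightarrow> d < 1 \<Longrightarrow> 0 < r \<Longrightarrow> r < 1 \<Longrightarrow> \<exists>c>0. \<forall>\<^sub>F n in sequentially.
       c * (ball_ratio n (k n) * (r ^ k n * sqrt (1 - r\<^sup>2) ^ (n - k n))) \<le> measure (\<sigma> n) {r * (1 - d)..r / (1 - d)}"
  shows "local_ldp \<sigma> (radius_rate l)"
  unfolding local_ldp_def
proof (intro conjI allI impI prob)
  note l01 = limit_fraction
  fix x a assume a: "ereal a < radius_rate l x"
  show "\<exists>e>0. \<forall>\<^sub>F n in sequentially. measure (\<sigma> n) (ball x e) \<le> exp (- real n * a)"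
  proof (cases "0 \<le> x \<and> x \<le> 1")
    case False
    then have "x \<notin> {0..1}" by auto
    then obtain e where e: "e > 0" "ball x e \<subseteq> - {0..1}"
      by (meson ComplI closed_atLeastAtMost open_Compl openE)
    have "\<forall>\<^sub>F n in sequentially. measure (\<sigma> n) (ball x e) \<le> exp (- real n * a)"
      using prob supp
    proof eventually_elim
      case (elim n)
      interpret prob_space "\<sigma> n" using elim by simp
      have "measure (\<sigma> n) (ball x e) \<le> measure (\<sigma> n) (- {0..1})"
        using e elim by (intro finite_measure_mono) auto
      then show ?case using elim by (auto intro: order_trans)
    qed
    then show ?thesis using e by blast
  next
    case True
    then consider "a < 0" | t b e where "0 \<le> t" "t < 1" "0 < b" "0 < e" "t = 0 \<or> t < x - e" "b = 1 \<or> x + e \<le> b"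
        "ent l + l * ln b + (1 - l) * ln (1 - t\<^sup>2) / 2 < - a"
      using radius_window[OF _ _ a] by blast
    then show ?thesis
    proof cases
      case 1
      have "\<forall>\<^sub>F n in sequentially. measure (\<sigma> n) (ball x 1) \<le> exp (- real n * a)"
        using prob
      proof eventually_elim
        case (elim n)
        have "measure (\<sigma> n) (ball x 1) \<le> 1" using elim prob_space.prob_le_1 by blast
        also have "\<dots> \<le> exp (- real n * a)" using 1 by (simp add: mult_nonneg_nonpos)
        finally show ?case .
      qed
      then show ?thesis by (intro exI[of _ 1]) auto
    next
      case 2
      define s where "s = (if t = 0 then 0 else x - e)"
      define d where "d = (if t = 0 then 1 / 2 else 1 - t / s)"
      have s: "0 \<le> s" "s < 1" using 2 True by (auto simp: s_def)
      have d: "0 < d" "d < 1" "s * (1 - d) = t" using 2 s by (auto simp: d_def s_def field_simps)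
      have w: "1 - t\<^sup>2 > 0" using 2 abs_square_less_1[of t] by simp
      obtain C where C: "C > 0" "\<forall>\<^sub>F n in sequentially. \<forall>a b. 0 \<le> a \<and> a < 1 \<and> 0 < b \<longrightarrow>
         measure (\<sigma> n) {a..b} \<le> C * (ball_ratio n (k n) * (b ^ k n * sqrt (1 - (a * (1 - d))\<^sup>2) ^ (n - k n)))"
        using upper[OF d(1,2)] by blast
      have "\<forall>\<^sub>F n in sequentially. measure (\<sigma> n) (ball x e) \<le> exp (- real n * a)"
        using C(2) radius_upper_exp[OF C(1) 2(3) w 2(7)] prob supp
      proof eventually_elim
        case (elim n)
        interpret prob_space "\<sigma> n" using elim by simp
        have "measure (\<sigma> n) (ball x e) \<le> measure (\<sigma> n) ({s..b} \<union> - {0..1})"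
        proof (rule finite_measure_mono)
          show "ball x e \<subseteq> {s..b} \<union> - {0..1}"
            using 2 by (auto simp: s_def dist_real_def abs_less_iff)
        qed (use elim in auto)
        also have "\<dots> \<le> measure (\<sigma> n) {s..b} + measure (\<sigma> n) (- {0..1})"
          using elim by (intro measure_Un_le) auto
        also have "\<dots> = measure (\<sigma> n) {s..b}" using elim by simp
        also have "\<dots> \<le> C * (ball_ratio n (k n) * (b ^ k n * sqrt (1 - t\<^sup>2) ^ (n - k n)))"
          using elim(1) s 2 unfolding d(3)[symmetric] by blast
        finally show ?case using elim by simp
      qed
      then show ?thesis using 2 by blast
    qed
  qed
next
  note l01 = limit_fraction
  have inner: "\<forall>\<^sub>F n in sequentially. exp (- real n * a) \<le> measure (\<sigma> n) (ball x e)"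
    if x: "0 < x" "x < 1" and a: "radius_rate l x < ereal a" and e: "e > 0" for x a e
  proof -
    have w: "1 - x\<^sup>2 > 0" using x abs_square_less_1[of x] by simp
    define d where "d = (e / 2) / (x + e)"
    have d: "0 < d" "d < 1" using x e by (auto simp: d_def pos_divide_less_eq)
    have "x * d < (x + e) * d" using d(1) e by simp
    moreover have "(x + e) * d = e / 2" using x e d_def nonzero_eq_divide_eq[of "x + e" d "e / 2"] by (simp add: mult.commute)
    ultimately have "x * d < (x + e) * d" "(x + e) * d = e / 2" by auto
    then have d1: "x * (1 - d) > x - e" "x < (x + e) * (1 - d)" using e by (simp_all add: ring_distribs)
    then have d2: "x / (1 - d) < x + e" using d d1 by (simp add: pos_divide_less_eq)
    obtain c where c: "c > 0" "\<forall>\<^sub>F n in sequentially.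
       c * (ball_ratio n (k n) * (x ^ k n * sqrt (1 - x\<^sup>2) ^ (n - k n))) \<le> measure (\<sigma> n) {x * (1 - d)..x / (1 - d)}"
      using lower[OF d x] by blast
    have "- a < ent l + l * ln x + (1 - l) * ln (1 - x\<^sup>2) / 2"
      using a x l01 by (simp add: radius_rate_def log_terms_interior)
    from radius_lower_exp[OF c(1) x(1) w this] c(2) prob show ?thesis
    proof eventually_elim
      case (elim n)
      interpret prob_space "\<sigma> n" using elim by simp
      have "measure (\<sigma> n) {x * (1 - d)..x / (1 - d)} \<le> measure (\<sigma> n) (ball x e)"
        using d1 d2 elim by (intro finite_measure_mono) (auto simp: dist_real_def)
      then show ?case using elim by simp
    qed
  qed
  \<comment> \<open>At an end with rate 0 the ball contains a ball around an interior point of rate close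
    to 0.\<close>
  have border: "\<forall>\<^sub>F n in sequentially. exp (- real n * a) \<le> measure (\<sigma> n) (ball x e)"
    if F: "F \<noteq> bot" "\<forall>\<^sub>F r in F. 0 < r \<and> r < 1 \<and> dist x r < e"
      "((\<lambda>r. ent l + l * ln r + (1 - l) * ln (1 - r\<^sup>2) / 2) \<longlongrightarrow> 0) F" and a: "a > 0" for F x a e
  proof -
    have "\<forall>\<^sub>F r in F. - a < ent l + l * ln r + (1 - l) * ln (1 - r\<^sup>2) / 2"
      using F(3) a by (intro order_tendstoD) auto
    with F(2) have "\<forall>\<^sub>F r in F. 0 < r \<and> r < 1 \<and> dist x r < e \<and> - a < ent l + l * ln r + (1 - l) * ln (1 - r\<^sup>2) / 2"
      by eventually_elim auto
    then obtain r where r: "0 < r" "r < 1" "dist x r < e" "- a < ent l + l * ln r + (1 - l) * ln (1 - r\<^sup>2) / 2"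
      using eventually_happens'[OF F(1)] by blast
    have "radius_rate l r < ereal a" using r l01 by (simp add: radius_rate_def log_terms_interior)
    moreover have "e - dist x r > 0" using r by simp
    ultimately have "\<forall>\<^sub>F n in sequentially. exp (- real n * a) \<le> measure (\<sigma> n) (ball r (e - dist x r))"
      using inner r by blast
    with prob show ?thesis
    proof eventually_elim
      case (elim n)
      interpret prob_space "\<sigma> n" using elim by simp
      have "ball r (e - dist x r) \<subseteq> ball x e"
      proof
        fix y assume "y \<in> ball r (e - dist x r)"
        then show "y \<in> ball x e" using dist_triangle[of x y r] by simp
      qed
      then have "measure (\<sigma> n) (ball r (e - dist x r)) \<le> measure (\<sigma> n) (ball x e)"
        using elim by (intro finite_measure_mono) auto
      then show ?case using elim by simp
    qed
  qed
  fix x a e :: real assume a: "radius_rate l x < ereal a" and e: "e > 0"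
  then have x: "0 \<le> x" "x \<le> 1" by (auto simp: radius_rate_def split: if_splits)
  consider "0 < x \<and> x < 1" | "x = 0" | "x = 1" using x by linarith
  then show "\<forall>\<^sub>F n in sequentially. exp (- real n * a) \<le> measure (\<sigma> n) (ball x e)"
  proof cases
    case 1 then show ?thesis using inner a e by blast
  next
    case 2
    then have l: "l = 0" "a > 0" using a by (auto simp: radius_rate_def split: if_splits)
    show ?thesis
    proof (rule border[of "at_right 0"])
      show "\<forall>\<^sub>F r in at_right 0. 0 < r \<and> r < 1 \<and> dist x r < e"
        unfolding eventually_at_right_field using 2 e by (intro exI[of _ "min 1 e"]) (auto simp: dist_real_def)
      have "((\<lambda>r. ln (1 - r\<^sup>2) / 2) \<longlongrightarrow> ln (1 - 0\<^sup>2) / 2) (at_right (0::real))"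
        by (intro tendsto_intros) auto
      then show "((\<lambda>r. ent l + l * ln r + (1 - l) * ln (1 - r\<^sup>2) / 2) \<longlongrightarrow> 0) (at_right 0)"
        by (simp add: l ent_def)
    qed (use l in auto)
  next
    case 3
    have "l = 1" using a 3 by (auto simp: radius_rate_def log_terms_def split: if_splits)
    then have l: "l = 1" "a > 0" using a 3 by (auto simp: radius_rate_def log_terms_def split: if_splits)
    show ?thesis
    proof (rule border[of "at_left 1"])
      show "\<forall>\<^sub>F r in at_left 1. 0 < r \<and> r < 1 \<and> dist x r < e"
        unfolding eventually_at_left_field using 3 e by (intro exI[of _ "max 0 (1 - e)"]) (auto simp: dist_real_def)
      have "((\<lambda>r. ln r) \<longlongrightarrow> ln 1) (at_left (1::real))"
        by (intro tendsto_intros) auto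
      then show "((\<lambda>r. ent l + l * ln r + (1 - l) * ln (1 - r\<^sup>2) / 2) \<longlongrightarrow> 0) (at_left 1)"
        by (simp add: l ent_def)
    qed (use l in auto)
  qed
qed

lemma local_ldp_partial_norm: "local_ldp (\<lambda>n. distr (uball n) borel (nrm (k n))) (radius_rate l)"
proof (rule local_ldp_radius)
  show "\<forall>\<^sub>F n in sequentially. prob_space (distr (uball n) borel (nrm (k n))) \<and> sets (distr (uball n) borel (nrm (k n))) = sets borel"
    using k by eventually_elim (auto intro!: prob_space.prob_space_distr prob_uball)
  show "\<forall>\<^sub>F n in sequentially. measure (distr (uball n) borel (nrm (k n))) (- {0..1}) = 0"
    using k by eventually_elim (rule partial_norm_01, auto)
  have d: "measure (distr (uball n) borel (nrm (k n))) {a..b} = measure (uball n) {x. a \<le> nrm (k n) x \<and> nrm (k n) x \<le> b}" for n a b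
    by (subst measure_distr) (auto intro!: arg_cong2[where f=measure])
  fix d :: real assume dd: "0 < d" "d < 1"
  show "\<exists>C>0. \<forall>\<^sub>F n in sequentially. \<forall>a b. 0 \<le> a \<and> a < 1 \<and> 0 < b \<longrightarrow>
       measure (distr (uball n) borel (nrm (k n))) {a..b} \<le> C * (ball_ratio n (k n) * (b ^ k n * sqrt (1 - (a * (1 - d))\<^sup>2) ^ (n - k n)))"
  proof (intro exI[of _ 1] conjI)
    show "\<forall>\<^sub>F n in sequentially. \<forall>a b. 0 \<le> a \<and> a < 1 \<and> 0 < b \<longrightarrow>
       measure (distr (uball n) borel (nrm (k n))) {a..b} \<le> 1 * (ball_ratio n (k n) * (b ^ k n * sqrt (1 - (a * (1 - d))\<^sup>2) ^ (n - k n)))"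
      using k
    proof (eventually_elim, intro allI impI)
      fix n and a b :: real assume kn: "1 \<le> k n \<and> k n < n" and ab: "0 \<le> a \<and> a < 1 \<and> 0 < b"
      have "measure (distr (uball n) borel (nrm (k n))) {a..b} \<le> ball_ratio n (k n) * (b ^ k n * sqrt (1 - a\<^sup>2) ^ (n - k n))"
        unfolding d using kn ab by (intro uball_upper) auto
      also have "\<dots> \<le> ball_ratio n (k n) * (b ^ k n * sqrt (1 - (a * (1 - d))\<^sup>2) ^ (n - k n))"
      proof (intro mult_left_mono)
        have "(a * (1 - d))\<^sup>2 \<le> a\<^sup>2" using ab dd by (intro power_mono mult_left_le) auto
        then show "sqrt (1 - a\<^sup>2) ^ (n - k n) \<le> sqrt (1 - (a * (1 - d))\<^sup>2) ^ (n - k n)"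
          using ab abs_square_le_1[of a] by (intro power_mono) auto
      qed (use ab ball_ratio_pos[of n "k n"] in auto)
      finally show "measure (distr (uball n) borel (nrm (k n))) {a..b} \<le> 1 * (ball_ratio n (k n) * (b ^ k n * sqrt (1 - (a * (1 - d))\<^sup>2) ^ (n - k n)))"
        by simp
    qed
  qed simp
  fix r :: real assume r: "0 < r" "r < 1"
  show "\<exists>c>0. \<forall>\<^sub>F n in sequentially.
       c * (ball_ratio n (k n) * (r ^ k n * sqrt (1 - r\<^sup>2) ^ (n - k n))) \<le> measure (distr (uball n) borel (nrm (k n))) {r * (1 - d)..r / (1 - d)}"
  proof (intro exI[of _ "d\<^sup>2"] conjI)
    show "\<forall>\<^sub>F n in sequentially. d\<^sup>2 * (ball_ratio n (k n) * (r ^ k n * sqrt (1 - r\<^sup>2) ^ (n - k n))) \<le> measure (distr (uball n) borel (nrm (k n))) {r * (1 - d)..r / (1 - d)}"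
      using k
    proof eventually_elim
      case (elim n)
      interpret prob_space "uball n" by (rule prob_uball) (use elim in simp)
      have w: "1 - r\<^sup>2 > 0" using r abs_square_less_1[of r] by simp
      have "r \<le> r / (1 - d)" using r dd by (simp add: pos_le_divide_eq)
      have "ball_ratio n (k n) * (d\<^sup>2 * (r ^ k n * sqrt (1 - r\<^sup>2) ^ (n - k n))) \<le> measure (uball n) {x. r * (1 - d) < nrm (k n) x \<and> nrm (k n) x \<le> r \<and>
        (sqrt (1 - r\<^sup>2) * (1 - d))\<^sup>2 < (nrm n x)\<^sup>2 - (nrm (k n) x)\<^sup>2 \<and> (nrm n x)\<^sup>2 - (nrm (k n) x)\<^sup>2 \<le> (sqrt (1 - r\<^sup>2))\<^sup>2}"
        using elim r w dd by (intro uball_lower) auto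
      also have "\<dots> \<le> measure (uball n) {x. r * (1 - d) \<le> nrm (k n) x \<and> nrm (k n) x \<le> r / (1 - d)}"
        using \<open>r \<le> r / (1 - d)\<close> by (intro finite_measure_mono) auto
      finally show ?case unfolding d by (simp add: mult.left_commute)
    qed
  qed (use dd in simp)
qed

lemma local_ldp_direction_norm: "local_ldp (\<lambda>n. distr (uball n) borel (\<lambda>x. nrm (k n) x / nrm n x)) (radius_rate l)"
proof (rule local_ldp_radius)
  let ?R = "\<lambda>n x. nrm (k n) x / nrm n x"
  show "\<forall>\<^sub>F n in sequentially. prob_space (distr (uball n) borel (?R n)) \<and> sets (distr (uball n) borel (?R n)) = sets borel"
    using k by eventually_elim (auto intro!: prob_space.prob_space_distr prob_uball)
  show "\<forall>\<^sub>F n in sequentially. measure (distr (uball n) borel (?R n)) (- {0..1}) = 0"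
    using k by eventually_elim (rule direction_norm_01, auto)
  have d: "measure (distr (uball n) borel (?R n)) {a..b} = measure (uball n) {x. a \<le> ?R n x \<and> ?R n x \<le> b}" for n a b
    by (subst measure_distr) (auto intro!: arg_cong2[where f=measure])
  fix d :: real assume dd: "0 < d" "d < 1"
  show "\<exists>C>0. \<forall>\<^sub>F n in sequentially. \<forall>a b. 0 \<le> a \<and> a < 1 \<and> 0 < b \<longrightarrow>
       measure (distr (uball n) borel (?R n)) {a..b} \<le> C * (ball_ratio n (k n) * (b ^ k n * sqrt (1 - (a * (1 - d))\<^sup>2) ^ (n - k n)))"
  proof (intro exI[of _ "1 / d"] conjI)
    show "\<forall>\<^sub>F n in sequentially. \<forall>a b. 0 \<le> a \<and> a < 1 \<and> 0 < b \<longrightarrow>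
       measure (distr (uball n) borel (?R n)) {a..b} \<le> 1 / d * (ball_ratio n (k n) * (b ^ k n * sqrt (1 - (a * (1 - d))\<^sup>2) ^ (n - k n)))"
      using k
    proof (eventually_elim, intro allI impI)
      fix n and a b :: real assume kn: "1 \<le> k n \<and> k n < n" and ab: "0 \<le> a \<and> a < 1 \<and> 0 < b"
      interpret prob_space "uball n" by (rule prob_uball) (use kn in simp)
      interpret g: gauge n "nrm n" by (rule gauge_nrm) (use kn in simp)
      have gU: "g.U = uball n" by (simp add: g.U_def uball_def)
      let ?C = "{x. a \<le> ?R n x \<and> ?R n x \<le> b}"
      \<comment> \<open>Since C is a cone, its part with norm above \<open>1 - d\<close> carries at least the fraction d
        of its mass. There the ratio and the partial norm agree up to a factor \<open>1 - d\<close>.\<close>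
      have "measure (uball n) {x\<in>?C. nrm n x \<le> 1 - d} = clip (1 - d) ^ n * measure (uball n) ?C"
        unfolding gU[symmetric] by (rule g.cone_cdf) (auto simp: nrm_scale)
      also have "\<dots> \<le> (1 - d) ^ 1 * measure (uball n) ?C"
        using dd kn by (intro mult_right_mono) (auto simp: clip_def intro!: power_le_one_iff[THEN iffD2] power_decreasing[of 1 n "1 - d", simplified])
      finally have "d * measure (uball n) ?C \<le> measure (uball n) ?C - measure (uball n) {x\<in>?C. nrm n x \<le> 1 - d}"
        by (simp add: algebra_simps)
      also have "\<dots> = measure (uball n) (?C - {x\<in>?C. nrm n x \<le> 1 - d})"
        by (rule finite_measure_Diff[symmetric]) auto
      also have "\<dots> \<le> measure (uball n) {x. a * (1 - d) \<le> nrm (k n) x \<and> nrm (k n) x \<le> b}"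
      proof (rule finite_measure_mono_AE)
        show "AE x in uball n. x \<in> ?C - {x\<in>?C. nrm n x \<le> 1 - d} \<longrightarrow> x \<in> {x. a * (1 - d) \<le> nrm (k n) x \<and> nrm (k n) x \<le> b}"
        proof -
          have "1 \<le> n" using kn by simp
          from uball_le_1[OF this] show ?thesis
          proof (eventually_elim, intro impI)
            fix x assume x1: "nrm n x \<le> 1" and x: "x \<in> ?C - {x\<in>?C. nrm n x \<le> 1 - d}"
            then have nx: "1 - d < nrm n x" by auto
            then have n0: "0 < nrm n x" using dd by simp
            have "a * nrm n x \<le> nrm (k n) x" "nrm (k n) x \<le> b * nrm n x"
              using x n0 by (auto simp: field_simps)
            moreover have "a * (1 - d) \<le> a * nrm n x" using ab nx by (intro mult_left_mono) auto
            moreover have "b * nrm n x \<le> b * 1" using ab x1 by (intro mult_left_mono) auto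
            ultimately show "x \<in> {x. a * (1 - d) \<le> nrm (k n) x \<and> nrm (k n) x \<le> b}" by simp
          qed
        qed
      qed auto
      also have "\<dots> \<le> ball_ratio n (k n) * (b ^ k n * sqrt (1 - (a * (1 - d))\<^sup>2) ^ (n - k n))"
      proof (intro uball_upper)
        have "a * (1 - d) \<le> a" using ab dd by (intro mult_left_le) auto
        then show "a * (1 - d) < 1" using ab by simp
      qed (use kn ab dd in auto)
      finally show "measure (distr (uball n) borel (?R n)) {a..b} \<le> 1 / d * (ball_ratio n (k n) * (b ^ k n * sqrt (1 - (a * (1 - d))\<^sup>2) ^ (n - k n)))"
        unfolding d using dd by (simp add: field_simps)
    qed
  qed (use dd in simp)
  fix r :: real assume r: "0 < r" "r < 1"
  show "\<exists>c>0. \<forall>\<^sub>F n in sequentially.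
       c * (ball_ratio n (k n) * (r ^ k n * sqrt (1 - r\<^sup>2) ^ (n - k n))) \<le> measure (distr (uball n) borel (?R n)) {r * (1 - d)..r / (1 - d)}"
  proof (intro exI[of _ "d\<^sup>2"] conjI)
    show "\<forall>\<^sub>F n in sequentially. d\<^sup>2 * (ball_ratio n (k n) * (r ^ k n * sqrt (1 - r\<^sup>2) ^ (n - k n))) \<le> measure (distr (uball n) borel (?R n)) {r * (1 - d)..r / (1 - d)}"
      using k
    proof eventually_elim
      case (elim n)
      interpret prob_space "uball n" by (rule prob_uball) (use elim in simp)
      have w: "1 - r\<^sup>2 > 0" using r abs_square_less_1[of r] by simp
      let ?s = "sqrt (1 - r\<^sup>2)"
      have "ball_ratio n (k n) * (d\<^sup>2 * (r ^ k n * ?s ^ (n - k n))) \<le> measure (uball n) {x. r * (1 - d) < nrm (k n) x \<and> nrm (k n) x \<le> r \<and>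
        (?s * (1 - d))\<^sup>2 < (nrm n x)\<^sup>2 - (nrm (k n) x)\<^sup>2 \<and> (nrm n x)\<^sup>2 - (nrm (k n) x)\<^sup>2 \<le> ?s\<^sup>2}"
        using elim r w dd by (intro uball_lower) auto
      also have "\<dots> \<le> measure (uball n) {x. r * (1 - d) \<le> ?R n x \<and> ?R n x \<le> r / (1 - d)}"
      proof (rule finite_measure_mono)
        show "{x. r * (1 - d) < nrm (k n) x \<and> nrm (k n) x \<le> r \<and>
          (?s * (1 - d))\<^sup>2 < (nrm n x)\<^sup>2 - (nrm (k n) x)\<^sup>2 \<and> (nrm n x)\<^sup>2 - (nrm (k n) x)\<^sup>2 \<le> ?s\<^sup>2} \<subseteq>
          {x. r * (1 - d) \<le> ?R n x \<and> ?R n x \<le> r / (1 - d)}"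
        proof safe
          fix x assume x: "r * (1 - d) < nrm (k n) x" "nrm (k n) x \<le> r"
            "(?s * (1 - d))\<^sup>2 < (nrm n x)\<^sup>2 - (nrm (k n) x)\<^sup>2" "(nrm n x)\<^sup>2 - (nrm (k n) x)\<^sup>2 \<le> ?s\<^sup>2"
          have s2: "?s\<^sup>2 = 1 - r\<^sup>2" using w by simp
          have a1: "(r * (1 - d))\<^sup>2 \<le> (nrm (k n) x)\<^sup>2" using x(1) r dd by (intro power_mono) auto
          have a2: "(nrm (k n) x)\<^sup>2 \<le> r\<^sup>2" using x(2) by (intro power_mono) auto
          have "(1 - d)\<^sup>2 = (r * (1 - d))\<^sup>2 + (?s * (1 - d))\<^sup>2"
            unfolding power_mult_distrib s2 by (simp add: algebra_simps)
          then have "(1 - d)\<^sup>2 \<le> (nrm n x)\<^sup>2" using a1 x(3) by simp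
          then have lo: "1 - d \<le> nrm n x" by (rule power2_le_imp_le) simp
          have "(nrm n x)\<^sup>2 \<le> 1\<^sup>2" using a2 x(4) s2 by simp
          then have hi: "nrm n x \<le> 1" by (rule power2_le_imp_le) simp
          have n0: "nrm n x > 0" using lo dd by simp
          have "r * (1 - d) * nrm n x \<le> r * (1 - d) * 1" using hi r dd by (intro mult_left_mono) auto
          then show "r * (1 - d) \<le> ?R n x" using x(1) n0 by (simp add: pos_le_divide_eq)
          show "?R n x \<le> r / (1 - d)" using x(2) lo dd r by (intro frac_le) auto
        qed
      qed simp
      finally show ?case unfolding d by (simp add: mult.left_commute)
    qed
  qed (use dd in simp)
qed

end

section \<open>Rotating subspaces to coordinate subspaces\<close>

text \<open>
  Products \<open>g\<close> of reflections, together with their inverses \<open>h\<close>. Every property below follows by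
  induction from the case of one reflection.
\<close>

inductive rot :: "nat \<Rightarrow> ((nat \<Rightarrow> real) \<Rightarrow> nat \<Rightarrow> real) \<Rightarrow> ((nat \<Rightarrow> real) \<Rightarrow> nat \<Rightarrow> real) \<Rightarrow> bool"
  for n where
  rot_id: "rot n (\<lambda>x. x) (\<lambda>x. x)"
| rot_step: "rot n g h \<Longrightarrow> w \<in> Rn n \<Longrightarrow> rot n (\<lambda>x. reflect n w (g x)) (\<lambda>x. h (reflect n w x))"

lemma linear_reflect: "Vector_Spaces.linear scale_fun scale_fun (reflect n w)"
  by (simp add: Vector_Spaces.linear_iff reflect_add reflect_scale rvec.vector_space_axioms)

lemma rot_inverse: "rot n g h \<Longrightarrow> g (h x) = x \<and> h (g x) = x"
  by (induction arbitrary: x rule: rot.induct) (auto simp: reflect_reflect)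

lemma rot_linear:
  assumes "rot n g h"
  shows "Vector_Spaces.linear scale_fun scale_fun g \<and> Vector_Spaces.linear scale_fun scale_fun h"
  using assms
  by induction (auto simp: Vector_Spaces.linear_iff reflect_add reflect_scale rvec.vector_space_axioms)

lemma rot_Rn: "rot n g h \<Longrightarrow> x \<in> Rn n \<Longrightarrow> g x \<in> Rn n \<and> h x \<in> Rn n"
  by (induction arbitrary: x rule: rot.induct) (auto simp: reflect_Rn)

lemma rot_dot: "rot n g h \<Longrightarrow> dot n (g x) (g y) = dot n x y \<and> dot n (h x) (h y) = dot n x y"
  by (induction arbitrary: x y rule: rot.induct) (auto simp: dot_reflect)

lemma rot_measurable: "rot n g h \<Longrightarrow> g \<in> borel_measurable borel"
  by (induction rule: rot.induct) (auto intro: measurable_compose[OF _ measurable_reflect])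

lemma rot_distr: "rot n g h \<Longrightarrow> distr (lebesgue_Rn n) borel g = lebesgue_Rn n"
proof (induction rule: rot.induct)
  case rot_id
  show ?case by (rule measure_eqI) (auto simp: emeasure_distr)
next
  case (rot_step g h w)
  have "distr (lebesgue_Rn n) borel (\<lambda>x. reflect n w (g x)) =
      distr (distr (lebesgue_Rn n) borel g) borel (reflect n w)"
    using rot_measurable[OF rot_step.hyps(1)] by (subst distr_distr) (auto simp: comp_def)
  then show ?case using rot_step by (simp add: distr_reflect)
qed

lemma subspace_Rn: "rvec.subspace (Rn m)"
  by (auto simp: rvec.subspace_def Rn_def scale_fun_def)

definition trunc :: "nat \<Rightarrow> (nat \<Rightarrow> real) \<Rightarrow> nat \<Rightarrow> real" where
  "trunc k x = (\<lambda>i. if i < k then x i else 0)"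

lemma trunc_Rn: "trunc k x \<in> Rn k"
  by (simp add: trunc_def Rn_def)

lemma trunc_Suc: "trunc (Suc j) x = trunc j x + scale_fun (x j) (unit_vec j)"
proof
  fix i show "trunc (Suc j) x i = (trunc j x + scale_fun (x j) (unit_vec j)) i"
    by (cases i j rule: linorder_cases) (auto simp: trunc_def scale_fun_def unit_vec_def)
qed

lemma trunc_id: "x \<in> Rn k \<Longrightarrow> trunc k x = x"
  by (auto simp: trunc_def Rn_def fun_eq_iff)

lemma span_unit_vec: "rvec.span (unit_vec ` {..<m}) = Rn m"
proof
  show "rvec.span (unit_vec ` {..<m}) \<subseteq> Rn m"
    by (rule rvec.span_minimal) (auto simp: subspace_Rn, auto simp: Rn_def unit_vec_def)
  show "Rn m \<subseteq> rvec.span (unit_vec ` {..<m})"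
  proof (induction m)
    case 0
    have "x = 0" if "x \<in> Rn 0" for x using that by (auto simp: Rn_def fun_eq_iff)
    then show ?case using rvec.span_zero by blast
  next
    case (Suc m)
    show ?case
    proof
      fix x assume x: "x \<in> Rn (Suc m)"
      have "trunc m x \<in> rvec.span (unit_vec ` {..<m})" using Suc trunc_Rn by blast
      moreover have "rvec.span (unit_vec ` {..<m}) \<subseteq> rvec.span (unit_vec ` {..<Suc m})"
        by (intro rvec.span_mono image_mono) auto
      ultimately have 1: "trunc m x \<in> rvec.span (unit_vec ` {..<Suc m})" by blast
      have 2: "scale_fun (x m) (unit_vec m) \<in> rvec.span (unit_vec ` {..<Suc m})"
        by (intro rvec.span_scale rvec.span_base) auto
      from rvec.span_add[OF 1 2] show "x \<in> rvec.span (unit_vec ` {..<Suc m})"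
        unfolding trunc_Suc[symmetric] trunc_id[OF x] .
    qed
  qed
qed

lemma inj_unit_vec: "inj unit_vec"
  by (rule injI) (metis unit_vec_def zero_neq_one)

lemma independent_unit_vec: "rvec.independent (unit_vec ` {..<m})"
proof (induction m)
  case (Suc m)
  have "unit_vec m \<notin> Rn m" by (auto simp: Rn_def unit_vec_def)
  then have "rvec.independent (insert (unit_vec m) (unit_vec ` {..<m}))"
    using Suc by (intro rvec.independent_insertI) (auto simp: span_unit_vec)
  then show ?case by (simp add: lessThan_Suc)
qed (auto simp: rvec.independent_empty)

lemma unit_vec_Rn: "j < n \<Longrightarrow> unit_vec j \<in> Rn n"
  by (auto simp: Rn_def unit_vec_def)

lemma dot_unit_vec: "j < n \<Longrightarrow> dot n x (unit_vec j) = x j"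
proof -
  assume j: "j < n"
  have "dot n x (unit_vec j) = (\<Sum>i<n. if i = j then x j else 0)"
    unfolding dot_def unit_vec_def by (intro sum.cong) auto
  then show ?thesis using j by simp
qed

lemma subspace_diff_trunc:
  assumes V: "rvec.subspace V" and j: "Rn j \<subseteq> V" and v: "v \<in> V"
  shows "(\<lambda>i. if i < j then 0 else v i) \<in> V"
proof -
  have "(\<lambda>i. if i < j then v i else 0) \<in> V" using j by (auto simp: Rn_def)
  from rvec.subspace_diff[OF V v this]
  have "v - (\<lambda>i. if i < j then v i else 0) \<in> V" .
  also have "v - (\<lambda>i. if i < j then v i else 0) = (\<lambda>i. if i < j then 0 else v i)" by auto
  finally show ?thesis .
qed

text \<open>
  Cutting off the first \<open>j\<close> coordinates of a vector in \<open>V\<close> outside \<open>Rn j\<close> leaves a vector \<open>u \<in> V\<close>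
  orthogonal to \<open>Rn j\<close>. The reflection that takes \<open>u / |u|\<close> to the unit vector \<open>j\<close> fixes \<open>Rn j\<close>.
\<close>

lemma reflect_extend:
  assumes V: "rvec.subspace V" "V \<subseteq> Rn n" and j: "Rn j \<subseteq> V" "\<not> V \<subseteq> Rn j"
  obtains w where "w \<in> Rn n" "Rn (Suc j) \<subseteq> reflect n w ` V"
proof -
  obtain v where v: "v \<in> V" "v \<notin> Rn j" using j by auto
  define u where "u = (\<lambda>i. if i < j then 0 else v i)"
  have uV: "u \<in> V" unfolding u_def by (rule subspace_diff_trunc[OF V(1) j(1) v(1)])
  obtain i where i: "i \<ge> j" "v i \<noteq> 0" using v(2) by (auto simp: Rn_def)
  have "v \<in> Rn n" using v(1) V(2) by blast
  then have in_: "i < n" using i(2) by (auto simp: Rn_def not_less intro: ccontr)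
  have jn: "j < n" using i in_ by simp
  have uu: "dot n u u > 0"
  proof -
    have "(u i)\<^sup>2 \<le> dot n u u" unfolding dot_sqsum sqsum_def using in_ by (intro member_le_sum) auto
    moreover have "(u i)\<^sup>2 > 0" using i by (simp add: u_def)
    ultimately show ?thesis by linarith
  qed
  define z where "z = scale_fun (1 / sqrt (dot n u u)) u"
  have zV: "z \<in> V" unfolding z_def using V(1) uV by (rule rvec.subspace_scale)
  have zz: "dot n z z = 1"
    unfolding z_def scale_fun_def dot_scale using uu by (simp add: power_divide)
  have ej: "unit_vec j \<in> Rn n" "dot n (unit_vec j) (unit_vec j) = 1"
    using jn by (auto simp: unit_vec_Rn dot_unit_vec) (simp add: unit_vec_def)
  define w where "w = z - unit_vec j"
  have wR: "w \<in> Rn n" using zV V(2) ej rvec.subspace_diff[OF subspace_Rn] by (auto simp: w_def)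
  have rz: "reflect n w z = unit_vec j"
    unfolding w_def using zV V(2) ej zz by (intro reflect_diff) auto
  have fix_: "reflect n w x = x" if "x \<in> Rn j" for x
  proof (rule reflect_orthogonal_fixed)
    have "x i * w i = 0" for i
      using that by (cases "i < j") (auto simp: w_def z_def u_def scale_fun_def unit_vec_def Rn_def)
    then show "dot n x w = 0" unfolding dot_def by (intro sum.neutral ballI)
  qed
  have "Rn (Suc j) \<subseteq> reflect n w ` V"
  proof
    fix x assume x: "x \<in> Rn (Suc j)"
    define y where "y = trunc j x"
    have yR: "y \<in> Rn j" unfolding y_def by (rule trunc_Rn)
    have "x = y + scale_fun (x j) (unit_vec j)" unfolding y_def using trunc_Suc[of j x] unfolding trunc_id[OF x] .
    also have "\<dots> = reflect n w (y + scale_fun (x j) z)"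
      by (simp add: reflect_add reflect_scale rz fix_ yR)
    finally show "x \<in> reflect n w ` V"
      using rvec.subspace_add[OF V(1), of y "scale_fun (x j) z"] rvec.subspace_scale[OF V(1) zV] yR j(1) by blast
  qed
  then show ?thesis using that wR by blast
qed

text \<open>
  Reflections produce one further coordinate direction at a time. The dimension of \<open>E\<close> forbids
  the process to stop before step \<open>k\<close>, and forbids further vectors in the image after it.
\<close>

lemma subspace_rot_standard:
  assumes E: "rvec.subspace E" "E \<subseteq> Rn n" "rvec.dim E = k" and k: "k \<ge> 1"
  obtains g h where "rot n g h" "g ` E = Rn k"
proof -
  obtain B where B: "B \<subseteq> E" "rvec.independent B" "E \<subseteq> rvec.span B" "card B = k"
    using rvec.basis_exists[of E] E(3) by metis
  have finB: "finite B" using B(4) k by (intro card_ge_0_finite) simp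
  have small: "\<not> g ` E \<subseteq> Rn j" if r: "rot n g h" and j: "j < k" for g h j
  proof
    assume sub: "g ` E \<subseteq> Rn j"
    interpret h: Vector_Spaces.linear scale_fun scale_fun h using rot_linear[OF r] by simp
    have "B \<subseteq> h ` Rn j"
    proof
      fix b assume "b \<in> B"
      then have "g b \<in> Rn j" using B(1) sub by auto
      moreover have "b = h (g b)" using rot_inverse[OF r] by simp
      ultimately show "b \<in> h ` Rn j" by blast
    qed
    also have "\<dots> = rvec.span (h ` unit_vec ` {..<j})" by (simp add: h.span_image span_unit_vec)
    finally have "card B \<le> card (h ` unit_vec ` {..<j})"
      using rvec.independent_span_bound[OF _ B(2), of "h ` unit_vec ` {..<j}"] by auto
    also have "\<dots> \<le> j" using card_image_le[of "{..<j}" "\<lambda>i. h (unit_vec i)"] by (simp add: image_image)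
    finally show False using j B(4) by simp
  qed
  have gE: "rvec.subspace (g ` E)" "g ` E \<subseteq> Rn n" if r: "rot n g h" for g h
  proof -
    interpret g: Vector_Spaces.linear scale_fun scale_fun g using rot_linear[OF r] by simp
    show "rvec.subspace (g ` E)" using E(1) by (rule g.subspace_image)
    show "g ` E \<subseteq> Rn n" using rot_Rn[OF r] E(2) by auto
  qed
  have ex: "\<exists>g h. rot n g h \<and> Rn j \<subseteq> g ` E" if "j \<le> k" for j
    using that
  proof (induction j)
    case 0
    have "Rn 0 \<subseteq> E"
    proof
      fix x assume "x \<in> Rn 0"
      then have "x = 0" by (auto simp: Rn_def fun_eq_iff)
      then show "x \<in> E" using rvec.subspace_0[OF E(1)] by simp
    qed
    then show ?case using rot_id by (intro exI[of _ "\<lambda>x. x"]) auto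
  next
    case (Suc j)
    then obtain g h where r: "rot n g h" "Rn j \<subseteq> g ` E" by auto
    obtain w where w: "w \<in> Rn n" "Rn (Suc j) \<subseteq> reflect n w ` g ` E"
      using reflect_extend[OF gE[OF r(1)] r(2) small[OF r(1)]] Suc.prems by auto
    then show ?case using rot_step[OF r(1) w(1)] by (auto simp: image_image)
  qed
  from ex[of k] obtain g h where r: "rot n g h" "Rn k \<subseteq> g ` E" by blast
  interpret g: Vector_Spaces.linear scale_fun scale_fun g using rot_linear[OF r(1)] by simp
  have "g ` E \<subseteq> Rn k"
  proof (rule ccontr)
    assume "\<not> g ` E \<subseteq> Rn k"
    then obtain v where v: "v \<in> g ` E" "v \<notin> Rn k" by auto
    have ind: "rvec.independent (insert v (unit_vec ` {..<k}))"
      using v by (intro rvec.independent_insertI) (auto simp: span_unit_vec independent_unit_vec)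
    have "unit_vec ` {..<k} \<subseteq> g ` E" using r(2) unit_vec_Rn by blast
    then have "insert v (unit_vec ` {..<k}) \<subseteq> g ` E" using v by simp
    also have "\<dots> \<subseteq> rvec.span (g ` B)" unfolding g.span_image using B(3) by blast
    finally have "card (insert v (unit_vec ` {..<k})) \<le> card (g ` B)"
      using rvec.independent_span_bound[OF _ ind, of "g ` B"] finB by auto
    also have "\<dots> \<le> k" using card_image_le[OF finB, of g] B(4) by simp
    finally show False
      using v(2) unit_vec_Rn card_image[OF inj_on_subset[OF inj_unit_vec], of "{..<k}"]
      by (subst (asm) card_insert_disjoint) auto
  qed
  with r that show ?thesis by blast
qed

section \<open>Orthogonal projections and the Haar measure\<close>

lemma proj_eqI:
  assumes E: "rvec.subspace E" "E \<subseteq> Rn n" and y: "y \<in> E" "\<And>z. z \<in> E \<Longrightarrow> dot n (x - y) z = 0"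
  shows "proj n E x = y"
  unfolding proj_def
proof (rule the_equality)
  show "y \<in> E \<and> (\<forall>z\<in>E. dot n (x - y) z = 0)" using y by blast
  fix y' assume y': "y' \<in> E \<and> (\<forall>z\<in>E. dot n (x - y') z = 0)"
  define d where "d = y - y'"
  have d: "d \<in> E" unfolding d_def using E(1) y(1) y' by (intro rvec.subspace_diff) auto
  have "dot n d d = dot n (x - y') d - dot n (x - y) d"
    by (simp add: d_def dot_def sum_subtractf[symmetric] algebra_simps)
  also have "\<dots> = 0" using y(2)[OF d] y' d by simp
  finally have z: "dot n d d = 0" .
  have "d i = 0" for i
  proof (cases "i < n")
    case True
    then have "d i = dot n d (unit_vec i)" by (rule dot_unit_vec[symmetric])
    also have "\<dots> = dot n (unit_vec i) d" by (rule dot_commute)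
    finally show ?thesis using dot_eq_0[OF z] by simp
  next
    case False then show ?thesis using d E(2) by (auto simp: Rn_def)
  qed
  then show "y' = y" by (auto simp: d_def fun_eq_iff)
qed

lemma rot_trunc_orthogonal:
  assumes r: "rot n g h" and gE: "g ` E = Rn k" and z: "z \<in> E"
  shows "dot n (x - h (trunc k (g x))) z = 0"
proof -
  note inv = rot_inverse[OF r]
  interpret h: Vector_Spaces.linear scale_fun scale_fun h using rot_linear[OF r] by simp
  have "x - h (trunc k (g x)) = h (g x - trunc k (g x))" using inv by (simp add: h.diff)
  moreover have "z = h (g z)" using inv by simp
  ultimately have "dot n (x - h (trunc k (g x))) z = dot n (g x - trunc k (g x)) (g z)"
    using rot_dot[OF r] by metis
  also have "\<dots> = 0"
  proof -
    have "g z \<in> Rn k" using z gE by blast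
    then have "(g x - trunc k (g x)) i * g z i = 0" for i
      by (cases "i < k") (auto simp: trunc_def Rn_def)
    then show ?thesis unfolding dot_def by (intro sum.neutral ballI)
  qed
  finally show ?thesis .
qed

text \<open>
  The projection to \<open>E\<close> is conjugate to the truncation to the first \<open>k\<close> coordinates; in
  particular it exists.
\<close>

lemma grassmannian_rot:
  assumes E: "E \<in> grassmannian n k" and k: "1 \<le> k" "k \<le> n"
  obtains g h where "rot n g h" "g ` E = Rn k" "\<And>x. proj n E x = h (trunc k (g x))" "\<And>x. nrm n (proj n E x) = nrm k (g x)"
proof -
  have E': "rvec.subspace E" "E \<subseteq> Rn n" "rvec.dim E = k" using E by (auto simp: grassmannian_def)
  obtain g h where r: "rot n g h" "g ` E = Rn k" using subspace_rot_standard[OF E' k(1)] .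
  note inv = rot_inverse[OF r(1)]
  interpret h: Vector_Spaces.linear scale_fun scale_fun h using rot_linear[OF r(1)] by simp
  have p: "proj n E x = h (trunc k (g x))" for x
  proof (rule proj_eqI[OF E'(1,2)])
    have "trunc k (g x) \<in> g ` E" unfolding r(2) by (simp add: Rn_def trunc_def)
    then show "h (trunc k (g x)) \<in> E" using inv by auto
    fix z assume z: "z \<in> E"
    show "dot n (x - h (trunc k (g x))) z = 0" using r z by (rule rot_trunc_orthogonal)
  qed
  have "nrm n (proj n E x) = nrm k (g x)" for x
  proof -
    have "nrm n (proj n E x) = nrm n (trunc k (g x))" using rot_dot[OF r(1)] by (simp add: nrm_def p)
    also have "dot n (trunc k (g x)) (trunc k (g x)) = dot k (g x) (g x)"
      unfolding dot_def trunc_def using k(2) by (intro sum.mono_neutral_cong_right) auto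
    then have "nrm n (trunc k (g x)) = nrm k (g x)" by (simp add: nrm_def)
    finally show ?thesis .
  qed
  with r p that show ?thesis by blast
qed

context
  fixes n k :: nat
  assumes k: "1 \<le> k" "k \<le> n"
begin

lemma proj_props:
  assumes E: "E \<in> grassmannian n k"
  shows proj_in: "proj n E x \<in> E" and proj_orth: "z \<in> E \<Longrightarrow> dot n (x - proj n E x) z = 0"
    and proj_add: "proj n E (x + y) = proj n E x + proj n E y"
    and proj_scale: "proj n E (scale_fun c x) = scale_fun c (proj n E x)"
proof -
  obtain g h where r: "rot n g h" "g ` E = Rn k" "\<And>x. proj n E x = h (trunc k (g x))"
    using grassmannian_rot[OF E k] by metis
  note inv = rot_inverse[OF r(1)]
  interpret h: Vector_Spaces.linear scale_fun scale_fun h using rot_linear[OF r(1)] by simp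
  interpret g: Vector_Spaces.linear scale_fun scale_fun g using rot_linear[OF r(1)] by simp
  have "trunc k (g x) \<in> g ` E" unfolding r(2) by (simp add: Rn_def trunc_def)
  then show "proj n E x \<in> E" using inv r(3) by auto
  show "proj n E (x + y) = proj n E x + proj n E y"
    unfolding r(3) h.add[symmetric] g.add by (rule arg_cong[where f=h]) (auto simp: trunc_def)
  show "proj n E (scale_fun c x) = scale_fun c (proj n E x)"
    unfolding r(3) h.scale[symmetric] g.scale by (rule arg_cong[where f=h]) (auto simp: trunc_def scale_fun_def)
  show "dot n (x - proj n E x) z = 0" if "z \<in> E"
    unfolding r(3) using r(1,2) that by (rule rot_trunc_orthogonal)
qed

lemma proj_coord:
  assumes E: "E \<in> grassmannian n k" and i: "i < n"
  shows "proj n E x i = (\<Sum>j<n. x j * proj_matrix n E i j)"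
proof -
  have E': "rvec.subspace E" "E \<subseteq> Rn n" using E by (auto simp: grassmannian_def)
  have "proj n E (trunc m x) i = (\<Sum>j<m. x j * proj n E (unit_vec j) i)" for m
  proof (induction m)
    case 0
    have "proj n E (trunc 0 x) = scale_fun 0 (proj n E x)"
      unfolding proj_scale[OF E, symmetric] by (rule arg_cong[where f="proj n E"]) (auto simp: trunc_def scale_fun_def)
    then show ?case by (simp add: scale_fun_def)
  next
    case (Suc m)
    have "trunc (Suc m) x = trunc m x + scale_fun (x m) (unit_vec m)"
      by (auto simp: trunc_def scale_fun_def unit_vec_def fun_eq_iff less_Suc_eq)
    then have "proj n E (trunc (Suc m) x) i = proj n E (trunc m x) i + x m * proj n E (unit_vec m) i"
      by (simp add: proj_add[OF E] proj_scale[OF E]) (simp add: scale_fun_def)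
    then show ?case using Suc by simp
  qed
  from this[of n] have "proj n E (trunc n x) i = (\<Sum>j<n. x j * proj_matrix n E i j)"
    using i by (simp add: proj_matrix_def)
  moreover have "proj n E (trunc n x) = proj n E x"
  proof (rule proj_eqI[OF E' proj_in[OF E]])
    fix z assume "z \<in> E"
    from proj_orth[OF E this, of x] show "dot n (trunc n x - proj n E x) z = 0"
      by (simp add: dot_def trunc_def)
  qed
  ultimately show ?thesis by simp
qed

lemma nrm_proj:
  assumes E: "E \<in> grassmannian n k"
  shows "nrm n (proj n E x) = sqrt (\<Sum>i<n. (\<Sum>j<n. x j * proj_matrix n E i j)\<^sup>2)"
  unfolding nrm_def dot_def by (simp add: proj_coord[OF E] power2_eq_square)

lemma space_grassmann_algebra [simp]: "space (grassmann_algebra n k) = grassmannian n k"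
  by (simp add: grassmann_algebra_def)

lemma measurable_proj_matrix [measurable]: "(\<lambda>E. proj_matrix n E i j) \<in> borel_measurable (grassmann_algebra n k)"
proof -
  have "proj_matrix n \<in> measurable (grassmann_algebra n k) borel"
    unfolding grassmann_algebra_def by (rule measurable_vimage_algebra1) auto
  moreover have "(\<lambda>m::nat\<Rightarrow>nat\<Rightarrow>real. m i) \<in> borel_measurable borel" by (rule measurable_product_coordinates)
  ultimately have "(\<lambda>E. proj_matrix n E i) \<in> borel_measurable (grassmann_algebra n k)"
    by (rule measurable_compose)
  then show ?thesis by (rule measurable_compose) (rule coord_borel)
qed

text \<open>
  The norm is the square root of a polynomial in the coordinates of the point and the entries
  of the projection matrix.
\<close>

lemma measurable_nrm_proj_pair:
  "(\<lambda>p. nrm n (proj n (snd p) (fst p))) \<in> borel_measurable (borel \<Otimes>\<^sub>M grassmann_algebra n k)"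
proof -
  have [measurable]: "(\<lambda>p :: (nat \<Rightarrow> real) \<times> (nat \<Rightarrow> real) set. fst p j) \<in> borel_measurable (borel \<Otimes>\<^sub>M grassmann_algebra n k)" for j
    by (rule measurable_compose[OF measurable_fst coord_borel])
  have [measurable]: "(\<lambda>p. proj_matrix n (snd p) i j) \<in> borel_measurable (borel \<Otimes>\<^sub>M grassmann_algebra n k)" for i j
    by (rule measurable_compose[OF measurable_snd measurable_proj_matrix])
  have "(\<lambda>p. sqrt (\<Sum>i<n. (\<Sum>j<n. fst p j * proj_matrix n (snd p) i j)\<^sup>2)) \<in> borel_measurable (borel \<Otimes>\<^sub>M grassmann_algebra n k)"
    by measurable
  then show ?thesis
    by (rule measurable_cong[THEN iffD1, rotated]) (auto simp: space_pair_measure nrm_proj)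
qed

lemma measurable_nrm_proj: "(\<lambda>E. nrm n (proj n E x)) \<in> borel_measurable (grassmann_algebra n k)"
  using measurable_compose[OF measurable_Pair1'[of x borel "grassmann_algebra n k"] measurable_nrm_proj_pair] by simp

lemma grassmannian_reflect:
  assumes E: "E \<in> grassmannian n k" and w: "w \<in> Rn n"
  shows "reflect n w ` E \<in> grassmannian n k"
    "proj n (reflect n w ` E) x = reflect n w (proj n E (reflect n w x))"
proof -
  have E': "rvec.subspace E" "E \<subseteq> Rn n" "rvec.dim E = k" using E by (auto simp: grassmannian_def)
  interpret r: Vector_Spaces.linear scale_fun scale_fun "reflect n w" by (rule linear_reflect)
  have inj: "inj (reflect n w)" by (metis injI reflect_reflect)
  obtain B where B: "B \<subseteq> E" "rvec.independent B" "E \<subseteq> rvec.span B" "card B = k"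
    using rvec.basis_exists[of E] E'(3) by metis
  have "rvec.dim (reflect n w ` E) = k"
  proof (rule rvec.dim_unique)
    show "reflect n w ` B \<subseteq> reflect n w ` E" using B by auto
    show "reflect n w ` E \<subseteq> rvec.span (reflect n w ` B)" unfolding r.span_image using B by blast
    show "rvec.independent (reflect n w ` B)" using B(2) inj by (rule r.independent_inj_image)
    show "card (reflect n w ` B) = k" using B(4) inj by (simp add: card_image inj_on_subset)
  qed
  moreover have sub: "rvec.subspace (reflect n w ` E)" using E'(1) by (rule r.subspace_image)
  moreover have sub2: "reflect n w ` E \<subseteq> Rn n" using E'(2) w by (auto simp: reflect_Rn)
  ultimately show "reflect n w ` E \<in> grassmannian n k" by (simp add: grassmannian_def)
  show "proj n (reflect n w ` E) x = reflect n w (proj n E (reflect n w x))"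
  proof (rule proj_eqI[OF sub sub2])
    show "reflect n w (proj n E (reflect n w x)) \<in> reflect n w ` E" using proj_in[OF E] by blast
    fix z assume "z \<in> reflect n w ` E"
    then obtain v where v: "v \<in> E" "z = reflect n w v" by blast
    have "x - reflect n w (proj n E (reflect n w x)) = reflect n w (reflect n w x - proj n E (reflect n w x))"
      by (simp add: r.diff reflect_reflect)
    then have "dot n (x - reflect n w (proj n E (reflect n w x))) z = dot n (reflect n w x - proj n E (reflect n w x)) v"
      by (simp add: v dot_reflect)
    then show "dot n (x - reflect n w (proj n E (reflect n w x))) z = 0"
      using proj_orth[OF E v(1)] by simp
  qed
qed

text \<open>
  The projection matrix of the reflected subspace is conjugate to that of \<open>E\<close>, so its entries
  depend polynomially on those of \<open>E\<close>.
\<close>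

lemma measurable_reflect_image:
  assumes w: "w \<in> Rn n"
  shows "(\<lambda>E. reflect n w ` E) \<in> measurable (grassmann_algebra n k) (grassmann_algebra n k)"
  unfolding grassmann_algebra_def[of n k, THEN arg_cong[where f="\<lambda>A. measurable (grassmann_algebra n k) A"]]
proof (rule measurable_vimage_algebra2)
  show "(`) (reflect n w) \<in> space (grassmann_algebra n k) \<rightarrow> grassmannian n k"
    using grassmannian_reflect(1)[OF _ w] by auto
  show "(\<lambda>E. proj_matrix n (reflect n w ` E)) \<in> measurable (grassmann_algebra n k) borel"
  proof (intro measurable_coordinatewise_then_product)
    fix i j
    have m: "(\<lambda>E. if i < n \<and> j < n then
        (\<Sum>l<n. reflect n w (unit_vec j) l * proj_matrix n E i l) +
          (- 2 * (\<Sum>m<n. (\<Sum>l<n. reflect n w (unit_vec j) l * proj_matrix n E m l) * w m) / dot n w w) * w i else 0)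
       \<in> borel_measurable (grassmann_algebra n k)"
      by measurable
    have "proj_matrix n (reflect n w ` E) i j = (if i < n \<and> j < n then
        (\<Sum>l<n. reflect n w (unit_vec j) l * proj_matrix n E i l) +
          (- 2 * (\<Sum>m<n. (\<Sum>l<n. reflect n w (unit_vec j) l * proj_matrix n E m l) * w m) / dot n w w) * w i else 0)"
      if "E \<in> space (grassmann_algebra n k)" for E
    proof (cases "i < n \<and> j < n")
      case True
      have E: "E \<in> grassmannian n k" using that by simp
      have "dot n (proj n E y) w = (\<Sum>m<n. (\<Sum>l<n. y l * proj_matrix n E m l) * w m)" for y
        unfolding dot_def by (simp add: proj_coord[OF E])
      then show ?thesis
        using True unfolding proj_matrix_def[of n "reflect n w ` E"] grassmannian_reflect(2)[OF E w]
        unfolding reflect_def[of n w "proj n E _"] by (simp add: proj_coord[OF E])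
    next
      case False
      then show ?thesis unfolding proj_matrix_def[of n "reflect n w ` E"] by (simp only: if_False)
    qed
    with m show "(\<lambda>E. proj_matrix n (reflect n w ` E) i j) \<in> borel_measurable (grassmann_algebra n k)"
      by (subst measurable_cong) auto
  qed
qed

text \<open>
  The reflection that takes \<open>x\<close> to \<open>|x|\<close> times the unit vector preserves the Haar measure, and
  the projection of \<open>x\<close> to \<open>E\<close> has the same norm as the projection of the image of \<open>x\<close> to the image
  of \<open>E\<close>.
\<close>

lemma haar_norm_depends_on_norm:
  assumes \<mu>: "grassmann_haar n k \<mu>" and x: "x \<in> Rn n"
  shows "distr \<mu> borel (\<lambda>E. nrm n (proj n E x)) = distr \<mu> borel (\<lambda>E. nrm n x * nrm n (proj n E (unit_vec 0)))"
proof -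
  have sets[measurable_cong]: "sets \<mu> = sets (grassmann_algebra n k)" using \<mu> by (simp add: grassmann_haar_def)
  have sp: "space \<mu> = grassmannian n k" using sets_eq_imp_space_eq[OF sets] by simp
  define y where "y = scale_fun (nrm n x) (unit_vec 0)"
  have n0: "0 < n" using k by simp
  have y: "y \<in> Rn n" unfolding y_def using n0 by (intro rvec.subspace_scale[OF subspace_Rn] unit_vec_Rn)
  have "dot n (unit_vec 0) (unit_vec 0) = 1" using n0 by (simp add: dot_unit_vec) (simp add: unit_vec_def)
  then have yy: "dot n x x = dot n y y" by (simp add: y_def scale_fun_def dot_scale nrm_power2)
  define w where "w = x - y"
  have w: "w \<in> Rn n" unfolding w_def using x y by (intro rvec.subspace_diff[OF subspace_Rn])
  have rx: "reflect n w x = y" unfolding w_def by (rule reflect_diff[OF x y yy])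
  then have ry: "reflect n w y = x" by (metis reflect_reflect)
  have inv: "distr \<mu> (grassmann_algebra n k) (\<lambda>E. reflect n w ` E) = \<mu>"
    using \<mu> orthogonal_map_reflect[OF w] by (simp add: grassmann_haar_def)
  have m: "(\<lambda>E. reflect n w ` E) \<in> measurable \<mu> (grassmann_algebra n k)"
    using measurable_reflect_image[OF w] by (simp add: sets cong: measurable_cong_sets)
  have "distr \<mu> borel (\<lambda>E. nrm n (proj n E y)) =
     distr (distr \<mu> (grassmann_algebra n k) (\<lambda>E. reflect n w ` E)) borel (\<lambda>E. nrm n (proj n E y))"
    by (simp add: inv)
  also have "\<dots> = distr \<mu> borel (\<lambda>E. nrm n (proj n (reflect n w ` E) y))"
    using m measurable_nrm_proj by (subst distr_distr) (auto simp: comp_def)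
  also have "\<dots> = distr \<mu> borel (\<lambda>E. nrm n (proj n E x))"
    by (intro distr_cong refl) (simp add: grassmannian_reflect(2)[OF _ w] sp ry nrm_def dot_reflect)
  finally have "distr \<mu> borel (\<lambda>E. nrm n (proj n E x)) = distr \<mu> borel (\<lambda>E. nrm n (proj n E y))" by simp
  also have "\<dots> = distr \<mu> borel (\<lambda>E. nrm n x * nrm n (proj n E (unit_vec 0)))"
    unfolding y_def by (intro distr_cong refl) (subst proj_scale, auto simp: sp scale_fun_def nrm_scale)
  finally show ?thesis .
qed

lemma AE_uball_nrm_pos: "AE x in uball n. 0 < nrm n x"
proof -
  interpret g: gauge n "nrm n" by (rule gauge_nrm) (use k in simp)
  interpret prob_space "uball n" by (rule prob_uball) (use k in simp)
  have gU: "g.U = uball n" by (simp add: g.U_def uball_def)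
  have "measure (uball n) {x. nrm n x \<le> 0} = 0"
    using g.cdf_N[of 0] k unfolding gU by (simp add: clip_def zero_power)
  then have "emeasure (uball n) {x. nrm n x \<le> 0} = 0" by (simp add: emeasure_eq_measure)
  then have "AE x in uball n. \<not> nrm n x \<le> 0" by (subst AE_iff_measurable[of "{x. nrm n x \<le> 0}"]) auto
  then show ?thesis by (auto simp: not_le)
qed

lemma rot_uball:
  assumes r: "rot n g h"
  shows "distr (uball n) borel g = uball n"
proof (rule measure_eqI)
  have gm: "g \<in> borel_measurable borel" by (rule rot_measurable[OF r])
  fix A assume "A \<in> sets (distr (uball n) borel g)"
  then have A[measurable]: "A \<in> sets borel" by simp
  have gA: "g -` A \<in> sets borel" using measurable_sets[OF gm A] by simp
  have ng: "nrm n (g x) = nrm n x" for x using rot_dot[OF r] by (simp add: nrm_def)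
  have b[measurable]: "{x. nrm n x \<le> 1} \<in> sets borel" by measurable
  have "emeasure (distr (uball n) borel g) A = emeasure (lebesgue_Rn n) ({x. nrm n x \<le> 1} \<inter> g -` A) / emeasure (lebesgue_Rn n) {x. nrm n x \<le> 1}"
    using gm gA by (subst emeasure_distr) (auto simp: uball_def cong: measurable_cong_sets)
  also have "{x. nrm n x \<le> 1} \<inter> g -` A = g -` ({x. nrm n x \<le> 1} \<inter> A) \<inter> space (lebesgue_Rn n)" by (auto simp: ng)
  also have "emeasure (lebesgue_Rn n) \<dots> = emeasure (distr (lebesgue_Rn n) borel g) ({x. nrm n x \<le> 1} \<inter> A)"
    using gm by (subst emeasure_distr) auto
  also have "distr (lebesgue_Rn n) borel g = lebesgue_Rn n" by (rule rot_distr[OF r])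
  also have "emeasure (lebesgue_Rn n) ({x. nrm n x \<le> 1} \<inter> A) / emeasure (lebesgue_Rn n) {x. nrm n x \<le> 1} = emeasure (uball n) A"
    by (simp add: uball_def)
  finally show "emeasure (distr (uball n) borel g) A = emeasure (uball n) A" .
qed simp

text \<open>
  Consider \<open>|P\<^sub>E x| / |x|\<close> for \<open>x\<close> uniform in the ball and \<open>E\<close> independent. Given \<open>x\<close>, it has the law
  on the left. Given \<open>E\<close>, a rotation of \<open>E\<close> to \<open>Rn k\<close>, which preserves the uniform distribution,
  shows that it has the law on the right.
\<close>

lemma haar_direction_law:
  assumes \<mu>: "grassmann_haar n k \<mu>"
  shows "distr \<mu> borel (\<lambda>E. nrm n (proj n E (unit_vec 0))) = distr (uball n) borel (\<lambda>x. nrm k x / nrm n x)"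
proof (rule measure_eqI)
  have sets[measurable_cong]: "sets \<mu> = sets (grassmann_algebra n k)" using \<mu> by (simp add: grassmann_haar_def)
  have sp: "space \<mu> = grassmannian n k" using sets_eq_imp_space_eq[OF sets] by simp
  interpret \<mu>: prob_space \<mu> using \<mu> by (simp add: grassmann_haar_def)
  interpret U: prob_space "uball n" by (rule prob_uball) (use k in simp)
  interpret P: pair_sigma_finite "uball n" \<mu> ..
  let ?\<rho> = "distr \<mu> borel (\<lambda>E. nrm n (proj n E (unit_vec 0)))"
  fix A :: "real set" assume "A \<in> sets ?\<rho>"
  then have A[measurable]: "A \<in> sets borel" by simp
  have mp[measurable]: "(\<lambda>E. nrm n (proj n E x)) \<in> borel_measurable \<mu>" for x
    using measurable_nrm_proj by (simp add: sets cong: measurable_cong_sets)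
  have mpp: "(\<lambda>p. nrm n (proj n (snd p) (fst p))) \<in> borel_measurable (uball n \<Otimes>\<^sub>M \<mu>)"
    using measurable_nrm_proj_pair by (simp add: sets cong: measurable_cong_sets sets_pair_measure_cong)
  have mn: "(\<lambda>p. nrm n (fst p)) \<in> borel_measurable (uball n \<Otimes>\<^sub>M \<mu>)"
    by (rule measurable_compose[OF measurable_fst]) simp
  have mm: "(\<lambda>p. indicator A (nrm n (proj n (snd p) (fst p)) / nrm n (fst p)) :: ennreal) \<in> borel_measurable (uball n \<Otimes>\<^sub>M \<mu>)"
    using mpp mn by (intro measurable_compose[OF borel_measurable_divide borel_measurable_indicator[OF A]])
  have "emeasure ?\<rho> A = (\<integral>\<^sup>+x. emeasure ?\<rho> A \<partial>uball n)" by (simp add: U.emeasure_space_1[simplified])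
  also have "\<dots> = (\<integral>\<^sup>+x. (\<integral>\<^sup>+E. indicator A (nrm n (proj n E x) / nrm n x) \<partial>\<mu>) \<partial>uball n)"
  proof (rule nn_integral_cong_AE)
    have "AE x in uball n. x \<in> Rn n"
      unfolding uball_def using AE_lebesgue_Rn[of n] by (intro AE_uniform_measureI) auto
    with AE_uball_nrm_pos
    show "AE x in uball n. emeasure ?\<rho> A = (\<integral>\<^sup>+E. indicator A (nrm n (proj n E x) / nrm n x) \<partial>\<mu>)"
    proof eventually_elim
      case (elim x)
      have "(\<integral>\<^sup>+E. indicator A (nrm n (proj n E x) / nrm n x) \<partial>\<mu>) =
         (\<integral>\<^sup>+t. indicator A (t / nrm n x) \<partial>distr \<mu> borel (\<lambda>E. nrm n (proj n E x)))"
        by (subst nn_integral_distr) auto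
      also have "\<dots> = (\<integral>\<^sup>+t. indicator A (t / nrm n x) \<partial>distr \<mu> borel (\<lambda>E. nrm n x * nrm n (proj n E (unit_vec 0))))"
        by (simp add: haar_norm_depends_on_norm[OF \<mu> elim(2)])
      also have "\<dots> = (\<integral>\<^sup>+E. indicator A (nrm n (proj n E (unit_vec 0))) \<partial>\<mu>)"
        using elim(1) by (subst nn_integral_distr) auto
      also have "\<dots> = (\<integral>\<^sup>+t. indicator A t \<partial>?\<rho>)" by (subst nn_integral_distr) auto
      also have "\<dots> = emeasure ?\<rho> A" by simp
      finally show ?case by simp
    qed
  qed
  also have "\<dots> = (\<integral>\<^sup>+E. (\<integral>\<^sup>+x. indicator A (nrm n (proj n E x) / nrm n x) \<partial>uball n) \<partial>\<mu>)"
    using P.Fubini'[of "\<lambda>x E. indicator A (nrm n (proj n E x) / nrm n x)"] mm by (simp add: split_beta')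
  also have "\<dots> = (\<integral>\<^sup>+E. emeasure (distr (uball n) borel (\<lambda>x. nrm k x / nrm n x)) A \<partial>\<mu>)"
  proof (rule nn_integral_cong)
    fix E assume "E \<in> space \<mu>"
    then have E: "E \<in> grassmannian n k" by (simp add: sp)
    obtain g h where r: "rot n g h" "\<And>x. nrm n (proj n E x) = nrm k (g x)"
      using grassmannian_rot[OF E k] by metis
    have gm: "g \<in> borel_measurable borel" by (rule rot_measurable[OF r(1)])
    have ng: "nrm n x = nrm n (g x)" for x using rot_dot[OF r(1)] by (simp add: nrm_def)
    have "(\<integral>\<^sup>+x. indicator A (nrm n (proj n E x) / nrm n x) \<partial>uball n) = (\<integral>\<^sup>+x. indicator A (nrm k (g x) / nrm n (g x)) \<partial>uball n)"
      unfolding r(2) by (rule nn_integral_cong) (metis ng)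
    also have "\<dots> = (\<integral>\<^sup>+x. indicator A (nrm k x / nrm n x) \<partial>distr (uball n) borel g)"
      using gm by (subst nn_integral_distr) (auto cong: measurable_cong_sets)
    also have "\<dots> = (\<integral>\<^sup>+x. indicator A (nrm k x / nrm n x) \<partial>uball n)" by (simp add: rot_uball[OF r(1)])
    also have "\<dots> = (\<integral>\<^sup>+t. indicator A t \<partial>distr (uball n) borel (\<lambda>x. nrm k x / nrm n x))"
      by (subst nn_integral_distr) auto
    also have "\<dots> = emeasure (distr (uball n) borel (\<lambda>x. nrm k x / nrm n x)) A" by simp
    finally show "(\<integral>\<^sup>+x. indicator A (nrm n (proj n E x) / nrm n x) \<partial>uball n) =
       emeasure (distr (uball n) borel (\<lambda>x. nrm k x / nrm n x)) A" .
  qed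
  also have "\<dots> = emeasure (distr (uball n) borel (\<lambda>x. nrm k x / nrm n x)) A"
    by (simp add: \<mu>.emeasure_space_1)
  finally show "emeasure ?\<rho> A = emeasure (distr (uball n) borel (\<lambda>x. nrm k x / nrm n x)) A" .
qed simp

text \<open>
  Direction and norm are independent under the uniform distribution.
\<close>

lemma partial_norm_law:
  "distr (uball n) borel (nrm k) =
   distr (distr (uball n) borel (\<lambda>x. nrm k x / nrm n x) \<Otimes>\<^sub>M distr (uball n) borel (nrm n)) borel (\<lambda>(r, v). r * v)"
proof -
  interpret g: gauge n "nrm n" by (rule gauge_nrm) (use k in simp)
  have gU: "g.U = uball n" by (simp add: g.U_def uball_def)
  have "distr (uball n) borel (\<lambda>x. nrm k x / nrm n x) \<Otimes>\<^sub>M distr (uball n) borel (nrm n) =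
     distr (uball n) (borel \<Otimes>\<^sub>M borel) (\<lambda>x. (nrm k x / nrm n x, nrm n x))"
    unfolding gU[symmetric] by (rule g.cone_gauge_independent) (auto simp: nrm_scale)
  then have "distr (distr (uball n) borel (\<lambda>x. nrm k x / nrm n x) \<Otimes>\<^sub>M distr (uball n) borel (nrm n)) borel (\<lambda>(r, v). r * v) =
     distr (uball n) borel (\<lambda>x. nrm k x / nrm n x * nrm n x)"
    by (simp add: distr_distr comp_def)
  also have "(\<lambda>x. nrm k x / nrm n x * nrm n x) = nrm k"
  proof
    fix x
    have "nrm k x = 0" if "nrm n x = 0" using nrm_mono[OF k(2), of x] that nrm_nonneg[of k x] by simp
    then show "nrm k x / nrm n x * nrm n x = nrm k x" by (cases "nrm n x = 0") auto
  qed
  finally show ?thesis by simp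
qed

end

section \<open>Uniform points of lp balls\<close>

lemma lp_norm_ereal: "lp_norm n (ereal q) x = (\<Sum>i<n. \<bar>x i\<bar> powr q) powr (1 / q)"
  by (simp add: lp_norm_def)

lemma lp_norm_infty: "lp_norm n \<infinity> x = Max ((\<lambda>i. \<bar>x i\<bar>) ` {..<n})"
  by (simp add: lp_norm_def)

lemma lp_norm_2: "lp_norm n 2 x = nrm n x"
proof -
  have "(2::ereal) = ereal 2" by simp
  then have "lp_norm n 2 x = (\<Sum>i<n. \<bar>x i\<bar> powr 2) powr (1 / 2)" by (simp only: lp_norm_ereal)
  also have "(\<Sum>i<n. \<bar>x i\<bar> powr 2) = dot n x x"
    unfolding dot_def by (intro sum.cong) (auto simp: power2_eq_square)
  also have "dot n x x powr (1 / 2) = nrm n x" using dot_nonneg[of n x] by (simp add: nrm_def powr_half_sqrt)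
  finally show ?thesis .
qed

text \<open>
  The tangent to \<open>s\<^sup>r\<close> at \<open>m\<close> lies below the graph. For \<open>s > 0\<close> this is Young's inequality.
\<close>

lemma powr_tangent:
  fixes s m r :: real
  assumes "0 \<le> s" "0 < m" "1 \<le> r"
  shows "m powr r + r * m powr (r - 1) * (s - m) \<le> s powr r"
proof (cases "s = 0")
  case True
  have "m powr (r - 1) * m powr 1 = m powr r" by (subst powr_add[symmetric]) simp
  then have e: "m powr (r - 1) * m = m powr r" using assms by simp
  have "m powr r + r * m powr (r - 1) * (s - m) = m powr r - r * (m powr (r - 1) * m)"
    using True by (simp add: algebra_simps)
  also have "\<dots> = (1 - r) * m powr r" unfolding e by (simp add: algebra_simps)
  also have "\<dots> \<le> 0" using assms by (intro mult_nonpos_nonneg) auto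
  finally show ?thesis by (auto intro: order_trans)
next
  case False
  have "(s powr r) powr (1 / r) * (m powr r) powr (1 - 1 / r) \<le> 1 / r * (s powr r) + (1 - 1 / r) * (m powr r)"
    using assms False by (intro Youngs_inequality_0) auto
  moreover have "(s powr r) powr (1 / r) = s" using assms by (simp add: powr_powr)
  moreover have "(m powr r) powr (1 - 1 / r) = m powr (r - 1)" using assms by (simp add: powr_powr right_diff_distrib)
  ultimately have "s * m powr (r - 1) \<le> 1 / r * (s powr r) + (1 - 1 / r) * (m powr r)" by simp
  then have "r * (s * m powr (r - 1)) \<le> r * (1 / r * (s powr r) + (1 - 1 / r) * (m powr r))"
    using assms by (intro mult_left_mono) auto
  also have "\<dots> = s powr r + (r - 1) * m powr r" using assms by (simp add: field_simps)
  finally have 1: "r * (s * m powr (r - 1)) \<le> s powr r + (r - 1) * m powr r" .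
  have "m powr r = m powr (r - 1) * m powr 1" by (subst powr_add[symmetric]) simp
  then have 2: "m powr r = m powr (r - 1) * m" using assms by simp
  show ?thesis using 1 unfolding 2 by (simp add: algebra_simps)
qed

text \<open>
  Jensen's inequality: sum the tangent inequalities at the mean.
\<close>

lemma power_mean:
  fixes s :: "nat \<Rightarrow> real"
  assumes "\<And>i. i < n \<Longrightarrow> 0 \<le> s i" "1 \<le> r" "n \<ge> 1"
  shows "((\<Sum>i<n. s i) / n) powr r \<le> (\<Sum>i<n. s i powr r) / n"
proof -
  define m where "m = (\<Sum>i<n. s i) / n"
  have m0: "m \<ge> 0" unfolding m_def using assms(1) by (intro divide_nonneg_nonneg sum_nonneg) auto
  show ?thesis
  proof (cases "m = 0")
    case True
    then show ?thesis unfolding m_def[symmetric] using assms by (auto intro!: divide_nonneg_nonneg sum_nonneg)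
  next
    case False
    with m0 have m: "m > 0" by simp
    have sm: "(\<Sum>i<n. s i) = real n * m" using assms(3) by (simp add: m_def)
    have "real n * m powr r = (\<Sum>i<n. m powr r + r * m powr (r - 1) * (s i - m))"
      using sm by (simp add: sum.distrib sum_distrib_left[symmetric] sum_subtractf)
    also have "\<dots> \<le> (\<Sum>i<n. s i powr r)"
      using assms m by (intro sum_mono powr_tangent) auto
    finally show ?thesis unfolding m_def[symmetric] using assms(3) by (simp add: pos_le_divide_eq mult.commute)
  qed
qed

definition norm_scale :: "nat \<Rightarrow> ereal \<Rightarrow> real" where
  "norm_scale n p = real n powr (real_of_ereal (1 / p) - 1 / 2)"

lemma norm_scale_pos: "n \<ge> 1 \<Longrightarrow> norm_scale n p > 0"
  by (simp add: norm_scale_def)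

lemma p_cases:
  assumes "2 \<le> (p::ereal)"
  obtains q where "p = ereal q" "2 \<le> q" | "p = \<infinity>"
  using assms by (cases p) auto

lemma norm_scale_ereal: "q > 0 \<Longrightarrow> norm_scale n (ereal q) = real n powr (1 / q - 1 / 2)"
  by (simp add: norm_scale_def one_ereal_def)

lemma norm_scale_infty: "norm_scale n \<infinity> = real n powr (- (1 / 2))"
  by (simp add: norm_scale_def)

text \<open>
  Power means increase with the exponent. In particular the normalised norm of a point of the
  unit ball is at most \<open>1\<close>.
\<close>

lemma scaled_nrm_le:
  assumes p: "2 \<le> p" and n: "n \<ge> 1"
  shows "norm_scale n p * nrm n x \<le> lp_norm n p x"
  using p
proof (cases rule: p_cases)
  case (1 q)
  have "(dot n x x / n) powr (q / 2) \<le> (\<Sum>i<n. \<bar>x i\<bar> powr q) / n"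
  proof -
    have "((\<Sum>i<n. (x i)\<^sup>2) / n) powr (q / 2) \<le> (\<Sum>i<n. ((x i)\<^sup>2) powr (q / 2)) / n"
      using 1 n by (intro power_mean) auto
    moreover have "((x i)\<^sup>2) powr (q / 2) = \<bar>x i\<bar> powr q" for i
    proof -
      have "(x i)\<^sup>2 = \<bar>x i\<bar> powr 2" by simp
      then show ?thesis by (simp only: powr_powr) simp
    qed
    ultimately show ?thesis by (simp add: dot_def power2_eq_square)
  qed
  then have "((dot n x x / n) powr (q / 2)) powr (1 / q) \<le> ((\<Sum>i<n. \<bar>x i\<bar> powr q) / n) powr (1 / q)"
    using 1 by (intro powr_mono2) auto
  moreover have "((dot n x x / n) powr (q / 2)) powr (1 / q) = nrm n x / sqrt n"
    using 1 dot_nonneg[of n x] by (simp add: powr_powr powr_half_sqrt nrm_def real_sqrt_divide)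
  moreover have "((\<Sum>i<n. \<bar>x i\<bar> powr q) / n) powr (1 / q) = lp_norm n p x / n powr (1 / q)"
    using 1 by (simp add: lp_norm_ereal powr_divide sum_nonneg)
  ultimately have "nrm n x / sqrt n \<le> lp_norm n p x / n powr (1 / q)" by simp
  then have "n powr (1 / q) * (nrm n x / sqrt n) \<le> n powr (1 / q) * (lp_norm n p x / n powr (1 / q))"
    by (intro mult_left_mono) auto
  also have "\<dots> = lp_norm n p x" using n by simp
  also have "n powr (1 / q) * (nrm n x / sqrt n) = norm_scale n p * nrm n x"
    using 1 n by (simp add: norm_scale_ereal powr_diff powr_half_sqrt)
  finally show ?thesis .
next
  case 2
  let ?N = "lp_norm n p x"
  have le: "\<bar>x i\<bar> \<le> ?N" if "i < n" for i unfolding 2 lp_norm_infty using that by (intro Max_ge) auto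
  have N0: "0 \<le> ?N" using le[of 0] n by linarith
  have "dot n x x \<le> (\<Sum>i<n. ?N\<^sup>2)"
    unfolding dot_def power2_eq_square[symmetric]
    using le N0 by (intro sum_mono) (auto simp: abs_le_square_iff[symmetric])
  then have "nrm n x \<le> sqrt (real n * ?N\<^sup>2)" by (simp add: nrm_def)
  also have "\<dots> = sqrt n * ?N" using N0 by (simp add: real_sqrt_mult)
  finally have "nrm n x / sqrt n \<le> ?N" using n by (simp add: pos_divide_le_eq mult.commute)
  moreover have "norm_scale n p = 1 / sqrt n"
    unfolding 2 norm_scale_infty powr_minus_divide using n by (simp add: powr_half_sqrt)
  ultimately show ?thesis by simp
qed

lemma lp_norm_small:
  assumes p: "2 \<le> p" and n: "n \<ge> 1" and x: "\<And>i. i < n \<Longrightarrow> \<bar>x i\<bar> \<le> 1 / real n"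
  shows "lp_norm n p x \<le> 1"
  using p
proof (cases rule: p_cases)
  case (1 q)
  have "(\<Sum>i<n. \<bar>x i\<bar> powr q) \<le> (\<Sum>i<n. 1 / real n)"
  proof (rule sum_mono)
    fix i assume "i \<in> {..<n}"
    then have xi: "\<bar>x i\<bar> \<le> 1 / real n" using x by simp
    have "\<bar>x i\<bar> powr q \<le> (1 / real n) powr q" using 1 xi by (intro powr_mono2) auto
    also have "\<dots> \<le> (1 / real n) powr 1" using 1 n by (intro powr_mono') auto
    finally show "\<bar>x i\<bar> powr q \<le> 1 / real n" using n by simp
  qed
  then have "(\<Sum>i<n. \<bar>x i\<bar> powr q) \<le> 1" using n by simp
  then have "(\<Sum>i<n. \<bar>x i\<bar> powr q) powr (1 / q) \<le> 1 powr (1 / q)"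
    using 1 by (intro powr_mono2) (auto intro: sum_nonneg)
  then show ?thesis using 1 by (simp add: lp_norm_ereal)
next
  case 2
  have "1 / real n \<le> 1" using n by simp
  then have "\<bar>x i\<bar> \<le> 1" if "i < n" for i using x[OF that] by linarith
  then show ?thesis unfolding 2 lp_norm_infty using n by (subst Max_le_iff) (auto simp: lessThan_empty_iff)
qed

lemma measurable_lp_norm [measurable]:
  assumes p: "2 \<le> p" shows "lp_norm n p \<in> borel_measurable borel"
  using p
proof (cases rule: p_cases)
  case (1 q) then show ?thesis unfolding 1 lp_norm_ereal[abs_def] by measurable
next
  case 2 show ?thesis unfolding 2 lp_norm_infty by measurable
qed

text \<open>
  The unit ball lies between two Euclidean balls.
\<close>

lemma gauge_lp_norm:
  assumes p: "2 \<le> p" and n: "n \<ge> 1"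
  shows "gauge n (lp_norm n p)"
proof
  show "lp_norm n p \<in> borel_measurable borel" using p by (rule measurable_lp_norm)
  show nn: "0 \<le> lp_norm n p x" for x
    using scaled_nrm_le[OF p n, of x] norm_scale_pos[OF n, of p] nrm_nonneg[of n x]
    by (meson order_trans less_imp_le mult_nonneg_nonneg)
  show "lp_norm n p (\<lambda>i. c * x i) = c * lp_norm n p x" if c: "c > 0" for c x
    using p
  proof (cases rule: p_cases)
    case (1 q)
    have "(\<Sum>i<n. \<bar>c * x i\<bar> powr q) = c powr q * (\<Sum>i<n. \<bar>x i\<bar> powr q)"
      using c by (simp add: abs_mult powr_mult sum_distrib_left)
    then show ?thesis using 1 c by (simp add: lp_norm_ereal powr_mult sum_nonneg powr_powr)
  next
    case 2
    have "Max ((\<lambda>t. c * t) ` (\<lambda>i. \<bar>x i\<bar>) ` {..<n}) = c * Max ((\<lambda>i. \<bar>x i\<bar>) ` {..<n})"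
      using c n by (intro mono_Max_commute[symmetric]) (auto simp: mono_def lessThan_empty_iff)
    then show ?thesis using c by (simp add: 2 lp_norm_infty image_image abs_mult)
  qed
  have m: "{x. lp_norm n p x \<le> 1} \<in> sets borel" using measurable_lp_norm[OF p, of n] by measurable
  have "emeasure (lebesgue_Rn n) {x. lp_norm n p x \<le> 1} \<le> emeasure (lebesgue_Rn n) {x. dot n x x \<le> (1 / norm_scale n p)\<^sup>2}"
  proof (rule emeasure_mono)
    show "{x. lp_norm n p x \<le> 1} \<subseteq> {x. dot n x x \<le> (1 / norm_scale n p)\<^sup>2}"
    proof safe
      fix x assume "lp_norm n p x \<le> 1"
      then have "norm_scale n p * nrm n x \<le> 1" using scaled_nrm_le[OF p n, of x] by simp
      then have "nrm n x \<le> 1 / norm_scale n p" using norm_scale_pos[OF n, of p] by (simp add: pos_le_divide_eq mult.commute)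
      then show "dot n x x \<le> (1 / norm_scale n p)\<^sup>2" using norm_scale_pos[OF n, of p] by (subst (asm) nrm_le_iff) auto
    qed
  qed measurable
  also have "\<dots> < \<infinity>" using norm_scale_pos[OF n, of p] by (subst emeasure_euclid_ball) auto
  finally show "emeasure (lebesgue_Rn n) {x. lp_norm n p x \<le> 1} \<noteq> \<infinity>" by simp
  have "0 < emeasure (lebesgue_Rn n) {x. dot n x x \<le> (1 / real n)\<^sup>2}"
    using n ball_vol_pos[of "{..<n}"] by (subst emeasure_euclid_ball) auto
  also have "\<dots> \<le> emeasure (lebesgue_Rn n) {x. lp_norm n p x \<le> 1}"
  proof (rule emeasure_mono)
    show "{x. dot n x x \<le> (1 / real n)\<^sup>2} \<subseteq> {x. lp_norm n p x \<le> 1}"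
    proof safe
      fix x assume d: "dot n x x \<le> (1 / real n)\<^sup>2"
      show "lp_norm n p x \<le> 1"
      proof (rule lp_norm_small[OF p n])
        fix i assume "i < n"
        then have "(x i)\<^sup>2 \<le> dot n x x" unfolding dot_sqsum sqsum_def by (intro member_le_sum) auto
        then have "(x i)\<^sup>2 \<le> (1 / real n)\<^sup>2" using d by simp
        then show "\<bar>x i\<bar> \<le> 1 / real n" by (simp add: abs_le_square_iff[symmetric])
      qed
    qed
  qed (use m in simp)
  finally show "emeasure (lebesgue_Rn n) {x. lp_norm n p x \<le> 1} \<noteq> 0" by simp
qed (fact n)

lemma uniform_lp_ball_gauge:
  assumes p: "2 \<le> p" and n: "n \<ge> 1"
  shows "uniform_lp_ball n p = gauge.U n (lp_norm n p)"
proof -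
  interpret g: gauge n "lp_norm n p" by (rule gauge_lp_norm[OF p n])
  have m: "{x. lp_norm n p x \<le> 1} \<in> sets borel" using measurable_lp_norm[OF p, of n] by measurable
  have b: "lp_ball n p = Rn n \<inter> {x. lp_norm n p x \<le> 1}" by (auto simp: lp_ball_def)
  have mb: "lp_ball n p \<in> sets borel" unfolding b using m by auto
  have eq: "emeasure (lebesgue_Rn n) (lp_ball n p \<inter> A) = emeasure (lebesgue_Rn n) ({x. lp_norm n p x \<le> 1} \<inter> A)"
    if "A \<in> sets borel" for A
    using AE_lebesgue_Rn[of n] that m mb by (intro emeasure_eq_AE) (auto elim!: eventually_mono simp: b)
  show ?thesis
  proof (rule measure_eqI)
    show "sets (uniform_lp_ball n p) = sets g.U" by (simp add: uniform_lp_ball_def uniform_measure_def)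
    fix A assume "A \<in> sets (uniform_lp_ball n p)"
    then have A: "A \<in> sets borel" by (simp add: uniform_lp_ball_def uniform_measure_def)
    have "emeasure (uniform_lp_ball n p) A =
        emeasure (lebesgue_Rn n) (lp_ball n p \<inter> A) / emeasure (lebesgue_Rn n) (lp_ball n p)"
      unfolding uniform_lp_ball_def using A mb by (intro emeasure_uniform_measure) auto
    also have "\<dots> = emeasure (lebesgue_Rn n) ({x. lp_norm n p x \<le> 1} \<inter> A) /
        emeasure (lebesgue_Rn n) {x. lp_norm n p x \<le> 1}"
      using eq[OF A] eq[of UNIV] by simp
    also have "\<dots> = emeasure g.U A"
      unfolding g.U_def using A m by (intro emeasure_uniform_measure[symmetric]) auto
    finally show "emeasure (uniform_lp_ball n p) A = emeasure g.U A" .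
  qed
qed

text \<open>
  Write \<open>exp (- h)\<close> as the integral of \<open>exp (- t)\<close> over \<open>t \<ge> h\<close> and exchange the integrals. This
  reduces integrals of a function of a homogeneous quantity to volumes of sublevel sets.
\<close>

lemma layer_cake_exp:
  assumes "sigma_finite_measure M" and [measurable]: "h \<in> borel_measurable M" and C[measurable]: "C \<in> sets M" and h0: "\<And>x. 0 \<le> h x"
  shows "(\<integral>\<^sup>+x. ennreal (exp (- h x)) * indicator C x \<partial>M) =
     (\<integral>\<^sup>+t. ennreal (exp (- t)) * indicator {0..} t * emeasure M {x\<in>space M. x \<in> C \<and> h x \<le> t} \<partial>lborel)"
proof -
  interpret M: sigma_finite_measure M by fact
  interpret P: pair_sigma_finite M "lborel :: real measure" ..
  have e: "ennreal (exp (- a)) = (\<integral>\<^sup>+t. ennreal (exp (- t)) * indicator {a..} t \<partial>lborel)" for a :: real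
  proof -
    have "((\<lambda>t::real. - exp (- t)) \<longlongrightarrow> - 0) at_top"
      by (intro tendsto_minus filterlim_compose[OF exp_at_bot] filterlim_uminus_at_bot_at_top)
    then have "(\<integral>\<^sup>+t. ennreal (exp (- t)) * indicator {a..} t \<partial>lborel) = ennreal (- 0 - (- exp (- a)))"
      by (intro nn_integral_FTC_atLeast) (auto intro!: derivative_eq_intros)
    then show ?thesis by simp
  qed
  have "(\<integral>\<^sup>+x. ennreal (exp (- h x)) * indicator C x \<partial>M) =
      (\<integral>\<^sup>+x. (\<integral>\<^sup>+t. ennreal (exp (- t)) * indicator {h x..} t * indicator C x \<partial>lborel) \<partial>M)"
  proof (intro nn_integral_cong)
    fix x
    have "(\<integral>\<^sup>+t. ennreal (exp (- t)) * indicator {h x..} t * indicator C x \<partial>lborel) =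
        (\<integral>\<^sup>+t. ennreal (exp (- t)) * indicator {h x..} t \<partial>lborel) * indicator C x"
      by (rule nn_integral_multc) simp
    also have "\<dots> = ennreal (exp (- h x)) * indicator C x" by (simp only: e[symmetric])
    finally show "ennreal (exp (- h x)) * indicator C x =
        (\<integral>\<^sup>+t. ennreal (exp (- t)) * indicator {h x..} t * indicator C x \<partial>lborel)" ..
  qed
  also have "\<dots> = (\<integral>\<^sup>+t. (\<integral>\<^sup>+x. ennreal (exp (- t)) * indicator {h x..} t * indicator C x \<partial>M) \<partial>lborel)"
  proof -
    have "(\<lambda>p. ennreal (exp (- snd p)) * (if h (fst p) \<le> snd p then 1 else 0) * indicator C (fst p)) \<in> borel_measurable (M \<Otimes>\<^sub>M (lborel :: real measure))"
      by measurable
    also have "(\<lambda>p. ennreal (exp (- snd p)) * (if h (fst p) \<le> snd p then 1 else 0) * indicator C (fst p)) =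
      (\<lambda>(x, t). ennreal (exp (- t)) * indicator {h x..} t * indicator C x)"
      by (auto simp: fun_eq_iff indicator_def)
    finally show ?thesis by (rule P.Fubini'[symmetric])
  qed
  also have "\<dots> = (\<integral>\<^sup>+t. ennreal (exp (- t)) * indicator {0..} t * emeasure M {x\<in>space M. x \<in> C \<and> h x \<le> t} \<partial>lborel)"
  proof (intro nn_integral_cong)
    fix t :: real
    have "(\<integral>\<^sup>+x. ennreal (exp (- t)) * indicator {h x..} t * indicator C x \<partial>M) =
       (\<integral>\<^sup>+x. (ennreal (exp (- t)) * indicator {0..} t) * indicator {x\<in>space M. x \<in> C \<and> h x \<le> t} x \<partial>M)"
    proof (intro nn_integral_cong)
      fix x assume "x \<in> space M"
      then show "ennreal (exp (- t)) * indicator {h x..} t * indicator C x =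
        (ennreal (exp (- t)) * indicator {0..} t) * indicator {x\<in>space M. x \<in> C \<and> h x \<le> t} x"
      proof (cases "x \<in> C \<and> h x \<le> t")
        case True
        then have "0 \<le> t" using h0[of x] by linarith
        then show ?thesis using True \<open>x \<in> space M\<close> by simp
      qed (auto simp: indicator_def)
    qed
    also have "\<dots> = (ennreal (exp (- t)) * indicator {0..} t) * emeasure M {x\<in>space M. x \<in> C \<and> h x \<le> t}"
      by (intro nn_integral_cmult_indicator) measurable
    finally show "(\<integral>\<^sup>+x. ennreal (exp (- t)) * indicator {h x..} t * indicator C x \<partial>M) = \<dots>" .
  qed
  finally show ?thesis .
qed

lemma f_dens_const_pos: "(q::real) \<ge> 2 \<Longrightarrow> 0 < 2 * q powr (1 / q) * Gamma (1 + 1 / q)"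
  by (intro mult_pos_pos Gamma_real_pos) (auto intro: add_pos_pos)

lemma f_dens_pos: "q \<ge> 2 \<Longrightarrow> 0 < f_dens q x"
  unfolding f_dens_def by (intro mult_pos_pos divide_pos_pos f_dens_const_pos) auto

lemma f_dens_nonneg: "q \<ge> 2 \<Longrightarrow> 0 \<le> f_dens q x"
  by (rule less_imp_le[OF f_dens_pos])

lemma measurable_f_dens [measurable]: "f_dens q \<in> borel_measurable borel"
  unfolding f_dens_def by measurable

definition f_law :: "real \<Rightarrow> real measure" where
  "f_law q = density lborel (\<lambda>x. ennreal (f_dens q x))"

lemma sets_f_law [simp, measurable_cong]: "sets (f_law q) = sets borel"
  by (simp add: f_law_def)

lemma space_f_law [simp]: "space (f_law q) = UNIV"
  by (simp add: f_law_def)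

text \<open>
  By the layer cake formula the normalisation is the Gamma integral for \<open>Gamma (1 + 1 / q)\<close>.
\<close>

lemma prob_f_law:
  assumes q: "q \<ge> 2" shows "prob_space (f_law q)"
proof
  let ?c = "2 * q powr (1 / q) * Gamma (1 + 1 / q)"
  have c: "?c > 0" by (rule f_dens_const_pos[OF q])
  have "(\<integral>\<^sup>+x. ennreal (exp (- (\<bar>x\<bar> powr q / q))) * indicator UNIV x \<partial>lborel) =
      (\<integral>\<^sup>+t. ennreal (exp (- t)) * indicator {0..} t * emeasure lborel {x\<in>space lborel. x \<in> UNIV \<and> \<bar>x\<bar> powr q / q \<le> t} \<partial>lborel)"
    using q by (intro layer_cake_exp sigma_finite_lborel) auto
  also have "\<dots> = (\<integral>\<^sup>+t. ennreal (2 * q powr (1 / q)) * ennreal (indicator {0..} t * t powr (1 + 1 / q - 1) / exp t) \<partial>lborel)"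
  proof (intro nn_integral_cong)
    fix t :: real
    show "ennreal (exp (- t)) * indicator {0..} t * emeasure lborel {x\<in>space lborel. x \<in> UNIV \<and> \<bar>x\<bar> powr q / q \<le> t} =
      ennreal (2 * q powr (1 / q)) * ennreal (indicator {0..} t * t powr (1 + 1 / q - 1) / exp t)"
    proof (cases "t \<ge> 0")
      case True
      let ?r = "(q * t) powr (1 / q)"
      have eqv: "\<bar>x\<bar> powr q / q \<le> t \<longleftrightarrow> \<bar>x\<bar> \<le> ?r" for x
      proof -
        have "\<bar>x\<bar> powr q / q \<le> t \<longleftrightarrow> \<bar>x\<bar> powr q \<le> q * t" using q by (simp add: pos_divide_le_eq mult.commute)
        also have "\<dots> \<longleftrightarrow> \<bar>x\<bar> \<le> ?r"
        proof
          assume "\<bar>x\<bar> powr q \<le> q * t"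
          then have "(\<bar>x\<bar> powr q) powr (1 / q) \<le> ?r" using q by (intro powr_mono2) auto
          then show "\<bar>x\<bar> \<le> ?r" using q by (simp add: powr_powr)
        next
          assume "\<bar>x\<bar> \<le> ?r"
          then have "\<bar>x\<bar> powr q \<le> ?r powr q" using q by (intro powr_mono2) auto
          then show "\<bar>x\<bar> powr q \<le> q * t" using q True by (simp add: powr_powr)
        qed
        finally show ?thesis .
      qed
      have "{x\<in>space lborel. x \<in> UNIV \<and> \<bar>x\<bar> powr q / q \<le> t} = {x. \<bar>x\<bar> \<le> ?r}"
        by (intro set_eqI) (simp only: mem_Collect_eq eqv space_lborel space_borel UNIV_I simp_thms)
      also have "\<dots> = {- ?r..?r}" by auto
      finally have "{x\<in>space lborel. x \<in> UNIV \<and> \<bar>x\<bar> powr q / q \<le> t} = {- ?r..?r}" .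
      then have A: "emeasure lborel {x\<in>space lborel. x \<in> UNIV \<and> \<bar>x\<bar> powr q / q \<le> t} = ennreal (2 * ?r)"
        by (simp only:) simp
      have "ennreal (exp (- t)) * indicator {0..} t * ennreal (2 * ?r) = ennreal (exp (- t) * (2 * ?r))"
        using True by (subst ennreal_mult) auto
      also have "exp (- t) * (2 * ?r) = (2 * q powr (1 / q)) * (t powr (1 / q) / exp t)"
        using True q by (simp add: powr_mult exp_minus divide_inverse)
      also have "ennreal \<dots> = ennreal (2 * q powr (1 / q)) * ennreal (t powr (1 / q) / exp t)"
        by (rule ennreal_mult) auto
      finally show ?thesis unfolding A using True by simp
    qed simp
  qed
  also have "\<dots> = ennreal (2 * q powr (1 / q)) * ennreal (Gamma (1 + 1 / q))"
    using q by (subst nn_integral_cmult) (auto simp: Gamma_conv_nn_integral_real add_pos_pos)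
  also have "\<dots> = ennreal ?c" using q by (subst ennreal_mult[symmetric]) (auto intro!: less_imp_le Gamma_real_pos add_pos_pos)
  finally have I: "(\<integral>\<^sup>+x. ennreal (exp (- (\<bar>x\<bar> powr q / q))) \<partial>lborel) = ennreal ?c" by simp
  have "emeasure (f_law q) (space (f_law q)) = (\<integral>\<^sup>+x. ennreal (f_dens q x) \<partial>lborel)"
    unfolding f_law_def by (subst emeasure_density) auto
  also have "\<dots> = (\<integral>\<^sup>+x. ennreal (1 / ?c) * ennreal (exp (- (\<bar>x\<bar> powr q / q))) \<partial>lborel)"
  proof (intro nn_integral_cong)
    fix x
    have "f_dens q x = 1 / ?c * exp (- (\<bar>x\<bar> powr q / q))" by (simp add: f_dens_def)
    then show "ennreal (f_dens q x) = ennreal (1 / ?c) * ennreal (exp (- (\<bar>x\<bar> powr q / q)))"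
      using c by (simp only:) (intro ennreal_mult, auto)
  qed
  also have "\<dots> = ennreal (1 / ?c) * ennreal ?c" by (subst nn_integral_cmult) (auto simp: I)
  also have "\<dots> = 1" using c by (subst ennreal_mult[symmetric]) auto
  finally show "emeasure (f_law q) (space (f_law q)) = 1" .
qed

lemma measurable_zero_fill': "sets M = sets borel \<Longrightarrow> zero_fill n \<in> borel_measurable (iid M n)"
proof (rule measurable_fun_borelI)
  fix i assume M: "sets M = sets borel"
  show "(\<lambda>x. zero_fill n x i) \<in> borel_measurable (iid M n)"
  proof (cases "i < n")
    case True
    have "(\<lambda>x. x i) \<in> measurable (iid M n) M" using True by (intro measurable_component_singleton) simp
    also have "measurable (iid M n) M = borel_measurable (iid M n)"
      using M by (intro measurable_cong_sets) auto
    finally show ?thesis using True by (simp add: zero_fill_def)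
  qed (simp add: zero_fill_def)
qed

lemma mult_eq_divide_ennreal:
  fixes K X V :: ennreal
  assumes "K * V = 1" "V \<noteq> 0" "V \<noteq> \<infinity>"
  shows "K * X = X / V"
proof -
  have "K * X = K * X * V / V" using assms by (intro ennreal_mult_divide_eq[symmetric]) auto
  also have "K * X * V = X * (K * V)" by (simp only: mult_ac)
  finally show ?thesis using assms(1) by simp
qed

lemma product_density_zero_fill:
  assumes w: "w \<in> borel_measurable borel" and pr: "prob_space (density lborel (\<lambda>x. ennreal (w x)))"
    and w0: "\<And>x. 0 \<le> w x" and A: "A \<in> sets borel"
  shows "emeasure (distr (PiM {..<n} (\<lambda>_. density lborel (\<lambda>x. ennreal (w x)))) borel (zero_fill n)) A =
     (\<integral>\<^sup>+x. ennreal (\<Prod>i<n. w (x i)) * indicator A x \<partial>lebesgue_Rn n)"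
proof -
  note [measurable] = w A
  let ?P = "PiM {..<n} (\<lambda>_. density lborel (\<lambda>x. ennreal (w x)))"
  have zf: "zero_fill n \<in> borel_measurable ?P" by (rule measurable_zero_fill') simp
  have P: "?P = density (lbPi {..<n}) (\<lambda>x. \<Prod>i<n. ennreal (w (x i)))"
    using w by (intro PiM_density prob_space_imp_sigma_finite pr sigma_finite_lborel) auto
  have [measurable]: "(\<lambda>x. x i) \<in> borel_measurable (lbPi {..<n})" if "i < n" for i
    using that by (intro coord_lbPi) simp
  have pm: "(\<lambda>x. \<Prod>i<n. ennreal (w (x i))) \<in> borel_measurable (lbPi {..<n})"
    by (intro borel_measurable_prod_ennreal measurable_compose[OF _ measurable_compose[OF w measurable_ennreal]]) (auto intro: coord_lbPi)
  have B: "zero_fill n -` A \<inter> space (lbPi {..<n}) \<in> sets (lbPi {..<n})" by measurable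
  have "emeasure (distr ?P borel (zero_fill n)) A = emeasure ?P (zero_fill n -` A \<inter> space ?P)"
    using zf A by (rule emeasure_distr)
  also have "zero_fill n -` A \<inter> space ?P = zero_fill n -` A \<inter> space (lbPi {..<n})" by (simp add: space_PiM)
  also have "emeasure ?P (zero_fill n -` A \<inter> space (lbPi {..<n})) =
      (\<integral>\<^sup>+x. (\<Prod>i<n. ennreal (w (x i))) * indicator (zero_fill n -` A \<inter> space (lbPi {..<n})) x \<partial>lbPi {..<n})"
    unfolding P using pm B by (rule emeasure_density)
  also have "\<dots> = (\<integral>\<^sup>+x. ennreal (\<Prod>i<n. w (zero_fill n x i)) * indicator A (zero_fill n x) \<partial>lbPi {..<n})"
    by (intro nn_integral_cong) (auto simp: prod_ennreal w0 zero_fill_def indicator_def)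
  also have "\<dots> = (\<integral>\<^sup>+x. ennreal (\<Prod>i<n. w (x i)) * indicator A x \<partial>lebesgue_Rn n)"
    unfolding lebesgue_Rn_eq by (subst nn_integral_distr) auto
  finally show ?thesis .
qed

text \<open>
  The density of the sample is a function of the \<open>q\<close>-norm. By the layer cake formula its mass
  of a cone is thus a constant times the volume of the part of the cone in the unit ball, as
  for the uniform distribution, and sets defined by \<open>T\<close> are cones.
\<close>

lemma cone_law_f_law:
  assumes q: "q \<ge> 2" and n: "n \<ge> 1" and T[measurable]: "T \<in> borel_measurable borel" and inv: "\<And>c x. c > 0 \<Longrightarrow> T (\<lambda>i. c * x i) = (T x :: real)"
  shows "distr (distr (iid (f_law q) n) borel (zero_fill n)) borel T = distr (uniform_lp_ball n (ereal q)) borel T"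
proof -
  have p2: "2 \<le> ereal q" using q by simp
  interpret g: gauge n "lp_norm n (ereal q)" by (rule gauge_lp_norm[OF p2 n])
  let ?N = "lp_norm n (ereal q)"
  let ?L = "lebesgue_Rn n"
  have Nm[measurable]: "?N \<in> borel_measurable borel" by (rule measurable_lp_norm[OF p2])
  let ?c = "1 / (2 * q powr (1 / q) * Gamma (1 + 1 / q))"
  let ?Z = "distr (iid (f_law q) n) borel (zero_fill n)"
  have zf: "zero_fill n \<in> borel_measurable (iid (f_law q) n)" by (rule measurable_zero_fill') simp
  have N_pow: "?N x powr q = (\<Sum>i<n. \<bar>x i\<bar> powr q)" for x
    using q by (simp add: lp_norm_ereal powr_powr sum_nonneg)
  have pf: "(\<Prod>i<n. f_dens q (x i)) = ?c ^ n * exp (- (?N x powr q / q))" for x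
    unfolding f_dens_def prod.distrib exp_sum[OF finite_lessThan, symmetric] N_pow by (simp add: sum_negf sum_divide_distrib)
  define K where "K = (\<integral>\<^sup>+t. ennreal (?c ^ n) * (ennreal (exp (- t)) * indicator {0..} t * ennreal ((q * t) powr (1 / q)) ^ n) \<partial>lborel)"
  have c0: "?c > 0" using f_dens_const_pos[OF q] by simp
  have cone: "emeasure ?Z C = K * emeasure ?L {x\<in>C. ?N x \<le> 1}"
    if C[measurable]: "C \<in> sets borel" and cC: "\<And>c x. c > 0 \<Longrightarrow> (\<lambda>i. c * x i) \<in> C \<longleftrightarrow> x \<in> C" for C
  proof -
    have "emeasure ?Z C = (\<integral>\<^sup>+x. ennreal (\<Prod>i<n. f_dens q (x i)) * indicator C x \<partial>?L)"
      unfolding f_law_def using q prob_f_law[OF q]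
      by (intro product_density_zero_fill) (auto simp: f_law_def f_dens_nonneg)
    also have "\<dots> = (\<integral>\<^sup>+x. ennreal (?c ^ n) * (ennreal (exp (- (?N x powr q / q))) * indicator C x) \<partial>?L)"
      unfolding pf using c0 by (intro nn_integral_cong) (simp add: ennreal_mult mult.assoc)
    also have "\<dots> = ennreal (?c ^ n) * (\<integral>\<^sup>+x. ennreal (exp (- (?N x powr q / q))) * indicator C x \<partial>?L)"
      by (intro nn_integral_cmult) measurable
    also have "(\<integral>\<^sup>+x. ennreal (exp (- (?N x powr q / q))) * indicator C x \<partial>?L) =
        (\<integral>\<^sup>+t. ennreal (exp (- t)) * indicator {0..} t * emeasure ?L {x\<in>space ?L. x \<in> C \<and> ?N x powr q / q \<le> t} \<partial>lborel)"
      using q by (intro layer_cake_exp sigma_finite_lebesgue_Rn) auto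
    also have "\<dots> = (\<integral>\<^sup>+t. ennreal (exp (- t)) * indicator {0..} t * ennreal ((q * t) powr (1 / q)) ^ n * emeasure ?L {x\<in>C. ?N x \<le> 1} \<partial>lborel)"
    proof (rule nn_integral_cong_AE)
      show "AE t in lborel. ennreal (exp (- t)) * indicator {0..} t * emeasure ?L {x\<in>space ?L. x \<in> C \<and> ?N x powr q / q \<le> t} =
        ennreal (exp (- t)) * indicator {0..} t * ennreal ((q * t) powr (1 / q)) ^ n * emeasure ?L {x\<in>C. ?N x \<le> 1}"
        using AE_lborel_singleton[of 0]
      proof eventually_elim
        case (elim t)
        show ?case
        proof (cases "t > 0")
          case True
          let ?r = "(q * t) powr (1 / q)"
          have r: "?r > 0" using True q by simp
          have "?N x powr q / q \<le> t \<longleftrightarrow> ?N x \<le> ?r" for x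
          proof -
            have "?N x powr q / q \<le> t \<longleftrightarrow> ?N x powr q \<le> q * t" using q by (simp add: pos_divide_le_eq mult.commute)
            also have "\<dots> \<longleftrightarrow> ?N x \<le> ?r"
            proof
              assume "?N x powr q \<le> q * t"
              then have "(?N x powr q) powr (1 / q) \<le> ?r" using q by (intro powr_mono2) auto
              then show "?N x \<le> ?r" using q g.N_nonneg[of x] by (simp add: powr_powr)
            next
              assume "?N x \<le> ?r"
              then have "?N x powr q \<le> ?r powr q" using q g.N_nonneg[of x] by (intro powr_mono2) auto
              then show "?N x powr q \<le> q * t" using q True by (simp add: powr_powr)
            qed
            finally show ?thesis .
          qed
          then have "{x\<in>space ?L. x \<in> C \<and> ?N x powr q / q \<le> t} = {x\<in>C. ?N x \<le> ?r}" by auto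
          then show ?thesis using g.cone_volume[OF C cC r] by (simp add: mult.assoc)
        qed (use elim in simp)
      qed
    qed
    also have "ennreal (?c ^ n) * \<dots> = K * emeasure ?L {x\<in>C. ?N x \<le> 1}"
    proof -
      let ?g = "\<lambda>t. ennreal (exp (- t)) * indicator {0..} t * ennreal ((q * t) powr (1 / q)) ^ n"
      have gp: "(\<lambda>t. ennreal ((q * t) powr (1 / q)) ^ n) \<in> borel_measurable lborel"
        by (subst ennreal_power) auto
      have gm: "?g \<in> borel_measurable lborel"
        using gp by (intro borel_measurable_times_ennreal) auto
      have "(\<integral>\<^sup>+t. ?g t * emeasure ?L {x\<in>C. ?N x \<le> 1} \<partial>lborel) = (\<integral>\<^sup>+t. ?g t \<partial>lborel) * emeasure ?L {x\<in>C. ?N x \<le> 1}"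
        using gm by (rule nn_integral_multc)
      moreover have "K = ennreal (?c ^ n) * (\<integral>\<^sup>+t. ?g t \<partial>lborel)"
        unfolding K_def using gm by (rule nn_integral_cmult)
      ultimately show ?thesis by (simp only: mult.assoc)
    qed
    finally show ?thesis .
  qed
  interpret Z: prob_space ?Z
    using zf by (intro prob_space.prob_space_distr prob_space_PiM prob_f_law[OF q])
  have "emeasure ?Z UNIV = 1" using Z.emeasure_space_1 by simp
  then have K1: "K * emeasure ?L {x. ?N x \<le> 1} = 1" using cone[of UNIV] by simp
  show ?thesis
  proof (rule measure_eqI)
    fix A assume "A \<in> sets (distr ?Z borel T)"
    then have A[measurable]: "A \<in> sets borel" by simp
    have TA: "T -` A \<in> sets borel" using measurable_sets[OF T A] by simp
    have cA: "(\<lambda>i. c * x i) \<in> T -` A \<longleftrightarrow> x \<in> T -` A" if "c > 0" for c x using inv[OF that] by simp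
    have "emeasure (distr ?Z borel T) A = K * emeasure ?L {x\<in>T -` A. ?N x \<le> 1}"
      using cone[OF TA cA] by (subst emeasure_distr) auto
    also have "\<dots> = emeasure ?L {x\<in>T -` A. ?N x \<le> 1} / emeasure ?L {x. ?N x \<le> 1}"
      by (rule mult_eq_divide_ennreal[OF K1 g.pos g.fin])
    also have "\<dots> = emeasure g.U (T -` A)" using g.emeasure_U[OF TA] by simp
    also have "\<dots> = emeasure (distr (uniform_lp_ball n (ereal q)) borel T) A"
      by (subst emeasure_distr) (auto simp: uniform_lp_ball_gauge[OF p2 n])
    finally show "emeasure (distr ?Z borel T) A = emeasure (distr (uniform_lp_ball n (ereal q)) borel T) A" .
  qed simp
qed

section \<open>Cramer's theorem\<close>

(* From here on, this rule sends the measurability prover to unprovable goals about function-valued maps. *)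
declare coord_borel [measurable del]

lemma mgf_pos:
  assumes "prob_space \<mu>" "integrable \<mu> (\<lambda>y. exp (f y :: real))"
  shows "0 < (LINT y|\<mu>. exp (f y))"
proof -
  interpret prob_space \<mu> by fact
  have "(LINT y|\<mu>. exp (f y)) \<noteq> 0"
  proof
    assume "(LINT y|\<mu>. exp (f y)) = 0"
    then have "AE y in \<mu>. exp (f y) = 0"
      using assms(2) by (subst (asm) integral_nonneg_eq_0_iff_AE) auto
    then have "AE y in \<mu>. False" by simp
    then show False by simp
  qed
  moreover have "0 \<le> (LINT y|\<mu>. exp (f y))" by (rule Bochner_Integration.integral_nonneg) simp
  ultimately show ?thesis by linarith
qed

lemma distr_emp:
  fixes \<phi> :: "'b \<Rightarrow> 'a::euclidean_space"
  assumes [measurable]: "\<phi> \<in> borel_measurable \<mu>" and B: "B \<in> sets borel"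
  shows "measure (emp_law \<mu> \<phi> n) B =
    measure (iid \<mu> n) {x\<in>space (iid \<mu> n). emp \<phi> n x \<in> B}"
  using B by (subst measure_distr) (auto intro!: arg_cong2[where f=measure])

lemma cramer_upper_local:
  fixes \<phi> :: "'b \<Rightarrow> 'a::euclidean_space"
  assumes pr: "prob_space \<mu>" and \<phi>[measurable]: "\<phi> \<in> borel_measurable \<mu>"
    and I: "\<And>u. I u = \<infinity> \<or> (integrable \<mu> (\<lambda>y. exp (u \<bullet> \<phi> y)) \<and> I u = ereal (ln (LINT y|\<mu>. exp (u \<bullet> \<phi> y))))"
    and a: "ereal a < legendre I x"
  shows "\<exists>e>0. \<forall>\<^sub>F n in sequentially. measure (emp_law \<mu> \<phi> n) (ball x e) \<le> exp (- real n * a)"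
proof -
  obtain u where u: "ereal a < ereal (u \<bullet> x) - I u"
    using a unfolding legendre_def less_SUP_iff by blast
  then have "I u \<noteq> \<infinity>" by auto
  then have i: "integrable \<mu> (\<lambda>y. exp (u \<bullet> \<phi> y))" "I u = ereal (ln (LINT y|\<mu>. exp (u \<bullet> \<phi> y)))"
    using I[of u] by auto
  define L where "L = ln (LINT y|\<mu>. exp (u \<bullet> \<phi> y))"
  have L: "(LINT y|\<mu>. exp (u \<bullet> \<phi> y)) = exp L" using mgf_pos[OF pr i(1)] by (simp add: L_def)
  define d where "d = u \<bullet> x - L - a"
  have d: "d > 0" using u i(2) by (simp add: d_def L_def)
  define e where "e = d / (norm u + 1)"
  have np: "norm u + 1 > 0" by (simp add: add_nonneg_pos)
  have e: "e > 0" using d np by (simp add: e_def)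
  show ?thesis
  proof (intro exI[of _ e] conjI e)
    show "\<forall>\<^sub>F n in sequentially. measure (emp_law \<mu> \<phi> n) (ball x e) \<le> exp (- real n * a)"
      using eventually_gt_at_top[of 0]
    proof eventually_elim
      case (elim n)
      have "measure (emp_law \<mu> \<phi> n) (ball x e) \<le>
         ((LINT y|\<mu>. exp (u \<bullet> \<phi> y)) * exp (- (L + a))) ^ n"
        unfolding distr_emp[OF \<phi> borel_open[OF open_ball]]
      proof (rule chernoff[OF pr \<phi> i(1) _ _ elim])
        fix z assume z: "z \<in> ball x e"
        have "u \<bullet> (x - z) \<le> norm u * norm (x - z)" by (rule norm_cauchy_schwarz)
        also have "\<dots> \<le> norm u * e" using z by (intro mult_left_mono) (auto simp: dist_norm)
        also have "\<dots> \<le> (norm u + 1) * e" using e by (intro mult_right_mono) auto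
        also have "\<dots> = d" using np by (simp add: e_def)
        finally show "L + a \<le> u \<bullet> z" by (simp add: d_def inner_diff_right)
      qed simp
      also have "\<dots> = exp (- a) ^ n" unfolding L by (simp add: exp_add[symmetric])
      also have "\<dots> = exp (- real n * a)" by (simp add: exp_of_nat_mult[symmetric])
      finally show ?case .
    qed
  qed
qed

lemma legendre_nonneg: "I 0 = 0 \<Longrightarrow> 0 \<le> legendre I x"
  unfolding legendre_def by (rule SUP_upper2[of 0]) auto

text \<open>
  The function \<open>I\<close> may be infinite at boundary points of the domain where the moment generating
  function is still finite; \<open>closure\<close> says that these points do not increase the Legendre
  transform, so that the lower bound, which takes all finite points into account, meets the
  upper bound.
\<close>

lemma cramer_local_ldp:
  fixes \<phi> :: "'b \<Rightarrow> 'a::euclidean_space"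
  assumes pr: "prob_space \<mu>" and \<phi>[measurable]: "\<phi> \<in> borel_measurable \<mu>"
    and int: "integrable \<mu> \<phi>"
    and nondeg: "\<And>u c. u \<noteq> 0 \<Longrightarrow> \<not> (AE y in \<mu>. u \<bullet> \<phi> y = c)"
    and I: "\<And>u. I u = \<infinity> \<or> (integrable \<mu> (\<lambda>y. exp (u \<bullet> \<phi> y)) \<and> I u = ereal (ln (LINT y|\<mu>. exp (u \<bullet> \<phi> y))))"
    and I0: "I 0 = 0"
    and closure: "\<And>b x v. (\<And>u. I u \<noteq> \<infinity> \<Longrightarrow> exp (- b) \<le> (LINT y|\<mu>. exp (u \<bullet> (\<phi> y - x)))) \<Longrightarrow>
       integrable \<mu> (\<lambda>y. exp (v \<bullet> \<phi> y)) \<Longrightarrow> exp (- b) \<le> (LINT y|\<mu>. exp (v \<bullet> (\<phi> y - x)))"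
  shows "local_ldp (\<lambda>n. emp_law \<mu> \<phi> n) (legendre I)"
  unfolding local_ldp_def
proof (intro conjI allI impI)
  show "\<forall>\<^sub>F n in sequentially. prob_space (emp_law \<mu> \<phi> n) \<and>
      sets (emp_law \<mu> \<phi> n) = sets borel"
    by (auto intro!: always_eventually prob_space.prob_space_distr prob_space_PiM pr)
  show "\<exists>e>0. \<forall>\<^sub>F n in sequentially. measure (emp_law \<mu> \<phi> n) (ball x e) \<le> exp (- real n * a)"
    if "ereal a < legendre I x" for x a
    using cramer_upper_local[OF pr \<phi> I that] by blast
  fix x a and e :: real assume a: "legendre I x < ereal a" and e: "e > 0"
  have "0 \<le> legendre I x" using I0 by (rule legendre_nonneg)
  then obtain b where b: "legendre I x = ereal b" using a by (cases "legendre I x") auto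
  have ba: "b < a" using a b by simp
  have shift: "(LINT y|\<mu>. exp (v \<bullet> (\<phi> y - x))) = (LINT y|\<mu>. exp (v \<bullet> \<phi> y)) * exp (- (v \<bullet> x))" for v
    by (simp add: inner_diff_right exp_diff exp_minus divide_inverse)
  have dom: "exp (- b) \<le> (LINT y|\<mu>. exp (u \<bullet> (\<phi> y - x)))" if u: "I u \<noteq> \<infinity>" for u
  proof -
    have i: "integrable \<mu> (\<lambda>y. exp (u \<bullet> \<phi> y))" "I u = ereal (ln (LINT y|\<mu>. exp (u \<bullet> \<phi> y)))"
      using I[of u] u by auto
    have "ereal (u \<bullet> x) - I u \<le> legendre I x" unfolding legendre_def by (rule SUP_upper) simp
    then have "- b \<le> ln (LINT y|\<mu>. exp (u \<bullet> \<phi> y)) - u \<bullet> x" using b i(2) by simp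
    then have "exp (- b) \<le> exp (ln (LINT y|\<mu>. exp (u \<bullet> \<phi> y)) - u \<bullet> x)" by simp
    then show ?thesis unfolding shift using mgf_pos[OF pr i(1)] by (simp add: exp_diff exp_minus divide_inverse)
  qed
  show "\<forall>\<^sub>F n in sequentially. exp (- real n * a) \<le> measure (emp_law \<mu> \<phi> n) (ball x e)"
    unfolding distr_emp[OF \<phi> borel_open[OF open_ball]]
    using cramer_lower[OF pr \<phi> int nondeg closure[OF dom] ba e] by simp
qed

lemma mgf_tendsto_0:
  fixes \<psi> :: "'b \<Rightarrow> real"
  assumes pr: "prob_space \<mu>" and [measurable]: "\<psi> \<in> borel_measurable \<mu>" and pos: "AE y in \<mu>. 0 < \<psi> y"
  shows "(\<lambda>j. LINT y|\<mu>. exp (- (real j * \<psi> y))) \<longlonglongrightarrow> 0"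
proof -
  interpret prob_space \<mu> by fact
  have "(\<lambda>j. LINT y|\<mu>. exp (- (real j * \<psi> y))) \<longlonglongrightarrow> (LINT y|\<mu>. 0)"
  proof (rule integral_dominated_convergence[where w = "\<lambda>_. 1"])
    show "AE y in \<mu>. (\<lambda>j. exp (- (real j * \<psi> y))) \<longlonglongrightarrow> 0"
      using pos
    proof eventually_elim
      case (elim y)
      have "(\<lambda>j. exp (- \<psi> y) ^ j) \<longlonglongrightarrow> 0" using elim by (intro LIMSEQ_power_zero) auto
      then show ?case by (simp add: exp_of_nat_mult[symmetric])
    qed
    show "AE y in \<mu>. norm (exp (- (real j * \<psi> y))) \<le> 1" for j
      using pos by eventually_elim simp
  qed auto
  then show ?thesis by simp
qed

text \<open>
  Along \<open>- j d\<close> the moment generating function tends to \<open>0\<close> while the linear term stays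
  nonnegative.
\<close>

lemma legendre_infinite:
  fixes \<phi> :: "'b \<Rightarrow> 'a::euclidean_space"
  assumes pr: "prob_space \<mu>" and [measurable]: "\<phi> \<in> borel_measurable \<mu>"
    and I: "\<And>j::nat. I (- (real j) *\<^sub>R d) = ereal (ln (LINT y|\<mu>. exp (- (real j * (d \<bullet> \<phi> y)))))"
    and pos: "AE y in \<mu>. 0 < d \<bullet> \<phi> y" and x: "d \<bullet> x \<le> 0"
  shows "legendre I x = \<infinity>"
proof (rule ereal_top)
  fix a :: real
  interpret prob_space \<mu> by fact
  have "\<forall>\<^sub>F j in sequentially. (LINT y|\<mu>. exp (- (real j * (d \<bullet> \<phi> y)))) < exp (- a)"
    using mgf_tendsto_0[OF pr _ pos] by (intro order_tendstoD(2)[of _ 0]) auto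
  then obtain j where j: "(LINT y|\<mu>. exp (- (real j * (d \<bullet> \<phi> y)))) < exp (- a)"
    by (auto simp: eventually_sequentially)
  have "integrable \<mu> (\<lambda>y. exp (- (real j * (d \<bullet> \<phi> y))))"
    using pos by (intro integrable_const_bound[of _ 1]) (auto elim!: eventually_mono)
  then have p: "0 < (LINT y|\<mu>. exp (- (real j * (d \<bullet> \<phi> y))))" by (rule mgf_pos[OF pr])
  have "ln (LINT y|\<mu>. exp (- (real j * (d \<bullet> \<phi> y)))) < ln (exp (- a))"
    using p j by (subst ln_less_cancel_iff) auto
  then have lt: "a < - ln (LINT y|\<mu>. exp (- (real j * (d \<bullet> \<phi> y))))" by simp
  have "real j * (d \<bullet> x) \<le> 0" using x by (simp add: mult_nonneg_nonpos)
  then have "ereal a \<le> ereal ((- (real j) *\<^sub>R d) \<bullet> x) - I (- (real j) *\<^sub>R d)"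
    unfolding I using lt by simp
  also have "\<dots> \<le> legendre I x" unfolding legendre_def by (rule SUP_upper) simp
  finally show "ereal a \<le> legendre I x" .
qed

section \<open>The moments of a sample with density f\<close>

lemma integrable_gauss:
  assumes "c > 0" shows "integrable lborel (\<lambda>y::real. exp (- (c * y\<^sup>2)))"
proof -
  define s where "s = sqrt (1 / (2 * c))"
  have s: "s > 0" "s\<^sup>2 = 1 / (2 * c)" using assms by (auto simp: s_def)
  have "integrable lborel (\<lambda>y. sqrt (2 * pi * s\<^sup>2) * normal_density 0 s y)"
    using s by (intro integrable_mult_right integrable_normal_density)
  moreover have "sqrt (2 * pi * s\<^sup>2) * normal_density 0 s y = exp (- (c * y\<^sup>2))" for y
  proof -
    have "sqrt (2 * pi * s\<^sup>2) \<noteq> 0" using s assms by simp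
    moreover have "y\<^sup>2 / (2 * s\<^sup>2) = c * y\<^sup>2" using s assms by (simp add: s(2))
    ultimately show ?thesis by (simp add: normal_density_def)
  qed
  ultimately show ?thesis by simp
qed

lemma powr_dominates_square:
  fixes a \<delta> q :: real
  assumes q: "q > 2" and d: "\<delta> > 0"
  obtains C where "C \<ge> 0" "\<And>y. a * y\<^sup>2 \<le> \<delta> * \<bar>y\<bar> powr q + C"
proof (cases "a \<le> 0")
  case True
  have "a * y\<^sup>2 \<le> \<delta> * \<bar>y\<bar> powr q + 0" for y
  proof -
    have "a * y\<^sup>2 \<le> 0" using True by (simp add: mult_nonpos_nonneg)
    also have "0 \<le> \<delta> * \<bar>y\<bar> powr q" using d by simp
    finally show ?thesis by simp
  qed
  then show ?thesis using that[of 0] by simp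
next
  case False
  define R where "R = (a / \<delta>) powr (1 / (q - 2))"
  have R: "R > 0" "R powr (q - 2) = a / \<delta>" using False d q by (auto simp: R_def powr_powr)
  have "a * y\<^sup>2 \<le> \<delta> * \<bar>y\<bar> powr q + a * R\<^sup>2" for y
  proof (cases "\<bar>y\<bar> \<ge> R")
    case True
    have "a / \<delta> \<le> \<bar>y\<bar> powr (q - 2)" using True R q powr_mono2[of "q - 2" R "\<bar>y\<bar>"] by simp
    then have "a \<le> \<delta> * \<bar>y\<bar> powr (q - 2)" using d by (simp add: pos_divide_le_eq mult.commute)
    then have "a * y\<^sup>2 \<le> \<delta> * \<bar>y\<bar> powr (q - 2) * y\<^sup>2" by (intro mult_right_mono) auto
    also have "\<bar>y\<bar> powr (q - 2) * y\<^sup>2 = \<bar>y\<bar> powr q"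
    proof -
      have "\<bar>y\<bar> powr (q - 2) * \<bar>y\<bar> powr 2 = \<bar>y\<bar> powr q" by (subst powr_add[symmetric]) simp
      then show ?thesis by simp
    qed
    then have "\<delta> * \<bar>y\<bar> powr (q - 2) * y\<^sup>2 = \<delta> * \<bar>y\<bar> powr q" by (simp add: mult.assoc)
    finally show ?thesis using False by (simp add: add_increasing2)
  next
    case F2: False
    then have "y\<^sup>2 \<le> R\<^sup>2" using R by (simp add: abs_le_square_iff[symmetric])
    then have "a * y\<^sup>2 \<le> a * R\<^sup>2" using False by (intro mult_left_mono) auto
    then show ?thesis using d by (simp add: add_increasing)
  qed
  then show ?thesis using that[of "a * R\<^sup>2"] False by simp
qed

definition \<phi>f :: "real \<Rightarrow> real \<Rightarrow> real \<times> real" where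
  "\<phi>f q y = (y\<^sup>2, \<bar>y\<bar> powr q)"

lemma measurable_\<phi>f [measurable]: "\<phi>f q \<in> borel_measurable borel"
proof -
  have "\<phi>f q = (\<lambda>y. (y\<^sup>2, \<bar>y\<bar> powr q))" by (simp add: \<phi>f_def fun_eq_iff)
  then show ?thesis by (simp add: borel_measurable_Pair)
qed

lemma inner_\<phi>f: "u \<bullet> \<phi>f q y = fst u * y\<^sup>2 + snd u * \<bar>y\<bar> powr q"
  by (simp add: \<phi>f_def inner_prod_def)

lemma f_law_integrable_iff:
  assumes q: "q \<ge> 2" and [measurable]: "g \<in> borel_measurable borel"
  shows "integrable (f_law q) g \<longleftrightarrow> integrable lborel (\<lambda>y. g y * f_dens q y :: real)"
  unfolding f_law_def using f_dens_nonneg[OF q]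
  by (subst integrable_real_density) (auto simp: mult.commute)

lemma f_law_integral:
  assumes q: "q \<ge> 2" and [measurable]: "g \<in> borel_measurable borel"
  shows "(LINT y|f_law q. g y) = (LINT y|lborel. g y * f_dens q y :: real)"
  unfolding f_law_def using f_dens_nonneg[OF q]
  by (subst integral_real_density) (auto simp: mult.commute)

definition f_const :: "real \<Rightarrow> real" where
  "f_const q = 1 / (2 * q powr (1 / q) * Gamma (1 + 1 / q))"

lemma f_dens_eq: "exp (t1 * y\<^sup>2 + t2 * \<bar>y\<bar> powr q) * f_dens q y = f_const q * exp (t1 * y\<^sup>2 + (t2 - 1 / q) * \<bar>y\<bar> powr q)"
proof -
  have "t1 * y\<^sup>2 + (t2 - 1 / q) * \<bar>y\<bar> powr q = (t1 * y\<^sup>2 + t2 * \<bar>y\<bar> powr q) + - (\<bar>y\<bar> powr q) / q"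
    by (simp add: left_diff_distrib)
  then show ?thesis unfolding f_dens_def f_const_def by (simp only: exp_add) simp
qed

lemma f_law_exp_integrable:
  assumes q: "q > 2" and t: "snd u < 1 / q"
  shows "integrable (f_law q) (\<lambda>y. exp (u \<bullet> \<phi>f q y))"
proof -
  obtain C where C: "\<And>y. (fst u + 1) * y\<^sup>2 \<le> (1 / q - snd u) * \<bar>y\<bar> powr q + C"
    using powr_dominates_square[OF q, of "1 / q - snd u" "fst u + 1"] t by auto
  have "integrable lborel (\<lambda>y::real. f_const q * exp (fst u * y\<^sup>2 + (snd u - 1 / q) * \<bar>y\<bar> powr q))"
  proof (rule Bochner_Integration.integrable_bound)
    show "integrable lborel (\<lambda>y::real. (\<bar>f_const q\<bar> * exp C) * exp (- (1 * y\<^sup>2)))"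
      by (intro integrable_mult_right integrable_gauss) simp
    show "AE y in lborel. norm (f_const q * exp (fst u * y\<^sup>2 + (snd u - 1 / q) * \<bar>y\<bar> powr q)) \<le>
       norm ((\<bar>f_const q\<bar> * exp C) * exp (- (1 * y\<^sup>2)))"
    proof (rule AE_I2)
      fix y :: real
      have "fst u * y\<^sup>2 + (snd u - 1 / q) * \<bar>y\<bar> powr q \<le> C - y\<^sup>2" using C[of y] by (simp add: algebra_simps)
      then have "exp (fst u * y\<^sup>2 + (snd u - 1 / q) * \<bar>y\<bar> powr q) \<le> exp (C - y\<^sup>2)" by simp
      also have "\<dots> = exp C * exp (- (1 * y\<^sup>2))" by (simp add: exp_diff exp_minus divide_inverse)
      finally show "norm (f_const q * exp (fst u * y\<^sup>2 + (snd u - 1 / q) * \<bar>y\<bar> powr q)) \<le>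
       norm ((\<bar>f_const q\<bar> * exp C) * exp (- (1 * y\<^sup>2)))"
        by (simp add: abs_mult mult.assoc mult_left_mono)
    qed
  qed measurable
  then show ?thesis
    using q by (subst f_law_integrable_iff) (auto simp: inner_\<phi>f f_dens_eq)
qed

lemma f_law_exp_not_integrable:
  assumes q: "q > 2" and t: "snd u > 1 / q"
  shows "\<not> integrable (f_law q) (\<lambda>y. exp (u \<bullet> \<phi>f q y))"
proof
  assume "integrable (f_law q) (\<lambda>y. exp (u \<bullet> \<phi>f q y))"
  then have i: "integrable lborel (\<lambda>y::real. f_const q * exp (fst u * y\<^sup>2 + (snd u - 1 / q) * \<bar>y\<bar> powr q))"
    using q by (subst (asm) f_law_integrable_iff) (auto simp: inner_\<phi>f f_dens_eq)
  obtain C where C: "\<And>y. - fst u * y\<^sup>2 \<le> (snd u - 1 / q) * \<bar>y\<bar> powr q + C"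
    using powr_dominates_square[OF q, of "snd u - 1 / q" "- fst u"] t by auto
  have c: "f_const q > 0" using f_dens_const_pos[of q] q by (simp add: f_const_def)
  have "integrable lborel (\<lambda>y::real. f_const q * exp (- C))"
  proof (rule Bochner_Integration.integrable_bound[OF i])
    show "AE y in lborel. norm (f_const q * exp (- C)) \<le> norm (f_const q * exp (fst u * y\<^sup>2 + (snd u - 1 / q) * \<bar>y\<bar> powr q))"
    proof (rule AE_I2)
      fix y :: real
      have "- C \<le> fst u * y\<^sup>2 + (snd u - 1 / q) * \<bar>y\<bar> powr q" using C[of y] by simp
      then show "norm (f_const q * exp (- C)) \<le> norm (f_const q * exp (fst u * y\<^sup>2 + (snd u - 1 / q) * \<bar>y\<bar> powr q))"
        using c by (simp add: abs_mult mult_left_mono)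
    qed
  qed simp
  then have "(\<integral>\<^sup>+y. ennreal (norm (f_const q * exp (- C))) \<partial>(lborel :: real measure)) < \<infinity>"
    by (simp only: integrable_iff_bounded)
  moreover have "(\<integral>\<^sup>+y. ennreal (norm (f_const q * exp (- C))) \<partial>(lborel :: real measure)) = \<infinity>"
    using c by (simp add: ennreal_mult_eq_top_iff)
  ultimately show False by simp
qed

lemma AE_lborel_continuous_const:
  fixes g :: "real \<Rightarrow> real"
  assumes g: "continuous_on UNIV g" and ae: "AE y in lborel. g y = c"
  shows "g y = c"
proof (rule ccontr)
  assume "g y \<noteq> c"
  have "open (g -` (- {c}))" using g by (intro open_vimage) auto
  moreover have "y \<in> g -` (- {c})" using \<open>g y \<noteq> c\<close> by simp
  ultimately obtain e where e: "e > 0" "ball y e \<subseteq> g -` (- {c})" by (meson openE)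
  have "AE z in lborel. z \<notin> {y - e<..<y + e}"
    using ae by eventually_elim (use e in \<open>auto simp: ball_eq_greaterThanLessThan\<close>)
  then have "emeasure lborel {y - e<..<y + e} = 0"
    by (subst (asm) AE_iff_measurable[of "{y - e<..<y + e}"]) auto
  then show False using e by simp
qed

lemma AE_f_law: "q \<ge> 2 \<Longrightarrow> (AE y in f_law q. P y) \<longleftrightarrow> (AE y in lborel. P y)"
  unfolding f_law_def by (subst AE_density) (auto simp: f_dens_pos)

text \<open>
  A continuous function that is constant almost everywhere is constant; compare the values at
  \<open>0\<close>, \<open>1\<close> and \<open>2\<close>.
\<close>

lemma f_law_nondegenerate:
  assumes q: "q > 2" and u: "u \<noteq> 0" shows "\<not> (AE y in f_law q. u \<bullet> \<phi>f q y = c)"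
proof
  assume "AE y in f_law q. u \<bullet> \<phi>f q y = c"
  then have ae: "AE y in lborel. fst u * y\<^sup>2 + snd u * \<bar>y\<bar> powr q = c"
    using q by (simp add: AE_f_law inner_\<phi>f)
  have cont: "continuous_on UNIV (\<lambda>y::real. fst u * y\<^sup>2 + snd u * \<bar>y\<bar> powr q)"
    using q by (intro continuous_intros continuous_on_powr') auto
  note v = AE_lborel_continuous_const[OF cont ae]
  have "c = 0" using v[of 0] by simp
  moreover have "fst u + snd u = c" using v[of 1] by simp
  moreover have "fst u * 4 + snd u * 2 powr q = c" using v[of 2] by simp
  moreover have "snd u * (2 powr q - 4) = (fst u * 4 + snd u * 2 powr q) - 4 * (fst u + snd u)"
    by (simp add: algebra_simps)
  ultimately have "snd u * (2 powr q - 4) = 0" by simp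
  moreover have "2 powr q > (2::real) powr 2" using q by (intro powr_less_mono) auto
  ultimately have "snd u = 0" by simp
  with \<open>fst u + snd u = c\<close> \<open>c = 0\<close> have "u = 0" by (simp add: prod_eq_iff)
  with u show False by simp
qed

lemma f_law_integrable_\<phi>f:
  assumes q: "q > 2" shows "integrable (f_law q) (\<phi>f q)"
proof (rule Bochner_Integration.integrable_bound)
  have "snd (1::real, 1 / (2 * q)) < 1 / q" using q by (simp add: field_simps)
  from f_law_exp_integrable[OF q this]
  show "integrable (f_law q) (\<lambda>y. (1 + 2 * q) * exp ((1::real, 1 / (2 * q)) \<bullet> \<phi>f q y))"
    by (intro integrable_mult_right)
  show "AE y in f_law q. norm (\<phi>f q y) \<le> norm ((1 + 2 * q) * exp ((1::real, 1 / (2 * q)) \<bullet> \<phi>f q y))"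
  proof (rule AE_I2)
    fix y :: real
    define A where "A = y\<^sup>2"
    define B where "B = 1 / (2 * q) * \<bar>y\<bar> powr q"
    have AB: "A \<ge> 0" "B \<ge> 0" using q by (auto simp: A_def B_def)
    have "\<phi>f q y = (A, 2 * q * B)" using q by (simp add: \<phi>f_def A_def B_def)
    then have "norm (\<phi>f q y) \<le> A + 2 * q * B"
      using AB q norm_Pair_le[of A "2 * q * B"] by (simp add: abs_mult)
    also have "\<dots> \<le> 1 * exp (A + B) + 2 * q * exp (A + B)"
    proof (intro add_mono mult_left_mono)
      show "A \<le> 1 * exp (A + B)" "B \<le> exp (A + B)" using exp_ge_add_one_self[of "A + B"] AB by linarith+
    qed (use q in auto)
    also have "\<dots> = (1 + 2 * q) * exp (A + B)" by (simp add: algebra_simps)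
    also have "\<dots> \<le> norm ((1 + 2 * q) * exp ((1::real, 1 / (2 * q)) \<bullet> \<phi>f q y))"
      using q by (simp add: inner_\<phi>f A_def B_def)
    finally show "norm (\<phi>f q y) \<le> norm ((1 + 2 * q) * exp ((1::real, 1 / (2 * q)) \<bullet> \<phi>f q y))" .
  qed
qed simp

lemma I_fin_eq:
  assumes q: "q > 2"
  shows "I_fin q u = (if snd u < 1 / q then ereal (ln (LINT y|f_law q. exp (u \<bullet> \<phi>f q y))) else \<infinity>)"
  using q by (cases u) (auto simp: I_fin_def f_law_integral inner_\<phi>f)

lemma I_fin_0: assumes "q \<ge> 2" shows "I_fin q 0 = 0"
proof -
  interpret prob_space "f_law q" by (rule prob_f_law[OF assms])
  have "(LINT x|lborel. f_dens q x) = (LINT y|f_law q. 1)"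
    using assms by (subst f_law_integral) auto
  also have "\<dots> = 1" using prob_space by simp
  finally show ?thesis using assms by (auto simp: I_fin_def zero_prod_def zero_ereal_def)
qed

text \<open>
  Cramer's theorem in the plane. The moment generating function may be finite for
  \<open>t\<^sub>2 = 1 / q\<close>, where \<open>I_fin\<close> is infinite by definition; it dominates its values for smaller
  \<open>t\<^sub>2\<close>, which settles the closure condition.
\<close>

lemma local_ldp_moments:
  assumes q: "q > 2"
  shows "local_ldp (\<lambda>n. emp_law (f_law q) (\<phi>f q) n) (legendre (I_fin q))"
proof (rule cramer_local_ldp)
  have q2: "q \<ge> 2" using q by simp
  show pr: "prob_space (f_law q)" by (rule prob_f_law[OF q2])
  show "\<phi>f q \<in> borel_measurable (f_law q)" by measurable
  show "integrable (f_law q) (\<phi>f q)" by (rule f_law_integrable_\<phi>f[OF q])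
  show "\<not> (AE y in f_law q. u \<bullet> \<phi>f q y = c)" if "u \<noteq> 0" for u c
    using f_law_nondegenerate[OF q that] .
  show "I_fin q 0 = 0" by (rule I_fin_0[OF q2])
  show "I_fin q u = \<infinity> \<or> integrable (f_law q) (\<lambda>y. exp (u \<bullet> \<phi>f q y)) \<and>
      I_fin q u = ereal (ln (LINT y|f_law q. exp (u \<bullet> \<phi>f q y)))" for u
    using f_law_exp_integrable[OF q, of u] by (simp add: I_fin_eq[OF q])
  fix b x v
  assume dom: "\<And>u. I_fin q u \<noteq> \<infinity> \<Longrightarrow> exp (- b) \<le> (LINT y|f_law q. exp (u \<bullet> (\<phi>f q y - x)))"
    and iv: "integrable (f_law q) (\<lambda>y. exp (v \<bullet> \<phi>f q y))"
  have shift: "(LINT y|f_law q. exp (u \<bullet> (\<phi>f q y - x))) = (LINT y|f_law q. exp (u \<bullet> \<phi>f q y)) * exp (- (u \<bullet> x))" for u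
    by (simp add: inner_diff_right exp_diff exp_minus divide_inverse)
  consider "snd v < 1 / q" | "snd v = 1 / q" | "snd v > 1 / q" by linarith
  then show "exp (- b) \<le> (LINT y|f_law q. exp (v \<bullet> (\<phi>f q y - x)))"
  proof cases
    case 1 then show ?thesis by (intro dom) (simp add: I_fin_eq[OF q])
  next
    case 3 then show ?thesis using f_law_exp_not_integrable[OF q 3] iv by simp
  next
    case 2
    let ?G = "LINT y|f_law q. exp (v \<bullet> \<phi>f q y)"
    have "exp (- b) \<le> ?G * exp (- (v \<bullet> x) + h * snd x)" if h: "h > 0" for h
    proof -
      let ?u = "(fst v, snd v - h)"
      have "exp (- b) \<le> (LINT y|f_law q. exp (?u \<bullet> \<phi>f q y)) * exp (- (?u \<bullet> x))"
        unfolding shift[symmetric] using 2 h by (intro dom) (simp add: I_fin_eq[OF q])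
      also have "\<dots> \<le> ?G * exp (- (?u \<bullet> x))"
      proof (intro mult_right_mono integral_mono)
        show "integrable (f_law q) (\<lambda>y. exp (?u \<bullet> \<phi>f q y))" using 2 h by (intro f_law_exp_integrable[OF q]) simp
        show "exp (?u \<bullet> \<phi>f q y) \<le> exp (v \<bullet> \<phi>f q y)" for y using h by (simp add: inner_\<phi>f left_diff_distrib)
      qed (use iv in auto)
      also have "- (?u \<bullet> x) = - (v \<bullet> x) + h * snd x" by (simp add: inner_prod_def algebra_simps)
      finally show ?thesis .
    qed
    then have "\<forall>\<^sub>F h in at_right 0. exp (- b) \<le> ?G * exp (- (v \<bullet> x) + h * snd x)"
      unfolding eventually_at_right_field by (intro exI[of _ 1]) auto
    moreover have "((\<lambda>h. ?G * exp (- (v \<bullet> x) + h * snd x)) \<longlongrightarrow> ?G * exp (- (v \<bullet> x) + 0 * snd x)) (at_right 0)"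
      by (intro tendsto_intros)
    ultimately have "exp (- b) \<le> ?G * exp (- (v \<bullet> x) + 0 * snd x)"
      by (intro tendsto_lowerbound[of _ _ "at_right 0"]) auto
    then show ?thesis unfolding shift by simp
  qed
qed

lemma legendre_I_fin_boundary:
  assumes q: "q > 2" and x: "fst x \<le> 0 \<or> snd x \<le> 0"
  shows "legendre (I_fin q) x = \<infinity>"
proof -
  have q2: "q \<ge> 2" using q by simp
  have pr: "prob_space (f_law q)" by (rule prob_f_law[OF q2])
  have nz: "AE y in f_law q. y \<noteq> 0" using AE_lborel_singleton[of "0::real"] by (simp add: AE_f_law[OF q2])
  have I: "I_fin q (- (real j) *\<^sub>R d) = ereal (ln (LINT y|f_law q. exp (- (real j * (d \<bullet> \<phi>f q y)))))"
    if "snd d \<ge> 0" for j d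
  proof -
    have "snd (- (real j) *\<^sub>R d) \<le> 0" using that by simp
    also have "0 < 1 / q" using q by simp
    finally show ?thesis by (simp add: I_fin_eq[OF q])
  qed
  have *: "legendre (I_fin q) x = \<infinity>"
    if d: "snd d \<ge> 0" "d \<bullet> x \<le> 0" "\<And>y. y \<noteq> 0 \<Longrightarrow> 0 < d \<bullet> \<phi>f q y" for d
  proof (rule legendre_infinite[OF pr _ I])
    show "AE y in f_law q. 0 < d \<bullet> \<phi>f q y" using nz by eventually_elim (rule d(3))
  qed (use d in auto)
  from x show ?thesis
  proof
    assume "fst x \<le> 0"
    then show ?thesis by (intro *[of "(1, 0)"]) (auto simp: \<phi>f_def inner_prod_def)
  next
    assume "snd x \<le> 0"
    then show ?thesis by (intro *[of "(0, 1)"]) (auto simp: \<phi>f_def inner_prod_def)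
  qed
qed

section \<open>The direction of a uniform point, finite exponents\<close>

lemma local_ldp_cong:
  assumes "local_ldp Q I" "\<forall>\<^sub>F n in sequentially. Q n = Q' n"
  shows "local_ldp Q' I"
  unfolding local_ldp_def
proof (intro conjI allI impI)
  show "\<forall>\<^sub>F n in sequentially. prob_space (Q' n) \<and> sets (Q' n) = sets borel"
    using local_ldp_prob[OF assms(1)] assms(2) by eventually_elim simp
  show "\<exists>e>0. \<forall>\<^sub>F n in sequentially. measure (Q' n) (ball x e) \<le> exp (- real n * a)" if a: "ereal a < I x" for x a
  proof -
    obtain e where e: "e > 0" "\<forall>\<^sub>F n in sequentially. measure (Q n) (ball x e) \<le> exp (- real n * a)"
      using local_ldp_upper[OF assms(1) a] by blast
    have "\<forall>\<^sub>F n in sequentially. measure (Q' n) (ball x e) \<le> exp (- real n * a)"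
      using e(2) assms(2) by eventually_elim simp
    then show ?thesis using e(1) by blast
  qed
  show "\<forall>\<^sub>F n in sequentially. exp (- real n * a) \<le> measure (Q' n) (ball x e)" if "I x < ereal a" "0 < e" for x a e
    using local_ldp_lower[OF assms(1) that] assms(2) by eventually_elim simp
qed

text \<open>
  The normalised direction \<open>n\<^bsup>1/q - 1/2\<^esup> |x| / |x|\<^sub>q\<close> as a function of the empirical means of
  squares and \<open>q\<close>-th powers.
\<close>

definition ratio :: "real \<Rightarrow> real \<times> real \<Rightarrow> real" where
  "ratio q x = fst x powr (1 / 2) * snd x powr (- 1 / q)"

lemma J_fin_ratio: "J_fin q y = (INF x \<in> {x. fst x > 0 \<and> snd x > 0 \<and> ratio q x = y}. legendre (I_fin q) x)"
  unfolding J_fin_def ratio_def by (intro arg_cong[where f=Inf] image_cong) auto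

lemma measurable_ratio [measurable]: "ratio q \<in> borel_measurable borel"
proof -
  have "fst \<in> borel_measurable (borel :: (real \<times> real) measure)" "snd \<in> borel_measurable (borel :: (real \<times> real) measure)"
    by (auto intro!: borel_measurable_continuous_onI continuous_intros)
  then show ?thesis unfolding ratio_def by measurable
qed

lemma emp_\<phi>f: "emp (\<phi>f q) n z = ((\<Sum>i<n. (z i)\<^sup>2) / real n, (\<Sum>i<n. \<bar>z i\<bar> powr q) / real n)"
proof -
  have "(\<Sum>i<n. \<phi>f q (z i)) = ((\<Sum>i<n. (z i)\<^sup>2), (\<Sum>i<n. \<bar>z i\<bar> powr q))"
    by (simp add: \<phi>f_def sum_prod)
  then show ?thesis by (simp add: emp_def)
qed

lemma emp_\<phi>f_nonneg: "0 \<le> fst (emp (\<phi>f q) n z)" "0 \<le> snd (emp (\<phi>f q) n z)"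
  by (auto simp: emp_\<phi>f intro!: divide_nonneg_nonneg sum_nonneg)

lemma emp_\<phi>f_0:
  assumes n: "n \<ge> 1" and s: "snd (emp (\<phi>f q) n z) = 0" shows "fst (emp (\<phi>f q) n z) = 0"
proof -
  have "(\<Sum>i<n. \<bar>z i\<bar> powr q) = 0" using s n by (simp add: emp_\<phi>f)
  then have "\<bar>z i\<bar> powr q = 0" if "i < n" for i using that by (subst (asm) sum_nonneg_eq_0_iff) auto
  then show ?thesis by (simp add: emp_\<phi>f)
qed

text \<open>
  Exponential tightness of the empirical means.
\<close>

lemma moment_tail:
  assumes q: "q > 2" and u: "snd u < 1 / q"
  obtains K where "\<And>n. n \<ge> 1 \<Longrightarrow> measure (emp_law (f_law q) (\<phi>f q) n) {x. K \<le> u \<bullet> x} \<le> exp (- real n * b)"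
proof -
  have q2: "q \<ge> 2" using q by simp
  have pr: "prob_space (f_law q)" by (rule prob_f_law[OF q2])
  have m: "\<phi>f q \<in> borel_measurable (f_law q)" by measurable
  note i = f_law_exp_integrable[OF q u]
  define L where "L = ln (LINT y|f_law q. exp (u \<bullet> \<phi>f q y))"
  have L: "(LINT y|f_law q. exp (u \<bullet> \<phi>f q y)) = exp L" using mgf_pos[OF pr i] by (simp add: L_def)
  show ?thesis
  proof (rule that[of "L + b"])
    fix n :: nat assume n: "n \<ge> 1"
    have "closed {x. L + b \<le> u \<bullet> x}" by (intro closed_Collect_le continuous_intros)
    then have B: "{x. L + b \<le> u \<bullet> x} \<in> sets borel" by (rule borel_closed)
    have "measure (emp_law (f_law q) (\<phi>f q) n) {x. L + b \<le> u \<bullet> x} \<le>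
       ((LINT y|f_law q. exp (u \<bullet> \<phi>f q y)) * exp (- (L + b))) ^ n"
      unfolding distr_emp[OF m B] using n by (intro chernoff[OF pr m i B]) auto
    also have "\<dots> = exp (- b) ^ n" unfolding L by (simp add: exp_add[symmetric])
    also have "\<dots> = exp (- real n * b)" by (simp add: exp_of_nat_mult[symmetric])
    finally show "measure (emp_law (f_law q) (\<phi>f q) n) {x. L + b \<le> u \<bullet> x} \<le> exp (- real n * b)" .
  qed
qed

text \<open>
  The function \<open>ratio q\<close> is not continuous at points with second component \<open>0\<close>, so the
  contraction principle does not apply. On a large box, the equation \<open>ratio q x = y\<close> is
  replaced by the continuous equation \<open>sqrt (fst x) = y * snd x powr (1 / q)\<close>; its further
  solutions lie on the axes, where the rate is infinite. Outside the box the Chernoff bounds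
  of \<open>moment_tail\<close> suffice.
\<close>

lemma local_ldp_ratio:
  assumes q: "q > 2"
  shows "local_ldp (\<lambda>n. distr (emp_law (f_law q) (\<phi>f q) n) borel (ratio q)) (J_fin q)"
  unfolding local_ldp_def
proof (intro conjI allI impI)
  let ?Q = "\<lambda>n. emp_law (f_law q) (\<phi>f q) n"
  have L: "local_ldp ?Q (legendre (I_fin q))" by (rule local_ldp_moments[OF q])
  have q2: "q \<ge> 2" using q by simp
  have pr: "prob_space (f_law q)" by (rule prob_f_law[OF q2])
  have prQ: "prob_space (?Q n)" for n
    by (intro prob_space.prob_space_distr prob_space_PiM pr) simp
  show "\<forall>\<^sub>F n in sequentially. prob_space (distr (?Q n) borel (ratio q)) \<and> sets (distr (?Q n) borel (ratio q)) = sets borel"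
    by (intro always_eventually allI conjI prob_space.prob_space_distr prQ) auto
  {
    fix y a assume a: "ereal a < J_fin q y"
    obtain b where b: "ereal a < ereal b" "ereal b < J_fin q y" using a ereal_dense2 by blast
    define b' where "b' = (a + b) / 2"
    have b': "a < b'" "b' < b" using b(1) by (auto simp: b'_def)
    obtain K1 where K1: "\<And>n. n \<ge> 1 \<Longrightarrow> measure (?Q n) {x. K1 \<le> (1, 0) \<bullet> x} \<le> exp (- real n * b')"
      using moment_tail[OF q, of "(1, 0)" b'] q by auto
    have "snd (0::real, 1 / (2 * q)) < 1 / q" using q by (simp add: field_simps)
    then obtain K2 where K2: "\<And>n. n \<ge> 1 \<Longrightarrow> measure (?Q n) {x. K2 \<le> (0, 1 / (2 * q)) \<bullet> x} \<le> exp (- real n * b')"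
      using moment_tail[OF q, of "(0, 1 / (2 * q))" b'] by blast
    define C where "C = cbox (0::real, 0::real) (K1, 2 * q * K2)"
    have C: "compact C" unfolding C_def by (rule compact_cbox)
    \<comment> \<open>The defect in the continuous equation. It is bounded below on the box away from G,
      which excludes ratios close to y there.\<close>
    define d where "d x = \<bar>sqrt (fst x) - y * snd x powr (1 / q)\<bar>" for x :: "real \<times> real"
    have C0: "0 \<le> fst x \<and> 0 \<le> snd x \<and> snd x \<le> 2 * q * K2" if "x \<in> C" for x
      using that by (cases x) (auto simp: C_def cbox_Pair_eq)
    have dc: "continuous_on C d"
      unfolding d_def using q C0 by (intro continuous_intros continuous_on_powr') auto
    have "closed (C \<inter> d -` {0})"
      using dc C by (intro continuous_closed_preimage) (auto dest: compact_imp_closed)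
    then have F: "compact (C \<inter> d -` {0})"
      using compact_Int_closed[OF C] by (metis inf.left_idem)
    obtain G where G: "open G" "C \<inter> d -` {0} \<subseteq> G" "\<forall>\<^sub>F n in sequentially. measure (?Q n) G \<le> exp (- real n * b')"
    proof (rule local_ldp_compact_upper[OF L F b'(2)])
      fix x assume x: "x \<in> C \<inter> d -` {0}"
      show "ereal b < legendre (I_fin q) x"
      proof (cases "fst x \<le> 0 \<or> snd x \<le> 0")
        case True then show ?thesis using legendre_I_fin_boundary[OF q True] by simp
      next
        case False
        then have p: "0 < fst x" "0 < snd x" by auto
        have "sqrt (fst x) = y * snd x powr (1 / q)" using x by (simp add: d_def)
        then have "ratio q x = y * (snd x powr (1 / q) * snd x powr (- 1 / q))"
          using p by (simp add: ratio_def powr_half_sqrt)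
        also have "snd x powr (1 / q) * snd x powr (- 1 / q) = 1"
          using p by (subst powr_add[symmetric]) simp
        finally have "J_fin q y \<le> legendre (I_fin q) x"
          unfolding J_fin_ratio using p by (intro INF_lower) auto
        with b(2) show ?thesis by (rule less_le_trans)
      qed
    qed blast
    obtain \<delta> where \<delta>: "\<delta> > 0" "\<And>x. x \<in> C \<Longrightarrow> x \<notin> G \<Longrightarrow> \<delta> \<le> d x"
    proof (cases "C - G = {}")
      case True then show ?thesis using that[of 1] by auto
    next
      case False
      have "compact (C - G)" using C G(1) by (rule compact_diff)
      moreover have "continuous_on (C - G) d" using dc by (rule continuous_on_subset) auto
      ultimately obtain x0 where x0: "x0 \<in> C - G" "\<And>x. x \<in> C - G \<Longrightarrow> d x0 \<le> d x"
        using continuous_attains_inf[of "C - G" d] False by blast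
      have "d x0 \<ge> 0" by (simp add: d_def)
      moreover have "d x0 \<noteq> 0" using x0(1) G(2) by auto
      ultimately show ?thesis using that[of "d x0"] x0 by simp
    qed
    define B where "B = (2 * q * K2) powr (1 / q) + 1"
    have B: "B > 0" by (simp add: B_def add_nonneg_pos)
    define e where "e = \<delta> / B"
    have e: "e > 0" using \<delta> B by (simp add: e_def)
    have inc: "x \<in> G"
      if x: "x \<in> C" "ratio q x \<in> ball y e" "snd x = 0 \<longrightarrow> fst x = 0" for x
    proof (cases "snd x = 0")
      case True
      then have "d x = 0" using x(3) q by (simp add: d_def)
      then show ?thesis using G(2) x(1) by blast
    next
      case False
      then have p: "0 < snd x" using C0[OF x(1)] by simp
      have "ratio q x * snd x powr (1 / q) = sqrt (fst x) * (snd x powr (- 1 / q) * snd x powr (1 / q))"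
        using C0[OF x(1)] by (simp add: ratio_def powr_half_sqrt)
      also have "snd x powr (- 1 / q) * snd x powr (1 / q) = 1"
        using p by (subst powr_add[symmetric]) simp
      finally have s: "sqrt (fst x) = ratio q x * snd x powr (1 / q)" by simp
      have "d x = \<bar>ratio q x - y\<bar> * snd x powr (1 / q)"
        unfolding d_def s by (simp add: left_diff_distrib[symmetric] abs_mult)
      also have "\<dots> \<le> e * snd x powr (1 / q)"
        using x(2) by (intro mult_right_mono) (auto simp: dist_real_def)
      also have "\<dots> < e * B"
      proof -
        have "snd x powr (1 / q) \<le> (2 * q * K2) powr (1 / q)" using p C0[OF x(1)] q by (intro powr_mono2) auto
        then show ?thesis using e by (simp add: B_def)
      qed
      also have "\<dots> = \<delta>" using B by (simp add: e_def)
      finally show ?thesis using \<delta>(2)[OF x(1)] by fastforce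
    qed
    have ev3: "\<forall>\<^sub>F n in sequentially. 3 \<le> exp (real n * (b' - a))"
      using b'(1) by (intro eventually_le_exp_mult) simp
    have "\<forall>\<^sub>F n in sequentially. measure (distr (?Q n) borel (ratio q)) (ball y e) \<le> exp (- real n * a)"
      using G(3) ev3 eventually_ge_at_top[of 1]
    proof eventually_elim
      case (elim n)
      interpret Q: prob_space "?Q n" by (rule prQ)
      let ?T1 = "{x. K1 \<le> (1, 0) \<bullet> x} :: (real \<times> real) set" and ?T2 = "{x. K2 \<le> (0, 1 / (2 * q)) \<bullet> x} :: (real \<times> real) set"
      have "closed ?T1" "closed ?T2" by (intro closed_Collect_le continuous_intros)+
      then have T: "?T1 \<in> sets borel" "?T2 \<in> sets borel" by (auto intro: borel_closed)
      have "measure (distr (?Q n) borel (ratio q)) (ball y e) = measure (?Q n) (ratio q -` ball y e)"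
        by (subst measure_distr) auto
      also have "\<dots> \<le> measure (?Q n) (G \<union> (?T1 \<union> ?T2))"
      proof (rule Q.finite_measure_mono_AE)
        have sup: "AE x in ?Q n. 0 \<le> fst x \<and> 0 \<le> snd x \<and> (snd x = 0 \<longrightarrow> fst x = 0)"
        proof (subst AE_distr_iff)
          have "{x \<in> space borel. 0 \<le> fst x \<and> 0 \<le> snd x \<and> (snd x = 0 \<longrightarrow> fst x = 0)} =
             ({0..} \<times> {0..}) - ({0<..} \<times> {0} :: (real \<times> real) set)" by (auto simp: order_le_less)
          also have "\<dots> \<in> sets (borel :: (real \<times> real) measure)"
            unfolding borel_prod[symmetric] by (intro sets.Diff pair_measureI) auto
          finally show "{x \<in> space borel. 0 \<le> fst x \<and> 0 \<le> snd x \<and> (snd x = 0 \<longrightarrow> fst x = 0)} \<in> sets (borel :: (real \<times> real) measure)" .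
        qed (use emp_\<phi>f_nonneg emp_\<phi>f_0[OF elim(3)] in auto)
        then show "AE x in ?Q n. x \<in> ratio q -` ball y e \<longrightarrow> x \<in> G \<union> (?T1 \<union> ?T2)"
        proof (eventually_elim, intro impI)
          fix x assume s: "0 \<le> fst x \<and> 0 \<le> snd x \<and> (snd x = 0 \<longrightarrow> fst x = 0)" and r: "x \<in> ratio q -` ball y e"
          show "x \<in> G \<union> (?T1 \<union> ?T2)"
          proof (cases "x \<in> C")
            case True then show ?thesis using inc[OF True] s r by auto
          next
            case False
            then have "K1 < fst x \<or> 2 * q * K2 < snd x" using s by (cases x) (auto simp: C_def cbox_Pair_eq)
            then show ?thesis using q by (auto simp: inner_prod_def field_simps)
          qed
        qed
      qed (use G T in auto)
      also have "\<dots> \<le> measure (?Q n) G + (measure (?Q n) ?T1 + measure (?Q n) ?T2)"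
        using G(1) T by (intro order_trans[OF measure_Un_le] add_left_mono measure_Un_le) auto
      also have "\<dots> \<le> exp (- real n * b') + (exp (- real n * b') + exp (- real n * b'))"
        using elim K1[OF elim(3)] K2[OF elim(3)] by (intro add_mono)
      also have "\<dots> = 3 * exp (- real n * b')" by simp
      also have "\<dots> \<le> exp (real n * (b' - a)) * exp (- real n * b')"
        using elim by (intro mult_right_mono) auto
      also have "\<dots> = exp (- real n * a)" by (simp add: exp_add[symmetric] algebra_simps)
      finally show ?case .
    qed
    then show "\<exists>e>0. \<forall>\<^sub>F n in sequentially. measure (distr (?Q n) borel (ratio q)) (ball y e) \<le> exp (- real n * a)"
      using e by blast
  }
  fix y a and e :: real assume a: "J_fin q y < ereal a" and e: "e > 0"
  obtain x where x: "fst x > 0" "snd x > 0" "ratio q x = y" "legendre (I_fin q) x < ereal a"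
    using a unfolding J_fin_ratio INF_less_iff by blast
  have "isCont (ratio q) x" unfolding ratio_def using x by (intro continuous_intros) auto
  then obtain d where d: "d > 0" "\<And>z. dist z x < d \<Longrightarrow> dist (ratio q z) (ratio q x) < e"
    using e unfolding continuous_at_eps_delta by blast
  show "\<forall>\<^sub>F n in sequentially. exp (- real n * a) \<le> measure (distr (?Q n) borel (ratio q)) (ball y e)"
    using local_ldp_lower[OF L x(4) d(1)]
  proof eventually_elim
    case (elim n)
    interpret Q: prob_space "?Q n" by (rule prQ)
    have "ratio q -` ball y e \<in> sets borel" using measurable_sets[OF measurable_ratio, of "ball y e" q] by simp
    then have "measure (?Q n) (ball x d) \<le> measure (?Q n) (ratio q -` ball y e)"
      using d(2) x(3) by (intro Q.finite_measure_mono) (auto simp: dist_commute)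
    also have "\<dots> = measure (distr (?Q n) borel (ratio q)) (ball y e)"
      by (subst measure_distr) auto
    finally show ?case using elim by simp
  qed
qed

text \<open>
  Both components of the moments agree for \<open>q = 2\<close>, and their mean \<open>m\<close> has rate \<open>0\<close> by Jensen's
  inequality.
\<close>

lemma legendre_I_fin_2_diag: "\<exists>m>0. legendre (I_fin 2) (m, m) = 0"
proof -
  interpret prob_space "f_law 2" by (rule prob_f_law) simp
  define g where "g = (\<lambda>y::real. exp (1 / 4 * y\<^sup>2))"
  have c: "f_const 2 > 0" using f_dens_const_pos[of 2] by (simp add: f_const_def)
  have dens: "exp (t1 * y\<^sup>2 + t2 * \<bar>y\<bar> powr 2) * f_dens 2 y = f_const 2 * exp (- ((1 / 2 - t1 - t2) * y\<^sup>2))" for t1 t2 y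
    unfolding f_dens_eq by (simp add: algebra_simps)
  have ei: "integrable (f_law 2) (\<lambda>y. exp (t1 * y\<^sup>2 + t2 * \<bar>y\<bar> powr 2))" if "t1 + t2 < 1 / 2" for t1 t2
    using that integrable_gauss[of "1 / 2 - t1 - t2"]
    by (subst f_law_integrable_iff) (simp_all only: dens, auto)
  have i2: "integrable (f_law 2) (\<lambda>y. y\<^sup>2)"
  proof (rule Bochner_Integration.integrable_bound)
    show "integrable (f_law 2) (\<lambda>y. 4 * exp (1 / 4 * y\<^sup>2 + 0 * \<bar>y\<bar> powr 2))"
      by (intro integrable_mult_right ei) simp
    show "AE y in f_law 2. norm (y\<^sup>2) \<le> norm (4 * exp (1 / 4 * y\<^sup>2 + 0 * \<bar>y\<bar> powr 2))"
    proof (rule AE_I2)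
      fix y :: real
      show "norm (y\<^sup>2) \<le> norm (4 * exp (1 / 4 * y\<^sup>2 + 0 * \<bar>y\<bar> powr 2))"
      proof -
        have "1 + y\<^sup>2 / 4 \<le> exp (y\<^sup>2 / 4)" by (rule exp_ge_add_one_self)
        then have "y\<^sup>2 \<le> 4 * exp (y\<^sup>2 / 4)" by linarith
        then show ?thesis by simp
      qed
    qed
  qed simp
  define m where "m = (LINT y|f_law 2. y\<^sup>2)"
  have "m \<noteq> 0"
  proof
    assume "m = 0"
    then have "AE y in f_law 2. y\<^sup>2 = 0" unfolding m_def using i2 by (subst (asm) integral_nonneg_eq_0_iff_AE) auto
    moreover have "AE y in f_law 2. y \<noteq> 0" using AE_lborel_singleton[of "0::real"] by (simp add: AE_f_law)
    ultimately have "AE y in f_law 2. False" by eventually_elim simp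
    then show False by simp
  qed
  moreover have "m \<ge> 0" unfolding m_def by (rule Bochner_Integration.integral_nonneg) simp
  ultimately have m: "m > 0" by simp
  have "legendre (I_fin 2) (m, m) \<le> 0"
    unfolding legendre_def
  proof (rule SUP_least)
    fix u :: "real \<times> real"
    obtain t1 t2 where u: "u = (t1, t2)" by (cases u)
    show "ereal (u \<bullet> (m, m)) - I_fin 2 u \<le> 0"
    proof (cases "t1 + t2 < 1 / 2")
      case True
      let ?L = "LINT y|f_law 2. exp (t1 * y\<^sup>2 + t2 * \<bar>y\<bar> powr 2)"
      have "exp ((t1 + t2) * m) * (LINT y|f_law 2. 1 + (t1 + t2) * (y\<^sup>2 - m)) \<le> ?L"
        unfolding integral_mult_right_zero[symmetric]
      proof (rule integral_mono)
        show "integrable (f_law 2) (\<lambda>y. exp ((t1 + t2) * m) * (1 + (t1 + t2) * (y\<^sup>2 - m)))" using i2 by simp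
        show "exp ((t1 + t2) * m) * (1 + (t1 + t2) * (y\<^sup>2 - m)) \<le> exp (t1 * y\<^sup>2 + t2 * \<bar>y\<bar> powr 2)" for y
        proof -
          have "exp ((t1 + t2) * m) * (1 + (t1 + t2) * (y\<^sup>2 - m)) \<le> exp ((t1 + t2) * m) * exp ((t1 + t2) * (y\<^sup>2 - m))"
            by (intro mult_left_mono exp_ge_add_one_self) simp
          also have "\<dots> = exp (t1 * y\<^sup>2 + t2 * \<bar>y\<bar> powr 2)" by (simp add: exp_add[symmetric] algebra_simps)
          finally show ?thesis .
        qed
      qed (rule ei[OF True])
      moreover have "(LINT y|f_law 2. 1 + (t1 + t2) * (y\<^sup>2 - m)) = 1"
        using i2 prob_space by (simp add: m_def[symmetric])
      ultimately have le: "exp ((t1 + t2) * m) \<le> ?L" by simp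
      then have "ln (exp ((t1 + t2) * m)) \<le> ln ?L"
        by (subst ln_le_cancel_iff) (auto intro: less_le_trans[OF exp_gt_zero])
      moreover have "I_fin 2 u = ereal (ln ?L)"
        using True by (simp add: I_fin_def u f_law_integral)
      ultimately show ?thesis by (simp add: u algebra_simps)
    qed (simp add: I_fin_def u)
  qed
  moreover have "0 \<le> legendre (I_fin 2) (m, m)" by (rule legendre_nonneg) (rule I_fin_0, simp)
  ultimately show ?thesis using m by (intro exI[of _ m]) simp
qed

text \<open>
  \<open>I_fin 2\<close> vanishes on the line \<open>t\<^sub>1 + t\<^sub>2 = 0\<close>, on which the linear term is unbounded.
\<close>

lemma legendre_I_fin_2_offdiag:
  assumes "fst x \<noteq> snd x" shows "legendre (I_fin 2) x = \<infinity>"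
proof (rule ereal_top)
  fix a :: real
  interpret prob_space "f_law 2" by (rule prob_f_law) simp
  define T where "T = a / (fst x - snd x)"
  have I: "I_fin 2 (T, - T) = 0"
  proof -
    have "I_fin 2 (T, - T) = I_fin 2 0" by (simp add: I_fin_def zero_prod_def)
    then show ?thesis using I_fin_0[of 2] by simp
  qed
  have "(T, - T) \<bullet> x = T * (fst x - snd x)" by (simp add: inner_prod_def algebra_simps)
  also have "\<dots> = a" using assms by (simp add: T_def)
  finally have "ereal a = ereal ((T, - T) \<bullet> x) - I_fin 2 (T, - T)" unfolding I by simp
  also have "\<dots> \<le> legendre (I_fin 2) x" unfolding legendre_def by (rule SUP_upper) simp
  finally show "ereal a \<le> legendre (I_fin 2) x" .
qed

lemma J_fin_2: "J_fin 2 y = (if y = 1 then 0 else \<infinity>)"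
proof (cases "y = 1")
  case True
  obtain m where m: "m > 0" "legendre (I_fin 2) (m, m) = 0" using legendre_I_fin_2_diag by blast
  have "m powr (1 / 2) * m powr (- 1 / 2) = 1" using m by (subst powr_add[symmetric]) simp
  then have "J_fin 2 1 \<le> legendre (I_fin 2) (m, m)"
    unfolding J_fin_ratio using m by (intro INF_lower) (auto simp: ratio_def)
  moreover have "0 \<le> J_fin 2 1"
    unfolding J_fin_ratio by (intro INF_greatest legendre_nonneg I_fin_0) simp
  ultimately show ?thesis using m True by simp
next
  case False
  have "legendre (I_fin 2) x = \<infinity>" if x: "fst x > 0" "snd x > 0" "ratio 2 x = y" for x
  proof (rule legendre_I_fin_2_offdiag)
    show "fst x \<noteq> snd x"
    proof
      assume e: "fst x = snd x"
      have "snd x powr (1 / 2) * snd x powr (- 1 / 2) = 1" using x by (subst powr_add[symmetric]) simp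
      then show False using x False e by (simp add: ratio_def)
    qed
  qed
  then have "J_fin 2 y = (INF x \<in> {x :: real \<times> real. fst x > 0 \<and> snd x > 0 \<and> ratio 2 x = y}. \<infinity>)"
    unfolding J_fin_ratio by (intro INF_cong) auto
  then show ?thesis using False by (simp add: INF_constant top_ereal_def)
qed

lemma local_ldp_point_mass:
  fixes c :: "'a::metric_space"
  assumes Q: "\<forall>\<^sub>F n in sequentially. prob_space (Q n) \<and> sets (Q n) = sets borel \<and> (AE x in Q n. x = c)"
  shows "local_ldp Q (\<lambda>x. if x = c then 0 else \<infinity>)"
  unfolding local_ldp_def
proof (intro conjI allI impI)
  show "\<forall>\<^sub>F n in sequentially. prob_space (Q n) \<and> sets (Q n) = sets borel"
    using Q by eventually_elim simp
  have one: "\<forall>\<^sub>F n in sequentially. \<forall>e>0. \<forall>x. measure (Q n) (ball x e) = (if c \<in> ball x e then 1 else 0)"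
    using Q
  proof eventually_elim
    case (elim n)
    then interpret prob_space "Q n" by simp
    have "measure (Q n) (ball x e) = (if c \<in> ball x e then 1 else 0)" for x e
    proof (cases "c \<in> ball x e")
      case True
      have "AE y in Q n. y \<in> ball x e" using elim True by auto
      then have "prob (ball x e) = 1" using elim by (intro prob_eq_1[THEN iffD2]) auto
      then show ?thesis using True by simp
    next
      case False
      have "AE y in Q n. y \<notin> ball x e" using elim False by (auto elim!: eventually_mono)
      then have "prob (ball x e) = 0" using elim by (intro prob_eq_0[THEN iffD2]) auto
      then show ?thesis using False by simp
    qed
    then show ?case by blast
  qed
  {
    fix x a assume a: "ereal a < (if x = c then 0 else \<infinity>)"
    show "\<exists>e>0. \<forall>\<^sub>F n in sequentially. measure (Q n) (ball x e) \<le> exp (- real n * a)"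
    proof (cases "x = c")
      case True
      then have "a < 0" using a by simp
      have "\<forall>\<^sub>F n in sequentially. measure (Q n) (ball x 1) \<le> exp (- real n * a)"
        using one
      proof eventually_elim
        case (elim n)
        then have "measure (Q n) (ball x 1) \<le> 1" by simp
        also have "\<dots> \<le> exp (- real n * a)" using \<open>a < 0\<close> by (simp add: mult_nonneg_nonpos)
        finally show ?case .
      qed
      then show ?thesis by (intro exI[of _ 1]) simp
    next
      case False
      then have "dist x c > 0" by simp
      moreover have "\<forall>\<^sub>F n in sequentially. measure (Q n) (ball x (dist x c)) \<le> exp (- real n * a)"
        using one by eventually_elim (use \<open>dist x c > 0\<close> in simp)
      ultimately show ?thesis by blast
    qed
  }
  fix x a and e :: real assume a: "(if x = c then 0 else \<infinity>) < ereal a" and e: "e > 0"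
  then have x: "x = c" "a > 0" by (auto split: if_splits)
  show "\<forall>\<^sub>F n in sequentially. exp (- real n * a) \<le> measure (Q n) (ball x e)"
    using one by eventually_elim (use x e in simp)
qed

lemma local_ldp_ratio_2:
  "local_ldp (\<lambda>n. distr (emp_law (f_law 2) (\<phi>f 2) n) borel (ratio 2)) (J_fin 2)"
proof -
  have pr: "prob_space (f_law 2)" by (rule prob_f_law) simp
  have "local_ldp (\<lambda>n. distr (emp_law (f_law 2) (\<phi>f 2) n) borel (ratio 2)) (\<lambda>y. if y = 1 then 0 else \<infinity>)"
  proof (rule local_ldp_point_mass)
    show "\<forall>\<^sub>F n in sequentially. prob_space (distr (emp_law (f_law 2) (\<phi>f 2) n) borel (ratio 2)) \<and>
       sets (distr (emp_law (f_law 2) (\<phi>f 2) n) borel (ratio 2)) = sets borel \<and>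
       (AE x in distr (emp_law (f_law 2) (\<phi>f 2) n) borel (ratio 2). x = 1)"
      using eventually_ge_at_top[of 1]
    proof (eventually_elim, intro conjI)
      fix n :: nat assume n: "n \<ge> 1"
      show "prob_space (distr (emp_law (f_law 2) (\<phi>f 2) n) borel (ratio 2))"
        by (intro prob_space.prob_space_distr prob_space_PiM pr) auto
      have "AE y in f_law 2. y \<noteq> 0" using AE_lborel_singleton[of "0::real"] by (simp add: AE_f_law)
      then have "AE z in iid (f_law 2) n. z 0 \<noteq> 0"
        using n pr by (intro AE_PiM_component) auto
      then have "AE z in iid (f_law 2) n. ratio 2 (emp (\<phi>f 2) n z) = 1"
      proof eventually_elim
        case (elim z)
        define s where "s = (\<Sum>i<n. (z i)\<^sup>2) / real n"
        have "(z 0)\<^sup>2 \<le> (\<Sum>i<n. (z i)\<^sup>2)" using n by (intro member_le_sum) auto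
        moreover have "(z 0)\<^sup>2 > 0" using elim by simp
        ultimately have "(\<Sum>i<n. (z i)\<^sup>2) > 0" by linarith
        then have "s > 0" unfolding s_def using n by (intro divide_pos_pos) auto
        moreover have "emp (\<phi>f 2) n z = (s, s)" by (simp add: emp_\<phi>f s_def)
        moreover have "s powr (1 / 2) * s powr (- 1 / 2) = 1" using \<open>s > 0\<close> by (subst powr_add[symmetric]) simp
        ultimately show ?case by (simp add: ratio_def)
      qed
      then show "AE x in distr (emp_law (f_law 2) (\<phi>f 2) n) borel (ratio 2). x = 1"
        by (subst AE_distr_iff, simp, simp, subst AE_distr_iff) auto
    qed simp
  qed
  then show ?thesis by (simp add: J_fin_2[abs_def])
qed

lemma scaled_direction_eq_ratio:
  assumes q: "q \<ge> 2" and n: "n \<ge> 1"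
  shows "norm_scale n (ereal q) * nrm n (zero_fill n z) / lp_norm n (ereal q) (zero_fill n z) = ratio q (emp (\<phi>f q) n z)"
proof -
  define A where "A = (\<Sum>i<n. (z i)\<^sup>2)"
  define B where "B = (\<Sum>i<n. \<bar>z i\<bar> powr q)"
  have AB: "A \<ge> 0" "B \<ge> 0" by (auto simp: A_def B_def intro: sum_nonneg)
  have "nrm n (zero_fill n z) = A powr (1 / 2)"
    using AB by (simp add: nrm_zero_fill sqsum_def A_def powr_half_sqrt)
  moreover have "lp_norm n (ereal q) (zero_fill n z) = B powr (1 / q)"
    by (simp add: lp_norm_ereal B_def zero_fill_def)
  moreover have "ratio q (emp (\<phi>f q) n z) = (A / n) powr (1 / 2) * (B / n) powr (- 1 / q)"
    by (simp add: ratio_def emp_\<phi>f A_def B_def)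
  moreover have "(A / n) powr (1 / 2) = A powr (1 / 2) / n powr (1 / 2)" using AB by (simp add: powr_divide)
  moreover have "(B / n) powr (- 1 / q) = n powr (1 / q) / B powr (1 / q)"
    using AB by (simp add: powr_divide powr_minus_divide)
  moreover have "norm_scale n (ereal q) = n powr (1 / q) / n powr (1 / 2)"
    using q n by (simp add: norm_scale_ereal powr_diff)
  ultimately show ?thesis by (simp add: mult.commute)
qed

lemma local_ldp_direction:
  assumes q: "q \<ge> 2"
  shows "local_ldp (\<lambda>n. distr (uniform_lp_ball n (ereal q)) borel
      (\<lambda>x. norm_scale n (ereal q) * nrm n x / lp_norm n (ereal q) x)) (J_fin q)"
proof (rule local_ldp_cong)
  show "local_ldp (\<lambda>n. distr (emp_law (f_law q) (\<phi>f q) n) borel (ratio q)) (J_fin q)"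
    using local_ldp_ratio[of q] local_ldp_ratio_2 q by (cases "q = 2") auto
  show "\<forall>\<^sub>F n in sequentially. distr (emp_law (f_law q) (\<phi>f q) n) borel (ratio q) =
      distr (uniform_lp_ball n (ereal q)) borel (\<lambda>x. norm_scale n (ereal q) * nrm n x / lp_norm n (ereal q) x)"
    using eventually_ge_at_top[of 1]
  proof eventually_elim
    case (elim n)
    have p2: "2 \<le> ereal q" using q by simp
    interpret g: gauge n "lp_norm n (ereal q)" by (rule gauge_lp_norm[OF p2 elim])
    let ?T = "\<lambda>x. norm_scale n (ereal q) * nrm n x / lp_norm n (ereal q) x"
    have zf: "zero_fill n \<in> borel_measurable (iid (f_law q) n)" by (rule measurable_zero_fill') simp
    have [measurable]: "lp_norm n (ereal q) \<in> borel_measurable borel" by (rule measurable_lp_norm[OF p2])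
    have T: "?T \<in> borel_measurable borel" by measurable
    have "distr (uniform_lp_ball n (ereal q)) borel ?T = distr (distr (iid (f_law q) n) borel (zero_fill n)) borel ?T"
      by (rule cone_law_f_law[OF q elim T, symmetric]) (simp add: nrm_scale g.N_scale)
    also have "\<dots> = distr (iid (f_law q) n) borel (\<lambda>z. ?T (zero_fill n z))"
      using zf T by (subst distr_distr) (auto simp: comp_def)
    also have "\<dots> = distr (iid (f_law q) n) borel (\<lambda>z. ratio q (emp (\<phi>f q) n z))"
      by (simp only: scaled_direction_eq_ratio[OF q elim])
    also have "\<dots> = distr (emp_law (f_law q) (\<phi>f q) n) borel (ratio q)"
      by (subst distr_distr) (auto simp: comp_def)
    finally show ?case ..
  qed
qed

section \<open>The cube\<close>

definition cube_law :: "real measure" where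
  "cube_law = density lborel (\<lambda>x. ennreal (indicator {-1..1} x / 2))"

lemma sets_cube_law [simp, measurable_cong]: "sets cube_law = sets borel"
  by (simp add: cube_law_def)

lemma space_cube_law [simp]: "space cube_law = UNIV"
  by (simp add: cube_law_def)

lemma prob_cube_law: "prob_space cube_law"
proof
  have "emeasure cube_law (space cube_law) = (\<integral>\<^sup>+x. ennreal (1 / 2) * indicator {-1..1::real} x \<partial>lborel)"
    unfolding cube_law_def by (subst emeasure_density) (auto intro!: nn_integral_cong simp: indicator_def)
  also have "\<dots> = ennreal (1 / 2) * emeasure lborel {-1..1::real}"
    by (intro nn_integral_cmult_indicator) simp
  also have "\<dots> = ennreal (1 / 2) * ennreal 2" by simp
  also have "\<dots> = 1" by (subst ennreal_mult[symmetric]) auto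
  finally show "emeasure cube_law (space cube_law) = 1" .
qed

lemma AE_cube_law: "(AE y in cube_law. P y) \<longleftrightarrow> (AE y in lborel. \<bar>y\<bar> \<le> 1 \<longrightarrow> P y)"
proof -
  have e: "(0 < ennreal (indicator {-1..1} y / 2)) = (\<bar>y\<bar> \<le> 1)" for y :: real
    by (auto simp: indicator_def abs_le_iff)
  show ?thesis unfolding cube_law_def by (subst AE_density) (simp_all only: e, simp)
qed

text \<open>
  The product density is constant on the cube and vanishes outside.
\<close>

lemma uniform_cube:
  assumes n: "n \<ge> 1"
  shows "distr (iid cube_law n) borel (zero_fill n) = uniform_lp_ball n \<infinity>"
proof -
  have p2: "2 \<le> (\<infinity>::ereal)" by simp
  interpret g: gauge n "lp_norm n \<infinity>" by (rule gauge_lp_norm[OF p2 n])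
  let ?N = "lp_norm n \<infinity>" and ?L = "lebesgue_Rn n"
  let ?Z = "distr (iid cube_law n) borel (zero_fill n)"
  have zf: "zero_fill n \<in> borel_measurable (iid cube_law n)" by (rule measurable_zero_fill') simp
  interpret Z: prob_space ?Z
    using zf by (intro prob_space.prob_space_distr prob_space_PiM prob_cube_law)
  have [measurable]: "?N \<in> borel_measurable borel" by (rule measurable_lp_norm[OF p2])
  have N1: "?N x \<le> 1 \<longleftrightarrow> (\<forall>i<n. \<bar>x i\<bar> \<le> 1)" for x
    unfolding lp_norm_infty using n by (subst Max_le_iff) (auto simp: lessThan_empty_iff)
  have pr: "(\<Prod>i<n. indicator {-1..1} (x i) / 2 :: real) = (1 / 2) ^ n * indicator {x. ?N x \<le> 1} x" for x
  proof (cases "?N x \<le> 1")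
    case True
    then have "(\<Prod>i<n. indicator {-1..1} (x i) / 2 :: real) = (\<Prod>i<n. 1 / 2)"
      by (intro prod.cong) (auto simp: N1 indicator_def abs_le_iff)
    then show ?thesis using True by simp
  next
    case False
    then obtain i where "i < n" "\<bar>x i\<bar> > 1" by (auto simp: N1 not_le)
    then have "(\<Prod>i<n. indicator {-1..1} (x i) / 2 :: real) = 0"
      by (intro prod_zero) (auto simp: indicator_def intro!: bexI[of _ i])
    then show ?thesis using False by simp
  qed
  define K where "K = ennreal ((1 / 2) ^ n)"
  have Z: "emeasure ?Z A = K * emeasure ?L {x\<in>A. ?N x \<le> 1}" if A[measurable]: "A \<in> sets borel" for A
  proof -
    have "emeasure ?Z A = (\<integral>\<^sup>+x. ennreal (\<Prod>i<n. indicator {-1..1} (x i) / 2) * indicator A x \<partial>?L)"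
      unfolding cube_law_def using prob_cube_law
      by (intro product_density_zero_fill A) (auto simp: cube_law_def)
    also have "\<dots> = (\<integral>\<^sup>+x. K * indicator {x\<in>A. ?N x \<le> 1} x \<partial>?L)"
      unfolding pr K_def by (intro nn_integral_cong) (auto simp: indicator_def)
    also have "\<dots> = K * emeasure ?L {x\<in>A. ?N x \<le> 1}"
      by (intro nn_integral_cmult_indicator) simp
    finally show ?thesis .
  qed
  have "emeasure ?Z UNIV = 1" using Z.emeasure_space_1 by simp
  then have K1: "K * emeasure ?L {x. ?N x \<le> 1} = 1" using Z[of UNIV] by simp
  have "?Z = g.U"
  proof (rule measure_eqI)
    fix A assume "A \<in> sets ?Z"
    then have A: "A \<in> sets borel" by simp
    show "emeasure ?Z A = emeasure g.U A"
      unfolding Z[OF A] g.emeasure_U[OF A] by (rule mult_eq_divide_ennreal[OF K1 g.pos g.fin])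
  qed simp
  then show ?thesis by (simp add: uniform_lp_ball_gauge[OF p2 n])
qed

lemma cube_law_exp_integrable: "integrable cube_law (\<lambda>y. exp (u * y\<^sup>2 :: real))"
proof -
  interpret prob_space cube_law by (rule prob_cube_law)
  show ?thesis
  proof (rule integrable_const_bound[of _ "exp \<bar>u\<bar>"])
    have "u * y\<^sup>2 \<le> \<bar>u\<bar>" if "\<bar>y\<bar> \<le> 1" for y :: real
    proof -
      have "y\<^sup>2 \<le> 1" using that by (simp add: abs_square_le_1)
      then have "\<bar>u\<bar> * y\<^sup>2 \<le> \<bar>u\<bar> * 1" by (intro mult_left_mono) auto
      moreover have "u * y\<^sup>2 \<le> \<bar>u\<bar> * y\<^sup>2" by (intro mult_right_mono) auto
      ultimately show ?thesis by simp
    qed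
    then show "AE y in cube_law. norm (exp (u * y\<^sup>2)) \<le> exp \<bar>u\<bar>" by (simp add: AE_cube_law)
  qed simp
qed

lemma cube_law_integral_even:
  fixes g :: "real \<Rightarrow> real"
  assumes g: "continuous_on UNIV g" and even: "\<And>x. g (- x) = g x"
  shows "(LINT y|cube_law. g y) = (LINT x:{0..1}|lborel. g x)"
proof -
  have [measurable]: "g \<in> borel_measurable borel" using g by (rule borel_measurable_continuous_onI)
  have i: "set_integrable lborel {a..b} g" for a b
    using g by (intro borel_integrable_atLeastAtMost') (rule continuous_on_subset, auto)
  let ?r = "LINT x|lborel. indicator {-1..0} x * g x" and ?p = "LINT x|lborel. indicator {0..1} x * g x"
  have "(LINT y|cube_law. g y) = (LINT x|lborel. indicator {-1..1} x / 2 * g x)"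
    unfolding cube_law_def by (subst integral_real_density) (auto simp: mult.commute)
  also have "\<dots> = (LINT x|lborel. (indicator {-1..0} x * g x + indicator {0..1} x * g x) / 2)"
  proof (rule integral_cong_AE)
    show "AE x in lborel. indicator {-1..1} x / 2 * g x = (indicator {-1..0} x * g x + indicator {0..1} x * g x) / 2"
      using AE_lborel_singleton[of "0::real"] by eventually_elim (auto simp: indicator_def)
  qed measurable
  also have "\<dots> = (?r + ?p) / 2"
    using i[of "-1" 0] i[of 0 1] by (simp add: set_integrable_def)
  also have "?r = \<bar>- 1\<bar> *\<^sub>R (LINT x|lborel. indicator {-1..0} (0 + (- 1) * x) * g (0 + (- 1) * x))"
    by (rule lborel_integral_real_affine) simp
  also have "\<dots> = ?p"
    by (simp add: even) (intro Bochner_Integration.integral_cong, auto simp: indicator_def)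
  finally show ?thesis by (simp add: set_lebesgue_integral_def)
qed

lemma I_infty_cube_law: "I_infty u = ereal (ln (LINT y|cube_law. exp (u * y\<^sup>2)))"
  unfolding I_infty_def
  by (subst cube_law_integral_even) (auto intro!: continuous_intros)

lemma local_ldp_cube_moment:
  "local_ldp (\<lambda>n. emp_law cube_law (\<lambda>y. y\<^sup>2) n) (legendre I_infty)"
proof (rule cramer_local_ldp)
  interpret prob_space cube_law by (rule prob_cube_law)
  show "prob_space cube_law" by (rule prob_cube_law)
  show "integrable cube_law (\<lambda>y. y\<^sup>2)"
    by (rule integrable_const_bound[of _ 1]) (auto simp: AE_cube_law abs_square_le_1)
  show "\<not> (AE y in cube_law. u \<bullet> y\<^sup>2 = c)" if "u \<noteq> 0" for u c :: real
  proof
    assume "AE y in cube_law. u \<bullet> y\<^sup>2 = c"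
    moreover have "AE y in cube_law. y \<noteq> s" for s
      unfolding AE_cube_law using AE_lborel_singleton[of s] by eventually_elim simp
    from this[of "sqrt (c / u)"] this[of "- sqrt (c / u)"]
    have "AE y in cube_law. y \<noteq> sqrt (c / u)" "AE y in cube_law. y \<noteq> - sqrt (c / u)" .
    ultimately have "AE y in cube_law. False"
    proof eventually_elim
      case (elim y)
      have "\<bar>y\<bar> = sqrt (c / u)" using elim(1) that by (auto simp: real_sqrt_abs[symmetric] simp del: real_sqrt_abs)
      then show ?case using elim(2,3) by (auto simp: abs_if split: if_splits)
    qed
    then show False by simp
  qed
  show "I_infty u = \<infinity> \<or> integrable cube_law (\<lambda>y. exp (u \<bullet> y\<^sup>2)) \<and>
      I_infty u = ereal (ln (LINT y|cube_law. exp (u \<bullet> y\<^sup>2)))" for u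
    by (simp add: I_infty_cube_law cube_law_exp_integrable)
  show "I_infty 0 = 0" using prob_space by (simp add: I_infty_cube_law)
qed (auto simp: I_infty_cube_law)

text \<open>
  The contraction principle for the square root. For negative \<open>w\<close> the extension of the square
  root to negative numbers gives the fibre \<open>{- w\<^sup>2}\<close>, where the rate is infinite because the
  empirical mean of squares is nonnegative.
\<close>

lemma local_ldp_cube_norm:
  "local_ldp (\<lambda>n. distr (uniform_lp_ball n \<infinity>) borel (\<lambda>x. norm_scale n \<infinity> * nrm n x)) (\<lambda>w. if w < 0 then \<infinity> else J_infty w)"
proof -
  let ?Q = "\<lambda>n. emp_law cube_law (\<lambda>y. y\<^sup>2) n"
  have [measurable]: "emp (\<lambda>y::real. y\<^sup>2) n \<in> borel_measurable (iid cube_law n)" for n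
    by (rule measurable_emp) measurable
  have out: "\<forall>\<^sub>F n in sequentially. measure (?Q n) (- {0..1}) = 0"
    using eventually_ge_at_top[of 1]
  proof eventually_elim
    case (elim n)
    have "AE z in iid cube_law n. \<forall>i\<in>{..<n}. \<bar>z i\<bar> \<le> 1"
    proof (rule AE_finite_allI)
      fix i assume "i \<in> {..<n}"
      then show "AE z in iid cube_law n. \<bar>z i\<bar> \<le> 1"
        by (intro AE_PiM_component[where P = "\<lambda>y. \<bar>y\<bar> \<le> 1"] prob_cube_law) (auto simp: AE_cube_law)
    qed simp
    then have "AE z in iid cube_law n. emp (\<lambda>y. y\<^sup>2) n z \<in> {0..1}"
    proof eventually_elim
      case (elim z)
      have "(\<Sum>i<n. (z i)\<^sup>2) \<le> (\<Sum>i<n. 1)" using elim by (intro sum_mono) (auto simp: abs_square_le_1)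
      then show ?case using \<open>1 \<le> n\<close> by (auto simp: emp_def field_simps intro!: sum_nonneg)
    qed
    then have "AE x in ?Q n. x \<in> {0..1}" by (subst AE_distr_iff) auto
    then have "AE x in ?Q n. x \<notin> - {0..1}" by simp
    then have "- {0..1} \<in> null_sets (?Q n)" by (subst (asm) AE_iff_null_sets[symmetric]) auto
    then show ?case by (auto simp: measure_def)
  qed
  have "local_ldp (\<lambda>n. distr (?Q n) borel sqrt) (\<lambda>y. INF z\<in>{z. sqrt z = y}. legendre I_infty z)"
    by (rule local_ldp_contraction[OF local_ldp_cube_moment _ _ out]) (auto intro!: continuous_intros)
  also have "(\<lambda>y. INF z\<in>{z. sqrt z = y}. legendre I_infty z) = (\<lambda>w. if w < 0 then \<infinity> else J_infty w)"
  proof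
    fix w :: real
    show "(INF z\<in>{z. sqrt z = w}. legendre I_infty z) = (if w < 0 then \<infinity> else J_infty w)"
    proof (cases "w < 0")
      case True
      have "legendre I_infty z = \<infinity>" if "sqrt z = w" for z
      proof (rule local_ldp_outside[OF local_ldp_cube_moment _ out])
        show "z \<notin> {0..1}" using that True by auto
      qed simp
      then show ?thesis using True by (auto simp: top_ereal_def[symmetric] intro!: INF_eqI)
    next
      case False
      then have "{z. sqrt z = w} = {w\<^sup>2}" by (auto simp: real_sqrt_eq_iff)
      then show ?thesis using False by (simp add: J_infty_def)
    qed
  qed
  finally have L: "local_ldp (\<lambda>n. distr (?Q n) borel sqrt) (\<lambda>w. if w < 0 then \<infinity> else J_infty w)" .
  show ?thesis
  proof (rule local_ldp_cong[OF L])
    show "\<forall>\<^sub>F n in sequentially. distr (?Q n) borel sqrt = distr (uniform_lp_ball n \<infinity>) borel (\<lambda>x. norm_scale n \<infinity> * nrm n x)"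
      using eventually_ge_at_top[of 1]
    proof eventually_elim
      case (elim n)
      have zf: "zero_fill n \<in> borel_measurable (iid cube_law n)" by (rule measurable_zero_fill') simp
      have e: "norm_scale n \<infinity> * nrm n (zero_fill n z) = sqrt (emp (\<lambda>y. y\<^sup>2) n z)" for z
      proof -
        have "norm_scale n \<infinity> = 1 / sqrt n" using elim by (simp add: norm_scale_infty powr_minus_divide powr_half_sqrt)
        then show ?thesis by (simp add: nrm_zero_fill sqsum_def emp_def real_sqrt_divide)
      qed
      have "distr (?Q n) borel sqrt = distr (iid cube_law n) borel (\<lambda>z. norm_scale n \<infinity> * nrm n (zero_fill n z))"
        by (subst distr_distr) (auto simp: comp_def e)
      also have "\<dots> = distr (distr (iid cube_law n) borel (zero_fill n)) borel (\<lambda>x. norm_scale n \<infinity> * nrm n x)"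
        using zf by (subst distr_distr) (auto simp: comp_def)
      also have "\<dots> = distr (uniform_lp_ball n \<infinity>) borel (\<lambda>x. norm_scale n \<infinity> * nrm n x)"
        by (simp only: uniform_cube[OF elim])
      finally show ?case .
    qed
  qed
qed

section \<open>Products of independent variables\<close>

definition product_law :: "real measure \<Rightarrow> real measure \<Rightarrow> real measure" where
  "product_law P Q = distr (P \<Otimes>\<^sub>M Q) borel (\<lambda>(x, y). x * y)"

lemma sets_product_law [simp, measurable_cong]: "sets (product_law P Q) = sets borel"
  by (simp add: product_law_def)

lemma space_product_law [simp]: "space (product_law P Q) = UNIV"
  by (simp add: product_law_def)

context
  fixes P Q :: "real measure"
  assumes pr: "prob_space P" "prob_space Q"
    and sets_law [simp, measurable_cong]: "sets P = sets borel" "sets Q = sets borel"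
begin

interpretation P: prob_space P by (rule pr)
interpretation Q: prob_space Q by (rule pr)

lemma measurable_times_pair: "(\<lambda>(x, y). x * y) \<in> borel_measurable (P \<Otimes>\<^sub>M Q)"
  by measurable

lemma prob_product_law: "prob_space (product_law P Q)"
proof -
  interpret PQ: pair_prob_space P Q ..
  show ?thesis unfolding product_law_def by (rule PQ.prob_space_distr[OF measurable_times_pair])
qed

lemma nn_integral_product_law:
  assumes [measurable]: "f \<in> borel_measurable borel"
  shows "(\<integral>\<^sup>+z. f z \<partial>product_law P Q) = (\<integral>\<^sup>+x. (\<integral>\<^sup>+y. f (x * y) \<partial>Q) \<partial>P)"
proof -
  have "(\<integral>\<^sup>+z. f z \<partial>product_law P Q) = (\<integral>\<^sup>+p. f (fst p * snd p) \<partial>(P \<Otimes>\<^sub>M Q))"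
    unfolding product_law_def by (subst nn_integral_distr) (auto simp: split_beta')
  also have "\<dots> = (\<integral>\<^sup>+x. (\<integral>\<^sup>+y. f (x * y) \<partial>Q) \<partial>P)"
    by (subst Q.nn_integral_fst[symmetric]) auto
  finally show ?thesis .
qed

lemma emeasure_product_law:
  assumes A: "A \<in> sets borel"
  shows "emeasure (product_law P Q) A = (\<integral>\<^sup>+x. (\<integral>\<^sup>+y. indicator A (x * y) \<partial>Q) \<partial>P)"
proof -
  have "emeasure (product_law P Q) A = (\<integral>\<^sup>+z. indicator A z \<partial>product_law P Q)" using A by simp
  also have "\<dots> = (\<integral>\<^sup>+x. (\<integral>\<^sup>+y. indicator A (x * y) \<partial>Q) \<partial>P)"
    using A by (intro nn_integral_product_law) simp
  finally show ?thesis .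
qed

end

lemma product_law_commute:
  assumes pr: "prob_space P" "prob_space Q" and s[simp, measurable_cong]: "sets P = sets borel" "sets Q = sets borel"
  shows "product_law P Q = product_law Q P"
proof (rule measure_eqI)
  interpret P: prob_space P by (rule pr)
  interpret Q: prob_space Q by (rule pr)
  interpret PQ: pair_sigma_finite P Q ..
  fix A assume "A \<in> sets (product_law P Q)"
  then have A[measurable]: "A \<in> sets borel" by simp
  have "(\<lambda>p. indicator A (fst p * snd p) :: ennreal) \<in> borel_measurable (P \<Otimes>\<^sub>M Q)"
    by measurable
  then have "(\<integral>\<^sup>+x. (\<integral>\<^sup>+y. indicator A (x * y) \<partial>Q) \<partial>P) = (\<integral>\<^sup>+y. (\<integral>\<^sup>+x. indicator A (x * y) \<partial>P) \<partial>Q)"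
    using PQ.Fubini'[of "\<lambda>x y. indicator A (x * y)"] by (simp add: split_beta')
  then show "emeasure (product_law P Q) A = emeasure (product_law Q P) A"
    using emeasure_product_law[OF pr(1,2) s(1,2) A] emeasure_product_law[OF pr(2,1) s(2,1) A]
    by (simp add: mult.commute)
qed simp

lemma product_law_assoc:
  assumes pr: "prob_space P" "prob_space Q" "prob_space R"
    and s[simp, measurable_cong]: "sets P = sets borel" "sets Q = sets borel" "sets R = sets borel"
  shows "product_law (product_law P Q) R = product_law P (product_law Q R)"
proof (rule measure_eqI)
  interpret R: prob_space R by (rule pr)
  fix A assume "A \<in> sets (product_law (product_law P Q) R)"
  then have A[measurable]: "A \<in> sets borel" by simp
  note pq = prob_product_law[OF pr(1,2) s(1,2)] and qr = prob_product_law[OF pr(2,3) s(2,3)]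
  have m: "(\<lambda>z. \<integral>\<^sup>+r. indicator A (z * r) \<partial>R) \<in> borel_measurable borel"
    by (intro R.borel_measurable_nn_integral) measurable
  have "emeasure (product_law (product_law P Q) R) A = (\<integral>\<^sup>+z. (\<integral>\<^sup>+r. indicator A (z * r) \<partial>R) \<partial>product_law P Q)"
    by (rule emeasure_product_law[OF pq pr(3) _ s(3) A]) simp
  also have "\<dots> = (\<integral>\<^sup>+x. (\<integral>\<^sup>+y. (\<integral>\<^sup>+r. indicator A (x * y * r) \<partial>R) \<partial>Q) \<partial>P)"
    by (rule nn_integral_product_law[OF pr(1,2) s(1,2) m])
  also have "\<dots> = (\<integral>\<^sup>+x. (\<integral>\<^sup>+z. indicator A (x * z) \<partial>product_law Q R) \<partial>P)"
    by (subst nn_integral_product_law[OF pr(2,3) s(2,3)]) (auto simp: mult.assoc)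
  also have "\<dots> = emeasure (product_law P (product_law Q R)) A"
    by (rule emeasure_product_law[OF pr(1) qr s(1) _ A, symmetric]) auto
  finally show "emeasure (product_law (product_law P Q) R) A = emeasure (product_law P (product_law Q R)) A" .
qed simp

lemma product_law_outside:
  assumes pr: "prob_space P" "prob_space Q" and s[simp, measurable_cong]: "sets P = sets borel" "sets Q = sets borel"
    and P: "measure P (- {0..1}) = 0" and Q: "measure Q (- {0..1}) = 0"
  shows "measure (P \<Otimes>\<^sub>M Q) (- ({0..1} \<times> {0..1})) = 0" and "measure (product_law P Q) (- {0..1}) = 0"
proof -
  interpret P: prob_space P by (rule pr)
  interpret Q: prob_space Q by (rule pr)
  interpret PQ: pair_prob_space P Q ..
  have sp: "space P = UNIV" "space Q = UNIV" using s[THEN sets_eq_imp_space_eq] by auto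
  have bs: "A \<times> B \<in> sets (P \<Otimes>\<^sub>M Q)" if "A \<in> sets borel" "B \<in> sets borel" for A B
    using that by (intro pair_measureI) auto
  have "measure (P \<Otimes>\<^sub>M Q) (- ({0..1} \<times> {0..1})) \<le> measure (P \<Otimes>\<^sub>M Q) ((- {0..1}) \<times> UNIV \<union> UNIV \<times> (- {0..1}))"
    by (intro PQ.P.finite_measure_mono sets.Un bs) auto
  also have "\<dots> \<le> measure (P \<Otimes>\<^sub>M Q) ((- {0..1}) \<times> UNIV) + measure (P \<Otimes>\<^sub>M Q) (UNIV \<times> (- {0..1}))"
    by (intro measure_Un_le bs) auto
  also have "\<dots> = 0"
    using P Q by (simp add: measure_def Q.emeasure_pair_measure_Times enn2real_mult)
  finally show z: "measure (P \<Otimes>\<^sub>M Q) (- ({0..1} \<times> {0..1})) = 0" by (simp add: measure_le_0_iff)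
  have "measure (product_law P Q) (- {0..1}) = measure (P \<Otimes>\<^sub>M Q) ((\<lambda>(x, y). x * y) -` (- {0..1}))"
    unfolding product_law_def by (subst measure_distr) (auto simp: space_pair_measure sp)
  also have "\<dots> \<le> measure (P \<Otimes>\<^sub>M Q) (- ({0..1} \<times> {0..1}))"
  proof (rule PQ.P.finite_measure_mono)
    show "(\<lambda>(x, y). x * y) -` (- {0..1}) \<subseteq> - ({0..1::real} \<times> {0..1})"
      by (auto simp: mult_le_one)
    have "space (P \<Otimes>\<^sub>M Q) - {0..1} \<times> {0..1} \<in> sets (P \<Otimes>\<^sub>M Q)" by (intro sets.compl_sets bs) auto
    then show "- ({0..1} \<times> {0..1}) \<in> sets (P \<Otimes>\<^sub>M Q)" by (simp add: space_pair_measure sp Compl_eq_Diff_UNIV)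
  qed
  finally show "measure (product_law P Q) (- {0..1}) = 0" using z by (simp add: measure_le_0_iff)
qed

text \<open>
  The contraction principle for multiplication, on the compact square that carries the pair.
\<close>

lemma local_ldp_product_law:
  assumes P: "local_ldp P I" and Q: "local_ldp Q J"
    and P01: "\<forall>\<^sub>F n in sequentially. measure (P n) (- {0..1}) = 0"
    and Q01: "\<forall>\<^sub>F n in sequentially. measure (Q n) (- {0..1}) = 0"
  shows "local_ldp (\<lambda>n. product_law (P n) (Q n)) (\<lambda>y. INF (w, r)\<in>{(w, r). w * r = y}. I w + J r)"
proof -
  have out: "\<forall>\<^sub>F n in sequentially. measure (P n \<Otimes>\<^sub>M Q n) (- ({0..1} \<times> {0..1})) = 0"
    using local_ldp_prob[OF P] local_ldp_prob[OF Q] P01 Q01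
    by eventually_elim (intro product_law_outside, auto)
  have c: "continuous_on UNIV (\<lambda>(x, y). x * y :: real)"
    unfolding split_beta' by (intro continuous_intros)
  have "local_ldp (\<lambda>n. product_law (P n) (Q n)) (\<lambda>y. INF z\<in>{z. (case z of (w, r) \<Rightarrow> w * r) = y}. case z of (w, r) \<Rightarrow> I w + J r)"
    unfolding product_law_def
    by (rule local_ldp_contraction[OF local_ldp_pair[OF P Q] c _ out]) (intro compact_Times compact_Icc)
  moreover have "{z. (case z of (w, r) \<Rightarrow> w * r) = y} = {(w, r). w * r = y}" for y :: real by auto
  ultimately show ?thesis by simp
qed

text \<open>
  Given the positive factor \<open>r\<close>, the preimage of a null set under multiplication by \<open>r\<close> is a null
  set.
\<close>

lemma product_law_absolutely_continuous:
  assumes pr: "prob_space P" "prob_space Q" and s[simp, measurable_cong]: "sets P = sets borel" "sets Q = sets borel"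
    and P: "\<And>N. N \<in> null_sets lborel \<Longrightarrow> emeasure P N = 0" and Q: "AE r in Q. 0 < r"
    and N: "N \<in> null_sets lborel"
  shows "emeasure (product_law P Q) N = 0"
proof -
  have Nb[measurable]: "N \<in> sets borel" using N by auto
  have "emeasure (product_law Q P) N = (\<integral>\<^sup>+r. (\<integral>\<^sup>+w. indicator N (r * w) \<partial>P) \<partial>Q)"
    by (rule emeasure_product_law[OF pr(2,1) s(2,1) Nb])
  also have "\<dots> = (\<integral>\<^sup>+r. 0 \<partial>Q)"
  proof (rule nn_integral_cong_AE)
    show "AE r in Q. (\<integral>\<^sup>+w. indicator N (r * w) \<partial>P) = 0"
      using Q
    proof eventually_elim
      case (elim r)
      let ?Y = "(\<lambda>t. r * t) -` N"
      have Y: "?Y \<in> null_sets lborel" by (rule null_sets_scale[OF elim N])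
      then have Yb: "?Y \<in> sets borel" by auto
      have "(\<integral>\<^sup>+w. indicator N (r * w) \<partial>P) = (\<integral>\<^sup>+w. indicator ?Y w \<partial>P)"
        by (intro nn_integral_cong) (auto simp: indicator_def)
      also have "\<dots> = emeasure P ?Y" using Yb by simp
      finally show ?case using P[OF Y] by simp
    qed
  qed
  finally show ?thesis using product_law_commute[OF pr s] by simp
qed

lemma log_terms_scale: "0 < y \<Longrightarrow> y \<le> x \<Longrightarrow> log_terms l 1 (y / x) = log_terms l x y"
  by (auto simp: log_terms_def power_divide)

text \<open>
  For \<open>y > 0\<close>, only \<open>r = y / w\<close> with \<open>w \<ge> y\<close> contributes. For \<open>y = 0\<close>, a vanishing \<open>r\<close> has finite rate
  only if \<open>l = 0\<close>, and then \<open>w\<close> is free. If \<open>l > 0\<close>, then \<open>w = 0\<close>, and the most likely \<open>r = sqrt l\<close>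
  costs nothing.
\<close>

lemma proj_rate_eq:
  fixes J R :: "real \<Rightarrow> ereal"
  assumes l: "0 \<le> l" "l \<le> 1" and J: "\<And>w. J w = (if w < 0 then \<infinity> else J_rate p w)"
    and Jn: "\<And>w. 0 \<le> J w" and Rn: "\<And>r. 0 \<le> radius_rate l r"
  shows "(INF (w, r)\<in>{(w, r). w * r = y}. J w + radius_rate l r) = proj_rate p l y"
    (is "?L = _")
proof -
  have lower: "?L \<le> J w + radius_rate l r" if "w * r = y" for w r
    by (rule INF_lower2[of "(w, r)"]) (use that in auto)
  have greatest: "c \<le> ?L" if "\<And>w r. w * r = y \<Longrightarrow> c \<le> J w + radius_rate l r" for c
    using that by (intro INF_greatest) auto
  consider "y > 0" | "y < 0" | "y = 0" "l = 0" | "y = 0" "l > 0" using l by linarith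
  then show ?thesis
  proof cases
    case 1
    have "?L = (INF x\<in>{y..}. log_terms l x y + J_rate p x)"
    proof (rule antisym)
      show "?L \<le> (INF x\<in>{y..}. log_terms l x y + J_rate p x)"
      proof (rule INF_greatest)
        fix x assume "x \<in> {y..}"
        then have x: "y \<le> x" "0 < x" using 1 by auto
        then have "?L \<le> J x + radius_rate l (y / x)" by (intro lower) simp
        also have "\<dots> = log_terms l x y + J_rate p x"
          using x 1 by (auto simp: J radius_rate_def log_terms_scale add.commute divide_less_0_iff)
        finally show "?L \<le> log_terms l x y + J_rate p x" .
      qed
      show "(INF x\<in>{y..}. log_terms l x y + J_rate p x) \<le> ?L"
      proof (rule greatest)
        fix w r assume wr: "w * r = y"
        show "(INF x\<in>{y..}. log_terms l x y + J_rate p x) \<le> J w + radius_rate l r"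
        proof (cases "w < 0 \<or> r < 0 \<or> 1 < r")
          case True
          then show ?thesis by (auto simp: J radius_rate_def)
        next
          case False
          have "w \<noteq> 0" "r \<noteq> 0" using wr 1 by auto
          then have w: "0 < w" "0 < r" "r \<le> 1" using False by auto
          have yw: "y \<le> w" using w wr[symmetric] by (simp add: mult_left_le)
          have r: "r = y / w" using w wr by (simp add: field_simps)
          have "(INF x\<in>{y..}. log_terms l x y + J_rate p x) \<le> log_terms l w y + J_rate p w"
            using yw by (intro INF_lower) simp
          also have "\<dots> = J w + log_terms l 1 (y / w)"
            using w 1 yw by (simp add: J log_terms_scale add.commute)
          also have "\<dots> = J w + radius_rate l r"
            using w unfolding r[symmetric] by (simp add: radius_rate_def)
          finally show ?thesis .
        qed
      qed
    qed
    then show ?thesis using 1 by (simp add: proj_rate_def)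
  next
    case 2
    have "\<infinity> \<le> ?L"
    proof (rule greatest)
      fix w r assume "w * r = y"
      then have "w < 0 \<or> r < 0" using 2 by (auto simp: mult_less_0_iff)
      then show "\<infinity> \<le> J w + radius_rate l r" by (auto simp: J radius_rate_def)
    qed
    then show ?thesis using 2 by (simp add: proj_rate_def)
  next
    case 3
    have "?L = (INF x\<in>{0..}. J_rate p x)"
    proof (rule antisym)
      show "?L \<le> (INF x\<in>{0..}. J_rate p x)"
      proof (rule INF_greatest)
        fix x :: real assume x: "x \<in> {0..}"
        have "?L \<le> J x + radius_rate l 0" by (rule lower) (use 3 in simp)
        then show "?L \<le> J_rate p x" using x 3 by (simp add: J radius_rate_def)
      qed
      show "(INF x\<in>{0..}. J_rate p x) \<le> ?L"
      proof (rule greatest)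
        fix w r :: real
        show "(INF x\<in>{0..}. J_rate p x) \<le> J w + radius_rate l r"
        proof (cases "w < 0")
          case False
          then have "(INF x\<in>{0..}. J_rate p x) \<le> J w" by (intro INF_lower2[of w]) (auto simp: J)
          also have "\<dots> = J w + 0" by simp
          also have "\<dots> \<le> J w + radius_rate l r" by (rule add_left_mono[OF Rn])
          finally show ?thesis .
        qed (simp add: J)
      qed
    qed
    then show ?thesis using 3 by (simp add: proj_rate_def)
  next
    case 4
    have s: "0 < sqrt l" "sqrt l \<le> 1" using 4 l by auto
    have "log_terms l 1 (sqrt l) = 0" using 4 l by (auto simp: log_terms_def zero_ereal_def)
    then have r0: "radius_rate l (sqrt l) = 0" using s by (simp add: radius_rate_def)
    have "?L = J_rate p 0"
    proof (rule antisym)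
      show "?L \<le> J_rate p 0" using lower[of 0 "sqrt l"] 4 by (simp add: r0 J)
      show "J_rate p 0 \<le> ?L"
      proof (rule greatest)
        fix w r :: real assume "w * r = y"
        then consider "w = 0" | "r = 0" using 4 by auto
        then show "J_rate p 0 \<le> J w + radius_rate l r"
        proof cases
          case 1
          have "J w + 0 \<le> J w + radius_rate l r" by (rule add_left_mono[OF Rn])
          then show ?thesis using 1 by (simp add: J)
        next
          case 2
          then show ?thesis using 4 by (simp add: radius_rate_def)
        qed
      qed
    qed
    then show ?thesis using 4 by (simp add: proj_rate_def)
  qed
qed

section \<open>The projected norm\<close>

text \<open>
  Condition on \<open>X\<close>: by \<open>haar_norm_depends_on_norm\<close> and \<open>haar_direction_law\<close>, the norm of the
  projection is then \<open>|X|\<close> times an independent variable whose law does not depend on \<open>X\<close>.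
\<close>

lemma projected_norm_law:
  fixes X :: "'w \<Rightarrow> nat \<Rightarrow> real" and E :: "'w \<Rightarrow> (nat \<Rightarrow> real) set"
  assumes k: "1 \<le> k" "k \<le> n" and M: "prob_space M" and X: "X \<in> measurable M borel"
    and XR: "AE x in distr M borel X. x \<in> Rn n"
    and E: "E \<in> measurable M (grassmann_algebra n k)"
    and haar: "grassmann_haar n k (distr M (grassmann_algebra n k) E)"
    and indep: "prob_space.indep_set M {X -` A \<inter> space M |A. A \<in> sets borel}
           {E -` B \<inter> space M |B. B \<in> sets (grassmann_algebra n k)}"
  shows "(\<lambda>\<omega>. c * nrm n (proj n (E \<omega>) (X \<omega>))) \<in> borel_measurable M"
    and "distr M borel (\<lambda>\<omega>. c * nrm n (proj n (E \<omega>) (X \<omega>))) =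
      product_law (distr (distr M borel X) borel (\<lambda>x. c * nrm n x)) (distr (uball n) borel (\<lambda>x. nrm k x / nrm n x))"
proof -
  let ?G = "grassmann_algebra n k"
  let ?\<nu> = "distr M borel X" and ?\<mu> = "distr M ?G E" and ?\<rho> = "distr (uball n) borel (\<lambda>x. nrm k x / nrm n x)"
  let ?f = "\<lambda>p. c * nrm n (proj n (snd p) (fst p))"
  interpret M: prob_space M by (rule M)
  interpret \<nu>: prob_space ?\<nu> by (rule M.prob_space_distr[OF X])
  interpret \<mu>: prob_space ?\<mu> by (rule M.prob_space_distr[OF E])
  have pr\<rho>: "prob_space ?\<rho>" using k by (intro prob_space.prob_space_distr prob_uball) auto
  have XE: "(\<lambda>\<omega>. (X \<omega>, E \<omega>)) \<in> measurable M (borel \<Otimes>\<^sub>M ?G)" by (intro measurable_Pair X E)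
  have joint: "?\<nu> \<Otimes>\<^sub>M ?\<mu> = distr M (borel \<Otimes>\<^sub>M ?G) (\<lambda>\<omega>. (X \<omega>, E \<omega>))"
  proof (rule pair_measure_eqI)
    show "sigma_finite_measure ?\<nu>" "sigma_finite_measure ?\<mu>" by unfold_locales
    show "sets (?\<nu> \<Otimes>\<^sub>M ?\<mu>) = sets (distr M (borel \<Otimes>\<^sub>M ?G) (\<lambda>\<omega>. (X \<omega>, E \<omega>)))"
      by (simp cong: sets_pair_measure_cong)
    fix A B assume "A \<in> sets ?\<nu>" "B \<in> sets ?\<mu>"
    then have AB: "A \<in> sets borel" "B \<in> sets ?G" by auto
    have "M.prob ((X -` A \<inter> space M) \<inter> (E -` B \<inter> space M)) = M.prob (X -` A \<inter> space M) * M.prob (E -` B \<inter> space M)"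
      by (rule M.indep_setD[OF indep]) (use AB in blast)+
    moreover have "(X -` A \<inter> space M) \<inter> (E -` B \<inter> space M) = (\<lambda>\<omega>. (X \<omega>, E \<omega>)) -` (A \<times> B) \<inter> space M" by auto
    ultimately have "M.prob ((\<lambda>\<omega>. (X \<omega>, E \<omega>)) -` (A \<times> B) \<inter> space M) = M.prob (X -` A \<inter> space M) * M.prob (E -` B \<inter> space M)"
      by simp
    then show "emeasure ?\<nu> A * emeasure ?\<mu> B = emeasure (distr M (borel \<Otimes>\<^sub>M ?G) (\<lambda>\<omega>. (X \<omega>, E \<omega>))) (A \<times> B)"
      using AB XE X E by (simp add: emeasure_distr M.emeasure_eq_measure ennreal_mult)
  qed
  have f: "?f \<in> borel_measurable (borel \<Otimes>\<^sub>M ?G)"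
    using measurable_nrm_proj_pair[OF k] by (intro borel_measurable_times) auto
  show "(\<lambda>\<omega>. c * nrm n (proj n (E \<omega>) (X \<omega>))) \<in> borel_measurable M"
    using measurable_compose[OF XE f] by simp
  have law: "distr M borel (\<lambda>\<omega>. c * nrm n (proj n (E \<omega>) (X \<omega>))) = distr (?\<nu> \<Otimes>\<^sub>M ?\<mu>) borel ?f"
    unfolding joint using XE f by (subst distr_distr) (auto simp: comp_def)
  have f\<nu>: "?f \<in> borel_measurable (?\<nu> \<Otimes>\<^sub>M ?\<mu>)" using f by (simp cong: measurable_cong_sets sets_pair_measure_cong)
  have mp: "(\<lambda>E. nrm n (proj n E x)) \<in> borel_measurable ?\<mu>" for x
    using measurable_nrm_proj[OF k] by (simp cong: measurable_cong_sets)
  show "distr M borel (\<lambda>\<omega>. c * nrm n (proj n (E \<omega>) (X \<omega>))) = product_law (distr ?\<nu> borel (\<lambda>x. c * nrm n x)) ?\<rho>"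
    unfolding law
  proof (rule measure_eqI)
    let ?W = "distr ?\<nu> borel (\<lambda>x. c * nrm n x)"
    fix A assume "A \<in> sets (distr (?\<nu> \<Otimes>\<^sub>M ?\<mu>) borel ?f)"
    then have A[measurable]: "A \<in> sets borel" by simp
    have cm: "(\<lambda>x. c * nrm n x) \<in> borel_measurable ?\<nu>" by measurable
    have prW: "prob_space ?W" by (rule \<nu>.prob_space_distr[OF cm])
    have iA: "(\<lambda>p. indicator A (?f p) :: ennreal) \<in> borel_measurable (?\<nu> \<Otimes>\<^sub>M ?\<mu>)"
      by (rule measurable_compose[OF f\<nu>]) simp
    interpret \<rho>: prob_space ?\<rho> by (rule pr\<rho>)
    have rm: "(\<lambda>w. \<integral>\<^sup>+r. indicator A (w * r) \<partial>?\<rho>) \<in> borel_measurable borel"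
      by (intro \<rho>.borel_measurable_nn_integral) measurable
    have "emeasure (distr (?\<nu> \<Otimes>\<^sub>M ?\<mu>) borel ?f) A = (\<integral>\<^sup>+t. indicator A t \<partial>distr (?\<nu> \<Otimes>\<^sub>M ?\<mu>) borel ?f)" by simp
    also have "\<dots> = (\<integral>\<^sup>+p. indicator A (?f p) \<partial>(?\<nu> \<Otimes>\<^sub>M ?\<mu>))"
      by (rule nn_integral_distr[OF f\<nu>]) simp
    also have "\<dots> = (\<integral>\<^sup>+x. (\<integral>\<^sup>+E. indicator A (c * nrm n (proj n E x)) \<partial>?\<mu>) \<partial>?\<nu>)"
      using \<mu>.nn_integral_fst[OF iA] by simp
    also have "\<dots> = (\<integral>\<^sup>+x. (\<integral>\<^sup>+r. indicator A (c * nrm n x * r) \<partial>?\<rho>) \<partial>?\<nu>)"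
    proof (rule nn_integral_cong_AE)
      show "AE x in ?\<nu>. (\<integral>\<^sup>+E. indicator A (c * nrm n (proj n E x)) \<partial>?\<mu>) = (\<integral>\<^sup>+r. indicator A (c * nrm n x * r) \<partial>?\<rho>)"
        using XR
      proof eventually_elim
        case (elim x)
        have "(\<integral>\<^sup>+E. indicator A (c * nrm n (proj n E x)) \<partial>?\<mu>) =
          (\<integral>\<^sup>+t. indicator A (c * t) \<partial>distr ?\<mu> borel (\<lambda>E. nrm n (proj n E x)))"
          using mp by (subst nn_integral_distr) auto
        also have "\<dots> = (\<integral>\<^sup>+t. indicator A (c * t) \<partial>distr ?\<mu> borel (\<lambda>E. nrm n x * nrm n (proj n E (unit_vec 0))))"
          by (simp only: haar_norm_depends_on_norm[OF k haar elim])
        also have "\<dots> = (\<integral>\<^sup>+E. indicator A (c * (nrm n x * nrm n (proj n E (unit_vec 0)))) \<partial>?\<mu>)"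
          using mp[of "unit_vec 0"] by (subst nn_integral_distr) auto
        also have "\<dots> = (\<integral>\<^sup>+r. indicator A (c * (nrm n x * r)) \<partial>distr ?\<mu> borel (\<lambda>E. nrm n (proj n E (unit_vec 0))))"
          using mp[of "unit_vec 0"] by (subst nn_integral_distr) auto
        also have "\<dots> = (\<integral>\<^sup>+r. indicator A (c * nrm n x * r) \<partial>?\<rho>)"
          by (simp only: haar_direction_law[OF k haar] mult.assoc)
        finally show ?case .
      qed
    qed
    also have "\<dots> = (\<integral>\<^sup>+w. (\<integral>\<^sup>+r. indicator A (w * r) \<partial>?\<rho>) \<partial>?W)"
      using cm rm by (subst nn_integral_distr) auto
    also have "\<dots> = emeasure (product_law ?W ?\<rho>) A"
      by (rule emeasure_product_law[OF prW pr\<rho> _ _ A, symmetric]) auto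
    finally show "emeasure (distr (?\<nu> \<Otimes>\<^sub>M ?\<mu>) borel ?f) A = emeasure (product_law ?W ?\<rho>) A" .
  qed simp
qed

text \<open>
  The upper bound for the uniform distribution tends to \<open>0\<close> with \<open>b\<close>.
\<close>

lemma AE_direction_pos:
  assumes k: "1 \<le> k" "k < n"
  shows "AE r in distr (uball n) borel (\<lambda>x. nrm k x / nrm n x). 0 < r"
proof -
  interpret prob_space "uball n" by (rule prob_uball) (use k in simp)
  let ?S = "{x. nrm k x \<le> 0}"
  have "measure (uball n) ?S = 0"
  proof (rule ccontr)
    assume "measure (uball n) ?S \<noteq> 0"
    then have m: "measure (uball n) ?S > 0" by (simp add: zero_less_measure_iff)
    define K where "K = \<bar>ball_ratio n k\<bar> + 1"
    define b where "b = min 1 (measure (uball n) ?S / (2 * K))"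
    have K: "K > 0" by (simp add: K_def add_nonneg_pos)
    have b: "0 < b" "b \<le> 1" using m K by (auto simp: b_def)
    have "measure (uball n) ?S \<le> measure (uball n) {x. 0 \<le> nrm k x \<and> nrm k x \<le> b}"
      using b by (intro finite_measure_mono) auto
    also have "\<dots> \<le> ball_ratio n k * (b ^ k * sqrt (1 - 0\<^sup>2) ^ (n - k))"
      by (rule uball_upper[OF k _ _ b(1)]) auto
    also have "\<dots> \<le> K * b"
    proof -
      have "b ^ k \<le> b ^ 1" using b k by (intro power_decreasing) auto
      then have "ball_ratio n k * b ^ k \<le> K * b" using b by (intro mult_mono) (auto simp: K_def)
      then show ?thesis by simp
    qed
    also have "\<dots> \<le> K * (measure (uball n) ?S / (2 * K))" using K by (intro mult_left_mono) (auto simp: b_def)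
    also have "\<dots> = measure (uball n) ?S / 2" using K by simp
    finally show False using m by simp
  qed
  then have "emeasure (uball n) ?S = 0" by (simp add: emeasure_eq_measure)
  then have "AE x in uball n. \<not> nrm k x \<le> 0" by (subst AE_iff_measurable[of ?S]) auto
  moreover have "AE x in uball n. 0 < nrm n x" by (rule AE_uball_nrm_pos[of k n]) (use k in auto)
  ultimately have "AE x in uball n. 0 < nrm k x / nrm n x" by eventually_elim (simp add: not_le)
  then show ?thesis by (subst AE_distr_iff) auto
qed

lemma uniform_lp_ball_props:
  assumes p: "2 \<le> p" and n: "n \<ge> 1"
  shows "prob_space (uniform_lp_ball n p)" "sets (uniform_lp_ball n p) = sets borel"
    and "AE x in uniform_lp_ball n p. x \<in> Rn n" "AE x in uniform_lp_ball n p. lp_norm n p x \<le> 1"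
proof -
  interpret g: gauge n "lp_norm n p" by (rule gauge_lp_norm[OF p n])
  note U = uniform_lp_ball_gauge[OF p n]
  show "prob_space (uniform_lp_ball n p)" unfolding U by (rule g.prob_U)
  show "sets (uniform_lp_ball n p) = sets borel" unfolding U by simp
  have m: "{x. lp_norm n p x \<le> 1} \<in> sets (lebesgue_Rn n)" by simp
  show "AE x in uniform_lp_ball n p. x \<in> Rn n"
    unfolding U g.U_def using AE_lebesgue_Rn[of n] m by (intro AE_uniform_measureI) auto
  show "AE x in uniform_lp_ball n p. lp_norm n p x \<le> 1"
    unfolding U g.U_def using m by (intro AE_uniform_measureI) auto
qed

lemma scaled_norm_law_01:
  assumes p: "2 \<le> p" and n: "n \<ge> 1"
  shows "measure (distr (uniform_lp_ball n p) borel (\<lambda>x. norm_scale n p * nrm n x)) (- {0..1}) = 0"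
proof (rule measure_outside_AE)
  note U = uniform_lp_ball_props[OF p n]
  note [measurable_cong] = U(2)
  show "prob_space (distr (uniform_lp_ball n p) borel (\<lambda>x. norm_scale n p * nrm n x))"
    by (rule prob_space.prob_space_distr[OF U(1)]) simp
  have "norm_scale n p * nrm n x \<in> {0..1}" if "lp_norm n p x \<le> 1" for x
    using scaled_nrm_le[OF p n, of x] that norm_scale_pos[OF n, of p] by auto
  then show "AE x in distr (uniform_lp_ball n p) borel (\<lambda>x. norm_scale n p * nrm n x). x \<in> {0..1}"
    using U(4) by (subst AE_distr_iff) auto
qed simp

lemma scaled_norm_law_null:
  assumes p: "2 \<le> p" and n: "n \<ge> 1" and N: "N \<in> null_sets lborel"
  shows "emeasure (distr (uniform_lp_ball n p) borel (\<lambda>x. norm_scale n p * nrm n x)) N = 0"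
proof -
  let ?c = "norm_scale n p"
  note U = uniform_lp_ball_props[OF p n]
  note [measurable_cong] = U(2)
  interpret g: gauge n "lp_norm n p" by (rule gauge_lp_norm[OF p n])
  interpret h: gauge n "nrm n" by (rule gauge_nrm[OF n])
  have c: "?c > 0" by (rule norm_scale_pos[OF n])
  have Nb[measurable]: "N \<in> sets borel" using N by auto
  let ?Y = "(\<lambda>t. ?c * t) -` N"
  have Y: "?Y \<in> null_sets lborel" by (rule null_sets_scale[OF c N])
  then have Yb[measurable]: "?Y \<in> sets borel" by auto
  have Z: "{x. nrm n x \<in> ?Y} \<in> sets borel" by measurable
  have "emeasure (lebesgue_Rn n) {x. nrm n x \<in> ?Y} = 0" by (rule h.null_N[OF Y])
  then have "emeasure (lebesgue_Rn n) {x\<in>{x. nrm n x \<in> ?Y}. lp_norm n p x \<le> 1} = 0"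
    using Z by (rule_tac emeasure_eq_0[of "{x. nrm n x \<in> ?Y}"]) auto
  then have "emeasure g.U {x. nrm n x \<in> ?Y} = 0" unfolding g.emeasure_U[OF Z] by (simp only:) simp
  moreover have "emeasure (distr (uniform_lp_ball n p) borel (\<lambda>x. ?c * nrm n x)) N = emeasure (uniform_lp_ball n p) {x. nrm n x \<in> ?Y}"
    using sets_eq_imp_space_eq[OF U(2)] by (subst emeasure_distr) (auto intro!: arg_cong2[where f=emeasure])
  ultimately show ?thesis by (simp add: uniform_lp_ball_gauge[OF p n])
qed

text \<open>
  The factors are the normalised direction and the \<open>q\<close>-norm. The latter is replaced by the
  Euclidean norm of a uniform point of the Euclidean ball, which has the same law.
\<close>

lemma scaled_norm_law_factor:
  assumes q: "q \<ge> 2" and n: "n \<ge> 1"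
  shows "distr (uniform_lp_ball n (ereal q)) borel (\<lambda>x. norm_scale n (ereal q) * nrm n x) =
    product_law (distr (uniform_lp_ball n (ereal q)) borel (\<lambda>x. norm_scale n (ereal q) * nrm n x / lp_norm n (ereal q) x))
      (distr (uball n) borel (nrm n))"
proof -
  have p: "2 \<le> ereal q" using q by simp
  let ?N = "lp_norm n (ereal q)" and ?c = "norm_scale n (ereal q)"
  interpret g: gauge n ?N by (rule gauge_lp_norm[OF p n])
  interpret h: gauge n "nrm n" by (rule gauge_nrm[OF n])
  have hU: "h.U = uball n" by (simp add: h.U_def uball_def)
  have gU: "uniform_lp_ball n (ereal q) = g.U" by (rule uniform_lp_ball_gauge[OF p n])
  have [measurable]: "?N \<in> borel_measurable borel" by (rule measurable_lp_norm[OF p])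
  have T: "(\<lambda>x. ?c * nrm n x / ?N x) \<in> borel_measurable borel" by measurable
  have N: "distr (uball n) borel (nrm n) = distr g.U borel ?N"
    using g.distr_N_density h.distr_N_density by (simp add: hU)
  have e: "?c * nrm n x / ?N x * ?N x = ?c * nrm n x" for x
  proof (cases "?N x = 0")
    case True
    then have "?c * nrm n x = 0"
      using scaled_nrm_le[OF p n, of x] norm_scale_pos[OF n, of "ereal q"] nrm_nonneg[of n x]
      by (intro antisym) auto
    then show ?thesis by simp
  qed simp
  have "product_law (distr g.U borel (\<lambda>x. ?c * nrm n x / ?N x)) (distr g.U borel ?N) =
     distr (distr g.U (borel \<Otimes>\<^sub>M borel) (\<lambda>x. (?c * nrm n x / ?N x, ?N x))) borel (\<lambda>(x, y). x * y)"
    unfolding product_law_def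
    by (subst g.cone_gauge_independent[OF T]) (auto simp: nrm_scale g.N_scale)
  also have "\<dots> = distr g.U borel (\<lambda>x. ?c * nrm n x / ?N x * ?N x)"
    using T by (subst distr_distr) (auto simp: comp_def)
  also have "\<dots> = distr g.U borel (\<lambda>x. ?c * nrm n x)" by (simp only: e)
  finally show ?thesis unfolding gU N by simp
qed

lemma local_ldp_proj_rate:
  assumes P: "local_ldp P J" and Q: "local_ldp Q (radius_rate l)"
    and P01: "\<forall>\<^sub>F n in sequentially. measure (P n) (- {0..1}) = 0"
    and Q01: "\<forall>\<^sub>F n in sequentially. measure (Q n) (- {0..1}) = 0"
    and l: "0 \<le> l" "l \<le> 1" and J: "\<And>w. J w = (if w < 0 then \<infinity> else J_rate p w)"
  shows "local_ldp (\<lambda>n. product_law (P n) (Q n)) (proj_rate p l)"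
  using local_ldp_product_law[OF P Q P01 Q01]
  unfolding proj_rate_eq[OF l J local_ldp_nonneg[OF P] local_ldp_nonneg[OF Q]] .

lemma J_fin_neg: "w < 0 \<Longrightarrow> J_fin q w = \<infinity>"
proof -
  assume "w < 0"
  moreover have "0 \<le> a powr b * c powr d" for a b c d :: real by simp
  ultimately have "a powr b * c powr d \<noteq> w" for a b c d :: real by (simp add: not_less[symmetric]) (metis not_less)
  then have "{(x1, x2). x1 > 0 \<and> x2 > 0 \<and> x1 powr (1 / 2) * x2 powr (- 1 / q) = w} = {}"
    by blast
  then show ?thesis unfolding J_fin_def by (simp only: image_empty Inf_empty top_ereal_def)
qed

text \<open>
  For finite \<open>q\<close> the product of direction, \<open>q\<close>-norm and \<open>R\<close> is bracketed so that the last two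
  combine to the norm of the first \<open>k\<close> coordinates of a uniform point of the Euclidean ball.
\<close>

lemma local_ldp_projected_norm:
  fixes k :: "nat \<Rightarrow> nat"
  assumes p: "2 \<le> p" and k: "\<forall>\<^sub>F n in sequentially. 1 \<le> k n \<and> k n < n"
    and lim: "(\<lambda>n. real (k n) / real n) \<longlonglongrightarrow> l"
  shows "local_ldp (\<lambda>n. product_law (distr (uniform_lp_ball n p) borel (\<lambda>x. norm_scale n p * nrm n x))
      (distr (uball n) borel (\<lambda>x. nrm (k n) x / nrm n x))) (proj_rate p l)"
  using p
proof (cases rule: p_cases)
  note l = limit_fraction[OF k lim]
  note ge1 = eventually_ge_at_top[of "1::nat"]
  {
    case 2
    show ?thesis
      unfolding 2
    proof (rule local_ldp_proj_rate[OF local_ldp_cube_norm local_ldp_direction_norm[OF k lim] _ _ l])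
      show "\<forall>\<^sub>F n in sequentially. measure (distr (uniform_lp_ball n \<infinity>) borel (\<lambda>x. norm_scale n \<infinity> * nrm n x)) (- {0..1}) = 0"
        using ge1 by eventually_elim (rule scaled_norm_law_01, auto)
      show "\<forall>\<^sub>F n in sequentially. measure (distr (uball n) borel (\<lambda>x. nrm (k n) x / nrm n x)) (- {0..1}) = 0"
        using k by eventually_elim (rule direction_norm_01, auto)
    qed (simp add: J_rate_def)
  }
  case (1 q)
  have q: "q \<ge> 2" using p 1 by simp
  let ?S = "\<lambda>n. distr (uniform_lp_ball n (ereal q)) borel (\<lambda>x. norm_scale n (ereal q) * nrm n x / lp_norm n (ereal q) x)"
  show ?thesis
    unfolding 1
  proof (rule local_ldp_cong)
    show "local_ldp (\<lambda>n. product_law (?S n) (distr (uball n) borel (nrm (k n)))) (proj_rate (ereal q) l)"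
    proof (rule local_ldp_proj_rate[OF local_ldp_direction[OF q] local_ldp_partial_norm[OF k lim] _ _ l])
      show "\<forall>\<^sub>F n in sequentially. measure (?S n) (- {0..1}) = 0"
        using ge1
      proof eventually_elim
        case (elim n)
        have p2: "2 \<le> ereal q" using q by simp
        note U = uniform_lp_ball_props[OF p2 elim]
        note [measurable_cong] = U(2)
        have [measurable]: "lp_norm n (ereal q) \<in> borel_measurable borel" by (rule measurable_lp_norm[OF p2])
        have T: "(\<lambda>x. norm_scale n (ereal q) * nrm n x / lp_norm n (ereal q) x) \<in> borel_measurable (uniform_lp_ball n (ereal q))"
          by measurable
        interpret g: gauge n "lp_norm n (ereal q)" by (rule gauge_lp_norm[OF p2 elim])
        have "norm_scale n (ereal q) * nrm n x / lp_norm n (ereal q) x \<in> {0..1}" for x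
          using scaled_nrm_le[OF p2 elim, of x] norm_scale_pos[OF elim, of "ereal q"] g.N_nonneg[of x]
          by (auto simp: divide_le_eq_1 less_le)
        then have "AE y in ?S n. y \<in> {0..1}" using T by (subst AE_distr_iff) auto
        then show ?case using T by (intro measure_outside_AE prob_space.prob_space_distr U(1)) auto
      qed
      show "\<forall>\<^sub>F n in sequentially. measure (distr (uball n) borel (nrm (k n))) (- {0..1}) = 0"
        using k by eventually_elim (rule partial_norm_01, auto)
    qed (simp add: J_rate_def J_fin_neg)
    show "\<forall>\<^sub>F n in sequentially. product_law (?S n) (distr (uball n) borel (nrm (k n))) =
       product_law (distr (uniform_lp_ball n (ereal q)) borel (\<lambda>x. norm_scale n (ereal q) * nrm n x))
         (distr (uball n) borel (\<lambda>x. nrm (k n) x / nrm n x))"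
      using k
    proof eventually_elim
      case (elim n)
      then have n: "1 \<le> n" and kn: "1 \<le> k n" "k n \<le> n" by auto
      have p2: "2 \<le> ereal q" using q by simp
      note U = uniform_lp_ball_props[OF p2 n]
      note [measurable_cong] = U(2)
      have [measurable]: "lp_norm n (ereal q) \<in> borel_measurable borel" by (rule measurable_lp_norm[OF p2])
      let ?V = "distr (uball n) borel (nrm n)" and ?R = "distr (uball n) borel (\<lambda>x. nrm (k n) x / nrm n x)"
      have pr: "prob_space (?S n)" "prob_space ?V" "prob_space ?R"
        by (auto intro!: prob_space.prob_space_distr U(1) prob_uball n)
      have "distr (uball n) borel (nrm (k n)) = product_law ?R ?V"
        unfolding product_law_def by (rule partial_norm_law[OF kn])
      also have "\<dots> = product_law ?V ?R" by (rule product_law_commute[OF pr(3,2)]) auto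
      finally show ?case
        unfolding scaled_norm_law_factor[OF q n] by (simp add: product_law_assoc[OF pr])
    qed
  qed
qed

theorem theorem1p1:
  fixes p :: ereal and k :: "nat \<Rightarrow> nat" and l :: real
    and M :: "nat \<Rightarrow> 'w measure"
    and X :: "nat \<Rightarrow> 'w \<Rightarrow> (nat \<Rightarrow> real)"
    and E :: "nat \<Rightarrow> 'w \<Rightarrow> (nat \<Rightarrow> real) set"
  assumes "2 \<le> p"
    and "\<And>n. n \<ge> 2 \<Longrightarrow> k n \<in> {1..n - 1}"
    and "(\<lambda>n. real (k n) / real n) \<longlonglongrightarrow> l"
    and "\<And>n. n \<ge> 2 \<Longrightarrow> prob_space (M n)"
    and "\<And>n. n \<ge> 2 \<Longrightarrow> X n \<in> measurable (M n) borel"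
    and "\<And>n. n \<ge> 2 \<Longrightarrow> distr (M n) borel (X n) = uniform_lp_ball n p"
    and "\<And>n. n \<ge> 2 \<Longrightarrow> E n \<in> measurable (M n) (grassmann_algebra n (k n))"
    and "\<And>n. n \<ge> 2 \<Longrightarrow> grassmann_haar n (k n) (distr (M n) (grassmann_algebra n (k n)) (E n))"
    and "\<And>n. n \<ge> 2 \<Longrightarrow> prob_space.indep_set (M n)
           {X n -` A \<inter> space (M n) |A. A \<in> sets borel}
           {E n -` B \<inter> space (M n) |B. B \<in> sets (grassmann_algebra n (k n))}"
  shows "LDP M
           (\<lambda>n \<omega>. real n powr (real_of_ereal (1 / p) - 1 / 2) * lp_norm n 2 (proj n (E n \<omega>) (X n \<omega>)))
           (\<lambda>n. ereal (real n))
           (proj_rate p l)"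
proof -
  note p = assms(1)
  let ?Y = "\<lambda>n \<omega>. norm_scale n p * nrm n (proj n (E n \<omega>) (X n \<omega>))"
  let ?W = "\<lambda>n. distr (uniform_lp_ball n p) borel (\<lambda>x. norm_scale n p * nrm n x)"
  let ?R = "\<lambda>n. distr (uball n) borel (\<lambda>x. nrm (k n) x / nrm n x)"
  have kn: "1 \<le> k n" "k n < n" if "n \<ge> 2" for n using assms(2)[OF that] that by auto
  have k: "\<forall>\<^sub>F n in sequentially. 1 \<le> k n \<and> k n < n"
    using eventually_ge_at_top[of "2::nat"] by eventually_elim (use kn in auto)
  have Y: "?Y n \<in> borel_measurable (M n) \<and> distr (M n) borel (?Y n) = product_law (?W n) (?R n)" if n: "n \<ge> 2" for n
  proof -
    have n1: "1 \<le> n" using n by simp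
    have "AE x in distr (M n) borel (X n). x \<in> Rn n"
      unfolding assms(6)[OF n] by (rule uniform_lp_ball_props(3)[OF p n1])
    note law = projected_norm_law[OF kn(1)[OF n] less_imp_le[OF kn(2)[OF n]] assms(4,5)[OF n] this assms(7,8,9)[OF n], of "norm_scale n p"]
    show ?thesis using law unfolding assms(6)[OF n] by blast
  qed
  have L: "local_ldp (\<lambda>n. distr (M n) borel (?Y n)) (proj_rate p l)"
  proof (rule local_ldp_cong[OF local_ldp_projected_norm[OF p k assms(3)]])
    show "\<forall>\<^sub>F n in sequentially. product_law (?W n) (?R n) = distr (M n) borel (?Y n)"
      using eventually_ge_at_top[of "2::nat"] by eventually_elim (use Y in simp)
  qed
  have "LDP M ?Y (\<lambda>n. ereal (real n)) (proj_rate p l)"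
  proof (rule LDP_of_local_ldp[OF L])
    show "compact {0..1::real}" by simp
    show "\<forall>\<^sub>F n in sequentially. prob_space (M n) \<and> ?Y n \<in> borel_measurable (M n) \<and>
          measure (M n) {\<omega>\<in>space (M n). ?Y n \<omega> \<notin> {0..1}} = 0 \<and>
          (\<forall>N\<in>null_sets lborel. ?Y n -` N \<inter> space (M n) \<in> null_sets (M n))"
      using eventually_ge_at_top[of "2::nat"]
    proof (eventually_elim, intro conjI ballI)
      fix n :: nat assume n: "2 \<le> n"
      then have n1: "1 \<le> n" by simp
      have Ym: "?Y n \<in> borel_measurable (M n)" and law: "distr (M n) borel (?Y n) = product_law (?W n) (?R n)"
        using Y[OF n] by auto
      show "prob_space (M n)" by (rule assms(4)[OF n])
      show "?Y n \<in> borel_measurable (M n)" by (rule Ym)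
      note U = uniform_lp_ball_props[OF p n1]
      note [measurable_cong] = U(2)
      have pr: "prob_space (?W n)" "prob_space (?R n)"
        by (auto intro!: prob_space.prob_space_distr U(1) prob_uball n1)
      have "measure (M n) {\<omega>\<in>space (M n). ?Y n \<omega> \<notin> {0..1}} = measure (distr (M n) borel (?Y n)) (- {0..1})"
        using Ym by (subst measure_distr) (auto intro!: arg_cong2[where f=measure])
      also have "\<dots> = 0"
        unfolding law
        by (rule product_law_outside(2)[OF pr]) (simp_all add: scaled_norm_law_01[OF p n1] direction_norm_01[OF kn[OF n]])
      finally show "measure (M n) {\<omega>\<in>space (M n). ?Y n \<omega> \<notin> {0..1}} = 0" .
      fix N :: "real set" assume N: "N \<in> null_sets lborel"
      then have Nb: "N \<in> sets borel" by auto
      have "emeasure (distr (M n) borel (?Y n)) N = 0"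
        unfolding law
        by (rule product_law_absolutely_continuous[OF pr _ _ scaled_norm_law_null[OF p n1] AE_direction_pos[OF kn[OF n]] N]) auto
      then show "?Y n -` N \<inter> space (M n) \<in> null_sets (M n)"
        using Ym Nb by (auto simp: emeasure_distr null_sets_def)
    qed
  qed
  then show ?thesis unfolding lp_norm_2 norm_scale_def .
qed

end
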